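(* Let $\rho$ be an admissible function on an RD-space $\mathcal X$. Let $\{\tilde T_t\}_{t>0}$ be a continuous $(\epsilon_1,\epsilon_2,\epsilon_3)$-AOTI for some $\epsilon_1\in(0,1]$, $\epsilon_2,\epsilon_3>0$, and let $\{T_t\}_{t>0}$ be a family of linear operators bounded on $L^2(\mathcal X)$ with integrable kernels $T_t(x,y)$ such that, for some constants $C>0$, $\delta_2\in(0,\epsilon_2]$ and $\delta_1,\delta_3>0$, for all $t>0$ and $x,y\in\mathcal X$: (i) $|T_t(x,y)|\le C\frac{1}{V_t(x)+V(x,y)}\big[\frac{t}{t+d(x,y)}\big]^{\delta_2}\big[\frac{\rho(x)}{t+\rho(x)}\big]^{\delta_3}$; (ii) $|T_t(x,y)-\tilde T_t(x,y)|\le C\big[\frac{t}{t+\rho(x)}\big]^{\delta_1}\frac{1}{V_t(x)+V(x,y)}\big[\frac{t}{t+d(x,y)}\big]^{\delta_2}$. For $f\in L^1(\mathcal X)$ let $T^+(f)(x)=\sup_{t>0}|T_t(f)(x)|$ and $T^+_\rho(f)(x)=\sup_{0<t<\rho(x)}|T_t(f)(x)|$. Then the following are equivalent: (a) $f\in H^1_\rho(\mathcal X)$; (b) $f\in L^1(\mathcal X)$ and $\|T^+(f)\|_{L^1(\mathcal X)}<\infty$; (c) $f\in L^1(\mathcal X)$ and $\|T^+_\rho(f)\|_{L^1(\mathcal X)}<\infty$. Moreover, for all $f\in L^1(\mathcal X)$, $\|f\|_{H^1_\rho(\mathcal X)}\sim\|T^+(f)\|_{L^1(\mathcal X)}\sim\|T^+_\rho(f)\|_{L^1(\mathcal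 X)}$ with constants independent of $f$.
   Context: An RD-space is a triple $(\mathcal X,d,\mu)$ where $(\mathcal X,d)$ is a metric space and $\mu$ a regular Borel measure such that every ball $B(x,r)=\{y:d(x,y)<r\}$ has finite positive measure, $\mu$ is doubling, and there exist constants $0<\kappa\le n$, $C_2\ge1$ with $C_2^{-1}\lambda^\kappa\mu(B(x,r))\le\mu(B(x,\lambda r))\le C_2\lambda^n\mu(B(x,r))$ for all $x$, $0<r<\operatorname{diam}(\mathcal X)/2$, $1\le\lambda<\operatorname{diam}(\mathcal X)/(2r)$; $\mu(\mathcal X)=\infty$. $V_r(x)=\mu(B(x,r))$, $V(x,y)=\mu(B(x,d(x,y)))$. A positive function $\rho$ on $\mathcal X$ is admissible if there exist constants $C_3,k_0>0$ such that for all $x,y$, $\rho(y)\le C_3[\rho(x)]^{1/(1+k_0)}[\rho(x)+d(x,y)]^{k_0/(1+k_0)}$. Test functions: for $x\in\mathcal X$, $r>0$, $\beta\in(0,1]$, $\gamma>0$, $\mathcal G(x,r,\beta,\gamma)$ is the Banach space of functions $f$ for which there is $C_f$ with $|f(y)|\le C_f\frac{1}{V_r(x)+V(x,y)}\big(\frac{r}{r+d(x,y)}\big)^\gamma$ for all $y$ and $|f(y)-f(y')|\le C_f\big(\frac{d(y,y')}{r+d(x,y)}\big)^\beta\frac{1}{V_r(x)+V(x,y)}\big(\frac{r}{r+d(x,y)}\big)^\gamma$ whenever $d(y,y')\le[r+d(x,y)]/2$; $\|f\|_{\mathcal G(x,r,\beta,\gamma)}$ is the infimum of such $C_f$. For $\epsilon\in(0,1]$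 and $\beta,\gamma\in(0,\epsilon]$, $\mathcal G^\epsilon_0(x,r,\beta,\gamma)$ is the closure of $\mathcal G(x,r,\epsilon,\epsilon)$ in $\mathcal G(x,r,\beta,\gamma)$. Fix $x_1\in\mathcal X$ and put $\mathcal G^\epsilon_0(\beta,\gamma)=\mathcal G^\epsilon_0(x_1,1,\beta,\gamma)$, with dual $(\mathcal G^\epsilon_0(\beta,\gamma))'$ carrying the weak-* topology. Hardy space: fix $\epsilon\in(0,1)$, $\beta,\gamma\in(0,\epsilon)$. For $f\in(\mathcal G^\epsilon_0(\beta,\gamma))'$, $G_\rho(f)(x)=\sup\{|\langle f,\varphi\rangle|:\varphi\in\mathcal G^\epsilon_0(\beta,\gamma),\ \|\varphi\|_{\mathcal G(x,r,\beta,\gamma)}\le1\text{ for some }r\in(0,\rho(x))\}$; $H^1_\rho(\mathcal X)=\{f:\|f\|_{H^1_\rho}=\|G_\rho(f)\|_{L^1}<\infty\}$ (its elements are $L^1$ functions). Continuous AOTI: for $\epsilon_1\in(0,1]$, $\epsilon_2,\epsilon_3>0$, a family $\{\tilde S_t\}_{t>0}$ of bounded linear integral operators on $L^2(\mathcal X)$ with kernels $\tilde S_t(x,y)$ is a continuous $(\epsilon_1,\epsilon_2,\epsilon_3)$-AOTI if there is $C_6>0$ such that for all $t>0$ and $x,x',y,y'$: (i) $|\tilde S_t(x,y)|\le C_6\frac{1}{V_t(x)+V(x,y)}\big[\frac{t}{t+d(x,y)}\big]^{\epsilon_2}$; (ii) $|\tilde S_t(x,y)-\tilde S_t(x',y)|\le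 C_6\big[\frac{d(x,x')}{t+d(x,y)}\big]^{\epsilon_1}\frac{1}{V_t(x)+V(x,y)}\big[\frac{t}{t+d(x,y)}\big]^{\epsilon_2}$ for $d(x,x')\le[t+d(x,y)]/2$; (iii) the same with $x$ and $y$ interchanged; (iv) $|[\tilde S_t(x,y)-\tilde S_t(x,y')]-[\tilde S_t(x',y)-\tilde S_t(x',y')]|\le C_6\big[\frac{d(x,x')}{t+d(x,y)}\big]^{\epsilon_1}\big[\frac{d(y,y')}{t+d(x,y)}\big]^{\epsilon_1}\frac{1}{V_t(x)+V(x,y)}\big[\frac{t}{t+d(x,y)}\big]^{\epsilon_3}$ for $d(x,x')\le[t+d(x,y)]/3$, $d(y,y')\le[t+d(x,y)]/3$; (v) $\int\tilde S_t(x,z)\,d\mu(z)=1=\int\tilde S_t(z,y)\,d\mu(z)$. *)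

theory Defs
  imports "HOL-Analysis.Analysis"
begin

definition Vr :: "'a::metric_space measure \<Rightarrow> real \<Rightarrow> 'a \<Rightarrow> real" where
  "Vr M r x = measure M (ball x r)"

definition Vxy :: "'a::metric_space measure \<Rightarrow> 'a \<Rightarrow> 'a \<Rightarrow> real" where
  "Vxy M x y = measure M (ball x (dist x y))"

text \<open>Regular Borel measure: Borel sigma-algebra, outer regular by open sets.
  The condition \<open>0 < r < diam/2\<close>, \<open>1 \<le> lambda < diam/(2r)\<close> is rendered as
  \<open>1 \<le> lambda\<close> and existence of two points at distance \<open>> 2 lambda r\<close>.\<close>
definition RD_space :: "'a::metric_space measure \<Rightarrow> bool" where
  "RD_space M \<longleftrightarrow>
     sets M = sets borel \<and>
     (\<forall>A\<in>sets M. emeasure M A = (INF U\<in>{U. open U \<and> A \<subseteq> U}. emeasure M U)) \<and>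
     (\<forall>x r. 0 < r \<longrightarrow> 0 < emeasure M (ball x r) \<and> emeasure M (ball x r) < \<infinity>) \<and>
     (\<exists>C1. \<forall>x r. 0 < r \<longrightarrow> Vr M (2 * r) x \<le> C1 * Vr M r x) \<and>
     (\<exists>\<kappa> n C2. 0 < \<kappa> \<and> \<kappa> \<le> n \<and> 1 \<le> C2 \<and>
        (\<forall>x r l. 0 < r \<longrightarrow> 1 \<le> l \<longrightarrow> (\<exists>y z::'a. 2 * l * r < dist y z) \<longrightarrow>
           (l powr \<kappa>) * Vr M r x / C2 \<le> Vr M (l * r) x \<and>
           Vr M (l * r) x \<le> C2 * (l powr n) * Vr M r x)) \<and>
     emeasure M UNIV = \<infinity>"

definition admissible :: "('a::metric_space \<Rightarrow> real) \<Rightarrow> bool" where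
  "admissible \<rho> \<longleftrightarrow> (\<forall>x. 0 < \<rho> x) \<and>
     (\<exists>C3 k0. 0 < C3 \<and> 0 < k0 \<and> (\<forall>x y.
        \<rho> y \<le> C3 * (\<rho> x) powr (1 / (1 + k0)) * (\<rho> x + dist x y) powr (k0 / (1 + k0))))"

definition G_bound :: "'a::metric_space measure \<Rightarrow> 'a \<Rightarrow> real \<Rightarrow> real \<Rightarrow> real
    \<Rightarrow> ('a \<Rightarrow> real) \<Rightarrow> real \<Rightarrow> bool" where
  "G_bound M x r \<beta> \<gamma> f C \<longleftrightarrow>
     (\<forall>y. \<bar>f y\<bar> \<le> C * (1 / (Vr M r x + Vxy M x y)) * (r / (r + dist x y)) powr \<gamma>) \<and>
     (\<forall>y y'. dist y y' \<le> (r + dist x y) / 2 \<longrightarrow>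
        \<bar>f y - f y'\<bar> \<le> C * (dist y y' / (r + dist x y)) powr \<beta>
                         * (1 / (Vr M r x + Vxy M x y)) * (r / (r + dist x y)) powr \<gamma>)"

definition Gsp :: "'a::metric_space measure \<Rightarrow> 'a \<Rightarrow> real \<Rightarrow> real \<Rightarrow> real \<Rightarrow> ('a \<Rightarrow> real) set" where
  "Gsp M x r \<beta> \<gamma> = {f. \<exists>C. G_bound M x r \<beta> \<gamma> f C}"

definition Gnorm :: "'a::metric_space measure \<Rightarrow> 'a \<Rightarrow> real \<Rightarrow> real \<Rightarrow> real \<Rightarrow> ('a \<Rightarrow> real) \<Rightarrow> real" where
  "Gnorm M x r \<beta> \<gamma> f = Inf {C. G_bound M x r \<beta> \<gamma> f C}"

definition G0 :: "'a::metric_space measure \<Rightarrow> real \<Rightarrow> 'a \<Rightarrow> real \<Rightarrow> real \<Rightarrow> real \<Rightarrow> ('a \<Rightarrow> real) set" where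
  "G0 M \<epsilon> x r \<beta> \<gamma> = {f \<in> Gsp M x r \<beta> \<gamma>. \<forall>e>0. \<exists>g\<in>Gsp M x r \<epsilon> \<epsilon>.
       Gnorm M x r \<beta> \<gamma> (\<lambda>y. f y - g y) < e}"

definition Gdual :: "'a::metric_space measure \<Rightarrow> real \<Rightarrow> 'a \<Rightarrow> real \<Rightarrow> real
    \<Rightarrow> (('a \<Rightarrow> real) \<Rightarrow> real) set" where
  "Gdual M \<epsilon> x1 \<beta> \<gamma> = {L.
     (\<forall>\<phi>\<in>G0 M \<epsilon> x1 1 \<beta> \<gamma>. \<forall>\<psi>\<in>G0 M \<epsilon> x1 1 \<beta> \<gamma>. \<forall>a b::real.
        L (\<lambda>y. a * \<phi> y + b * \<psi> y) = a * L \<phi> + b * L \<psi>) \<and>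
     (\<exists>B. \<forall>\<phi>\<in>G0 M \<epsilon> x1 1 \<beta> \<gamma>. \<bar>L \<phi>\<bar> \<le> B * Gnorm M x1 1 \<beta> \<gamma> \<phi>)}"

definition pairing :: "'a::metric_space measure \<Rightarrow> ('a \<Rightarrow> real) \<Rightarrow> ('a \<Rightarrow> real) \<Rightarrow> real" where
  "pairing M f = (\<lambda>\<phi>. \<integral>y. f y * \<phi> y \<partial>M)"

definition Gmax :: "'a::metric_space measure \<Rightarrow> ('a \<Rightarrow> real) \<Rightarrow> real \<Rightarrow> 'a \<Rightarrow> real \<Rightarrow> real
    \<Rightarrow> (('a \<Rightarrow> real) \<Rightarrow> real) \<Rightarrow> 'a \<Rightarrow> ennreal" where
  "Gmax M \<rho> \<epsilon> x1 \<beta> \<gamma> L x =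
     (SUP \<phi>\<in>{\<phi> \<in> G0 M \<epsilon> x1 1 \<beta> \<gamma>. \<exists>r. 0 < r \<and> r < \<rho> x \<and>
                \<phi> \<in> Gsp M x r \<beta> \<gamma> \<and> Gnorm M x r \<beta> \<gamma> \<phi> \<le> 1}.
        ennreal \<bar>L \<phi>\<bar>)"

definition H1norm :: "'a::metric_space measure \<Rightarrow> ('a \<Rightarrow> real) \<Rightarrow> real \<Rightarrow> 'a \<Rightarrow> real \<Rightarrow> real
    \<Rightarrow> (('a \<Rightarrow> real) \<Rightarrow> real) \<Rightarrow> ennreal" where
  "H1norm M \<rho> \<epsilon> x1 \<beta> \<gamma> L = (\<integral>\<^sup>+ x. Gmax M \<rho> \<epsilon> x1 \<beta> \<gamma> L x \<partial>M)"

definition L2_kernel_op :: "'a::metric_space measure \<Rightarrow> ('a \<Rightarrow> 'a \<Rightarrow> real) \<Rightarrow> bool" where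
  "L2_kernel_op M K \<longleftrightarrow> (\<lambda>(x, y). K x y) \<in> borel_measurable (M \<Otimes>\<^sub>M M) \<and>
     (\<exists>B\<ge>0. \<forall>f\<in>borel_measurable M. integrable M (\<lambda>y. (f y)\<^sup>2) \<longrightarrow>
        (AE x in M. integrable M (\<lambda>y. K x y * f y)) \<and>
        (\<integral>\<^sup>+ x. ennreal ((\<integral>y. K x y * f y \<partial>M)\<^sup>2) \<partial>M) \<le> ennreal B * (\<integral>\<^sup>+ y. ennreal ((f y)\<^sup>2) \<partial>M))"

definition cont_AOTI :: "'a::metric_space measure \<Rightarrow> real \<Rightarrow> real \<Rightarrow> real
    \<Rightarrow> (real \<Rightarrow> 'a \<Rightarrow> 'a \<Rightarrow> real) \<Rightarrow> bool" where
  "cont_AOTI M e1 e2 e3 S \<longleftrightarrow> (\<forall>t>0. L2_kernel_op M (S t)) \<and>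
    (\<exists>C6>0. \<forall>t>0. \<forall>x x' y y'.
      \<bar>S t x y\<bar> \<le> C6 * (1 / (Vr M t x + Vxy M x y)) * (t / (t + dist x y)) powr e2 \<and>
      (dist x x' \<le> (t + dist x y) / 2 \<longrightarrow>
         \<bar>S t x y - S t x' y\<bar> \<le> C6 * (dist x x' / (t + dist x y)) powr e1
             * (1 / (Vr M t x + Vxy M x y)) * (t / (t + dist x y)) powr e2) \<and>
      (dist y y' \<le> (t + dist x y) / 2 \<longrightarrow>
         \<bar>S t x y - S t x y'\<bar> \<le> C6 * (dist y y' / (t + dist x y)) powr e1
             * (1 / (Vr M t x + Vxy M x y)) * (t / (t + dist x y)) powr e2) \<and>
      (dist x x' \<le> (t + dist x y) / 3 \<longrightarrow> dist y y' \<le> (t + dist x y) / 3 \<longrightarrow>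
         \<bar>(S t x y - S t x y') - (S t x' y - S t x' y')\<bar> \<le>
             C6 * (dist x x' / (t + dist x y)) powr e1 * (dist y y' / (t + dist x y)) powr e1
             * (1 / (Vr M t x + Vxy M x y)) * (t / (t + dist x y)) powr e3) \<and>
      (\<integral>z. S t x z \<partial>M) = 1 \<and> (\<integral>z. S t z y \<partial>M) = 1)"

definition kop :: "'a::metric_space measure \<Rightarrow> ('a \<Rightarrow> 'a \<Rightarrow> real) \<Rightarrow> ('a \<Rightarrow> real) \<Rightarrow> 'a \<Rightarrow> real" where
  "kop M K f x = (\<integral>y. K x y * f y \<partial>M)"

definition Tplus :: "'a::metric_space measure \<Rightarrow> (real \<Rightarrow> 'a \<Rightarrow> 'a \<Rightarrow> real) \<Rightarrow> ('a \<Rightarrow> real) \<Rightarrow> 'a \<Rightarrow> ennreal" where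
  "Tplus M T f x = (SUP t\<in>{0<..}. ennreal \<bar>kop M (T t) f x\<bar>)"

definition Tplus_rho :: "'a::metric_space measure \<Rightarrow> ('a \<Rightarrow> real) \<Rightarrow> (real \<Rightarrow> 'a \<Rightarrow> 'a \<Rightarrow> real)
    \<Rightarrow> ('a \<Rightarrow> real) \<Rightarrow> 'a \<Rightarrow> ennreal" where
  "Tplus_rho M \<rho> T f x = (SUP t\<in>{0<..<\<rho> x}. ennreal \<bar>kop M (T t) f x\<bar>)"

end

theory Submission
  imports Defs
begin

text \<open>
  An iteration replaces the Calderon reproducing formula. Averaging a test function \<open>\<phi>\<close> at scale
  \<open>r < \<rho> x\<close> against the kernel at scale \<open>\<delta> r\<close> leaves a residual smaller than \<open>\<phi>\<close> by a factor
  \<open>O(\<delta> powr b)\<close>, while its Hoelder constant grows only by a factor independent of \<open>\<delta>\<close>; this is repeated at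
  the scales \<open>\<delta>\<^sup>k r\<close>. The averages may be sampled at points where the radial
  maximal function \<open>u\<close> of \<open>f\<close> lies below a local mean, so the pairing of \<open>f\<close> with \<open>\<phi>\<close> is bounded by the
  \<open>q\<close>-th power of the Hardy-Littlewood maximal function of \<open>u powr (1 / q)\<close>, \<open>q > 1\<close>, whose integral is
  controlled by that of \<open>u\<close>. The contribution from outside \<open>ball x (\<rho> x)\<close> and the difference
  between \<open>T t\<close> and \<open>S t\<close> are absorbed by an operator bounded on \<open>L\<^sup>1\<close>. The same estimate for an
  explicit Lipschitz kernel \<open>Q\<close> with bounded support, whose rows are multiples of admissible test functions,
  gives the converse inequality. Finally, evaluating a functional \<open>L\<close> at Riemann sums of convolutions with \<open>Q\<close>
  shows \<open>\<bar>L \<phi>\<bar> \<le> \<integral> \<bar>\<phi>\<bar> v\<close> with \<open>v\<close> integrable, so that \<open>L\<close> is given by a function.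
\<close>

section \<open>Doubling measures\<close>

text \<open>Neither \<open>Gmax\<close> nor \<open>Tplus\<close> is known to be measurable, and
  \<open>nn_integral\<close> of such a function is only a lower integral: monotone, but not
  additive. Every estimate therefore passes through a measurable function, namely a maximal function
  along countably many radii from below and a majorant of all pairings from above. The exponents
  decide convergence. At step \<open>k\<close> the residual has gained \<open>\<delta>\<close> to
  the power \<open>k * b\<close>, up to a constant to the power \<open>k\<close> that a small
  \<open>\<delta>\<close> beats. The local means, taken at that scale, cost \<open>\<delta>\<close>
  to the power \<open>- k * b / 2\<close>: means over small balls are compared with means over large
  ones, but this crude comparison is applied only to their power \<open>q - 1 = b / (2 * n)\<close>.
  The power \<open>q\<close> must exceed 1 because the maximal operator is not bounded on integrable
  functions. The error operator sees only the norm of \<open>f\<close>, so the maximal function of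
  \<open>f\<close> must also dominate that norm. This holds because the kernels reproduce
  \<open>f\<close> on balls as the scale tends to 0.\<close>

locale doubling_measure =
  fixes M :: "'a::metric_space measure" and D n :: real
  assumes sets_M: "sets M = sets borel"
    and ball_pos: "0 < r \<Longrightarrow> 0 < emeasure M (ball x r)"
    and ball_fin: "0 < r \<Longrightarrow> emeasure M (ball x r) < \<infinity>"
    and scale: "0 < r \<Longrightarrow> 1 \<le> l \<Longrightarrow> measure M (ball x (l * r)) \<le> D * l powr n * measure M (ball x r)"
    and D1: "1 \<le> D" and n_pos: "0 < n"
begin

definition V :: "'a \<Rightarrow> real \<Rightarrow> real" where "V x r = measure M (ball x r)"

text \<open>The envelope of a kernel at scale \<open>r\<close>. A single ball of radius
  \<open>r + dist x y\<close> stands in the denominator, so that comparisons of envelopes reduce to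
  inclusions of balls. Its integral in \<open>y\<close> is bounded independently of \<open>x\<close>
  and \<open>r\<close>, see \<open>E_integral\<close>.\<close>

definition E :: "real \<Rightarrow> real \<Rightarrow> 'a \<Rightarrow> 'a \<Rightarrow> real" where
  "E g r x y = (r / (r + dist x y)) powr g / V x (r + dist x y)"

lemma space_M [simp]: "space M = UNIV"
  using sets_eq_imp_space_eq[OF sets_M] by simp

lemma measurable_M_eq: "borel_measurable M = borel_measurable borel"
  by (rule measurable_cong_sets[OF sets_M refl])

lemma ball_sets [measurable, simp]: "ball x r \<in> sets M"
  by (simp add: sets_M)

lemma emeasure_ball: "emeasure M (ball x r) = ennreal (V x r)"
proof (cases "0 < r")
  case True
  have "emeasure M (ball x r) \<noteq> \<infinity>"
    using ball_fin[OF True] by (rule less_imp_neq)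
  from emeasure_eq_ennreal_measure[OF this[unfolded infinity_ennreal_def]]
  show ?thesis unfolding V_def .
next
  case False
  then have "ball x r = {}" by simp
  show ?thesis unfolding V_def \<open>ball x r = {}\<close> by simp
qed

lemma V_pos: "0 < r \<Longrightarrow> 0 < V x r"
  using ball_pos[of r x] by (simp add: emeasure_ball)

lemma V_nonneg [simp]: "0 \<le> V x r"
  by (simp add: V_def)

lemma V_subset: "ball x r \<subseteq> ball y s \<Longrightarrow> V x r \<le> V y s"
  using emeasure_mono[of "ball x r" "ball y s" M] by (simp add: emeasure_ball)

lemma V_mono: "r \<le> s \<Longrightarrow> V x r \<le> V x s"
  by (intro V_subset) auto

lemma V_compare:
  assumes "0 < r" "1 \<le> l" "dist x y + s \<le> l * r"
  shows "V x s \<le> D * l powr n * V y r"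
proof -
  have "ball x s \<subseteq> ball y (l * r)"
  proof
    fix z assume "z \<in> ball x s"
    with assms dist_triangle[of y z x] show "z \<in> ball y (l * r)"
      by (auto simp: dist_commute)
  qed
  then have "V x s \<le> V y (l * r)" by (rule V_subset)
  also have "\<dots> \<le> D * l powr n * V y r" unfolding V_def using assms by (intro scale) auto
  finally show ?thesis .
qed

lemma D_powr_ge1: "1 \<le> l \<Longrightarrow> 1 \<le> D * l powr n"
  using D1 n_pos mult_mono[of 1 D 1 "l powr n"] by (simp add: ge_one_powr_ge_zero)

lemma E_pos: "0 < r \<Longrightarrow> 0 < E g r x y"
  unfolding E_def using add_pos_nonneg[of r "dist x y"] by (intro divide_pos_pos V_pos) auto

lemma E_nonneg [simp]: "0 \<le> E g r x y"
  unfolding E_def by simp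

lemma E_le: "0 < r \<Longrightarrow> 0 \<le> g \<Longrightarrow> E g r x y \<le> 1 / V x r"
  unfolding E_def
  by (intro frac_le V_pos V_mono) (auto intro!: powr_le1 simp: add_pos_nonneg divide_le_eq_1)

text \<open>Changes of centre, argument and radius reduce to this. Hypothesis \<open>1\<close>
  compares the decay factors; hypothesis \<open>2\<close> puts the ball in the denominator on the
  right into the \<open>l\<close>-fold dilate of the one on the left.\<close>

lemma E_comp:
  assumes "0 < r" "0 < r'" "0 \<le> g" "0 \<le> c" "1 \<le> l"
    and 1: "r / (r + dist x y) \<le> c * (r' / (r' + dist x' y'))"
    and 2: "dist x' x + (r' + dist x' y') \<le> l * (r + dist x y)"
  shows "E g r x y \<le> c powr g * (D * l powr n) * E g r' x' y'"
proof -
  have a: "(r / (r + dist x y)) powr g \<le> c powr g * (r' / (r' + dist x' y')) powr g"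
  proof -
    have "(r / (r + dist x y)) powr g \<le> (c * (r' / (r' + dist x' y'))) powr g"
      using assms by (intro powr_mono2) auto
    also have "\<dots> = c powr g * (r' / (r' + dist x' y')) powr g"
      using assms by (intro powr_mult)
    finally show ?thesis .
  qed
  have p: "0 < r + dist x y" "0 < r' + dist x' y'" using assms by (auto intro: add_pos_nonneg)
  have b: "V x' (r' + dist x' y') \<le> D * l powr n * V x (r + dist x y)"
    using assms p by (intro V_compare) auto
  have "1 / V x (r + dist x y) \<le> (D * l powr n) / V x' (r' + dist x' y')"
    using b V_pos[OF p(1), of x] V_pos[OF p(2), of x'] by (simp add: divide_simps mult.commute)
  then have "(r / (r + dist x y)) powr g * (1 / V x (r + dist x y)) \<le>
     (c powr g * (r' / (r' + dist x' y')) powr g) * ((D * l powr n) / V x' (r' + dist x' y'))"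
    using a by (intro mult_mono) auto
  then show ?thesis by (simp add: E_def mult_ac)
qed

lemma E_sym:
  assumes "0 < r" "0 \<le> g" shows "E g r x y \<le> D * 2 powr n * E g r y x"
  using E_comp[of r r g 1 2 x y y x] assms by (simp add: dist_commute)

lemma E_shift:
  assumes "0 < r" "0 \<le> g" "dist y y' \<le> r"
  shows "E g r x y \<le> 2 powr g * (D * 2 powr n) * E g r x y'"
proof (rule E_comp)
  have "dist x y' \<le> dist x y + dist y y'" "dist x y \<le> dist x y' + dist y y'"
    using dist_triangle[of x y' y] dist_triangle[of x y y'] by (simp_all add: dist_commute)
  then have *: "r + dist x y' \<le> 2 * (r + dist x y) \<and> r + dist x y \<le> 2 * (r + dist x y')"
    using assms zero_le_dist[of x y] zero_le_dist[of x y'] by (smt (verit))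
  have "r * (r + dist x y') \<le> r * (2 * (r + dist x y))"
    using assms * by (intro mult_left_mono) auto
  then show "r / (r + dist x y) \<le> 2 * (r / (r + dist x y'))"
    using assms by (simp add: divide_simps add_pos_nonneg algebra_simps)
  show "dist x x + (r + dist x y') \<le> 2 * (r + dist x y)" using * by simp
qed (use assms in auto)

lemma E_smaller:
  assumes "0 < r'" "r' \<le> r" "r \<le> l * r'" "0 \<le> g"
  shows "E g r x y \<le> l powr g * E g r' x y"
proof -
  have l: "0 < l" using assms by (smt (verit) mult_nonpos_nonneg)
  have "r / (r + dist x y) \<le> l * r' / (r' + dist x y)"
    using assms by (intro frac_le) (auto simp: add_pos_nonneg)
  then have a: "(r / (r + dist x y)) powr g \<le> l powr g * (r' / (r' + dist x y)) powr g"
  proof -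
    have "(r / (r + dist x y)) powr g \<le> (l * (r' / (r' + dist x y))) powr g"
      using assms \<open>r / (r + dist x y) \<le> _\<close> by (intro powr_mono2) auto
    also have "\<dots> = l powr g * (r' / (r' + dist x y)) powr g"
      by (intro powr_mult)
    finally show ?thesis .
  qed
  show ?thesis unfolding E_def
    using a assms frac_le[OF _ a V_pos[of "r' + dist x y" x] V_mono[of "r' + dist x y" "r + dist x y" x]]
    by (simp add: add_pos_nonneg)
qed

lemma E_larger:
  assumes "0 < r" "r \<le> r'" "r' \<le> l * r" "0 \<le> g" "1 \<le> l"
  shows "E g r x y \<le> D * l powr n * E g r' x y"
proof -
  have "r * (r' + dist x y) \<le> r' * (r + dist x y)"
    using assms by (simp add: algebra_simps mult_right_mono)
  then have "r / (r + dist x y) \<le> 1 * (r' / (r' + dist x y))"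
    using assms by (simp add: divide_simps add_pos_nonneg)
  moreover have "dist x x + (r' + dist x y) \<le> l * (r + dist x y)"
    using assms mult_right_mono[of 1 l "dist x y"] by (simp add: algebra_simps)
  ultimately show ?thesis using E_comp[of r r' g 1 l x y x y] assms by simp
qed

definition K3 :: "real \<Rightarrow> real" where "K3 g = 2 powr g * (D * 4 powr n)"

lemma K3_pos: "0 < K3 g" using D1 by (simp add: K3_def)

text \<open>By the triangle inequality \<open>r + dist x y\<close> is at most twice
  \<open>r + dist x z\<close> or at most twice \<open>dist y z\<close>. In the first case the factor
  centred at \<open>x\<close> is bounded by its value at \<open>y\<close>; in the second the factor
  centred at \<open>y\<close> is bounded by that value, with the gain \<open>(t / r) powr g\<close>.
  Integrated in \<open>z\<close>, this composes envelopes of different scales.\<close>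

lemma E_three_point:
  assumes "0 < r" "0 < t" "0 \<le> g"
  shows "E g r x z * E g t y z \<le> K3 g * (E g r x y * E g t y z) + K3 g * ((t / r) powr g * E g r x z * E g r x y)"
proof -
  define d where "d = r + dist x y"
  have d: "0 < d" using assms by (simp add: d_def add_pos_nonneg)
  have tri: "d \<le> (r + dist x z) + dist y z"
    using dist_triangle[of x y z] by (simp add: d_def dist_commute)
  have "d \<le> 2 * (r + dist x z) \<or> d \<le> 2 * dist y z" using tri by argo
  then consider "d \<le> 2 * (r + dist x z)" | "d \<le> 2 * dist y z" by blast
  then show ?thesis
  proof cases
    case 1
    have "r / (r + dist x z) \<le> 2 * (r / (r + dist x y))"
    proof -
      have "r * d \<le> r * (2 * (r + dist x z))" using assms 1 by (intro mult_left_mono) auto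
      then show ?thesis using assms by (simp add: divide_simps add_pos_nonneg d_def algebra_simps)
    qed
    moreover have "dist x x + (r + dist x y) \<le> 4 * (r + dist x z)"
      using 1 assms zero_le_dist[of x z] unfolding d_def dist_self by argo
    ultimately have "E g r x z \<le> K3 g * E g r x y"
      unfolding K3_def using assms by (intro E_comp) auto
    then have "E g r x z * E g t y z \<le> K3 g * E g r x y * E g t y z"
      by (intro mult_right_mono) auto
    then show ?thesis using K3_pos[of g] by (simp add: mult.assoc add_increasing2)
  next
    case 2
    have "t / (t + dist y z) \<le> t / (d / 2)" using assms d 2 by (intro divide_left_mono) (auto simp: add_pos_nonneg)
    also have "\<dots> = 2 * t / r * (r / (r + dist x y))" using assms d by (simp add: d_def)
    finally have "t / (t + dist y z) \<le> 2 * t / r * (r / (r + dist x y))" .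
    moreover have "dist x y + (r + dist x y) \<le> 4 * (t + dist y z)" using 2 assms
      by (simp add: d_def)
    ultimately have "E g t y z \<le> (2 * t / r) powr g * (D * 4 powr n) * E g r x y"
      using assms by (intro E_comp) auto
    also have "\<dots> = K3 g * ((t / r) powr g * E g r x y)"
      using assms powr_mult[of 2 "t/r" g] by (simp add: K3_def)
    finally have "E g t y z \<le> K3 g * ((t / r) powr g * E g r x y)" .
    then have "E g r x z * E g t y z \<le> E g r x z * (K3 g * ((t / r) powr g * E g r x y))"
      by (intro mult_left_mono) auto
    then show ?thesis using K3_pos[of g] by (simp add: mult.assoc mult.left_commute add_increasing)
  qed
qed

lemma E_measurable [measurable]: "(\<lambda>y. E g r x y) \<in> borel_measurable M"
proof -
  have m: "(\<lambda>s. V x (r + s)) \<in> borel_measurable borel"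
    by (intro borel_measurable_mono monoI V_mono) auto
  have "(\<lambda>s. (r / (r + s)) powr g / V x (r + s)) \<in> borel_measurable borel"
    using m by measurable
  moreover have "dist x \<in> borel_measurable M"
    unfolding measurable_M_eq by (intro borel_measurable_continuous_onI continuous_intros)
  ultimately have "(\<lambda>s. (r / (r + s)) powr g / V x (r + s)) \<circ> dist x \<in> borel_measurable M"
    by (rule measurable_comp[rotated])
  then show ?thesis by (simp add: o_def E_def)
qed

definition KI :: "real \<Rightarrow> real" where "KI g = D * 2 powr n / (1 - 2 powr (- g))"

lemma KI_pos: "0 < g \<Longrightarrow> 0 < KI g"
  using D1 by (simp add: KI_def powr_less_one)

lemma dyadic_scale:
  fixes r s :: real
  assumes "0 < r" "r \<le> s"
  obtains k :: nat where "2 ^ k * r \<le> s" "s < 2 ^ Suc k * r"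
proof -
  have "\<exists>k::nat. s < 2 ^ k * r"
    using real_arch_pow[of 2 "s / r"] assms by (auto simp: divide_simps)
  define k where "k = (LEAST k::nat. s < 2 ^ k * r)"
  have k: "s < 2 ^ k * r" using \<open>\<exists>k::nat. _\<close> unfolding k_def by (rule LeastI_ex)
  have k0: "k \<noteq> 0" using k assms by (intro notI) simp
  have "\<not> s < 2 ^ (k - 1) * r" using not_less_Least[of "k - 1" "\<lambda>k. s < 2 ^ k * r"] k0
    unfolding k_def[symmetric] by simp
  then show ?thesis using k k0 that[of "k - 1"] by simp
qed

text \<open>On the annulus where \<open>r + dist x z\<close> lies between \<open>2^k * r\<close> and
  \<open>2^(k+1) * r\<close> the envelope is at most \<open>2^(-g*k) / V x (2^k * r)\<close>. The
  growth condition on \<open>F\<close> and doubling bound the contribution of the annulus by a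
  multiple of \<open>2^(-g*k) * m\<close>, and the geometric series gives \<open>KI g\<close>. With
  \<open>F = 1\<close> this is the mass of the envelope; in \<open>averages_bound\<close>,
  \<open>F\<close> is a family of local means.\<close>

lemma E_layer:
  fixes m :: ennreal
  assumes F[measurable]: "F \<in> borel_measurable M" and r: "0 < r" and g: "0 < g"
    and m: "\<And>R. r \<le> R \<Longrightarrow> (\<integral>\<^sup>+z. F z * indicator (ball x R) z \<partial>M) \<le> m * ennreal (V x R)"
  shows "(\<integral>\<^sup>+z. ennreal (E g r x z) * F z \<partial>M) \<le> ennreal (KI g) * m"
proof -
  define q where "q = (2::real) powr (- g)"
  have q: "0 < q" "q < 1" using g by (auto simp: q_def powr_less_one)
  have Vp: "0 < V x (2 ^ k * r)" for k using r by (intro V_pos) simp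
  define T where "T k z = ennreal (q ^ k / V x (2 ^ k * r)) * indicator (ball x (2 ^ Suc k * r)) z" for k z
  have T[measurable]: "T k \<in> borel_measurable M" for k unfolding T_def by measurable
  have pt: "ennreal (E g r x z) * F z \<le> (\<Sum>k. T k z * F z)" for z
  proof -
    obtain k where k: "2 ^ k * r \<le> r + dist x z" "r + dist x z < 2 ^ Suc k * r"
      using dyadic_scale[OF r, of "r + dist x z"] by auto
    have "(r / (r + dist x z)) powr g \<le> (1 / 2 ^ k) powr g"
      using k r g by (intro powr_mono2) (auto simp: divide_simps add_pos_nonneg mult.commute)
    also have "\<dots> = q ^ k"
      by (simp add: q_def powr_minus powr_divide powr_power powr_realpow[symmetric] powr_powr mult.commute inverse_eq_divide power_one_over)
    finally have "E g r x z \<le> q ^ k / V x (2 ^ k * r)"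
      unfolding E_def using q by (intro frac_le Vp V_mono k) auto
    moreover have "z \<in> ball x (2 ^ Suc k * r)" using k r by auto
    ultimately have "ennreal (E g r x z) \<le> T k z" by (simp add: T_def ennreal_leI)
    then have "ennreal (E g r x z) * F z \<le> T k z * F z" by (intro mult_right_mono) auto
    also have "\<dots> \<le> (\<Sum>k. T k z * F z)"
      using sum_le_suminf[of "\<lambda>k. T k z * F z" "{k}"] by simp
    finally show ?thesis .
  qed
  have each: "(\<integral>\<^sup>+z. T k z * F z \<partial>M) \<le> ennreal (D * 2 powr n * q ^ k) * m" for k
  proof -
    have "(\<integral>\<^sup>+z. T k z * F z \<partial>M) = (\<integral>\<^sup>+z. ennreal (q ^ k / V x (2 ^ k * r)) * (F z * indicator (ball x (2 ^ Suc k * r)) z) \<partial>M)"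
      by (simp add: T_def mult_ac)
    also have "\<dots> = ennreal (q ^ k / V x (2 ^ k * r)) * (\<integral>\<^sup>+z. F z * indicator (ball x (2 ^ Suc k * r)) z \<partial>M)"
      by (intro nn_integral_cmult) measurable
    also have "\<dots> \<le> ennreal (q ^ k / V x (2 ^ k * r)) * (m * ennreal (V x (2 ^ Suc k * r)))"
    proof (intro mult_left_mono m)
      have "1 * r \<le> 2 ^ Suc k * r" using r by (intro mult_right_mono one_le_power) auto
      then show "r \<le> 2 ^ Suc k * r" by simp
    qed auto
    also have "\<dots> = ennreal (q ^ k / V x (2 ^ k * r) * V x (2 ^ Suc k * r)) * m"
      using q ennreal_mult''[of "V x (2 ^ Suc k * r)" "q ^ k / V x (2 ^ k * r)"] by (simp add: mult_ac)
    also have "\<dots> \<le> ennreal (D * 2 powr n * q ^ k) * m"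
    proof (intro mult_right_mono ennreal_leI)
      have "V x (2 ^ Suc k * r) \<le> D * 2 powr n * V x (2 ^ k * r)"
        using r by (intro V_compare) auto
      then have "q ^ k / V x (2 ^ k * r) * V x (2 ^ Suc k * r) \<le> q ^ k / V x (2 ^ k * r) * (D * 2 powr n * V x (2 ^ k * r))"
        using q by (intro mult_left_mono) auto
      then show "q ^ k / V x (2 ^ k * r) * V x (2 ^ Suc k * r) \<le> D * 2 powr n * q ^ k"
        using Vp[of k] by (simp add: mult_ac)
    qed auto
    finally show ?thesis .
  qed
  have "(\<integral>\<^sup>+z. ennreal (E g r x z) * F z \<partial>M) \<le> (\<integral>\<^sup>+z. (\<Sum>k. T k z * F z) \<partial>M)"
    by (intro nn_integral_mono pt)
  also have "\<dots> = (\<Sum>k. \<integral>\<^sup>+z. T k z * F z \<partial>M)"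
    by (intro nn_integral_suminf) measurable
  also have "\<dots> \<le> (\<Sum>k. ennreal (D * 2 powr n * q ^ k) * m)"
    by (intro suminf_le each) auto
  also have "\<dots> = (\<Sum>k. ennreal (D * 2 powr n * q ^ k)) * m" by simp
  also have "(\<Sum>k. ennreal (D * 2 powr n * q ^ k)) = ennreal (\<Sum>k. D * 2 powr n * q ^ k)"
    using q D1 by (intro suminf_ennreal2 summable_mult summable_geometric) auto
  also have "(\<Sum>k. D * 2 powr n * q ^ k) = KI g"
    using q by (subst suminf_mult) (auto simp: suminf_geometric KI_def q_def)
  finally show ?thesis .
qed

lemma E_integral:
  assumes "0 < r" "0 < g" shows "(\<integral>\<^sup>+z. ennreal (E g r x z) \<partial>M) \<le> ennreal (KI g)"
  using E_layer[of "\<lambda>_. 1" r g x 1] assms by (simp add: emeasure_ball)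

section \<open>Separability\<close>

text \<open>Packing: the balls of radius \<open>s / 2\<close> about the points are disjoint, lie in
  \<open>ball x (R + s)\<close>, and by doubling each has mass at least \<open>c\<close>.\<close>

lemma separated_card_bound:
  fixes x :: 'a
  assumes "0 < s" "0 < R"
  shows "\<exists>N. \<forall>F. finite F \<longrightarrow> F \<subseteq> ball x R \<longrightarrow> (\<forall>a\<in>F. \<forall>b\<in>F. a \<noteq> b \<longrightarrow> s \<le> dist a b) \<longrightarrow> card F \<le> N"
proof -
  define l where "l = 1 + 2 * R / (s / 2)"
  have l: "1 \<le> l" using assms by (simp add: l_def)
  define c where "c = V x R / (D * l powr n)"
  have c: "0 < c" using V_pos[OF assms(2)] D_powr_ge1[OF l] by (simp add: c_def)
  have "card F \<le> nat \<lceil>V x (R + s) / c\<rceil>"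
    if F: "finite F" "F \<subseteq> ball x R" "\<forall>a\<in>F. \<forall>b\<in>F. a \<noteq> b \<longrightarrow> s \<le> dist a b" for F
  proof -
    have low: "c \<le> V a (s / 2)" if "a \<in> F" for a
    proof -
      have "dist x a + R \<le> l * (s / 2)"
      proof -
        have "dist x a < R" using that F by auto
        moreover have "l * (s / 2) = s / 2 + 2 * R" using assms by (simp add: l_def field_simps)
        ultimately show ?thesis using assms by linarith
      qed
      then have "V x R \<le> D * l powr n * V a (s / 2)"
        using assms l by (intro V_compare) auto
      then show ?thesis using D_powr_ge1[OF l] by (simp add: c_def divide_simps mult.commute)
    qed
    have disj: "disjoint_family_on (\<lambda>a. ball a (s / 2)) F"
      unfolding disjoint_family_on_def
    proof (intro ballI impI)
      fix a b assume "a \<in> F" "b \<in> F" "a \<noteq> b"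
      then have "s \<le> dist a b" using F by auto
      then show "ball a (s/2) \<inter> ball b (s/2) = {}"
        by (intro disjoint_ballI) auto
    qed
    have "ennreal (real (card F) * c) = (\<Sum>a\<in>F. ennreal c)" using c by (simp add: ennreal_mult' ennreal_of_nat_eq_real_of_nat)
    also have "\<dots> \<le> (\<Sum>a\<in>F. emeasure M (ball a (s/2)))"
      by (intro sum_mono) (simp add: emeasure_ball low)
    also have "\<dots> = emeasure M (\<Union>a\<in>F. ball a (s/2))"
      using disj F by (intro sum_emeasure) auto
    also have "\<dots> \<le> emeasure M (ball x (R + s))"
    proof (intro emeasure_mono)
      show "(\<Union>a\<in>F. ball a (s/2)) \<subseteq> ball x (R + s)"
      proof
        fix z assume "z \<in> (\<Union>a\<in>F. ball a (s/2))"
        then obtain a where "a \<in> F" "dist a z < s/2" by auto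
        moreover have "dist x a < R" using F \<open>a \<in> F\<close> by auto
        ultimately show "z \<in> ball x (R + s)"
          using dist_triangle[of x z a] assms by simp
      qed
    qed simp
    finally have "real (card F) * c \<le> V x (R + s)" by (simp add: emeasure_ball)
    then have "real (card F) \<le> V x (R + s) / c" using c by (simp add: divide_simps)
    then show ?thesis by (simp add: le_nat_iff) linarith
  qed
  then show ?thesis by blast
qed

text \<open>A separated subset of largest cardinality exists by the packing bound, and it is a
  net.\<close>

lemma totally_bounded_ball:
  fixes x :: 'a
  assumes "0 < s" shows "\<exists>F. finite F \<and> ball x R \<subseteq> (\<Union>c\<in>F. ball c s)"
proof (cases "0 < R")
  case False
  then have "ball x R = {}" by simp
  then show ?thesis by blast
next
  case True
  define P where "P F \<longleftrightarrow> finite F \<and> F \<subseteq> ball x R \<and> (\<forall>a\<in>F. \<forall>b\<in>F. a \<noteq> b \<longrightarrow> s \<le> dist a b)" for F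
  from separated_card_bound[OF assms True, of x] obtain N where
    "\<forall>F. finite F \<longrightarrow> F \<subseteq> ball x R \<longrightarrow> (\<forall>a\<in>F. \<forall>b\<in>F. a \<noteq> b \<longrightarrow> s \<le> dist a b) \<longrightarrow> card F \<le> N"
    by (rule exE)
  then have N: "card F \<le> N" if "P F" for F using that by (simp add: P_def)
  have "P {}" by (simp add: P_def)
  then have "\<exists>F. P F \<and> (\<forall>G. P G \<longrightarrow> card G \<le> card F)"
    by (rule ex_has_greatest_nat[where b = "Suc N"]) (intro allI impI le_imp_less_Suc N)
  then obtain F where F: "P F" "\<forall>G. P G \<longrightarrow> card G \<le> card F" by (elim exE conjE)
  have "ball x R \<subseteq> (\<Union>c\<in>F. ball c s)"
  proof
    fix z assume z: "z \<in> ball x R"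
    show "z \<in> (\<Union>c\<in>F. ball c s)"
    proof (rule ccontr)
      assume "\<not> ?thesis"
      then have far: "\<forall>c\<in>F. s \<le> dist c z" by auto
      then have "z \<notin> F" using assms by force
      have "P (insert z F)" using F(1) z far unfolding P_def by (auto simp: dist_commute)
      from F(2)[rule_format, OF this] show False using F(1) \<open>z \<notin> F\<close> by (simp add: P_def)
    qed
  qed
  then show ?thesis using F(1) by (auto simp: P_def)
qed

text \<open>The type class provides no countable base; separability is extracted from the measure.
  It makes \<open>dist\<close> measurable on the product, reduces unions of balls to countable ones
  and allows sampling points to be chosen measurably.\<close>

lemma dense_sequence_exists: "\<exists>w::nat \<Rightarrow> 'a. \<forall>x s. 0 < s \<longrightarrow> (\<exists>j. dist x (w j) < s)"
proof -
  \<comment> \<open>\<open>undefined\<close> serves as an arbitrary base point; the balls of integer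
    radius about it exhaust the space.\<close>
  define F :: "nat \<Rightarrow> nat \<Rightarrow> 'a set" where
    "F R k = (SOME F. finite F \<and> ball undefined (real R) \<subseteq> (\<Union>c\<in>F. ball c (1 / real (Suc k))))" for R k
  have F: "finite (F R k) \<and> ball undefined (real R) \<subseteq> (\<Union>c\<in>F R k. ball c (1 / real (Suc k)))" for R k
    unfolding F_def by (rule someI_ex, rule totally_bounded_ball) simp
  define S where "S = insert undefined (\<Union>R k. F R k)"
  have "countable (F R k)" for R k using F by (intro countable_finite) blast
  then have S: "countable S" unfolding S_def
    by (intro countable_insert countable_UN) auto
  have "\<exists>j. dist x (from_nat_into S j) < s" if "0 < s" for x s
  proof -
    obtain R :: nat where R: "dist undefined x < real R"
      using reals_Archimedean2[of "dist undefined x"] by (elim exE)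
    obtain k where k: "1 / real (Suc k) < s" using nat_approx_posE[OF \<open>0 < s\<close>] by (metis (no_types))
    have "x \<in> (\<Union>c\<in>F R k. ball c (1 / real (Suc k)))" using F[of R k] R by (meson in_mono mem_ball)
    then obtain c where c: "c \<in> F R k" "dist c x < 1 / real (Suc k)" by auto
    then have "c \<in> S" unfolding S_def by blast
    from from_nat_into_surj[OF S this] obtain j where "from_nat_into S j = c" by (elim exE)
    then have "dist x (from_nat_into S j) < s" using c(2) k by (simp only: dist_commute)
    then show ?thesis ..
  qed
  then show ?thesis by blast
qed

definition w :: "nat \<Rightarrow> 'a" where
  "w = (SOME w. \<forall>x s. 0 < s \<longrightarrow> (\<exists>j. dist x (w j) < s))"

lemma w_dense: "0 < s \<Longrightarrow> \<exists>j. dist x (w j) < s"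
  using someI_ex[OF dense_sequence_exists] unfolding w_def[symmetric] by blast

text \<open>Taking the least index cuts the space into countably many measurable cells of diameter
  at most \<open>2 * s\<close>. Anything that depends on \<open>z\<close> only through
  \<open>idx s z\<close> is then measurable, however it was chosen.\<close>

definition idx :: "real \<Rightarrow> 'a \<Rightarrow> nat" where "idx s z = (LEAST j. dist z (w j) < s)"

lemma idx_dist: "0 < s \<Longrightarrow> dist z (w (idx s z)) < s"
  unfolding idx_def using w_dense[of s z] by (rule LeastI_ex)

lemma idx_measurable [measurable]: "idx s \<in> measurable M (count_space UNIV)"
proof -
  have [measurable]: "Measurable.pred M (\<lambda>z. dist z (w j) < s)" for j
  proof -
    have "{z. dist z (w j) < s} = ball (w j) s" by (auto simp: dist_commute)
    then show ?thesis by (simp add: pred_def)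
  qed
  show ?thesis unfolding idx_def by measurable
qed

text \<open>A least index is bounded by any index that works, and one index for each point of a
  finite \<open>s / 2\<close>-net works. Sums over the cells that meet a ball are therefore
  finite.\<close>

lemma idx_finite:
  assumes "0 < s" shows "finite (idx s ` ball x R)"
proof -
  from totally_bounded_ball[of "s/2" x R] assms obtain F
    where F: "finite F" "ball x R \<subseteq> (\<Union>c\<in>F. ball c (s/2))" by (elim meta_impE exE conjE) simp
  define j where "j c = (SOME i. dist c (w i) < s/2)" for c
  have j: "dist c (w (j c)) < s/2" for c
    unfolding j_def by (rule someI_ex, rule w_dense) (use assms in simp)
  have "idx s z \<le> Max (j ` F)" if z: "z \<in> ball x R" for z
  proof -
    obtain c where c: "c \<in> F" "dist c z < s/2" using F z by auto
    have "dist z (w (j c)) < s" using dist_triangle[of z "w (j c)" c] c j[of c] by (simp add: dist_commute)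
    then have "idx s z \<le> j c" unfolding idx_def by (rule Least_le)
    also have "\<dots> \<le> Max (j ` F)" using F c by (intro Max_ge) auto
    finally show ?thesis .
  qed
  then have "idx s ` ball x R \<subseteq> {.. Max (j ` F)}" by auto
  then show ?thesis by (rule finite_subset) simp
qed

lemma sigma_finite_M: "sigma_finite_measure M"
proof
  show "\<exists>A. countable A \<and> A \<subseteq> sets M \<and> \<Union> A = space M \<and> (\<forall>a\<in>A. emeasure M a \<noteq> \<infinity>)"
  proof (intro exI[of _ "range (\<lambda>j. ball (w j) 1)"] conjI ballI)
    show "\<Union> (range (\<lambda>j. ball (w j) 1)) = space M"
      using w_dense[of 1] by (auto simp: dist_commute)
    show "emeasure M a \<noteq> \<infinity>" if "a \<in> range (\<lambda>j. ball (w j) 1)" for a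
      using that by (auto simp: emeasure_ball)
  qed auto
qed

text \<open>The product measure carries the product of the Borel algebras, so continuity of
  \<open>dist\<close> does not suffice. By density, two points are closer than \<open>c\<close> iff
  some \<open>w j\<close> has distances to them with sum below \<open>c\<close>, a countable union
  of conditions on distances to fixed points.\<close>

lemma dist_measurable [measurable (raw)]:
  assumes [measurable]: "u \<in> measurable N M" "v \<in> measurable N M"
  shows "(\<lambda>p. dist (u p) (v p)) \<in> borel_measurable N"
proof -
  have [measurable]: "dist a \<in> borel_measurable M" for a
    unfolding measurable_M_eq by (intro borel_measurable_continuous_onI continuous_intros)
  show ?thesis
  proof (rule borel_measurable_iff_less[THEN iffD2], rule allI)
    fix c :: real
    have "{p \<in> space N. dist (u p) (v p) < c} =
          {p \<in> space N. \<exists>j. dist (w j) (u p) + dist (w j) (v p) < c}"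
    proof (intro Collect_cong conj_cong refl iffI)
      fix p assume "dist (u p) (v p) < c"
      then have "0 < (c - dist (u p) (v p)) / 2" by simp
      from w_dense[OF this, of "u p"] obtain j where "dist (u p) (w j) < (c - dist (u p) (v p)) / 2"
        by (elim exE)
      then have "dist (w j) (u p) + dist (w j) (v p) < c"
        using dist_triangle[of "w j" "v p" "u p"] by (simp add: dist_commute[of "w j" "u p"])
      then show "\<exists>j. dist (w j) (u p) + dist (w j) (v p) < c" ..
    next
      fix p assume "\<exists>j. dist (w j) (u p) + dist (w j) (v p) < c"
      then show "dist (u p) (v p) < c"
        using dist_triangle[of "u p" "v p"] by (metis dist_commute le_less_trans)
    qed
    also have "\<dots> \<in> sets N" by measurable
    finally show "{p \<in> space N. dist (u p) (v p) < c} \<in> sets N" .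
  qed
qed

text \<open>The volume is the measure of a section of a measurable subset of the product, hence
  depends measurably on the parameter even when centre and radius both vary.\<close>

lemma V_measurable [measurable (raw)]:
  assumes [measurable]: "c \<in> measurable N M" "f \<in> borel_measurable N"
  shows "(\<lambda>p. V (c p) (f p)) \<in> borel_measurable N"
proof -
  interpret sigma_finite_measure M by (rule sigma_finite_M)
  define Q where "Q = {x \<in> space (N \<Otimes>\<^sub>M M). dist (c (fst x)) (snd x) < f (fst x)}"
  have [measurable]: "Q \<in> sets (N \<Otimes>\<^sub>M M)" unfolding Q_def by measurable
  have "(\<lambda>p. enn2real (emeasure M (Pair p -` Q))) \<in> borel_measurable N"
    by measurable
  moreover have "enn2real (emeasure M (Pair p -` Q)) = V (c p) (f p)" if "p \<in> space N" for p
  proof -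
    have "Pair p -` Q = ball (c p) (f p)" using that by (auto simp: Q_def space_pair_measure)
    then show ?thesis by (simp add: emeasure_ball)
  qed
  ultimately show ?thesis by (simp cong: measurable_cong)
qed

lemma E_measurable2 [measurable (raw)]:
  assumes [measurable]: "r \<in> borel_measurable N" "c \<in> measurable N M" "z \<in> measurable N M"
  shows "(\<lambda>p. E g (r p) (c p) (z p)) \<in> borel_measurable N"
  unfolding E_def by measurable

end

section \<open>Approximating test functions by averages of kernels\<close>

lemma integrable_of_bound:
  fixes h F :: "'b \<Rightarrow> real"
  assumes [measurable]: "h \<in> borel_measurable N" "F \<in> borel_measurable N"
    and hF: "\<And>z. \<bar>h z\<bar> \<le> k * F z" and F: "(\<integral>\<^sup>+z. ennreal (F z) \<partial>N) \<le> ennreal K"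
    and k: "0 \<le> k" and K: "0 \<le> K"
  shows "integrable N h" "\<bar>\<integral>z. h z \<partial>N\<bar> \<le> k * K"
proof -
  have "(\<integral>\<^sup>+z. ennreal (norm (h z)) \<partial>N) \<le> (\<integral>\<^sup>+z. ennreal k * ennreal (F z) \<partial>N)"
    using hF k by (intro nn_integral_mono) (simp add: ennreal_mult'[symmetric] ennreal_leI)
  also have "\<dots> = ennreal k * (\<integral>\<^sup>+z. ennreal (F z) \<partial>N)" by (intro nn_integral_cmult) measurable
  also have "\<dots> \<le> ennreal k * ennreal K" by (intro mult_left_mono F) auto
  also have "\<dots> = ennreal (k * K)" using k by (simp add: ennreal_mult')
  finally have *: "(\<integral>\<^sup>+z. ennreal (norm (h z)) \<partial>N) \<le> ennreal (k * K)" .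
  show i: "integrable N h"
    using * by (intro integrableI_bounded) (auto simp: ennreal_less_top le_less_trans)
  have "ennreal (norm (\<integral>z. h z \<partial>N)) \<le> (\<integral>\<^sup>+z. ennreal (norm (h z)) \<partial>N)"
    by (rule integral_norm_bound_ennreal[OF i])
  from order.trans[OF this *] show "\<bar>\<integral>z. h z \<partial>N\<bar> \<le> k * K"
    using k K by (simp add: ennreal_le_iff)
qed

text \<open>The envelope is centred at the second variable because \<open>smear\<close> integrates
  over the first, and \<open>P_int\<close> normalises in the variable of integration. The Hoelder
  exponent is \<open>2 * b\<close> although test functions are measured with \<open>b\<close>: one
  half is spent on interpolating between a displacement of the sampling point and a displacement of
  \<open>y\<close>.\<close>

locale kernel = doubling_measure +
  fixes P :: "real \<Rightarrow> 'a \<Rightarrow> 'a \<Rightarrow> real" and g b C :: real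
  assumes b: "0 < b" "2 * b \<le> g" and C: "0 < C"
    and P_meas: "0 < t \<Longrightarrow> (\<lambda>(x, y). P t x y) \<in> borel_measurable (M \<Otimes>\<^sub>M M)"
    and P_size: "0 < t \<Longrightarrow> \<bar>P t z y\<bar> \<le> C * E g t y z"
    and P_hol1: "0 < t \<Longrightarrow> dist z z' \<le> t / 2 \<Longrightarrow>
        \<bar>P t z y - P t z' y\<bar> \<le> C * (dist z z' / t) powr (2 * b) * E g t y z"
    and P_hol2: "0 < t \<Longrightarrow> dist y y' \<le> t / 2 \<Longrightarrow>
        \<bar>P t z y - P t z y'\<bar> \<le> C * (dist y y' / t) powr (2 * b) * E g t y z"
    and P_int: "0 < t \<Longrightarrow> (\<integral>z. P t z y \<partial>M) = 1"
begin

lemma g_pos: "0 < g" "b < g" "0 \<le> g" using b by auto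

definition mn :: "real \<Rightarrow> real" where "mn s = min 1 s powr b"

lemma mn_nonneg [simp]: "0 \<le> mn s" and mn_le1: "0 \<le> s \<Longrightarrow> mn s \<le> 1"
  using b by (auto simp: mn_def powr_le1)

text \<open>Size and Hoelder constant are kept apart because an averaging step changes them at
  different rates. The Hoelder condition ranges over all pairs, distant ones included; for these the
  modulus \<open>mn\<close> saturates at 1, and the sum of both envelopes makes the condition
  symmetric.\<close>

definition cls :: "'a \<Rightarrow> real \<Rightarrow> real \<Rightarrow> real \<Rightarrow> ('a \<Rightarrow> real) \<Rightarrow> bool" where
  "cls x r A B \<phi> \<longleftrightarrow> \<phi> \<in> borel_measurable M \<and> (\<forall>y. \<bar>\<phi> y\<bar> \<le> A * E g r x y) \<and>
     (\<forall>y z. \<bar>\<phi> y - \<phi> z\<bar> \<le> B * mn (dist y z / r) * (E g r x y + E g r x z))"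

lemma P_measurable:
  assumes "0 < t" "u \<in> measurable N M" "v \<in> measurable N M"
  shows "(\<lambda>p. P t (u p) (v p)) \<in> borel_measurable N"
  using measurable_compose[OF measurable_Pair[OF assms(2,3)] P_meas[OF assms(1)]] by simp

definition "KC1 = 2 * K3 g * KI g"
definition "KC2 = (1 + K3 g) * KI (g - b) + K3 g * KI g"
definition "KS = 2 powr g * (D * 3 powr n)"
definition "KK = 2 powr b * (1 + C * KC2 + 2 * C * KS * KC1)"

lemma consts_pos: "0 < KC1" "0 < KC2" "0 < KS" "1 \<le> KS" "0 < KK"
proof -
  show p: "0 < KC1" "0 < KC2" "0 < KS"
    unfolding KC1_def KC2_def KS_def using K3_pos[of g] KI_pos[of g] KI_pos[of "g-b"] g_pos D1
    by (auto intro!: add_pos_pos mult_pos_pos)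
  show "1 \<le> KS" unfolding KS_def
    using D_powr_ge1[of 3] ge_one_powr_ge_zero[of 2 g] g_pos mult_mono[of 1 "2 powr g" 1 "D * 3 powr n"] by simp
  show "0 < KK" unfolding KK_def using p C by (simp add: add_pos_pos)
qed

text \<open>The modulus is paid for by decay: \<open>dist y z / r\<close> times
  \<open>t / (t + dist y z)\<close> is at most \<open>t / r\<close>. Giving up \<open>b\<close> of
  the exponent \<open>g\<close> thus buys the gain \<open>(t / r) powr b\<close>.\<close>

lemma mn_E:
  assumes "0 < t" "0 < r"
  shows "mn (dist y z / r) * E g t y z \<le> (t / r) powr b * E (g - b) t y z"
proof -
  define s where "s = t / (t + dist y z)"
  have t: "0 < t + dist y z" using assms by (simp add: add_pos_nonneg)
  have s: "0 < s" using t assms by (simp add: s_def)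
  have "min 1 (dist y z / r) * s \<le> dist y z / r * s" using s by (intro mult_right_mono) auto
  also have "\<dots> \<le> t / r"
  proof -
    have "dist y z * t \<le> t * (t + dist y z)" using assms by (simp add: algebra_simps)
    then show ?thesis using assms t by (simp add: s_def divide_simps mult_ac)
  qed
  finally have "(min 1 (dist y z / r) * s) powr b \<le> (t / r) powr b"
    using b s assms by (intro powr_mono2) auto
  then have "mn (dist y z / r) * s powr b \<le> (t / r) powr b"
    using s assms by (simp add: mn_def powr_mult)
  then have "mn (dist y z / r) * s powr b * s powr (g - b) \<le> (t / r) powr b * s powr (g - b)"
    by (intro mult_right_mono) auto
  moreover have "s powr b * s powr (g - b) = s powr g" by (simp add: powr_add[symmetric])
  ultimately have "mn (dist y z / r) * s powr g \<le> (t / r) powr b * s powr (g - b)"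
    by (simp add: mult.assoc)
  then show ?thesis unfolding E_def s_def[symmetric] times_divide_eq_right
    by (intro divide_right_mono) auto
qed

lemma mn_meas [measurable (raw)]: "f \<in> borel_measurable N \<Longrightarrow> (\<lambda>x. mn (f x)) \<in> borel_measurable N"
  unfolding mn_def by measurable

lemma powr_tr: "0 < t \<Longrightarrow> t \<le> r \<Longrightarrow> (t / r) powr g \<le> (t / r) powr b"
  using g_pos by (intro powr_mono') auto

lemma conv1:
  assumes "0 < t" "t \<le> r"
  shows "(\<integral>\<^sup>+z. ennreal (E g r x z * E g t y z) \<partial>M) \<le> ennreal (KC1 * E g r x y)"
proof -
  have r: "0 < r" using assms by simp
  have 1: "(t / r) powr g \<le> 1" using assms g_pos by (intro powr_le1) auto
  have "E g r x z * E g t y z \<le> K3 g * E g r x y * (E g t y z + E g r x z)" for z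
  proof -
    have "(t / r) powr g * E g r x z * E g r x y \<le> 1 * E g r x z * E g r x y"
      using 1 by (intro mult_right_mono) auto
    then have "K3 g * ((t / r) powr g * E g r x z * E g r x y) \<le> K3 g * (E g r x z * E g r x y)"
      using K3_pos[of g] by (intro mult_left_mono) auto
    then show ?thesis using E_three_point[OF r assms(1) g_pos(3), of x z y] by (simp add: algebra_simps)
  qed
  then have "(\<integral>\<^sup>+z. ennreal (E g r x z * E g t y z) \<partial>M) \<le>
     (\<integral>\<^sup>+z. ennreal (K3 g * E g r x y) * (ennreal (E g t y z) + ennreal (E g r x z)) \<partial>M)"
    using K3_pos[of g] by (intro nn_integral_mono)
      (simp add: ennreal_plus[symmetric] ennreal_mult'[symmetric] ennreal_leI del: ennreal_plus)
  also have "\<dots> = ennreal (K3 g * E g r x y) * ((\<integral>\<^sup>+z. ennreal (E g t y z) \<partial>M) + (\<integral>\<^sup>+z. ennreal (E g r x z) \<partial>M))"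
    by (simp add: nn_integral_cmult nn_integral_add)
  also have "\<dots> \<le> ennreal (K3 g * E g r x y) * (ennreal (KI g) + ennreal (KI g))"
    using assms r g_pos by (intro mult_left_mono add_mono E_integral) auto
  also have "\<dots> = ennreal (K3 g * E g r x y * (KI g + KI g))"
    using KI_pos[OF g_pos(1)] K3_pos[of g]
    by (simp add: ennreal_plus[symmetric] ennreal_mult'[symmetric] del: ennreal_plus)
  also have "K3 g * E g r x y * (KI g + KI g) = KC1 * E g r x y" by (simp add: KC1_def)
  finally show ?thesis .
qed

text \<open>The integrand models the oscillation of a function of scale \<open>r\<close> against a
  kernel of the finer scale \<open>t\<close>. After the three-point inequality, the terms that carry
  the envelope of scale \<open>t\<close> gain through \<open>mn_E\<close>, the remaining one through
  \<open>(t / r) powr g\<close>.\<close>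

lemma conv2:
  assumes "0 < t" "t \<le> r"
  shows "(\<integral>\<^sup>+z. ennreal (mn (dist y z / r) * (E g r x y + E g r x z) * E g t y z) \<partial>M)
    \<le> ennreal (KC2 * (t / r) powr b * E g r x y)"
proof -
  have r: "0 < r" using assms by simp
  define q where "q = (t / r) powr b"
  have q: "0 \<le> q" by (simp add: q_def)
  let ?X = "E g r x y"
  have pt: "mn (dist y z / r) * (?X + E g r x z) * E g t y z \<le>
      q * ?X * (1 + K3 g) * E (g - b) t y z + q * ?X * K3 g * E g r x z" for z
  proof -
    let ?m = "mn (dist y z / r)"
    have m: "?m \<le> 1" using r by (intro mn_le1) auto
    have "E g r x z * E g t y z \<le> K3 g * (?X * E g t y z) + K3 g * (q * E g r x z * ?X)"
    proof -
      have "(t / r) powr g * E g r x z * ?X \<le> q * E g r x z * ?X"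
        unfolding q_def by (intro mult_right_mono powr_tr assms) auto
      then have "K3 g * ((t / r) powr g * E g r x z * ?X) \<le> K3 g * (q * E g r x z * ?X)"
        using K3_pos[of g] by (intro mult_left_mono) auto
      then show ?thesis using E_three_point[OF r assms(1) g_pos(3), of x z y] by linarith
    qed
    then have "?X * E g t y z + E g r x z * E g t y z \<le> (1 + K3 g) * ?X * E g t y z + K3 g * (q * E g r x z * ?X)"
      by (simp add: algebra_simps)
    then have "?m * (?X * E g t y z + E g r x z * E g t y z) \<le>
        ?m * ((1 + K3 g) * ?X * E g t y z + K3 g * (q * E g r x z * ?X))"
      by (intro mult_left_mono) auto
    also have "\<dots> = (1 + K3 g) * ?X * (?m * E g t y z) + ?m * (K3 g * (q * E g r x z * ?X))"
      by (simp add: algebra_simps)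
    also have "\<dots> \<le> (1 + K3 g) * ?X * (q * E (g - b) t y z) + 1 * (K3 g * (q * E g r x z * ?X))"
      unfolding q_def using K3_pos[of g] m
      by (intro add_mono mult_left_mono mn_E mult_right_mono assms r) auto
    finally show ?thesis by (simp add: algebra_simps)
  qed
  have "(\<integral>\<^sup>+z. ennreal (mn (dist y z / r) * (?X + E g r x z) * E g t y z) \<partial>M) \<le>
     (\<integral>\<^sup>+z. ennreal (q * ?X * (1 + K3 g)) * ennreal (E (g - b) t y z) + ennreal (q * ?X * K3 g) * ennreal (E g r x z) \<partial>M)"
    using K3_pos[of g] q pt by (intro nn_integral_mono)
      (simp add: ennreal_plus[symmetric] ennreal_mult'[symmetric] ennreal_leI del: ennreal_plus)
  also have "\<dots> = ennreal (q * ?X * (1 + K3 g)) * (\<integral>\<^sup>+z. ennreal (E (g - b) t y z) \<partial>M) +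
      ennreal (q * ?X * K3 g) * (\<integral>\<^sup>+z. ennreal (E g r x z) \<partial>M)"
    by (simp add: nn_integral_cmult nn_integral_add)
  also have "\<dots> \<le> ennreal (q * ?X * (1 + K3 g)) * ennreal (KI (g - b)) + ennreal (q * ?X * K3 g) * ennreal (KI g)"
    using assms r g_pos by (intro mult_left_mono add_mono E_integral) auto
  also have "\<dots> = ennreal (q * ?X * (1 + K3 g) * KI (g - b) + q * ?X * K3 g * KI g)"
    using KI_pos[of g] KI_pos[of "g - b"] K3_pos[of g] g_pos q
    by (simp add: ennreal_plus[symmetric] ennreal_mult'[symmetric] del: ennreal_plus)
  also have "q * ?X * (1 + K3 g) * KI (g - b) + q * ?X * K3 g * KI g = KC2 * q * ?X"
    by (simp add: KC2_def algebra_simps)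
  finally show ?thesis by (simp add: q_def)
qed

lemma E_shift_center:
  assumes "0 < t" "dist y y' \<le> t"
  shows "E g t y' z \<le> KS * E g t y z"
  unfolding KS_def
proof (rule E_comp)
  have tri: "dist y z \<le> dist y y' + dist y' z" "dist y' z \<le> dist y y' + dist y z"
    using dist_triangle[of y z y'] dist_triangle[of y' z y] by (simp_all add: dist_commute)
  show "dist y y' + (t + dist y z) \<le> 3 * (t + dist y' z)"
    using tri assms zero_le_dist[of y' z] by argo
  have "t * (t + dist y z) \<le> t * (2 * (t + dist y' z))"
    using tri assms zero_le_dist[of y' z] by (intro mult_left_mono) (argo, simp)
  then show "t / (t + dist y' z) \<le> 2 * (t / (t + dist y z))"
    using assms by (simp add: divide_simps add_pos_nonneg algebra_simps)
qed (use assms g_pos in auto)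

lemma E_shift_arg:
  assumes "0 < t" "dist z z' \<le> t"
  shows "E g t y z' \<le> KS * E g t y z"
proof -
  have "E g t y z' \<le> 2 powr g * (D * 2 powr n) * E g t y z"
    using assms g_pos by (intro E_shift) (auto simp: dist_commute)
  also have "\<dots> \<le> KS * E g t y z"
    unfolding KS_def using D1 n_pos by (intro mult_right_mono mult_left_mono powr_mono2) auto
  finally show ?thesis .
qed

lemma cls_E_nonneg:
  assumes "cls x r A B \<phi>" "0 < r" shows "0 \<le> A"
proof -
  have "0 \<le> A * E g r x x" using assms abs_ge_zero[of "\<phi> x"] unfolding cls_def by (meson order.trans)
  then show ?thesis using E_pos[OF assms(2), of g x x] by (simp add: zero_le_mult_iff)
qed

lemma P_zeta:
  assumes "0 < t" "dist z z' \<le> \<eta> * t" "0 \<le> \<eta>" "\<eta> \<le> 1/2"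
  shows "\<bar>P t z y - P t z' y\<bar> \<le> C * \<eta> powr (2 * b) * E g t y z"
    and "\<bar>P t z' y\<bar> \<le> 2 * C * E g t y z"
proof -
  have "dist z z' \<le> t / 2" using mult_right_mono[OF assms(4), of t] assms by linarith
  from P_hol1[OF assms(1) this, of y]
  have "\<bar>P t z y - P t z' y\<bar> \<le> C * (dist z z' / t) powr (2 * b) * E g t y z" .
  also have "\<dots> \<le> C * \<eta> powr (2 * b) * E g t y z"
    using assms C b by (intro mult_right_mono mult_left_mono powr_mono2) (auto simp: divide_simps)
  finally show 1: "\<bar>P t z y - P t z' y\<bar> \<le> C * \<eta> powr (2 * b) * E g t y z" .
  have "\<eta> powr (2 * b) \<le> 1" using assms b by (intro powr_le1) auto
  then have "C * \<eta> powr (2 * b) * E g t y z \<le> C * 1 * E g t y z"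
    using C by (intro mult_right_mono mult_left_mono) auto
  then show "\<bar>P t z' y\<bar> \<le> 2 * C * E g t y z" using 1 P_size[OF assms(1), of z y] by linarith
qed

text \<open>Dual to sampling: its pairing with \<open>f\<close> is the pairing of
  \<open>\<phi>\<close> with the values of \<open>kop M (P t) f\<close> at the points
  \<open>\<zeta> z\<close>, see \<open>smear_pairing\<close>.\<close>

definition smear :: "real \<Rightarrow> ('a \<Rightarrow> 'a) \<Rightarrow> ('a \<Rightarrow> real) \<Rightarrow> 'a \<Rightarrow> real" where
  "smear t \<zeta> \<phi> y = (\<integral>z. \<phi> z * P t (\<zeta> z) y \<partial>M)"

context
  fixes t r \<eta> A B :: real and x :: 'a and \<zeta> :: "'a \<Rightarrow> 'a" and \<phi> :: "'a \<Rightarrow> real"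
  assumes t: "0 < t" "t \<le> r" and \<eta>: "0 \<le> \<eta>" "\<eta> \<le> 1/2"
    and \<zeta>[measurable]: "\<zeta> \<in> measurable M M" and \<zeta>d: "\<And>z. dist z (\<zeta> z) \<le> \<eta> * t"
    and \<phi>: "cls x r A B \<phi>" and B: "0 \<le> B"
begin

private lemma r: "0 < r" using t by simp
private lemma A: "0 \<le> A" using cls_E_nonneg[OF \<phi> r] .
private lemma phi_meas [measurable]: "\<phi> \<in> borel_measurable M" using \<phi> by (simp add: cls_def)
private lemma phi_size: "\<bar>\<phi> y\<bar> \<le> A * E g r x y" using \<phi> by (simp add: cls_def)
private lemma phi_hol: "\<bar>\<phi> y - \<phi> z\<bar> \<le> B * mn (dist y z / r) * (E g r x y + E g r x z)"
  using \<phi> by (simp add: cls_def)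
private lemma Pz [measurable]: "(\<lambda>z. P t (\<zeta> z) y) \<in> borel_measurable M" "(\<lambda>z. P t z y) \<in> borel_measurable M"
  using t by (auto intro!: P_measurable)

private lemma P_integrable: "integrable M (\<lambda>z. P t z y)"
  using P_int[OF t(1), of y] not_integrable_integral_eq[of M "\<lambda>z. P t z y"] by fastforce

private lemma KC_nn: "0 \<le> KC1 * E g r x y" "0 \<le> KC2 * (t / r) powr b * E g r x y"
  using consts_pos by auto

private lemma a_part:
  "integrable M (\<lambda>z. (\<phi> y - \<phi> z) * P t z y)"
  "\<bar>\<integral>z. (\<phi> y - \<phi> z) * P t z y \<partial>M\<bar> \<le> B * C * (KC2 * (t / r) powr b * E g r x y)"
proof -
  have "\<bar>(\<phi> y - \<phi> z) * P t z y\<bar> \<le> (B * C) * (mn (dist y z / r) * (E g r x y + E g r x z) * E g t y z)" for z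
  proof -
    have "\<bar>\<phi> y - \<phi> z\<bar> * \<bar>P t z y\<bar> \<le> (B * mn (dist y z / r) * (E g r x y + E g r x z)) * (C * E g t y z)"
      using P_size[OF t(1), of z y] phi_hol[of y z] by (intro mult_mono) auto
    then show ?thesis by (simp add: abs_mult mult_ac)
  qed
  from integrable_of_bound[OF _ _ this conv2[OF t] _ KC_nn(2)]
  show "integrable M (\<lambda>z. (\<phi> y - \<phi> z) * P t z y)"
    "\<bar>\<integral>z. (\<phi> y - \<phi> z) * P t z y \<partial>M\<bar> \<le> B * C * (KC2 * (t / r) powr b * E g r x y)"
    using B C by auto
qed

private lemma e_part:
  "integrable M (\<lambda>z. \<phi> z * (P t (\<zeta> z) y - P t z y))"
  "\<bar>\<integral>z. \<phi> z * (P t (\<zeta> z) y - P t z y) \<partial>M\<bar> \<le> A * C * \<eta> powr (2 * b) * (KC1 * E g r x y)"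
proof -
  have "\<bar>\<phi> z * (P t (\<zeta> z) y - P t z y)\<bar> \<le> (A * C * \<eta> powr (2 * b)) * (E g r x z * E g t y z)" for z
  proof -
    have "\<bar>\<phi> z\<bar> * \<bar>P t (\<zeta> z) y - P t z y\<bar> \<le> (A * E g r x z) * (C * \<eta> powr (2 * b) * E g t y z)"
      using P_zeta(1)[OF t(1) \<zeta>d \<eta>, of z y] phi_size[of z] A by (intro mult_mono) (auto simp: abs_minus_commute)
    then show ?thesis by (simp add: abs_mult mult_ac)
  qed
  from integrable_of_bound[OF _ _ this conv1[OF t] _ KC_nn(1)]
  show "integrable M (\<lambda>z. \<phi> z * (P t (\<zeta> z) y - P t z y))"
  "\<bar>\<integral>z. \<phi> z * (P t (\<zeta> z) y - P t z y) \<partial>M\<bar> \<le> A * C * \<eta> powr (2 * b) * (KC1 * E g r x y)"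
    using A C by auto
qed

private lemma smear_int: "integrable M (\<lambda>z. \<phi> z * P t (\<zeta> z) y)" "integrable M (\<lambda>z. \<phi> z * P t z y)"
proof -
  have "integrable M (\<lambda>z. \<phi> y * P t z y - (\<phi> y - \<phi> z) * P t z y)"
    by (intro Bochner_Integration.integrable_diff integrable_mult_right a_part P_integrable)
  then show *: "integrable M (\<lambda>z. \<phi> z * P t z y)" by (simp add: algebra_simps)
  from Bochner_Integration.integrable_add[OF * e_part(1)[of y]]
  show "integrable M (\<lambda>z. \<phi> z * P t (\<zeta> z) y)" by (simp add: algebra_simps)
qed

text \<open>The unit mass of the kernel writes \<open>\<phi> y\<close> as an integral. What remains
  is the oscillation of \<open>\<phi>\<close> at scale \<open>t\<close> and the effect of displacing
  the sampling points.\<close>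

private lemma split: "\<phi> y - smear t \<zeta> \<phi> y =
    (\<integral>z. (\<phi> y - \<phi> z) * P t z y \<partial>M) - (\<integral>z. \<phi> z * (P t (\<zeta> z) y - P t z y) \<partial>M)"
proof -
  have "(\<integral>z. (\<phi> y - \<phi> z) * P t z y \<partial>M) = (\<integral>z. \<phi> y * P t z y \<partial>M) - (\<integral>z. \<phi> z * P t z y \<partial>M)"
    unfolding left_diff_distrib using smear_int P_integrable by (intro Bochner_Integration.integral_diff integrable_mult_right)
  moreover have "(\<integral>z. \<phi> z * (P t (\<zeta> z) y - P t z y) \<partial>M) = smear t \<zeta> \<phi> y - (\<integral>z. \<phi> z * P t z y \<partial>M)"
    unfolding right_diff_distrib smear_def using smear_int by (intro Bochner_Integration.integral_diff)
  ultimately show ?thesis using P_int[OF t(1), of y] by simp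
qed

private definition "X = B * C * KC2 * (t / r) powr b + A * C * KC1 * \<eta> powr b"

private lemma eta2: "\<eta> powr (2 * b) \<le> \<eta> powr b"
  using \<eta> b by (intro powr_mono') auto

private lemma size_X: "\<bar>\<phi> y - smear t \<zeta> \<phi> y\<bar> \<le> X * E g r x y"
proof -
  have "A * C * \<eta> powr (2 * b) * (KC1 * E g r x y) \<le> A * C * \<eta> powr b * (KC1 * E g r x y)"
    using eta2 A C KC_nn by (intro mult_right_mono mult_left_mono) auto
  then show ?thesis unfolding split using a_part(2)[of y] e_part(2)[of y]
    by (simp add: X_def algebra_simps)
qed

private lemma tr: "(t / r) powr b * (r / t) powr b = 1"
  using t r by (simp add: powr_mult[symmetric])

private lemma smear_meas: "smear t \<zeta> \<phi> \<in> borel_measurable M"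
proof -
  interpret sigma_finite_measure M by (rule sigma_finite_M)
  have [measurable]: "(\<lambda>p. P t (\<zeta> (snd p)) (fst p)) \<in> borel_measurable (M \<Otimes>\<^sub>M M)"
    by (rule P_measurable[OF t(1)]) measurable
  show ?thesis unfolding smear_def
    by (rule borel_measurable_lebesgue_integral) (simp add: case_prod_beta')
qed

text \<open>The kernel has unit mass for \<open>y\<close> and for \<open>y'\<close>, so the value
  \<open>\<phi> y\<close> may be subtracted under the integral. An oscillation term remains, and a
  double difference of the kernel in the sampling point and in \<open>y\<close>.\<close>

private lemma near_hol:
  assumes d: "dist y y' \<le> t / 2"
  shows "\<bar>smear t \<zeta> \<phi> y - smear t \<zeta> \<phi> y'\<bar> \<le>
    (B * C * KC2 + 2 * A * C * KS * KC1 * (\<eta> powr b * (r / t) powr b)) * (mn (dist y y' / r) * E g r x y)"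
proof -
  define d where "d = dist y y'"
  have d0: "0 \<le> d" "d \<le> t / 2" "d / t \<le> 1" using assms t by (auto simp: d_def divide_simps)
  define q where "q = (d / t) powr b"
  have q: "0 \<le> q" "q \<le> 1" using d0 t b by (auto simp: q_def powr_le1)
  have q2: "(d / t) powr (2 * b) = q * q" by (simp add: q_def powr_add[symmetric])
  have mnd: "mn (d / r) = q * (t / r) powr b"
  proof -
    have "d \<le> r" using d0 t by linarith
    then have "min 1 (d / r) = d / t * (t / r)" using r t by (simp add: min_def)
    then show ?thesis using d0 t r unfolding mn_def q_def by (simp only: powr_mult)
  qed
  have I1: "integrable M (\<lambda>z. (\<phi> y - \<phi> z) * (P t z y - P t z y'))"
    "\<bar>\<integral>z. (\<phi> y - \<phi> z) * (P t z y - P t z y') \<partial>M\<bar> \<le> (B * C * q) * (KC2 * (t / r) powr b * E g r x y)"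
  proof -
    have "\<bar>(\<phi> y - \<phi> z) * (P t z y - P t z y')\<bar> \<le> (B * C * q) * (mn (dist y z / r) * (E g r x y + E g r x z) * E g t y z)" for z
    proof -
      have "\<bar>P t z y - P t z y'\<bar> \<le> C * (q * q) * E g t y z"
        using P_hol2[OF t(1) d, of z] by (simp add: q2[symmetric] d_def)
      also have "\<dots> \<le> C * (1 * q) * E g t y z"
        using q C by (intro mult_right_mono mult_left_mono) auto
      finally have "\<bar>P t z y - P t z y'\<bar> \<le> C * q * E g t y z" by simp
      then have "\<bar>\<phi> y - \<phi> z\<bar> * \<bar>P t z y - P t z y'\<bar> \<le> (B * mn (dist y z / r) * (E g r x y + E g r x z)) * (C * q * E g t y z)"
        using phi_hol[of y z] by (intro mult_mono) auto
      then show ?thesis by (simp add: abs_mult mult_ac)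
    qed
    from integrable_of_bound[OF _ _ this conv2[OF t] _ KC_nn(2)]
    show "integrable M (\<lambda>z. (\<phi> y - \<phi> z) * (P t z y - P t z y'))"
      "\<bar>\<integral>z. (\<phi> y - \<phi> z) * (P t z y - P t z y') \<partial>M\<bar> \<le> (B * C * q) * (KC2 * (t / r) powr b * E g r x y)"
      using B C q by auto
  qed
  let ?R = "\<lambda>z. (P t (\<zeta> z) y - P t (\<zeta> z) y') - (P t z y - P t z y')"
  have I2: "integrable M (\<lambda>z. \<phi> z * ?R z)"
    "\<bar>\<integral>z. \<phi> z * ?R z \<partial>M\<bar> \<le> (2 * A * C * KS * (\<eta> powr b * q)) * (KC1 * E g r x y)"
  proof -
    \<comment> \<open>The double difference is bounded by multiples of
      \<open>\<eta> powr (2 * b)\<close> and of \<open>q * q\<close>. The smaller of the two is at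
      most their geometric mean \<open>\<eta> powr b * q\<close>; this consumes the exponent
      \<open>2 * b\<close>.\<close>
    have R: "\<bar>?R z\<bar> \<le> 2 * C * KS * (\<eta> powr b * q) * E g t y z" for z
    proof -
      have \<eta>2: "\<eta> powr (2 * b) = \<eta> powr b * \<eta> powr b" by (simp add: powr_add[symmetric])
      have KSE: "E g t y z \<le> KS * E g t y z" using consts_pos(4) mult_right_mono[of 1 KS "E g t y z"] by simp
      have 1: "\<bar>P t (\<zeta> z) y - P t z y\<bar> \<le> C * \<eta> powr (2 * b) * (KS * E g t y z)"
      proof -
        have "C * \<eta> powr (2 * b) * E g t y z \<le> C * \<eta> powr (2 * b) * (KS * E g t y z)"
          using C by (intro mult_left_mono KSE) auto
        then show ?thesis using P_zeta(1)[OF t(1) \<zeta>d \<eta>, of z y] by (simp add: abs_minus_commute)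
      qed
      have 2: "\<bar>P t (\<zeta> z) y' - P t z y'\<bar> \<le> C * \<eta> powr (2 * b) * (KS * E g t y z)"
      proof -
        have "E g t y' z \<le> KS * E g t y z" using d t by (intro E_shift_center) auto
        then have "C * \<eta> powr (2 * b) * E g t y' z \<le> C * \<eta> powr (2 * b) * (KS * E g t y z)"
          using C by (intro mult_left_mono) auto
        then show ?thesis using P_zeta(1)[OF t(1) \<zeta>d \<eta>, of z y'] by (simp add: abs_minus_commute)
      qed
      have 3: "\<bar>P t (\<zeta> z) y - P t (\<zeta> z) y'\<bar> \<le> C * (q * q) * (KS * E g t y z)"
      proof -
        have "dist z (\<zeta> z) \<le> t"
        proof -
          have "\<eta> * t \<le> 1 * t" using \<eta> t by (intro mult_right_mono) auto
          then show ?thesis using \<zeta>d[of z] by simp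
        qed
        then have "E g t y (\<zeta> z) \<le> KS * E g t y z" using t by (intro E_shift_arg) auto
        then have "C * (q * q) * E g t y (\<zeta> z) \<le> C * (q * q) * (KS * E g t y z)"
          using C q by (intro mult_left_mono) auto
        then show ?thesis using P_hol2[OF t(1) d, of "\<zeta> z"] by (simp add: q2[symmetric] d_def)
      qed
      have 4: "\<bar>P t z y - P t z y'\<bar> \<le> C * (q * q) * (KS * E g t y z)"
      proof -
        have "C * (q * q) * E g t y z \<le> C * (q * q) * (KS * E g t y z)"
          using C q by (intro mult_left_mono KSE) auto
        then show ?thesis using P_hol2[OF t(1) d, of z] by (simp add: q2[symmetric] d_def)
      qed
      have r1: "\<bar>?R z\<bar> \<le> 2 * (C * (\<eta> powr b * \<eta> powr b) * (KS * E g t y z))" using 1 2 by (simp add: \<eta>2)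
      have r2: "\<bar>?R z\<bar> \<le> 2 * (C * (q * q) * (KS * E g t y z))" using 3 4 by simp
      have F0: "0 \<le> 2 * C * (KS * E g t y z)" using C consts_pos by simp
      show ?thesis
      proof (cases "\<eta> powr b \<le> q")
        case True
        then have "\<eta> powr b * \<eta> powr b \<le> \<eta> powr b * q" by (intro mult_left_mono) auto
        from mult_left_mono[OF this F0] show ?thesis using r1 by (simp add: mult_ac)
      next
        case False
        then have "q * q \<le> \<eta> powr b * q" using q by (intro mult_right_mono) auto
        from mult_left_mono[OF this F0] show ?thesis using r2 by (simp add: mult_ac)
      qed
    qed
    have "\<bar>\<phi> z * ?R z\<bar> \<le> (2 * A * C * KS * (\<eta> powr b * q)) * (E g r x z * E g t y z)" for z
    proof -
      have "\<bar>\<phi> z\<bar> * \<bar>?R z\<bar> \<le> (A * E g r x z) * (2 * C * KS * (\<eta> powr b * q) * E g t y z)"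
        using R[of z] phi_size[of z] A by (intro mult_mono) auto
      then show ?thesis by (simp add: abs_mult mult_ac)
    qed
    from integrable_of_bound[OF _ _ this conv1[OF t] _ KC_nn(1)]
    show "integrable M (\<lambda>z. \<phi> z * ?R z)"
      "\<bar>\<integral>z. \<phi> z * ?R z \<partial>M\<bar> \<le> (2 * A * C * KS * (\<eta> powr b * q)) * (KC1 * E g r x y)"
      using A C q consts_pos(3) by auto
  qed
  have "smear t \<zeta> \<phi> y - smear t \<zeta> \<phi> y' = (\<integral>z. \<phi> z * P t (\<zeta> z) y - \<phi> z * P t (\<zeta> z) y' \<partial>M)"
    unfolding smear_def using smear_int by (intro Bochner_Integration.integral_diff[symmetric])
  also have "\<dots> = (\<integral>z. \<phi> z * ?R z + (\<phi> y * P t z y - \<phi> y * P t z y' - (\<phi> y - \<phi> z) * (P t z y - P t z y')) \<partial>M)"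
    by (intro Bochner_Integration.integral_cong) (auto simp: algebra_simps)
  also have "\<dots> = (\<integral>z. \<phi> z * ?R z \<partial>M) + (\<phi> y * 1 - \<phi> y * 1 - (\<integral>z. (\<phi> y - \<phi> z) * (P t z y - P t z y') \<partial>M))"
    using I1(1) I2(1) P_integrable P_int[OF t(1)] by (simp del: right_diff_distrib left_diff_distrib)
  finally have "\<bar>smear t \<zeta> \<phi> y - smear t \<zeta> \<phi> y'\<bar> \<le>
     (B * C * q) * (KC2 * (t / r) powr b * E g r x y) + (2 * A * C * KS * (\<eta> powr b * q)) * (KC1 * E g r x y)"
    using I1(2) I2(2) by linarith
  also have "\<dots> = (B * C * KC2 + 2 * A * C * KS * KC1 * (\<eta> powr b * (r / t) powr b)) * (mn (d / r) * E g r x y)"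
  proof -
    have "(r / t) powr b * (t / r) powr b = 1" using tr by (simp only: mult.commute)
    then show ?thesis unfolding mnd by (simp add: algebra_simps)
  qed
  finally show ?thesis by (simp add: d_def)
qed

text \<open>The size bound adds the oscillation of \<open>\<phi>\<close> at scale \<open>t\<close>
  and the sampling error. For the Hoelder constant, close pairs use \<open>near_hol\<close>; at
  distances above \<open>t / 2\<close> the size bound suffices, since there
  \<open>(t / r) powr b\<close> is at most a multiple of the modulus. The coefficient of
  \<open>B\<close> in the new Hoelder constant does not grow as \<open>t\<close> shrinks.\<close>

lemma smear_step:
  "cls x r (KK * ((t / r) powr b * B + \<eta> powr b * A)) (KK * (B + \<eta> powr b * (r / t) powr b * A))
     (\<lambda>y. \<phi> y - smear t \<zeta> \<phi> y)"
  unfolding cls_def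
proof (intro conjI allI)
  have k0: "1 \<le> 2 powr b" using b by (simp add: ge_one_powr_ge_zero)
  define Z where "Z = 1 + C * KC2 + 2 * C * KS * KC1"
  have Z: "C * KC2 \<le> Z" "C * KC1 \<le> Z" "2 * C * KS * KC1 \<le> Z" "1 + C * KC2 \<le> Z" "0 \<le> Z"
  proof -
    have "C * KC1 * 1 \<le> C * KC1 * (2 * KS)" using C consts_pos by (intro mult_left_mono) auto
    moreover have "0 \<le> C * KC2" "0 \<le> C * KC1" using C consts_pos by auto
    ultimately show "C * KC2 \<le> Z" "C * KC1 \<le> Z" "2 * C * KS * KC1 \<le> Z" "1 + C * KC2 \<le> Z" "0 \<le> Z"
      by (auto simp: Z_def algebra_simps)
  qed
  have KZ: "KK = 2 powr b * Z" "Z \<le> KK" using k0 Z mult_right_mono[of 1 "2 powr b" Z] by (auto simp: KK_def Z_def)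
  have X: "X \<le> Z * ((t / r) powr b * B + \<eta> powr b * A)"
  proof -
    have "(C * KC2) * ((t / r) powr b * B) \<le> Z * ((t / r) powr b * B)" "(C * KC1) * (\<eta> powr b * A) \<le> Z * (\<eta> powr b * A)"
      using Z A B by (auto intro!: mult_right_mono)
    then show ?thesis by (simp add: X_def algebra_simps)
  qed
  show "(\<lambda>y. \<phi> y - smear t \<zeta> \<phi> y) \<in> borel_measurable M" using smear_meas by measurable
  show "\<bar>\<phi> y - smear t \<zeta> \<phi> y\<bar> \<le> KK * ((t / r) powr b * B + \<eta> powr b * A) * E g r x y" for y
  proof -
    have "X * E g r x y \<le> KK * ((t / r) powr b * B + \<eta> powr b * A) * E g r x y"
      using order.trans[OF X mult_right_mono[OF KZ(2)]] A B by (intro mult_right_mono) auto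
    then show ?thesis using size_X[of y] by simp
  qed
  fix y y'
  let ?d = "dist y y'" and ?S = "E g r x y + E g r x y'" and ?W = "\<eta> powr b * (r / t) powr b * A"
  have W: "0 \<le> ?W" using A by simp
  show "\<bar>(\<phi> y - smear t \<zeta> \<phi> y) - (\<phi> y' - smear t \<zeta> \<phi> y')\<bar> \<le> KK * (B + ?W) * mn (?d / r) * ?S"
  proof (cases "?d \<le> t / 2")
    case True
    have "\<bar>smear t \<zeta> \<phi> y - smear t \<zeta> \<phi> y'\<bar> \<le> ((C * KC2) * B + (2 * C * KS * KC1) * ?W) * (mn (?d / r) * E g r x y)"
      using near_hol[OF True] by (simp add: mult_ac)
    also have "\<dots> \<le> ((C * KC2) * B + (2 * C * KS * KC1) * ?W) * (mn (?d / r) * ?S)"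
      using C consts_pos A B by (intro mult_left_mono) auto
    finally have "\<bar>(\<phi> y - smear t \<zeta> \<phi> y) - (\<phi> y' - smear t \<zeta> \<phi> y')\<bar> \<le>
       B * (mn (?d / r) * ?S) + ((C * KC2) * B + (2 * C * KS * KC1) * ?W) * (mn (?d / r) * ?S)"
      using phi_hol[of y y'] by (simp add: mult.assoc)
    also have "\<dots> = ((1 + C * KC2) * B + (2 * C * KS * KC1) * ?W) * (mn (?d / r) * ?S)" by (simp add: algebra_simps)
    also have "\<dots> \<le> (Z * B + Z * ?W) * (mn (?d / r) * ?S)"
      using Z A B by (intro mult_right_mono add_mono) auto
    also have "\<dots> = Z * ((B + ?W) * (mn (?d / r) * ?S))" by (simp add: algebra_simps)
    also have "\<dots> \<le> KK * ((B + ?W) * (mn (?d / r) * ?S))"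
      using KZ B W by (intro mult_right_mono) auto
    finally show ?thesis by (simp add: mult.assoc)
  next
    case False
    have "t / r \<le> 2 * min 1 (?d / r)"
      using False t r by (auto simp: min_def divide_simps)
    then have "(t / r) powr b \<le> (2 * min 1 (?d / r)) powr b" using t r b by (intro powr_mono2) auto
    then have m: "(t / r) powr b \<le> 2 powr b * mn (?d / r)" using r by (simp add: mn_def powr_mult)
    have "\<bar>(\<phi> y - smear t \<zeta> \<phi> y) - (\<phi> y' - smear t \<zeta> \<phi> y')\<bar> \<le> X * ?S"
      using size_X[of y] size_X[of y'] by (simp add: algebra_simps)
    also have "\<dots> \<le> Z * ((t / r) powr b * B + \<eta> powr b * A) * ?S"
      using X by (intro mult_right_mono) auto
    also have "\<dots> = Z * ((t / r) powr b * (B + ?W)) * ?S"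
    proof -
      have "(t / r) powr b * (B + ?W) = (t / r) powr b * B + ((t / r) powr b * (r / t) powr b) * (\<eta> powr b * A)"
        by (simp add: algebra_simps)
      then show ?thesis unfolding tr by simp
    qed
    also have "\<dots> \<le> Z * ((2 powr b * mn (?d / r)) * (B + ?W)) * ?S"
      using m Z B W by (intro mult_right_mono mult_left_mono) auto
    also have "\<dots> = KK * (B + ?W) * mn (?d / r) * ?S" by (simp add: KZ(1) mult_ac)
    finally show ?thesis .
  qed
qed

end

lemma kop_integrable:
  assumes t: "0 < t" and f: "integrable M f"
  shows "integrable M (\<lambda>y. P t z y * f y)"
proof (rule Bochner_Integration.integrable_bound)
  show "integrable M (\<lambda>y. C / V z t * D * 2 powr n * f y)" using f by simp
  have [measurable]: "f \<in> borel_measurable M" "(\<lambda>y. P t z y) \<in> borel_measurable M"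
    using f t by (auto intro!: P_measurable)
  show "(\<lambda>y. P t z y * f y) \<in> borel_measurable M" by measurable
  have "\<bar>P t z y\<bar> \<le> C / V z t * D * 2 powr n" for y
  proof -
    have "E g t y z \<le> D * 2 powr n * E g t z y" using t g_pos by (intro E_sym) auto
    also have "\<dots> \<le> D * 2 powr n * (1 / V z t)" using t g_pos D1 by (intro mult_left_mono E_le) auto
    finally have "C * E g t y z \<le> C * (D * 2 powr n * (1 / V z t))" using C by (intro mult_left_mono) auto
    then show ?thesis using P_size[OF t, of z y] by (simp add: mult_ac)
  qed
  from mult_right_mono[OF this, of "\<bar>f _\<bar>"]
  show "AE y in M. norm (P t z y * f y) \<le> norm (C / V z t * D * 2 powr n * f y)"
    using C D1 by (intro AE_I2) (simp add: abs_mult)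
qed

lemma kop_measurable [measurable]:
  assumes t: "0 < t" and [measurable]: "f \<in> borel_measurable M"
  shows "kop M (P t) f \<in> borel_measurable M"
proof -
  interpret sigma_finite_measure M by (rule sigma_finite_M)
  have [measurable]: "(\<lambda>p. P t (fst p) (snd p)) \<in> borel_measurable (M \<Otimes>\<^sub>M M)"
    by (rule P_measurable[OF t]) measurable
  show ?thesis unfolding kop_def
    by (rule borel_measurable_lebesgue_integral) (simp add: case_prod_beta')
qed

lemma cls_pairing:
  assumes \<phi>: "cls x r A B \<phi>" and r: "0 < r" and f: "integrable M f"
  shows "integrable M (\<lambda>y. f y * \<phi> y)" "\<bar>\<integral>y. f y * \<phi> y \<partial>M\<bar> \<le> A * ((\<integral>y. \<bar>f y\<bar> \<partial>M) / V x r)"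
proof -
  have [measurable]: "\<phi> \<in> borel_measurable M" "f \<in> borel_measurable M" using \<phi> f by (auto simp: cls_def)
  have A: "0 \<le> A" using cls_E_nonneg[OF \<phi> r] .
  have le: "\<bar>\<phi> y\<bar> \<le> A / V x r" for y
  proof -
    have "A * E g r x y \<le> A * (1 / V x r)" using A r g_pos by (intro mult_left_mono E_le) auto
    moreover have "\<bar>\<phi> y\<bar> \<le> A * E g r x y" using \<phi> by (simp add: cls_def)
    ultimately show ?thesis by simp
  qed
  have le2: "\<bar>f y * \<phi> y\<bar> \<le> A / V x r * \<bar>f y\<bar>" for y
    using mult_right_mono[OF le[of y], of "\<bar>f y\<bar>"] by (simp add: abs_mult mult_ac)
  show i: "integrable M (\<lambda>y. f y * \<phi> y)"
    by (rule Bochner_Integration.integrable_bound[of M "\<lambda>y. A / V x r * \<bar>f y\<bar>"])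
       (use f le2 A in \<open>auto intro!: AE_I2 simp: abs_mult\<close>)
  have "\<bar>\<integral>y. f y * \<phi> y \<partial>M\<bar> \<le> (\<integral>y. \<bar>f y * \<phi> y\<bar> \<partial>M)" by (rule integral_abs_bound)
  also have "\<dots> \<le> (\<integral>y. A / V x r * \<bar>f y\<bar> \<partial>M)"
    using i f le2 by (intro integral_mono) auto
  also have "\<dots> = A * ((\<integral>y. \<bar>f y\<bar> \<partial>M) / V x r)" by simp
  finally show "\<bar>\<integral>y. f y * \<phi> y \<partial>M\<bar> \<le> A * ((\<integral>y. \<bar>f y\<bar> \<partial>M) / V x r)" .
qed

text \<open>Fubini. The double integral converges absolutely by \<open>conv1\<close> and because the
  envelope is at most \<open>1 / V x r\<close>.\<close>

lemma smear_pairing: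
  assumes t: "0 < t" "t \<le> r" and \<eta>: "0 \<le> \<eta>" "\<eta> \<le> 1/2"
    and \<zeta>[measurable]: "\<zeta> \<in> measurable M M" and \<zeta>d: "\<And>z. dist z (\<zeta> z) \<le> \<eta> * t"
    and \<phi>: "cls x r A B \<phi>" and f: "integrable M f"
  shows "integrable M (\<lambda>y. f y * smear t \<zeta> \<phi> y)"
    and "integrable M (\<lambda>z. \<phi> z * kop M (P t) f (\<zeta> z))"
    and "(\<integral>y. f y * smear t \<zeta> \<phi> y \<partial>M) = (\<integral>z. \<phi> z * kop M (P t) f (\<zeta> z) \<partial>M)"
proof -
  interpret sigma_finite_measure M by (rule sigma_finite_M)
  interpret MM: pair_sigma_finite M M ..
  have r: "0 < r" using t by simp
  have A: "0 \<le> A" using cls_E_nonneg[OF \<phi> r] .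
  have [measurable]: "\<phi> \<in> borel_measurable M" "f \<in> borel_measurable M" using \<phi> f by (auto simp: cls_def)
  have [measurable]: "(\<lambda>p. P t (\<zeta> (snd p)) (fst p)) \<in> borel_measurable (M \<Otimes>\<^sub>M M)"
    by (rule P_measurable[OF t(1)]) measurable
  define H where "H y z = f y * (\<phi> z * P t (\<zeta> z) y)" for y z
  have [measurable]: "case_prod H \<in> borel_measurable (M \<Otimes>\<^sub>M M)" unfolding H_def case_prod_beta' by measurable
  define k where "k = A * 2 * C"
  have k: "0 \<le> k" using A C by (simp add: k_def)
  have Hle: "\<bar>H y z\<bar> \<le> \<bar>f y\<bar> * k * (E g r x z * E g t y z)" for y z
  proof -
    have "\<bar>\<phi> z\<bar> * \<bar>P t (\<zeta> z) y\<bar> \<le> (A * E g r x z) * (2 * C * E g t y z)"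
      using P_zeta(2)[OF t(1) \<zeta>d \<eta>, of z y] \<phi> A by (intro mult_mono) (auto simp: cls_def)
    then have "\<bar>f y\<bar> * (\<bar>\<phi> z\<bar> * \<bar>P t (\<zeta> z) y\<bar>) \<le> \<bar>f y\<bar> * ((A * E g r x z) * (2 * C * E g t y z))"
      by (intro mult_left_mono) auto
    then show ?thesis by (simp add: H_def abs_mult k_def mult_ac)
  qed
  define k2 where "k2 = k * KC1 / V x r"
  have k2: "0 \<le> k2" using k consts_pos by (simp add: k2_def)
  have int_z: "(\<integral>\<^sup>+z. ennreal (norm (H y z)) \<partial>M) \<le> ennreal (k2 * \<bar>f y\<bar>)" for y
  proof -
    have "(\<integral>\<^sup>+z. ennreal (norm (H y z)) \<partial>M) \<le> (\<integral>\<^sup>+z. ennreal (\<bar>f y\<bar> * k) * ennreal (E g r x z * E g t y z) \<partial>M)"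
      using Hle k by (intro nn_integral_mono) (simp add: ennreal_mult'[symmetric] ennreal_leI)
    also have "\<dots> = ennreal (\<bar>f y\<bar> * k) * (\<integral>\<^sup>+z. ennreal (E g r x z * E g t y z) \<partial>M)"
      by (intro nn_integral_cmult) measurable
    also have "\<dots> \<le> ennreal (\<bar>f y\<bar> * k) * ennreal (KC1 * E g r x y)"
      by (intro mult_left_mono conv1 t) auto
    also have "\<dots> = ennreal (\<bar>f y\<bar> * k * (KC1 * E g r x y))" using k by (simp add: ennreal_mult')
    also have "\<dots> \<le> ennreal (k2 * \<bar>f y\<bar>)"
    proof (rule ennreal_leI)
      have "\<bar>f y\<bar> * k * (KC1 * E g r x y) \<le> \<bar>f y\<bar> * k * (KC1 * (1 / V x r))"
        using k consts_pos r g_pos by (intro mult_left_mono E_le) auto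
      then show "\<bar>f y\<bar> * k * (KC1 * E g r x y) \<le> k2 * \<bar>f y\<bar>" by (simp add: k2_def mult_ac)
    qed
    finally show ?thesis .
  qed
  have HI: "integrable (M \<Otimes>\<^sub>M M) (case_prod H)"
  proof (rule integrableI_bounded)
    have "(\<integral>\<^sup>+p. ennreal (norm (case_prod H p)) \<partial>(M \<Otimes>\<^sub>M M)) = (\<integral>\<^sup>+y. \<integral>\<^sup>+z. ennreal (norm (H y z)) \<partial>M \<partial>M)"
      by (subst nn_integral_fst[symmetric]) auto
    also have "\<dots> \<le> (\<integral>\<^sup>+y. ennreal (k2 * \<bar>f y\<bar>) \<partial>M)" by (intro nn_integral_mono int_z)
    also have "\<dots> < \<infinity>"
    proof -
      have "integrable M (\<lambda>y. k2 * \<bar>f y\<bar>)" using f by simp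
      then show ?thesis using k2 by (subst nn_integral_eq_integral) auto
    qed
    finally show "(\<integral>\<^sup>+p. ennreal (norm (case_prod H p)) \<partial>(M \<Otimes>\<^sub>M M)) < \<infinity>" .
  qed simp
  have 1: "(\<integral>z. H y z \<partial>M) = f y * smear t \<zeta> \<phi> y" for y
    by (simp add: H_def smear_def)
  have 2: "(\<integral>y. H y z \<partial>M) = \<phi> z * kop M (P t) f (\<zeta> z)" for z
  proof -
    have "(\<integral>y. H y z \<partial>M) = (\<integral>y. \<phi> z * (P t (\<zeta> z) y * f y) \<partial>M)" by (simp add: H_def mult_ac)
    then show ?thesis by (simp add: kop_def)
  qed
  show "integrable M (\<lambda>y. f y * smear t \<zeta> \<phi> y)" using MM.integrable_fst[OF HI] by (simp add: 1)
  show "integrable M (\<lambda>z. \<phi> z * kop M (P t) f (\<zeta> z))" using MM.integrable_snd[OF HI] by (simp add: 2)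
  show "(\<integral>y. f y * smear t \<zeta> \<phi> y \<partial>M) = (\<integral>z. \<phi> z * kop M (P t) f (\<zeta> z) \<partial>M)"
    using MM.Fubini_integral[OF HI] by (simp add: 1 2)
qed

text \<open>The sampling points \<open>\<zeta> k z\<close> are left free, since they are later chosen according to \<open>f\<close>.\<close>

primrec residual :: "real \<Rightarrow> real \<Rightarrow> (nat \<Rightarrow> 'a \<Rightarrow> 'a) \<Rightarrow> ('a \<Rightarrow> real) \<Rightarrow> nat \<Rightarrow> 'a \<Rightarrow> real" where
  "residual \<delta> r \<zeta> \<phi> 0 = \<phi>"
| "residual \<delta> r \<zeta> \<phi> (Suc k) =
     (\<lambda>y. residual \<delta> r \<zeta> \<phi> k y - smear (\<delta> ^ Suc k * r) (\<zeta> k) (residual \<delta> r \<zeta> \<phi> k) y)"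

context
  fixes \<delta> r :: real and \<zeta> :: "nat \<Rightarrow> 'a \<Rightarrow> 'a" and x :: 'a and \<phi> :: "'a \<Rightarrow> real"
  assumes \<delta>: "0 < \<delta>" "\<delta> \<le> 1/2" and r: "0 < r"
    and \<zeta>: "\<And>k. \<zeta> k \<in> measurable M M" and \<zeta>d: "\<And>k z. dist z (\<zeta> k z) \<le> \<delta> * (\<delta> ^ Suc k * r)"
    and \<phi>: "cls x r 1 1 \<phi>"
begin

private lemma tk: "0 < \<delta> ^ Suc k * r" "\<delta> ^ Suc k * r \<le> r"
proof -
  show "0 < \<delta> ^ Suc k * r" using \<delta> r by simp
  have "\<delta> ^ Suc k \<le> 1" using \<delta> by (intro power_le_one) auto
  then show "\<delta> ^ Suc k * r \<le> r" using r mult_right_mono[of "\<delta> ^ Suc k" 1 r] by simp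
qed

text \<open>With \<open>d = \<delta> powr b\<close> and \<open>t / r = \<delta> ^ Suc k\<close>, the
  two terms of each bound in \<open>smear_step\<close> coincide, whence the factor 2. The loss
  \<open>(r / t) powr b\<close> is exactly compensated by the size of the residual and the relative
  displacement \<open>\<eta> = \<delta>\<close> of the sampling points.\<close>

lemma residual_cls: "cls x r ((2 * KK * \<delta> powr b) ^ k) ((2 * KK) ^ k) (residual \<delta> r \<zeta> \<phi> k)"
proof (induction k)
  case 0 then show ?case using \<phi> by simp
next
  case (Suc k)
  define t where "t = \<delta> ^ Suc k * r"
  define d where "d = \<delta> powr b"
  have t: "0 < t" "t \<le> r" unfolding t_def using tk[of k] by auto
  have d: "0 < d" using \<delta> by (simp add: d_def)
  have tr: "(t / r) powr b = d ^ Suc k"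
  proof -
    have "t / r = \<delta> ^ Suc k" using r by (simp add: t_def)
    then show ?thesis using \<delta> by (simp add: d_def powr_power powr_realpow[symmetric] powr_powr mult.commute del: power_Suc)
  qed
  have rt: "(r / t) powr b = 1 / d ^ Suc k"
  proof -
    have "(t / r) powr b * (r / t) powr b = 1" using t r by (simp add: powr_mult[symmetric])
    then show ?thesis unfolding tr using d by (simp add: field_simps)
  qed
  have K0: "0 < KK" by (rule consts_pos)
  have "cls x r (KK * ((t / r) powr b * (2 * KK) ^ k + \<delta> powr b * (2 * KK * \<delta> powr b) ^ k))
     (KK * ((2 * KK) ^ k + \<delta> powr b * (r / t) powr b * (2 * KK * \<delta> powr b) ^ k))
     (\<lambda>y. residual \<delta> r \<zeta> \<phi> k y - smear t (\<zeta> k) (residual \<delta> r \<zeta> \<phi> k) y)"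
    using \<delta> \<zeta>d[of _ k] K0 by (intro smear_step[OF t _ _ \<zeta> _ Suc]) (auto simp: t_def)
  moreover have "KK * ((t / r) powr b * (2 * KK) ^ k + \<delta> powr b * (2 * KK * \<delta> powr b) ^ k) = (2 * KK * \<delta> powr b) ^ Suc k"
    unfolding tr d_def[symmetric] by (simp add: power_mult_distrib)
  moreover have "KK * ((2 * KK) ^ k + \<delta> powr b * (r / t) powr b * (2 * KK * \<delta> powr b) ^ k) = (2 * KK) ^ Suc k"
    unfolding rt d_def[symmetric] using d by (simp add: power_mult_distrib)
  ultimately show ?case by (simp add: t_def del: power_Suc)
qed

text \<open>The pairings with the residuals telescope. Each difference is a pairing with a
  \<open>smear\<close>, bounded through the size of the residual, and the last term tends to 0 with
  that size.\<close>

lemma iteration_bound: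
  assumes small: "2 * KK * \<delta> powr b < 1" and f: "integrable M f"
  shows "ennreal \<bar>\<integral>y. f y * \<phi> y \<partial>M\<bar> \<le>
    (\<Sum>k. ennreal ((2 * KK * \<delta> powr b) ^ k) *
       (\<integral>\<^sup>+z. ennreal (E g r x z * \<bar>kop M (P (\<delta> ^ Suc k * r)) f (\<zeta> k z)\<bar>) \<partial>M))"
proof -
  define q where "q = 2 * KK * \<delta> powr b"
  have q: "0 \<le> q" "q < 1" using small consts_pos by (auto simp: q_def)
  let ?R = "residual \<delta> r \<zeta> \<phi>" and ?t = "\<lambda>k. \<delta> ^ Suc k * r"
  let ?J = "\<lambda>k. ennreal (q ^ k) * (\<integral>\<^sup>+z. ennreal (E g r x z * \<bar>kop M (P (?t k)) f (\<zeta> k z)\<bar>) \<partial>M)"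
  note R = residual_cls
  have step: "ennreal \<bar>(\<integral>y. f y * ?R k y \<partial>M) - (\<integral>y. f y * ?R (Suc k) y \<partial>M)\<bar> \<le> ?J k" for k
  proof -
    have z: "dist z (\<zeta> k z) \<le> \<delta> * ?t k" for z using \<zeta>d[of z k] by simp
    have \<delta>0: "0 \<le> \<delta>" using \<delta> by simp
    note sp = smear_pairing[OF tk[of k] \<delta>0 \<delta>(2) \<zeta> z R f]
    have [measurable]: "(\<lambda>z. kop M (P (?t k)) f (\<zeta> k z)) \<in> borel_measurable M"
      using f by (intro measurable_compose[OF \<zeta> kop_measurable] tk) auto
    have "(\<integral>y. f y * ?R k y \<partial>M) - (\<integral>y. f y * ?R (Suc k) y \<partial>M) = (\<integral>y. f y * smear (?t k) (\<zeta> k) (?R k) y \<partial>M)"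
      using cls_pairing(1)[OF R[of k] r f] sp(1) by (simp add: right_diff_distrib)
    also have "\<dots> = (\<integral>z. ?R k z * kop M (P (?t k)) f (\<zeta> k z) \<partial>M)" by (rule sp(3))
    finally have "ennreal \<bar>(\<integral>y. f y * ?R k y \<partial>M) - (\<integral>y. f y * ?R (Suc k) y \<partial>M)\<bar> \<le>
        (\<integral>\<^sup>+z. ennreal (norm (?R k z * kop M (P (?t k)) f (\<zeta> k z))) \<partial>M)"
      using integral_norm_bound_ennreal[OF sp(2)] by simp
    also have "\<dots> \<le> (\<integral>\<^sup>+z. ennreal (q ^ k) * ennreal (E g r x z * \<bar>kop M (P (?t k)) f (\<zeta> k z)\<bar>) \<partial>M)"
    proof (intro nn_integral_mono)
      fix z
      have "\<bar>?R k z\<bar> \<le> q ^ k * E g r x z" using R[of k] by (simp add: cls_def q_def)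
      from mult_right_mono[OF this, of "\<bar>kop M (P (?t k)) f (\<zeta> k z)\<bar>"]
      show "ennreal (norm (?R k z * kop M (P (?t k)) f (\<zeta> k z))) \<le> ennreal (q ^ k) * ennreal (E g r x z * \<bar>kop M (P (?t k)) f (\<zeta> k z)\<bar>)"
        using q by (simp add: ennreal_mult'[symmetric] ennreal_leI abs_mult mult.assoc)
    qed
    also have "\<dots> = ?J k" by (intro nn_integral_cmult) measurable
    finally show ?thesis .
  qed
  have tele: "ennreal \<bar>\<integral>y. f y * \<phi> y \<partial>M\<bar> \<le> (\<Sum>k<N. ?J k) + ennreal \<bar>\<integral>y. f y * ?R N y \<partial>M\<bar>" for N
  proof (induction N)
    case 0 then show ?case by simp
  next
    case (Suc N)
    have "ennreal \<bar>\<integral>y. f y * ?R N y \<partial>M\<bar> \<le>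
        ennreal (\<bar>(\<integral>y. f y * ?R N y \<partial>M) - (\<integral>y. f y * ?R (Suc N) y \<partial>M)\<bar> + \<bar>\<integral>y. f y * ?R (Suc N) y \<partial>M\<bar>)"
      by (intro ennreal_leI) linarith
    also have "\<dots> \<le> ?J N + ennreal \<bar>\<integral>y. f y * ?R (Suc N) y \<partial>M\<bar>"
      using step[of N] by (subst ennreal_plus) (auto intro: add_right_mono)
    finally show ?case using Suc by (simp add: add.assoc) (meson add_left_mono order.trans)
  qed
  define W where "W = (\<integral>y. \<bar>f y\<bar> \<partial>M) / V x r"
  have tail: "\<bar>\<integral>y. f y * ?R N y \<partial>M\<bar> \<le> q ^ N * W" for N
    using cls_pairing(2)[OF R[of N] r f] by (simp add: q_def W_def)
  have le: "ennreal \<bar>\<integral>y. f y * \<phi> y \<partial>M\<bar> \<le> (\<Sum>k. ?J k) + ennreal (q ^ N * W)" for N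
    using tele[of N] sum_le_suminf[of ?J "{..<N}"] ennreal_leI[OF tail[of N]]
    by (meson add_mono order.trans finite_lessThan summableI zero_le)
  have "(\<lambda>N. q ^ N * W) \<longlonglongrightarrow> 0 * W" using q by (intro tendsto_mult LIMSEQ_power_zero tendsto_const) auto
  then have "(\<lambda>N. (\<Sum>k. ?J k) + ennreal (q ^ N * W)) \<longlonglongrightarrow> (\<Sum>k. ?J k) + ennreal 0"
    by (intro tendsto_add tendsto_ennrealI tendsto_const) simp
  from LIMSEQ_le_const[OF this] le show ?thesis by (simp add: q_def)
qed

end
end

section \<open>Covering lemmas and the Hardy-Littlewood maximal function\<close>

context doubling_measure
begin

text \<open>Greedy choice: a ball of largest radius is kept, the balls that meet it lie in its
  threefold dilate, and the others are treated by induction on their number.\<close>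

lemma vitali_finite:
  fixes c :: "'i \<Rightarrow> 'a" and s :: "'i \<Rightarrow> real"
  assumes "finite I"
  shows "\<exists>J\<subseteq>I. disjoint_family_on (\<lambda>i. ball (c i) (s i)) J \<and>
    (\<Union>i\<in>I. ball (c i) (s i)) \<subseteq> (\<Union>j\<in>J. ball (c j) (3 * s j))"
  using assms
proof (induction "card I" arbitrary: I rule: less_induct)
  case less
  show ?case
  proof (cases "I = {}")
    case True
    then show ?thesis by (intro exI[of _ "{}"]) (simp add: disjoint_family_on_def)
  next
    case False
    have "Max (s ` I) \<in> s ` I" using less.prems False by (intro Max_in) auto
    then obtain m where m: "m \<in> I" "s m = Max (s ` I)" by auto
    have mx: "s i \<le> s m" if "i \<in> I" for i unfolding m(2) using that less.prems by simp
    define I' where "I' = {i \<in> I. i \<noteq> m \<and> ball (c i) (s i) \<inter> ball (c m) (s m) = {}}"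
    have "I' \<subset> I" using m by (auto simp: I'_def)
    then have "card I' < card I" "finite I'" using less.prems by (auto intro: psubset_card_mono finite_subset)
    from less.hyps[OF this] obtain J where J: "J \<subseteq> I'" "disjoint_family_on (\<lambda>i. ball (c i) (s i)) J"
      "(\<Union>i\<in>I'. ball (c i) (s i)) \<subseteq> (\<Union>j\<in>J. ball (c j) (3 * s j))" by (elim exE conjE)
    show ?thesis
    proof (intro exI[of _ "insert m J"] conjI)
      show "insert m J \<subseteq> I" using J(1) m by (auto simp: I'_def)
      show "disjoint_family_on (\<lambda>i. ball (c i) (s i)) (insert m J)"
        using J(1,2) unfolding disjoint_family_on_def I'_def by blast
      show "(\<Union>i\<in>I. ball (c i) (s i)) \<subseteq> (\<Union>j\<in>insert m J. ball (c j) (3 * s j))"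
      proof
        fix z assume "z \<in> (\<Union>i\<in>I. ball (c i) (s i))"
        then obtain i where i: "i \<in> I" "z \<in> ball (c i) (s i)" by blast
        show "z \<in> (\<Union>j\<in>insert m J. ball (c j) (3 * s j))"
        proof (cases "i \<in> I'")
          case True
          then show ?thesis using J(3) i by blast
        next
          case False
          have "z \<in> ball (c m) (3 * s m)"
          proof (cases "i = m")
            case True
            then have "dist (c m) z < s m" using i by simp
            moreover have "0 < s m" using calculation zero_le_dist[of "c m" z] by linarith
            ultimately show ?thesis by simp
          next
            case neq: False
            then obtain v where v: "dist (c i) v < s i" "dist (c m) v < s m" using False i(1) by (auto simp: I'_def)
            have "dist (c m) z \<le> dist (c m) v + dist v (c i) + dist (c i) z"
              using dist_triangle[of "c m" z v] dist_triangle[of v z "c i"] by linarith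
            then show ?thesis using v i mx[OF i(1)] by (simp add: dist_commute)
          qed
          then show ?thesis by blast
        qed
      qed
    qed
  qed
qed

text \<open>A Lindelof argument: every point of the union lies in a ball about some
  \<open>w j\<close> of radius \<open>1 / Suc m\<close> that is contained in a member of the family,
  and one member is picked for each such pair.\<close>

lemma countable_ball_subcover:
  fixes c :: "'i \<Rightarrow> 'a" and s :: "'i \<Rightarrow> real"
  shows "\<exists>J. countable J \<and> J \<subseteq> I \<and> (\<Union>i\<in>I. ball (c i) (s i)) = (\<Union>i\<in>J. ball (c i) (s i))"
proof -
  define Q where "Q j m i \<longleftrightarrow> i \<in> I \<and> ball (w j) (1 / real (Suc m)) \<subseteq> ball (c i) (s i)" for j m i
  define J where "J = (\<lambda>(j, m). SOME i. Q j m i) ` {(j, m). \<exists>i. Q j m i}"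
  have "J \<subseteq> I"
  proof
    fix v assume "v \<in> J"
    then obtain j m where v: "v = (SOME i. Q j m i)" "\<exists>i. Q j m i" by (auto simp: J_def)
    have "Q j m v" unfolding v(1) using v(2) by (rule someI_ex)
    then show "v \<in> I" by (simp add: Q_def)
  qed
  moreover have "(\<Union>i\<in>I. ball (c i) (s i)) \<subseteq> (\<Union>i\<in>J. ball (c i) (s i))"
  proof
    fix z assume "z \<in> (\<Union>i\<in>I. ball (c i) (s i))"
    then obtain i where i: "i \<in> I" "dist (c i) z < s i" by auto
    then have "0 < (s i - dist (c i) z) / 2" by simp
    from nat_approx_posE[OF this] obtain m where m: "1 / real (Suc m) < (s i - dist (c i) z) / 2" by (metis (no_types))
    have "0 < 1 / real (Suc m)" by simp
    from w_dense[OF this, of z] obtain j where j: "dist z (w j) < 1 / real (Suc m)" by (elim exE)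
    have "ball (w j) (1 / real (Suc m)) \<subseteq> ball (c i) (s i)"
    proof
      fix v assume "v \<in> ball (w j) (1 / real (Suc m))"
      then have "dist (w j) v < 1 / real (Suc m)" by (simp only: mem_ball)
      moreover have "dist (c i) v \<le> dist (c i) z + dist z (w j) + dist (w j) v"
        using dist_triangle[of "c i" v z] dist_triangle[of z v "w j"] by linarith
      ultimately show "v \<in> ball (c i) (s i)" unfolding mem_ball using j m by argo
    qed
    then have q: "\<exists>i. Q j m i" using i by (auto simp: Q_def)
    then have "Q j m (SOME i. Q j m i)" by (rule someI_ex)
    moreover have "(SOME i. Q j m i) \<in> J" unfolding J_def using q by force
    moreover have "z \<in> ball (w j) (1 / real (Suc m))" using j by (simp add: dist_commute)
    ultimately show "z \<in> (\<Union>i\<in>J. ball (c i) (s i))" unfolding Q_def by blast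
  qed
  moreover have "countable J" unfolding J_def by (intro countable_image) simp
  ultimately show ?thesis by (intro exI[of _ J]) blast
qed

text \<open>Vitali selection and doubling; the selected balls are disjoint, so the integrals of
  \<open>F\<close> over them add up to at most the whole integral.\<close>

lemma weak_type_finite:
  fixes F :: "'a \<Rightarrow> ennreal" and c :: "'i \<Rightarrow> 'a"
  assumes [measurable]: "F \<in> borel_measurable M" and "finite I"
    and s: "\<And>i. i \<in> I \<Longrightarrow> 0 < s i"
    and avg: "\<And>i. i \<in> I \<Longrightarrow> ennreal (\<alpha> * V (c i) (s i)) \<le> (\<integral>\<^sup>+z. F z * indicator (ball (c i) (s i)) z \<partial>M)"
    and \<alpha>: "0 < \<alpha>"
  shows "emeasure M (\<Union>i\<in>I. ball (c i) (s i)) \<le> ennreal (D * 3 powr n / \<alpha>) * (\<integral>\<^sup>+z. F z \<partial>M)"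
proof -
  from vitali_finite[OF \<open>finite I\<close>, of c s] obtain J where J: "J \<subseteq> I" "disjoint_family_on (\<lambda>i. ball (c i) (s i)) J"
    "(\<Union>i\<in>I. ball (c i) (s i)) \<subseteq> (\<Union>j\<in>J. ball (c j) (3 * s j))" by (elim exE conjE)
  have fJ: "finite J" using J(1) \<open>finite I\<close> by (rule finite_subset)
  have "emeasure M (\<Union>i\<in>I. ball (c i) (s i)) \<le> emeasure M (\<Union>j\<in>J. ball (c j) (3 * s j))"
    using fJ by (intro emeasure_mono J) auto
  also have "\<dots> \<le> (\<Sum>j\<in>J. emeasure M (ball (c j) (3 * s j)))"
    using fJ by (intro emeasure_subadditive_finite) auto
  also have "\<dots> \<le> (\<Sum>j\<in>J. ennreal (D * 3 powr n / \<alpha>) * (\<integral>\<^sup>+z. F z * indicator (ball (c j) (s j)) z \<partial>M))"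
  proof (intro sum_mono)
    fix j assume "j \<in> J"
    then have j: "j \<in> I" using J by blast
    have "V (c j) (3 * s j) \<le> D * 3 powr n * V (c j) (s j)" using s[OF j] by (intro V_compare) auto
    also have "\<dots> = D * 3 powr n / \<alpha> * (\<alpha> * V (c j) (s j))" using \<alpha> by simp
    finally have "emeasure M (ball (c j) (3 * s j)) \<le> ennreal (D * 3 powr n / \<alpha> * (\<alpha> * V (c j) (s j)))"
      unfolding emeasure_ball by (rule ennreal_leI)
    also have "\<dots> = ennreal (D * 3 powr n / \<alpha>) * ennreal (\<alpha> * V (c j) (s j))" using \<alpha> D1 by (intro ennreal_mult) auto
    also have "\<dots> \<le> ennreal (D * 3 powr n / \<alpha>) * (\<integral>\<^sup>+z. F z * indicator (ball (c j) (s j)) z \<partial>M)"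
      by (intro mult_left_mono avg j) auto
    finally show "emeasure M (ball (c j) (3 * s j)) \<le> \<dots>" .
  qed
  also have "\<dots> = ennreal (D * 3 powr n / \<alpha>) * (\<Sum>j\<in>J. \<integral>\<^sup>+z. F z * indicator (ball (c j) (s j)) z \<partial>M)"
    by (simp add: sum_distrib_left)
  also have "(\<Sum>j\<in>J. \<integral>\<^sup>+z. F z * indicator (ball (c j) (s j)) z \<partial>M) = (\<integral>\<^sup>+z. (\<Sum>j\<in>J. F z * indicator (ball (c j) (s j)) z) \<partial>M)"
    by (intro nn_integral_sum[symmetric]) auto
  also have "ennreal (D * 3 powr n / \<alpha>) * \<dots> \<le> ennreal (D * 3 powr n / \<alpha>) * (\<integral>\<^sup>+z. F z \<partial>M)"
  proof (intro mult_left_mono nn_integral_mono)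
    fix z
    have "(\<Sum>j\<in>J. F z * indicator (ball (c j) (s j)) z) = F z * indicator (\<Union>j\<in>J. ball (c j) (s j)) z"
      by (simp only: sum_distrib_left[symmetric] indicator_UN_disjoint[OF fJ J(2)])
    also have "\<dots> \<le> F z" by (simp add: indicator_def)
    finally show "(\<Sum>j\<in>J. F z * indicator (ball (c j) (s j)) z) \<le> F z" .
  qed auto
  finally show ?thesis .
qed

text \<open>The family may be uncountable: a countable subfamily has the same union, and the finite
  bound passes to the increasing limit.\<close>

lemma weak_type:
  fixes F :: "'a \<Rightarrow> ennreal" and c :: "'i \<Rightarrow> 'a"
  assumes F: "F \<in> borel_measurable M"
    and s: "\<And>i. i \<in> I \<Longrightarrow> 0 < s i"
    and avg: "\<And>i. i \<in> I \<Longrightarrow> ennreal (\<alpha> * V (c i) (s i)) \<le> (\<integral>\<^sup>+z. F z * indicator (ball (c i) (s i)) z \<partial>M)"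
    and \<alpha>: "0 < \<alpha>"
  shows "emeasure M (\<Union>i\<in>I. ball (c i) (s i)) \<le> ennreal (D * 3 powr n / \<alpha>) * (\<integral>\<^sup>+z. F z \<partial>M)"
proof -
  from countable_ball_subcover[of I c s] obtain J where J: "countable J" "J \<subseteq> I"
    "(\<Union>i\<in>I. ball (c i) (s i)) = (\<Union>i\<in>J. ball (c i) (s i))" by (elim exE conjE)
  show ?thesis
  proof (cases "J = {}")
    case True then show ?thesis unfolding J(3) by simp
  next
    case False
    define e where "e = from_nat_into J"
    have e: "e k \<in> I" for k using from_nat_into[OF False] J(2) by (auto simp: e_def)
    define A where "A N = (\<Union>i\<in>e ` {..<N}. ball (c i) (s i))" for N
    have "(\<Union>i\<in>J. ball (c i) (s i)) = (\<Union>N. A N)"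
    proof -
      have "J = range e" using range_from_nat_into[OF False J(1)] by (simp add: e_def)
      moreover have "\<exists>N. k \<in> {..<N}" for k :: nat by (rule exI[of _ "Suc k"]) simp
      ultimately show ?thesis unfolding A_def by blast
    qed
    moreover have "emeasure M (\<Union>N. A N) = (SUP N. emeasure M (A N))"
      by (intro SUP_emeasure_incseq[symmetric]) (auto simp: A_def incseq_def intro: order.strict_trans2)
    moreover have "(SUP N. emeasure M (A N)) \<le> ennreal (D * 3 powr n / \<alpha>) * (\<integral>\<^sup>+z. F z \<partial>M)"
      unfolding A_def using e s avg by (intro SUP_least weak_type_finite F \<alpha>) auto
    ultimately show ?thesis unfolding J(3) by simp
  qed
qed

end

text \<open>A geometric sum is comparable with its largest term, whose base \<open>2 powr m\<close>
  lies below \<open>u\<close>.\<close>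

lemma dyadic_geometric_sum:
  fixes a u :: real and F :: "int set"
  assumes a: "0 < a" and F: "finite F" and u: "\<And>k. k \<in> F \<Longrightarrow> 2 powr real_of_int k < u"
  shows "(\<Sum>k\<in>F. 2 powr (a * real_of_int k)) \<le> u powr a / (1 - 2 powr (- a))"
proof (cases "F = {}")
  case True
  have "2 powr (- a) < 1" using a by (simp add: powr_less_one)
  then show ?thesis using True by simp
next
  case False
  define m where "m = Max F"
  have m: "m \<in> F" "\<And>k. k \<in> F \<Longrightarrow> k \<le> m" using F False by (auto simp: m_def)
  define \<rho> where "\<rho> = 2 powr (- a)"
  have \<rho>: "0 < \<rho>" "\<rho> < 1" using a by (auto simp: \<rho>_def powr_less_one)
  have "(\<Sum>k\<in>F. 2 powr (a * real_of_int k)) = (\<Sum>k\<in>F. 2 powr (a * real_of_int m) * \<rho> ^ nat (m - k))"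
  proof (intro sum.cong refl)
    fix k assume k: "k \<in> F"
    have "\<rho> ^ nat (m - k) = 2 powr (- a * real (nat (m - k)))"
      by (simp add: \<rho>_def powr_realpow[symmetric] powr_powr)
    also have "real (nat (m - k)) = real_of_int m - real_of_int k" using m(2)[OF k] by simp
    finally show "2 powr (a * real_of_int k) = 2 powr (a * real_of_int m) * \<rho> ^ nat (m - k)"
      by (simp add: powr_add[symmetric] algebra_simps)
  qed
  also have "\<dots> = 2 powr (a * real_of_int m) * (\<Sum>j\<in>(\<lambda>k. nat (m - k)) ` F. \<rho> ^ j)"
  proof -
    have "inj_on (\<lambda>k. nat (m - k)) F"
    proof (rule inj_onI)
      fix x y assume "x \<in> F" "y \<in> F" "nat (m - x) = nat (m - y)"
      then show "x = y" using m(2)[of x] m(2)[of y] by linarith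
    qed
    then show ?thesis by (simp add: sum.reindex sum_distrib_left)
  qed
  also have "\<dots> \<le> u powr a * (1 / (1 - \<rho>))"
  proof (intro mult_mono)
    have "2 powr (a * real_of_int m) = (2 powr real_of_int m) powr a" by (simp add: powr_powr mult.commute)
    also have "\<dots> \<le> u powr a" using a u[OF m(1)] by (intro powr_mono2) auto
    finally show "2 powr (a * real_of_int m) \<le> u powr a" .
    have "(\<Sum>j\<in>(\<lambda>k. nat (m - k)) ` F. \<rho> ^ j) \<le> (\<Sum>j. \<rho> ^ j)"
      using F \<rho> by (intro sum_le_suminf summable_geometric) auto
    then show "(\<Sum>j\<in>(\<lambda>k. nat (m - k)) ` F. \<rho> ^ j) \<le> 1 / (1 - \<rho>)"
      using \<rho> by (simp add: suminf_geometric)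
  qed (use \<rho> in \<open>auto intro!: sum_nonneg\<close>)
  finally show ?thesis by (simp add: \<rho>_def)
qed

context doubling_measure
begin

definition avg :: "('a \<Rightarrow> real) \<Rightarrow> 'a \<Rightarrow> real \<Rightarrow> real" where
  "avg U c s = (\<integral>z. U z * indicator (ball c s) z \<partial>M) / V c s"

text \<open>The uncentred maximal function, raised to the power \<open>q\<close>. Uncentred balls
  make the superlevel sets open, hence measurable.\<close>

definition maxf :: "real \<Rightarrow> ('a \<Rightarrow> real) \<Rightarrow> 'a \<Rightarrow> ennreal" where
  "maxf q U x = (SUP p\<in>{p. 0 < snd p \<and> x \<in> ball (fst p) (snd p)}. ennreal (avg U (fst p) (snd p) powr q))"

lemma maxf_measurable [measurable]: "maxf q U \<in> borel_measurable M"
proof (rule borel_measurableI_greater)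
  fix y
  have "{x \<in> space M. y < maxf q U x} = (\<Union>p\<in>{p. 0 < snd p \<and> y < ennreal (avg U (fst p) (snd p) powr q)}. ball (fst p) (snd p))"
    by (auto simp: maxf_def less_SUP_iff) metis+
  also have "open \<dots>" by (intro open_UN ballI open_ball)
  then have "\<dots> \<in> sets M" by (simp add: sets_M)
  finally show "{x \<in> space M. y < maxf q U x} \<in> sets M" .
qed

definition KM :: "real \<Rightarrow> real" where
  "KM q = 4 powr q * (D * 3 powr n) / (1 - 2 powr (- (q - 1)))"

lemma KM_pos: "1 < q \<Longrightarrow> 0 < KM q"
  using D1 powr_less_one[of 2 "- (q - 1)"] unfolding KM_def by (intro divide_pos_pos mult_pos_pos) auto

text \<open>Marcinkiewicz interpolation at the heights \<open>2 powr m\<close>. The weak type bound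
  is applied at each height to the part of \<open>U\<close> above it; after exchanging sum and
  integral, only heights below \<open>U z\<close> contribute at \<open>z\<close>, and they form a
  geometric sum.\<close>

lemma maxf_bound:
  assumes U[measurable]: "U \<in> borel_measurable M" and U0: "\<And>z. 0 \<le> U z"
    and loc: "\<And>c s. integrable M (\<lambda>z. U z * indicator (ball c s) z)" and q: "1 < q"
  shows "(\<integral>\<^sup>+x. maxf q U x \<partial>M) \<le> ennreal (KM q) * (\<integral>\<^sup>+x. ennreal (U x powr q) \<partial>M)"
proof -
  define a where "a = q - 1"
  have a: "0 < a" using q by (simp add: a_def)
  \<comment> \<open>Twice the height: discarding the values of \<open>U\<close> up to
    \<open>2 powr m\<close> lowers a mean by at most \<open>2 powr m\<close>, so what is left still
    has mean at least \<open>2 powr m\<close>.\<close>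
  define I where "I m = {p. 0 < snd p \<and> 2 * 2 powr real_of_int m < avg U (fst p) (snd p)}" for m
  define Em where "Em m = (\<Union>p\<in>I m. ball (fst p) (snd p))" for m
  have [measurable]: "Em m \<in> sets M" for m
  proof -
    have "open (Em m)" unfolding Em_def by (intro open_UN ballI open_ball)
    then show ?thesis by (simp add: sets_M)
  qed
  define F where "F m z = ennreal (U z) * indicator {z. 2 powr real_of_int m < U z} z" for m z
  have [measurable]: "F m \<in> borel_measurable M" for m
  proof -
    have [measurable]: "{z. 2 powr real_of_int m < U z} \<in> sets M"
    proof -
      have "{z \<in> space M. 2 powr real_of_int m < U z} \<in> sets M" by measurable
      then show ?thesis by simp
    qed
    show ?thesis unfolding F_def by measurable
  qed
  have weak: "emeasure M (Em m) \<le> ennreal (D * 3 powr n / 2 powr m) * (\<integral>\<^sup>+z. F m z \<partial>M)" for m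
    unfolding Em_def
  proof (rule weak_type)
    fix p assume p: "p \<in> I m"
    let ?B = "ball (fst p) (snd p)" and ?V = "V (fst p) (snd p)" and ?l = "2 powr real_of_int m"
    have Vp: "0 < ?V" using p by (intro V_pos) (auto simp: I_def)
    have "2 * ?l * ?V \<le> (\<integral>z. U z * indicator ?B z \<partial>M)"
      using p Vp by (simp add: I_def avg_def divide_simps mult_ac split: if_splits)
    then have "ennreal (2 * ?l * ?V) \<le> ennreal (\<integral>z. U z * indicator ?B z \<partial>M)" by (rule ennreal_leI)
    also have "\<dots> = (\<integral>\<^sup>+z. ennreal (U z * indicator ?B z) \<partial>M)"
      using loc U0 by (intro nn_integral_eq_integral[symmetric]) auto
    also have "\<dots> \<le> (\<integral>\<^sup>+z. F m z * indicator ?B z + ennreal ?l * indicator ?B z \<partial>M)"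
      by (intro nn_integral_mono) (auto simp: F_def indicator_def ennreal_leI)
    also have "\<dots> = (\<integral>\<^sup>+z. F m z * indicator ?B z \<partial>M) + ennreal ?l * emeasure M ?B"
      by (subst nn_integral_add) (auto simp: nn_integral_cmult)
    also have "ennreal ?l * emeasure M ?B = ennreal (?l * ?V)"
      by (simp add: emeasure_ball ennreal_mult')
    finally have *: "ennreal (2 * ?l * ?V) \<le> (\<integral>\<^sup>+z. F m z * indicator ?B z \<partial>M) + ennreal (?l * ?V)" .
    have "2 * ?l * ?V = ?l * ?V + ?l * ?V" by simp
    then have "ennreal (2 * ?l * ?V) = ennreal (?l * ?V) + ennreal (?l * ?V)"
      by (simp only:) (rule ennreal_plus, auto)
    with * have "ennreal (?l * ?V) + ennreal (?l * ?V) \<le> ennreal (?l * ?V) + (\<integral>\<^sup>+z. F m z * indicator ?B z \<partial>M)"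
      by (metis add.commute)
    then show "ennreal (?l * ?V) \<le> (\<integral>\<^sup>+z. F m z * indicator ?B z \<partial>M)"
      by (simp only: ennreal_add_left_cancel_le) simp
  qed (auto simp: I_def)
  \<comment> \<open>\<open>int_decode\<close> enumerates the integers, which turns the sum over all
    heights into a series.\<close>
  define T where "T k x = ennreal (4 powr q * 2 powr (q * int_decode k)) * indicator (Em (int_decode k)) x" for k x
  have [measurable]: "T k \<in> borel_measurable M" for k unfolding T_def by measurable
  have pt: "maxf q U x \<le> (\<Sum>k. T k x)" for x
    unfolding maxf_def
  proof (rule SUP_least)
    fix p assume p: "p \<in> {p. 0 < snd p \<and> x \<in> ball (fst p) (snd p)}"
    let ?a = "avg U (fst p) (snd p)"
    have "0 \<le> ?a" unfolding avg_def using U0 by (intro divide_nonneg_nonneg integral_nonneg) auto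
    show "ennreal (?a powr q) \<le> (\<Sum>k. T k x)"
    proof (cases "?a = 0")
      case True then show ?thesis by simp
    next
      case False
      then have a0: "0 < ?a" using \<open>0 \<le> ?a\<close> by simp
      \<comment> \<open>The offset 2 yields \<open>2 * 2 powr m < ?a\<close> and
        \<open>?a \<le> 4 * 2 powr m\<close> at once: membership in \<open>I m\<close> and an upper
        bound for the mean.\<close>
      define m where "m = \<lceil>log 2 ?a\<rceil> - 2"
      have m: "log 2 ?a \<le> m + 2" "m + 1 < log 2 ?a" unfolding m_def by linarith+
      have "?a \<le> 2 powr (m + 2)" using m(1) a0 by (simp add: powr_add[symmetric] log_le_iff)
      then have up: "?a \<le> 4 * 2 powr m" by (simp add: powr_add)
      have "2 powr (m + 1) < ?a" using m(2) a0 by (simp add: less_log_iff)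
      then have "p \<in> I m" using p by (simp add: I_def powr_add)
      then have xE: "x \<in> Em m" using p by (auto simp: Em_def)
      have "?a powr q \<le> (4 * 2 powr m) powr q" using up a0 q by (intro powr_mono2) auto
      also have "\<dots> = 4 powr q * 2 powr (q * m)" by (simp add: powr_mult powr_powr mult.commute)
      finally have "ennreal (?a powr q) \<le> T (int_encode m) x"
        using xE by (simp add: T_def ennreal_leI)
      also have "\<dots> \<le> (\<Sum>k. T k x)"
        using sum_le_suminf[of "\<lambda>k. T k x" "{int_encode m}"] by simp
      finally show ?thesis .
    qed
  qed
  define c where "c = 4 powr q * (D * 3 powr n)"
  have c: "0 < c" using D1 by (simp add: c_def)
  have "(\<integral>\<^sup>+x. maxf q U x \<partial>M) \<le> (\<integral>\<^sup>+x. (\<Sum>k. T k x) \<partial>M)" by (intro nn_integral_mono pt)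
  also have "\<dots> = (\<Sum>k. \<integral>\<^sup>+x. T k x \<partial>M)" by (intro nn_integral_suminf) measurable
  also have "\<dots> \<le> (\<Sum>k. \<integral>\<^sup>+z. ennreal (c * 2 powr (a * int_decode k)) * F (int_decode k) z \<partial>M)"
  proof (intro suminf_le)
    fix k
    let ?m = "int_decode k"
    have "(\<integral>\<^sup>+x. T k x \<partial>M) = ennreal (4 powr q * 2 powr (q * ?m)) * emeasure M (Em ?m)"
      by (simp add: T_def nn_integral_cmult)
    also have "\<dots> \<le> ennreal (4 powr q * 2 powr (q * ?m)) * (ennreal (D * 3 powr n / 2 powr ?m) * (\<integral>\<^sup>+z. F ?m z \<partial>M))"
      by (intro mult_left_mono weak) auto
    also have "\<dots> = ennreal (4 powr q * 2 powr (q * ?m) * (D * 3 powr n / 2 powr ?m)) * (\<integral>\<^sup>+z. F ?m z \<partial>M)"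
    proof -
      have "ennreal (4 powr q * 2 powr (q * ?m) * (D * 3 powr n / 2 powr ?m)) =
          ennreal (4 powr q * 2 powr (q * ?m)) * ennreal (D * 3 powr n / 2 powr ?m)"
        by (rule ennreal_mult) (use D1 in auto)
      then show ?thesis by (simp only: mult.assoc)
    qed
    also have "4 powr q * 2 powr (q * ?m) * (D * 3 powr n / 2 powr ?m) = c * 2 powr (a * ?m)"
    proof -
      have "2 powr (q * ?m) / 2 powr ?m = 2 powr (a * ?m)" by (simp add: powr_diff[symmetric] a_def algebra_simps)
      moreover have "4 powr q * 2 powr (q * ?m) * (D * 3 powr n / 2 powr ?m) = c * (2 powr (q * ?m) / 2 powr ?m)"
        by (simp add: c_def mult_ac)
      ultimately show ?thesis by (simp only:)
    qed
    finally show "(\<integral>\<^sup>+x. T k x \<partial>M) \<le> (\<integral>\<^sup>+z. ennreal (c * 2 powr (a * int_decode k)) * F (int_decode k) z \<partial>M)"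
      by (simp add: nn_integral_cmult)
  qed auto
  also have "\<dots> = (\<integral>\<^sup>+z. (\<Sum>k. ennreal (c * 2 powr (a * int_decode k)) * F (int_decode k) z) \<partial>M)"
    by (intro nn_integral_suminf[symmetric]) measurable
  also have "\<dots> \<le> (\<integral>\<^sup>+z. ennreal (KM q) * ennreal (U z powr q) \<partial>M)"
  proof (intro nn_integral_mono)
    fix z
    have fin: "(\<Sum>k<N. ennreal (c * 2 powr (a * int_decode k)) * F (int_decode k) z) \<le> ennreal (KM q) * ennreal (U z powr q)" for N
    proof -
      define S where "S = {m \<in> int_decode ` {..<N}. 2 powr real_of_int m < U z}"
      have "(\<Sum>k<N. ennreal (c * 2 powr (a * int_decode k)) * F (int_decode k) z) =
            (\<Sum>m\<in>int_decode ` {..<N}. ennreal (c * 2 powr (a * m)) * F m z)"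
        by (simp add: sum.reindex inj_int_decode)
      also have "\<dots> = (\<Sum>m\<in>S. ennreal (c * 2 powr (a * m)) * F m z)"
        unfolding S_def by (intro sum.mono_neutral_right) (auto simp: F_def)
      also have "\<dots> = (\<Sum>m\<in>S. ennreal (c * 2 powr (a * m) * U z))"
        using U0 c by (intro sum.cong) (auto simp: F_def S_def ennreal_mult)
      also have "\<dots> = ennreal (\<Sum>m\<in>S. c * 2 powr (a * m) * U z)"
        using U0 c by (intro sum_ennreal) auto
      also have "(\<Sum>m\<in>S. c * 2 powr (a * m) * U z) = c * U z * (\<Sum>m\<in>S. 2 powr (a * m))"
        by (simp add: sum_distrib_left mult_ac)
      also have "ennreal \<dots> \<le> ennreal (c * U z * (U z powr a / (1 - 2 powr (- a))))"
        using U0 c a by (intro ennreal_leI mult_left_mono dyadic_geometric_sum) (auto simp: S_def)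
      also have "c * U z * (U z powr a / (1 - 2 powr (- a))) = KM q * U z powr q"
      proof -
        have "U z * U z powr a = U z powr q"
          using U0[of z] by (cases "U z = 0") (auto simp: a_def powr_diff)
        then show ?thesis unfolding KM_def c_def a_def[symmetric] by (simp add: mult_ac)
      qed
      finally show ?thesis using KM_pos[OF q] by (simp add: ennreal_mult')
    qed
    show "(\<Sum>k. ennreal (c * 2 powr (a * int_decode k)) * F (int_decode k) z) \<le> ennreal (KM q) * ennreal (U z powr q)"
      unfolding suminf_eq_SUP by (intro SUP_least fin)
  qed
  also have "\<dots> = ennreal (KM q) * (\<integral>\<^sup>+x. ennreal (U x powr q) \<partial>M)" by (intro nn_integral_cmult) measurable
  finally show ?thesis .
qed

text \<open>If \<open>h\<close> exceeded its mean everywhere on \<open>A\<close> off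
  \<open>N\<close>, then \<open>h\<close> minus the mean would be positive almost everywhere on
  \<open>A\<close> and yet have integral 0, so \<open>A\<close> would be null.\<close>

lemma exists_le_mean:
  assumes i1: "integrable M (\<lambda>z. h z * indicator A z)" and A: "A \<in> sets M" "0 < emeasure M A" "emeasure M A < \<infinity>"
    and N: "N \<in> null_sets M"
  shows "\<exists>v. v \<in> A \<and> v \<notin> N \<and> h v * measure M A \<le> (\<integral>z. h z * indicator A z \<partial>M)"
proof (rule ccontr)
  assume no: "\<not> ?thesis"
  define m where "m = measure M A"
  have em: "emeasure M A = ennreal m" unfolding m_def
    using emeasure_eq_ennreal_measure[of M A] A(3) by (simp add: less_top)
  have m: "0 < m" using A(2) unfolding em by simp
  define a where "a = (\<integral>z. h z * indicator A z \<partial>M) / m"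
  have gt: "a < h v" if "v \<in> A" "v \<notin> N" for v
    using no that m unfolding a_def m_def[symmetric] by (auto simp: divide_less_eq not_le)
  have iB: "integrable M (\<lambda>z. a * indicator A z)"
    using A by (intro integrable_mult_right integrable_real_indicator) auto
  define k where "k z = h z * indicator A z - a * indicator A z" for z
  have ki: "integrable M k" unfolding k_def by (intro Bochner_Integration.integrable_diff i1 iB)
  have "(\<integral>z. k z \<partial>M) = (\<integral>z. h z * indicator A z \<partial>M) - a * m"
    unfolding k_def using i1 iB by (simp add: m_def)
  then have k0: "(\<integral>z. k z \<partial>M) = 0" using m by (simp add: a_def)
  have ae: "AE z in M. 0 \<le> k z \<and> (z \<in> A \<longrightarrow> k z \<noteq> 0)"
    using AE_not_in[OF N]
  proof eventually_elim
    fix z assume "z \<notin> N" then show "0 \<le> k z \<and> (z \<in> A \<longrightarrow> k z \<noteq> 0)"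
      using gt[of z] by (cases "z \<in> A") (auto simp: k_def)
  qed
  then have "AE z in M. 0 \<le> k z" by eventually_elim auto
  from integral_nonneg_eq_0_iff_AE[OF ki this] k0 have "AE z in M. k z = 0" by simp
  with ae have "AE z in M. z \<notin> A" by eventually_elim auto
  then have "emeasure M A = 0" using A(1) by (subst (asm) AE_iff_null_sets[symmetric]) auto
  then show False using A by simp
qed

lemma exists_le_avg:
  assumes loc: "integrable M (\<lambda>z. U z * indicator (ball c s) z)"
    and N: "N \<in> null_sets M" and s: "0 < s"
  shows "\<exists>v. v \<in> ball c s \<and> v \<notin> N \<and> U v \<le> avg U c s"
proof -
  have Vp: "0 < V c s" by (rule V_pos[OF s])
  then have "0 < emeasure M (ball c s)" "emeasure M (ball c s) < \<infinity>" by (simp_all add: emeasure_ball)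
  from exists_le_mean[OF loc ball_sets this N] show ?thesis
    using Vp by (simp add: avg_def V_def[symmetric] le_divide_eq)
qed

end

section \<open>Admissible functions\<close>

text \<open>An admissible function need not be measurable; \<open>\<sigma>\<close> is a measurable function comparable with \<open>\<rho>\<close>.
  The exponent is \<open>a = 1 / (1 + k\<^sub>0)\<close>.\<close>

locale admissible_pair = doubling_measure +
  fixes \<rho> \<sigma> :: "'a \<Rightarrow> real" and a Ca Kr :: real
  assumes a: "0 < a" "a < 1" and Ca: "1 \<le> Ca" and Kr: "1 \<le> Kr"
    and \<sigma>_meas [measurable]: "\<sigma> \<in> borel_measurable M"
    and \<sigma>_pos: "0 < \<sigma> x" and \<sigma>_le: "\<sigma> x \<le> \<rho> x" and \<rho>_le: "\<rho> x \<le> Kr * \<sigma> x"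
    and \<rho>_adm: "\<rho> y \<le> Ca * \<rho> x powr a * (\<rho> x + dist x y) powr (1 - a)"
begin

lemma \<rho>_pos: "0 < \<rho> x" using \<sigma>_pos[of x] \<sigma>_le[of x] by simp

text \<open>Shrinking the radius function by \<open>s\<close> preserves admissibility with a
  constant independent of \<open>s\<close>: the exponents \<open>a\<close> and \<open>1 - a\<close>
  add up to 1, and \<open>s * dist x y\<close> is at most \<open>dist x y\<close>. Through this
  uniformity \<open>hf_bound\<close> holds for all \<open>s\<close> with one constant.\<close>

lemma \<sigma>_adm:
  assumes s: "0 < s" "s \<le> 1"
  shows "s * \<sigma> y \<le> Ca * Kr * (s * \<sigma> x) powr a * (s * \<sigma> x + dist x y) powr (1 - a)"
proof -
  let ?d = "dist x y"
  have "\<sigma> y \<le> Ca * \<rho> x powr a * (\<rho> x + ?d) powr (1 - a)" using \<sigma>_le[of y] \<rho>_adm[of y x] by simp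
  also have "\<dots> \<le> Ca * (Kr * \<sigma> x) powr a * (Kr * (\<sigma> x + ?d)) powr (1 - a)"
  proof (intro mult_mono powr_mono2 order_refl)
    show "\<rho> x + ?d \<le> Kr * (\<sigma> x + ?d)"
      using \<rho>_le[of x] Kr mult_right_mono[of 1 Kr ?d] by (simp add: algebra_simps)
  qed (use a Ca \<rho>_pos[of x] \<rho>_le[of x] in auto)
  also have "\<dots> = Ca * (Kr powr a * Kr powr (1 - a)) * (\<sigma> x powr a * (\<sigma> x + ?d) powr (1 - a))"
    by (simp add: powr_mult mult_ac)
  also have "Kr powr a * Kr powr (1 - a) = Kr" using Kr by (simp add: powr_add[symmetric])
  finally have 1: "\<sigma> y \<le> Ca * Kr * (\<sigma> x powr a * (\<sigma> x + ?d) powr (1 - a))" .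
  have "s * \<sigma> y \<le> s * (Ca * Kr * (\<sigma> x powr a * (\<sigma> x + ?d) powr (1 - a)))"
    using 1 s by (intro mult_left_mono) auto
  also have "\<dots> = Ca * Kr * ((s powr a * s powr (1 - a)) * (\<sigma> x powr a * (\<sigma> x + ?d) powr (1 - a)))"
    using s by (simp add: powr_add[symmetric])
  also have "\<dots> = Ca * Kr * ((s * \<sigma> x) powr a * (s * (\<sigma> x + ?d)) powr (1 - a))"
    by (simp add: powr_mult mult_ac)
  also have "\<dots> \<le> Ca * Kr * ((s * \<sigma> x) powr a * (s * \<sigma> x + ?d) powr (1 - a))"
  proof (intro mult_left_mono powr_mono2)
    show "s * (\<sigma> x + ?d) \<le> s * \<sigma> x + ?d"
      using s mult_right_mono[of s 1 ?d] by (simp add: algebra_simps)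
    show "0 \<le> s * (\<sigma> x + ?d)" using s \<sigma>_pos[of x] by simp
  qed (use a Ca Kr in auto)
  finally show ?thesis by (simp add: mult.assoc)
qed

lemma \<sigma>_linear:
  assumes s: "0 < s" "s \<le> 1" shows "s * \<sigma> y \<le> Ca * Kr * (s * \<sigma> x + dist x y)"
proof -
  have p: "0 < s * \<sigma> x" using s \<sigma>_pos[of x] by simp
  have "(s * \<sigma> x) powr a * (s * \<sigma> x + dist x y) powr (1 - a) \<le>
        (s * \<sigma> x + dist x y) powr a * (s * \<sigma> x + dist x y) powr (1 - a)"
    using a p by (intro mult_right_mono powr_mono2) auto
  also have "\<dots> = s * \<sigma> x + dist x y" using p by (simp add: powr_add[symmetric] add_pos_nonneg)
  finally have "Ca * Kr * ((s * \<sigma> x) powr a * (s * \<sigma> x + dist x y) powr (1 - a)) \<le> Ca * Kr * (s * \<sigma> x + dist x y)"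
    using Ca Kr by (intro mult_left_mono) auto
  then show ?thesis using \<sigma>_adm[OF s, of y x] by (simp add: mult.assoc)
qed

definition KA :: real where "KA = (3 * Ca) powr (1 / a)"

lemma KA: "1 \<le> KA" unfolding KA_def using a Ca by (intro ge_one_powr_ge_zero) auto

text \<open>When \<open>\<rho> y\<close> is the smaller value, admissibility read from
  \<open>y\<close> can be solved for it and gives
  \<open>\<rho> x powr a \<le> 3 * Ca * \<rho> y powr a\<close>. The range is
  \<open>2 * \<rho> x\<close> because a point within \<open>\<rho> x\<close> of \<open>x\<close> may
  still be moved to a sampling point.\<close>

lemma \<rho>_near:
  assumes "dist x y \<le> 2 * \<rho> x" shows "\<rho> x \<le> KA * \<rho> y"
proof (cases "\<rho> x \<le> \<rho> y")
  case True
  then show ?thesis using \<rho>_pos[of y] mult_right_mono[OF KA, of "\<rho> y"] by linarith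
next
  case False
  have p: "0 < \<rho> x" "0 < \<rho> y" using \<rho>_pos by auto
  have "\<rho> x \<le> Ca * \<rho> y powr a * (\<rho> y + dist x y) powr (1 - a)" using \<rho>_adm[of x y] by (simp add: dist_commute)
  also have "\<dots> \<le> Ca * \<rho> y powr a * (3 * \<rho> x) powr (1 - a)"
    using False assms Ca a p by (intro mult_left_mono powr_mono2) auto
  also have "\<dots> \<le> Ca * \<rho> y powr a * (3 * \<rho> x powr (1 - a))"
  proof (intro mult_left_mono)
    have "(3::real) powr (1 - a) \<le> 3 powr 1" using a by (intro powr_mono) auto
    then show "(3 * \<rho> x) powr (1 - a) \<le> 3 * \<rho> x powr (1 - a)" by (simp add: powr_mult mult_right_mono)
  qed (use Ca in auto)
  finally have "\<rho> x * \<rho> x powr (a - 1) \<le> (Ca * \<rho> y powr a * (3 * \<rho> x powr (1 - a))) * \<rho> x powr (a - 1)"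
    by (intro mult_right_mono) auto
  moreover have "\<rho> x * \<rho> x powr (a - 1) = \<rho> x powr a" using p by (simp add: powr_diff)
  moreover have "\<rho> x powr (1 - a) * \<rho> x powr (a - 1) = 1" using p by (simp add: powr_add[symmetric])
  ultimately have "\<rho> x powr a \<le> 3 * Ca * \<rho> y powr a" by (simp add: mult.assoc mult.left_commute)
  then have "(\<rho> x powr a) powr (1 / a) \<le> (3 * Ca * \<rho> y powr a) powr (1 / a)"
    using a by (intro powr_mono2) auto
  then show ?thesis using a p by (simp add: KA_def powr_mult powr_powr)
qed

definition hf :: "real \<Rightarrow> real \<Rightarrow> ('a \<Rightarrow> real) \<Rightarrow> 'a \<Rightarrow> ennreal" where
  "hf g s f x = (\<integral>\<^sup>+y. ennreal (E g (s * \<sigma> x) x y * \<bar>f y\<bar>) \<partial>M)"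

definition KH :: "real \<Rightarrow> real" where
  "KH g = (Ca * Kr * (Ca * Kr + 1)) powr g * (D * (Ca * Kr + 2) powr n) * KI (g * a)"

text \<open>The scale on the left varies with \<open>x\<close>, so an integration in
  \<open>x\<close> needs centre and scale moved to \<open>y\<close>. Admissibility bounds the decay
  ratio at \<open>x\<close> by a multiple of the power \<open>a\<close> of the ratio at
  \<open>y\<close>; hence the drop from \<open>g\<close> to \<open>g * a\<close>.\<close>

lemma E_swap_admissible:
  assumes s: "0 < s" "s \<le> 1" and g: "0 \<le> g"
  shows "E g (s * \<sigma> x) x y \<le> (Ca * Kr * (Ca * Kr + 1)) powr g * (D * (Ca * Kr + 2) powr n) * E (g * a) (s * \<sigma> y) y x"
proof -
  define c where "c = Ca * Kr"
  have c: "1 \<le> c" unfolding c_def using Ca Kr mult_mono[of 1 Ca 1 Kr] by simp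
  define X Y d where "X = s * \<sigma> x" and "Y = s * \<sigma> y" and "d = dist x y"
  have p: "0 < X" "0 < Y" "0 \<le> d" using s \<sigma>_pos by (auto simp: X_def Y_def d_def)
  have XY: "Y + d \<le> (c + 1) * (X + d)"
    using \<sigma>_linear[OF s, of y x] p by (simp add: c_def X_def Y_def d_def algebra_simps)
  have "X \<le> c * (Y powr a * (Y + d) powr (1 - a))"
    using \<sigma>_adm[OF s, of x y] by (simp add: c_def X_def Y_def d_def dist_commute mult.assoc)
  then have "X / (X + d) \<le> c * (Y powr a * (Y + d) powr (1 - a)) / ((Y + d) / (c + 1))"
    using p c XY by (intro frac_le) (auto simp: divide_simps mult.commute)
  also have "\<dots> = c * (c + 1) * (Y / (Y + d)) powr a"
  proof -
    have "(Y + d) powr (1 - a) / (Y + d) = 1 / (Y + d) powr a" using p by (simp add: powr_diff)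
    then show ?thesis using p by (simp add: powr_divide divide_simps mult_ac)
  qed
  finally have "(X / (X + d)) powr g \<le> (c * (c + 1) * (Y / (Y + d)) powr a) powr g"
    using g p by (intro powr_mono2) auto
  also have "\<dots> = (c * (c + 1)) powr g * (Y / (Y + d)) powr (g * a)"
    by (simp add: powr_mult powr_powr mult.commute)
  finally have 1: "(X / (X + d)) powr g \<le> (c * (c + 1)) powr g * (Y / (Y + d)) powr (g * a)" .
  have "V y (Y + d) \<le> D * (c + 2) powr n * V x (X + d)"
  proof (intro V_compare)
    show "dist y x + (Y + d) \<le> (c + 2) * (X + d)" using XY p by (simp add: d_def dist_commute algebra_simps)
  qed (use p c in auto)
  then have 2: "1 / V x (X + d) \<le> D * (c + 2) powr n / V y (Y + d)"
    using V_pos[of "X + d" x] V_pos[of "Y + d" y] p by (simp add: divide_simps mult.commute)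
  have "(X / (X + d)) powr g * (1 / V x (X + d)) \<le>
     ((c * (c + 1)) powr g * (Y / (Y + d)) powr (g * a)) * (D * (c + 2) powr n / V y (Y + d))"
    using 1 2 by (intro mult_mono) auto
  then show ?thesis by (simp add: E_def X_def Y_def d_def c_def dist_commute mult_ac)
qed

lemma hf_measurable [measurable]:
  assumes [measurable]: "f \<in> borel_measurable M" shows "hf g s f \<in> borel_measurable M"
proof -
  interpret sigma_finite_measure M by (rule sigma_finite_M)
  show ?thesis unfolding hf_def by measurable
qed

lemma hf_bound:
  assumes s: "0 < s" "s \<le> 1" and g: "0 < g" and [measurable]: "f \<in> borel_measurable M"
  shows "(\<integral>\<^sup>+x. hf g s f x \<partial>M) \<le> ennreal (KH g) * (\<integral>\<^sup>+y. ennreal \<bar>f y\<bar> \<partial>M)"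
proof -
  interpret sigma_finite_measure M by (rule sigma_finite_M)
  interpret MM: pair_sigma_finite M M ..
  define K where "K = (Ca * Kr * (Ca * Kr + 1)) powr g * (D * (Ca * Kr + 2) powr n)"
  have K: "0 \<le> K" using D1 by (simp add: K_def)
  have "(\<integral>\<^sup>+x. hf g s f x \<partial>M) \<le> (\<integral>\<^sup>+x. \<integral>\<^sup>+y. ennreal (K * \<bar>f y\<bar>) * ennreal (E (g * a) (s * \<sigma> y) y x) \<partial>M \<partial>M)"
    unfolding hf_def
  proof (intro nn_integral_mono)
    fix x y
    have "E g (s * \<sigma> x) x y * \<bar>f y\<bar> \<le> K * E (g * a) (s * \<sigma> y) y x * \<bar>f y\<bar>"
      unfolding K_def using g by (intro mult_right_mono E_swap_admissible s) auto
    then show "ennreal (E g (s * \<sigma> x) x y * \<bar>f y\<bar>) \<le> ennreal (K * \<bar>f y\<bar>) * ennreal (E (g * a) (s * \<sigma> y) y x)"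
      using K by (simp add: ennreal_mult'[symmetric] ennreal_leI mult_ac)
  qed
  also have "\<dots> = (\<integral>\<^sup>+y. \<integral>\<^sup>+x. ennreal (K * \<bar>f y\<bar>) * ennreal (E (g * a) (s * \<sigma> y) y x) \<partial>M \<partial>M)"
    by (rule MM.Fubini'[symmetric]) measurable
  also have "\<dots> = (\<integral>\<^sup>+y. ennreal (K * \<bar>f y\<bar>) * (\<integral>\<^sup>+x. ennreal (E (g * a) (s * \<sigma> y) y x) \<partial>M) \<partial>M)"
    by (intro nn_integral_cong nn_integral_cmult) measurable
  also have "\<dots> \<le> (\<integral>\<^sup>+y. ennreal (K * \<bar>f y\<bar>) * ennreal (KI (g * a)) \<partial>M)"
    using s g a \<sigma>_pos by (intro nn_integral_mono mult_left_mono E_integral) auto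
  also have "\<dots> = (\<integral>\<^sup>+y. ennreal (KH g) * ennreal \<bar>f y\<bar> \<partial>M)"
  proof -
    have "0 < KI (g * a)" using g a by (intro KI_pos) auto
    then show ?thesis using K by (simp add: ennreal_mult'[symmetric] KH_def K_def mult_ac)
  qed
  also have "\<dots> = ennreal (KH g) * (\<integral>\<^sup>+y. ennreal \<bar>f y\<bar> \<partial>M)" by (intro nn_integral_cmult) measurable
  finally show ?thesis .
qed

text \<open>Means at any scale \<open>t\<close> up to \<open>\<rho> x\<close>, weighted by
  \<open>(t / \<rho> x) powr g\<close>, are dominated by this series over dyadic fractions of
  \<open>\<sigma> x\<close>. A supremum over scales is thereby replaced with one positive operator
  that is bounded in the integral norm; it takes up all error terms.\<close>

definition H :: "real \<Rightarrow> ('a \<Rightarrow> real) \<Rightarrow> 'a \<Rightarrow> ennreal" where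
  "H g f x = (\<Sum>k. ennreal ((2 powr (- g)) ^ k) * hf g ((1/2) ^ k) f x)"

lemma H_measurable [measurable]: "f \<in> borel_measurable M \<Longrightarrow> H g f \<in> borel_measurable M"
  unfolding H_def by measurable

lemma H_term: "ennreal ((2 powr (- g)) ^ k) * hf g ((1/2) ^ k) f x \<le> H g f x"
  unfolding H_def
  using sum_le_suminf[of "\<lambda>k. ennreal ((2 powr (- g)) ^ k) * hf g ((1/2) ^ k) f x" "{k}"] by simp

lemma H_ge: "(\<integral>\<^sup>+y. ennreal (E g (\<sigma> x) x y * \<bar>f y\<bar>) \<partial>M) \<le> H g f x"
  using H_term[of g 0 f x] by (simp add: hf_def)

definition KHH :: "real \<Rightarrow> real" where "KHH g = KH g / (1 - 2 powr (- g))"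

lemma KH_nonneg: "0 < g \<Longrightarrow> 0 \<le> KH g"
  unfolding KH_def using KI_pos[of "g * a"] a D1 by simp

lemma KHH_nonneg: "0 < g \<Longrightarrow> 0 \<le> KHH g"
  unfolding KHH_def using KH_nonneg[of g] by (simp add: powr_less_one less_imp_le)

lemma H_bound:
  assumes g: "0 < g" and [measurable]: "f \<in> borel_measurable M"
  shows "(\<integral>\<^sup>+x. H g f x \<partial>M) \<le> ennreal (KHH g) * (\<integral>\<^sup>+y. ennreal \<bar>f y\<bar> \<partial>M)"
proof -
  define q where "q = (2::real) powr (- g)"
  have q: "0 < q" "q < 1" using g by (auto simp: q_def powr_less_one)
  have "(\<integral>\<^sup>+x. H g f x \<partial>M) = (\<Sum>k. \<integral>\<^sup>+x. ennreal (q ^ k) * hf g ((1/2) ^ k) f x \<partial>M)"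
    unfolding H_def q_def by (intro nn_integral_suminf) measurable
  also have "\<dots> = (\<Sum>k. ennreal (q ^ k) * (\<integral>\<^sup>+x. hf g ((1/2) ^ k) f x \<partial>M))"
    by (intro arg_cong[where f = suminf] ext nn_integral_cmult) measurable
  also have "\<dots> \<le> (\<Sum>k. ennreal (q ^ k) * (ennreal (KH g) * (\<integral>\<^sup>+y. ennreal \<bar>f y\<bar> \<partial>M)))"
    using g by (intro suminf_le mult_left_mono hf_bound) (auto intro: power_le_one)
  also have "\<dots> = (\<Sum>k. ennreal (q ^ k)) * (ennreal (KH g) * (\<integral>\<^sup>+y. ennreal \<bar>f y\<bar> \<partial>M))" by simp
  also have "(\<Sum>k. ennreal (q ^ k)) = ennreal (1 / (1 - q))"
    using q by (subst suminf_ennreal2) (auto simp: suminf_geometric intro: summable_geometric)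
  also have "ennreal (1 / (1 - q)) * (ennreal (KH g) * (\<integral>\<^sup>+y. ennreal \<bar>f y\<bar> \<partial>M)) = ennreal (KHH g) * (\<integral>\<^sup>+y. ennreal \<bar>f y\<bar> \<partial>M)"
    using q KH_nonneg[OF g] by (simp add: mult.assoc[symmetric] ennreal_mult'[symmetric] KHH_def q_def)
  finally show ?thesis .
qed

text \<open>Below \<open>\<sigma> x\<close> the scale \<open>t\<close> is within a factor 2 of a
  dyadic fraction of \<open>\<sigma> x\<close>, whose weight in the series matches
  \<open>(t / \<rho> x) powr g\<close>. Between \<open>\<sigma> x\<close> and
  \<open>\<rho> x\<close> the comparison is with \<open>\<sigma> x\<close> itself, at the price
  \<open>Kr powr g\<close>.\<close>

lemma small_scale_H:
  assumes g: "0 < g" and t: "0 < t" "t \<le> \<rho> x" and [measurable]: "f \<in> borel_measurable M"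
  shows "ennreal ((t / \<rho> x) powr g) * (\<integral>\<^sup>+y. ennreal (E g t x y * \<bar>f y\<bar>) \<partial>M) \<le> ennreal (Kr powr g + D * 2 powr n) * H g f x"
proof -
  define T where "T = \<sigma> x"
  have T: "0 < T" "T \<le> \<rho> x" "\<rho> x \<le> Kr * T" unfolding T_def using \<sigma>_pos \<sigma>_le \<rho>_le by auto
  have K0: "0 \<le> Kr powr g + D * 2 powr n" using D1 by simp
  have gen: "ennreal ((t / \<rho> x) powr g) * (\<integral>\<^sup>+y. ennreal (E g t x y * \<bar>f y\<bar>) \<partial>M) \<le> ennreal (Kr powr g + D * 2 powr n) * H g f x"
    if le: "\<And>y. E g t x y \<le> (Kr powr g + D * 2 powr n) * E g ((1/2) ^ k * T) x y" and c: "(t / \<rho> x) powr g \<le> (2 powr (- g)) ^ k" for k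
  proof -
    have "(\<integral>\<^sup>+y. ennreal (E g t x y * \<bar>f y\<bar>) \<partial>M) \<le> (\<integral>\<^sup>+y. ennreal (Kr powr g + D * 2 powr n) * ennreal (E g ((1/2) ^ k * T) x y * \<bar>f y\<bar>) \<partial>M)"
      using mult_right_mono[OF le, of "\<bar>f _\<bar>"] K0 by (intro nn_integral_mono) (simp add: ennreal_mult'[symmetric] ennreal_leI mult.assoc del: ennreal_plus)
    also have "\<dots> = ennreal (Kr powr g + D * 2 powr n) * hf g ((1/2) ^ k) f x"
      unfolding hf_def T_def by (intro nn_integral_cmult) measurable
    finally have "ennreal ((t / \<rho> x) powr g) * (\<integral>\<^sup>+y. ennreal (E g t x y * \<bar>f y\<bar>) \<partial>M) \<le>
       ennreal ((2 powr (- g)) ^ k) * (ennreal (Kr powr g + D * 2 powr n) * hf g ((1/2) ^ k) f x)"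
      using c by (intro mult_mono ennreal_leI) auto
    also have "\<dots> = ennreal (Kr powr g + D * 2 powr n) * (ennreal ((2 powr (- g)) ^ k) * hf g ((1/2) ^ k) f x)"
      by (simp only: mult_ac)
    also have "\<dots> \<le> ennreal (Kr powr g + D * 2 powr n) * H g f x" by (intro mult_left_mono H_term) auto
    finally show ?thesis .
  qed
  show ?thesis
  proof (cases "T \<le> t")
    case True
    have 1: "E g t x y \<le> Kr powr g * E g T x y" for y
      using T True t g by (intro E_smaller) auto
    have 2: "0 \<le> D * 2 powr n * E g T x y" for y using D1 by simp
    have "E g t x y \<le> (Kr powr g + D * 2 powr n) * E g ((1/2) ^ 0 * T) x y" for y
      using add_mono[OF 1[of y] 2[of y]] by (simp add: distrib_right)
    moreover have "(t / \<rho> x) powr g \<le> (2 powr (- g)) ^ 0" using t T g by (auto intro!: powr_le1)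
    ultimately show ?thesis by (rule gen)
  next
    case False
    then have "t \<le> T" by simp
    from dyadic_scale[OF t(1) this] obtain k where k: "2 ^ k * t \<le> T" "T < 2 ^ Suc k * t" .
    have hk: "(1/2) ^ k * T = T / 2 ^ k" by (simp add: power_one_over)
    have "E g t x y \<le> (Kr powr g + D * 2 powr n) * E g ((1/2) ^ k * T) x y" for y
    proof -
      have "E g t x y \<le> D * 2 powr n * E g ((1/2) ^ k * T) x y"
        unfolding hk using k t g by (intro E_larger) (auto simp: divide_simps mult_ac)
      moreover have "0 \<le> Kr powr g * E g ((1/2) ^ k * T) x y" by simp
      ultimately show ?thesis unfolding distrib_right by linarith
    qed
    moreover have "(t / \<rho> x) powr g \<le> (2 powr (- g)) ^ k"
    proof -
      have "t / \<rho> x \<le> t / T" using T t by (intro divide_left_mono) auto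
      also have "\<dots> \<le> 1 / 2 ^ k" using k T by (simp add: divide_simps mult.commute)
      finally have "(t / \<rho> x) powr g \<le> (1 / 2 ^ k) powr g" using t T g by (intro powr_mono2) auto
      also have "\<dots> = (2 powr (- g)) ^ k"
        by (simp add: powr_minus powr_divide powr_power powr_realpow[symmetric] powr_powr mult.commute inverse_eq_divide power_one_over)
      finally show ?thesis .
    qed
    ultimately show ?thesis by (rule gen)
  qed
qed

end

section \<open>The key estimate\<close>

locale kernel_admissible = kernel M D n P g b C + admissible_pair M D n \<rho> \<sigma> a Ca Kr
  for M :: "'a::metric_space measure" and D n P g b C \<rho> \<sigma> a Ca Kr
begin

text \<open>A mean over a ball of radius \<open>s\<close> exceeds one over a ball of radius
  \<open>R\<close> that contains it by at most a factor of order \<open>(R / s) powr n\<close>.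
  Raised to the power \<open>q - 1\<close> this becomes \<open>(R / s) powr (b / 2)\<close>, half of
  the exponent gained by the iteration.\<close>

definition q :: real where "q = 1 + b / (2 * n)"

lemma q1: "1 < q" using b n_pos by (simp add: q_def)

text \<open>The factor by which the scale is refined in each step: it has to beat the growth
  of the Hoelder constants, and to keep all radii below \<open>\<sigma>\<close> near the base point.\<close>
definition \<delta> :: real where
  "\<delta> = min (1/2) (min (1 / (KA * Kr)) ((1 / (4 * KK)) powr (2 / b)))"

lemma \<delta>: "0 < \<delta>" "\<delta> \<le> 1/2" "\<delta> \<le> 1 / (KA * Kr)" "2 * KK * \<delta> powr (b / 2) \<le> 1/2"
proof -
  have k: "0 < KA * Kr" using KA Kr by simp
  have kk: "0 < KK" by (rule consts_pos)
  show d: "0 < \<delta>" "\<delta> \<le> 1/2" "\<delta> \<le> 1 / (KA * Kr)" using k kk by (auto simp: \<delta>_def)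
  have "\<delta> powr (b / 2) \<le> ((1 / (4 * KK)) powr (2 / b)) powr (b / 2)"
    using d b by (intro powr_mono2) (auto simp: \<delta>_def)
  also have "\<dots> = 1 / (4 * KK)" using b kk by (simp add: powr_powr)
  finally show "2 * KK * \<delta> powr (b / 2) \<le> 1/2" using kk by (simp add: field_simps)
qed

lemma avg_nonneg: "(\<And>z. 0 \<le> U z) \<Longrightarrow> 0 \<le> avg U c s"
  unfolding avg_def by (intro divide_nonneg_nonneg integral_nonneg) auto

lemma nn_ball_avg:
  assumes "\<And>z. 0 \<le> U z" "integrable M (\<lambda>z. U z * indicator (ball c s) z)" "0 < s"
  shows "(\<integral>\<^sup>+z. ennreal (U z) * indicator (ball c s) z \<partial>M) = ennreal (avg U c s * V c s)"
proof -
  have "(\<integral>\<^sup>+z. ennreal (U z) * indicator (ball c s) z \<partial>M) = (\<integral>\<^sup>+z. ennreal (U z * indicator (ball c s) z) \<partial>M)"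
    by (intro nn_integral_cong) (simp add: indicator_def)
  also have "\<dots> = ennreal (\<integral>z. U z * indicator (ball c s) z \<partial>M)"
    using assms by (intro nn_integral_eq_integral) auto
  finally show ?thesis using V_pos[OF assms(3), of c] by (simp add: avg_def)
qed

definition KB :: real where
  "KB = KI (g - b / 2) * (D * 5 powr n * (D * 2 powr n)) * D powr (q - 1)"

lemma KB_pos: "0 < KB"
  unfolding KB_def using KI_pos[of "g - b/2"] b D1 by (intro mult_pos_pos) auto

text \<open>Let \<open>m\<close> be the maximal function at \<open>x\<close> before the power
  \<open>q\<close>. The local mean \<open>A\<close> enters as \<open>A powr (q - 1)\<close> times
  \<open>A\<close>. The first factor is bounded pointwise by enlarging the ball of radius
  \<open>s\<close> until it contains \<open>x\<close>; the second integrates over balls about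
  \<open>x\<close> to a multiple of \<open>m\<close> times their volume, with no loss in
  \<open>s\<close>.\<close>

lemma averages_bound:
  assumes U[measurable]: "U \<in> borel_measurable M" and U0: "\<And>z. 0 \<le> U z"
    and loc: "\<And>c s. integrable M (\<lambda>z. U z * indicator (ball c s) z)"
    and r: "0 < s" "2 * s \<le> r"
  shows "(\<integral>\<^sup>+z. ennreal (E g r x z * avg U (w (idx s z)) s powr q) \<partial>M)
     \<le> ennreal (KB * (2 * r / s) powr (b / 2)) * maxf q U x"
proof (cases "maxf q U x = \<infinity>")
  case True
  \<comment> \<open>The coefficient must be positive, since zero times infinity is zero in
    \<open>ennreal\<close>.\<close>
  define X where "X = KB * (2 * r / s) powr (b / 2)"
  have "0 < X" using KB_pos r by (simp add: X_def)
  then have "ennreal X * maxf q U x = top" using True by (simp add: ennreal_mult_top)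
  then show ?thesis unfolding X_def by simp
next
  case False
  define m where "m = enn2real (maxf q U x) powr (1 / q)"
  have m: "0 \<le> m" "ennreal (m powr q) = maxf q U x"
    using False q1 ennreal_enn2real[of "maxf q U x"] by (auto simp: m_def powr_powr less_top)
  have r0: "0 < r" using r by simp
  have avg_le: "avg U c R \<le> m" if "0 < R" "x \<in> ball c R" for c R
  proof -
    have "ennreal (avg U c R powr q) \<le> maxf q U x"
      unfolding maxf_def using that by (intro SUP_upper2[where i = "(c, R)"]) auto
    then have "avg U c R powr q \<le> m powr q" unfolding m(2)[symmetric] by (simp add: ennreal_le_iff)
    then have "(avg U c R powr q) powr (1 / q) \<le> (m powr q) powr (1 / q)"
      using q1 by (rule_tac powr_mono2) auto
    moreover have "0 \<le> avg U c R" using U0 by (rule avg_nonneg)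
    ultimately show ?thesis using q1 m by (simp add: powr_powr)
  qed
  have ball_le: "(\<integral>\<^sup>+z. ennreal (U z) * indicator (ball x R) z \<partial>M) \<le> ennreal (m * V x R)" if "0 < R" for R
    unfolding nn_ball_avg[OF U0 loc that] using avg_le[of R x] that
    by (intro ennreal_leI mult_right_mono) auto
  define A where "A z = avg U (w (idx s z)) s" for z
  have A0: "0 \<le> A z" for z unfolding A_def using U0 by (rule avg_nonneg)
  have [measurable]: "A \<in> borel_measurable M"
    unfolding A_def by (rule measurable_compose[OF idx_measurable]) simp
  have wd: "dist z (w (idx s z)) < s" for z using r by (intro idx_dist) simp
  have A1: "A z \<le> m * D * (2 * (r + dist x z) / s) powr n" for z
  proof -
    let ?R = "r + dist x z" and ?c = "w (idx s z)"
    have R: "0 < ?R" using r0 by (simp add: add_pos_nonneg)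
    have dc: "dist x ?c \<le> dist x z + s" using dist_triangle[of x ?c z] wd[of z] by linarith
    have sub: "ball ?c s \<subseteq> ball x ?R"
    proof
      fix v assume "v \<in> ball ?c s"
      then have "dist ?c v < s" by simp
      then have "dist x v < ?R" using dist_triangle[of x v ?c] dc r by linarith
      then show "v \<in> ball x ?R" by simp
    qed
    have "ennreal (A z * V ?c s) = (\<integral>\<^sup>+v. ennreal (U v) * indicator (ball ?c s) v \<partial>M)"
      unfolding A_def using nn_ball_avg[OF U0 loc r(1)] by simp
    also have "\<dots> \<le> (\<integral>\<^sup>+v. ennreal (U v) * indicator (ball x ?R) v \<partial>M)"
      using sub by (intro nn_integral_mono mult_left_mono) (auto simp: indicator_def)
    also have "\<dots> \<le> ennreal (m * V x ?R)" by (rule ball_le[OF R])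
    also have "\<dots> \<le> ennreal (m * (D * (2 * ?R / s) powr n * V ?c s))"
    proof (intro ennreal_leI mult_left_mono V_compare m)
      have "s \<le> 2 * ?R" using r r0 zero_le_dist[of x z] by argo
      then show "1 \<le> 2 * ?R / s" using r by (simp add: divide_simps)
      have "dist x ?c + ?R \<le> 2 * ?R" using dc r zero_le_dist[of x z] by argo
      then show "dist x ?c + ?R \<le> 2 * ?R / s * s" using r by simp
    qed (use r in auto)
    finally have "A z * V ?c s \<le> m * D * (2 * ?R / s) powr n * V ?c s"
      using m D1 by (simp add: ennreal_le_iff mult.assoc)
    then show ?thesis using V_pos[OF r(1), of ?c] by simp
  qed
  have A2: "(\<integral>\<^sup>+z. ennreal (A z) * indicator (ball x R) z \<partial>M) \<le> ennreal (D * 5 powr n * (D * 2 powr n) * m) * ennreal (V x R)"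
    if "r \<le> R" for R
  proof -
    interpret sigma_finite_measure M by (rule sigma_finite_M)
    interpret MM: pair_sigma_finite M M ..
    have R: "0 < R" using that r0 by simp
    let ?k = "D * 5 powr n"
    have k: "0 \<le> ?k" using D1 by simp
    \<comment> \<open>With \<open>V v (2 * s)\<close> in place of the volume at the centre of the
      cell, the kernel depends on \<open>z\<close> only through the condition
      \<open>dist z v < 2 * s\<close>. Integrating in \<open>z\<close> first then cancels the
      volume.\<close>
    have Az: "ennreal (A z) \<le> (\<integral>\<^sup>+v. ennreal (?k * U v / V v (2 * s)) * indicator {v. dist z v < 2 * s} v \<partial>M)" for z
    proof -
      let ?c = "w (idx s z)"
      have Vc: "0 < V ?c s" using r by (intro V_pos)
      have "ennreal (A z) = ennreal (1 / V ?c s) * ennreal (A z * V ?c s)"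
        using Vc A0[of z] by (simp add: ennreal_mult'[symmetric])
      also have "ennreal (A z * V ?c s) = (\<integral>\<^sup>+v. ennreal (U v) * indicator (ball ?c s) v \<partial>M)"
        unfolding A_def using nn_ball_avg[OF U0 loc r(1)] by simp
      also have "ennreal (1 / V ?c s) * \<dots> = (\<integral>\<^sup>+v. ennreal (1 / V ?c s) * (ennreal (U v) * indicator (ball ?c s) v) \<partial>M)"
        by (intro nn_integral_cmult[symmetric]) measurable
      also have "\<dots> \<le> (\<integral>\<^sup>+v. ennreal (?k * U v / V v (2 * s)) * indicator {v. dist z v < 2 * s} v \<partial>M)"
      proof (intro nn_integral_mono)
        fix v
        show "ennreal (1 / V ?c s) * (ennreal (U v) * indicator (ball ?c s) v) \<le> ennreal (?k * U v / V v (2 * s)) * indicator {v. dist z v < 2 * s} v"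
        proof (cases "v \<in> ball ?c s")
          case True
          then have cv: "dist ?c v < s" by simp
          then have zv: "dist z v < 2 * s" using dist_triangle[of z v ?c] wd[of z] by linarith
          have "V v (2 * s) \<le> ?k * V ?c s"
            using r cv by (intro V_compare) (auto simp: dist_commute)
          then have "1 / V ?c s \<le> ?k / V v (2 * s)"
            using Vc V_pos[of "2 * s" v] r by (simp add: divide_simps mult.commute)
          from mult_right_mono[OF this U0[of v]]
          show ?thesis using True zv Vc by (simp add: ennreal_mult'[symmetric] ennreal_leI)
        qed simp
      qed
      finally show ?thesis .
    qed
    have [measurable]: "Measurable.pred (M \<Otimes>\<^sub>M M) (\<lambda>p. dist (fst p) (snd p) < 2 * s)" by measurable
    let ?G = "\<lambda>z v. ennreal (?k * U v / V v (2 * s)) * indicator {p. dist (fst p) (snd p) < 2 * s} (z, v) * indicator (ball x R) z"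
    have Gm: "(\<lambda>p. ?G (fst p) (snd p)) \<in> borel_measurable (M \<Otimes>\<^sub>M M)"
    proof -
      have [measurable]: "{p. dist (fst p) (snd p) < 2 * s} \<in> sets (M \<Otimes>\<^sub>M M)"
      proof -
        have "{p \<in> space (M \<Otimes>\<^sub>M M). dist (fst p) (snd p) < 2 * s} \<in> sets (M \<Otimes>\<^sub>M M)" by measurable
        then show ?thesis by (simp add: space_pair_measure)
      qed
      show ?thesis by measurable
    qed
    have "(\<integral>\<^sup>+z. ennreal (A z) * indicator (ball x R) z \<partial>M) \<le> (\<integral>\<^sup>+z. \<integral>\<^sup>+v. ?G z v \<partial>M \<partial>M)"
    proof (intro nn_integral_mono)
      fix z
      have m1: "(\<lambda>v. ennreal (?k * U v / V v (2 * s)) * indicator {p. dist (fst p) (snd p) < 2 * s} (z, v)) \<in> borel_measurable M"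
      proof -
        have "{v \<in> space M. dist z v < 2 * s} \<in> sets M" by measurable
        then have [measurable]: "{v. dist z v < 2 * s} \<in> sets M" by simp
        have "indicator {p. dist (fst p) (snd p) < 2 * s} (z, v) = (indicator {v. dist z v < 2 * s} v :: ennreal)" for v
          by (simp add: indicator_def)
        then show ?thesis by (simp only:) measurable
      qed
      have "ennreal (A z) * indicator (ball x R) z \<le>
         (\<integral>\<^sup>+v. ennreal (?k * U v / V v (2 * s)) * indicator {p. dist (fst p) (snd p) < 2 * s} (z, v) \<partial>M) * indicator (ball x R) z"
        using Az[of z] by (intro mult_right_mono) (auto simp: indicator_def)
      also have "\<dots> = (\<integral>\<^sup>+v. ?G z v \<partial>M)" by (rule nn_integral_multc[symmetric, OF m1])
      finally show "ennreal (A z) * indicator (ball x R) z \<le> (\<integral>\<^sup>+v. ?G z v \<partial>M)" .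
    qed
    also have "\<dots> = (\<integral>\<^sup>+v. \<integral>\<^sup>+z. ?G z v \<partial>M \<partial>M)"
      using Gm by (intro MM.Fubini'[symmetric]) (simp add: case_prod_beta')
    also have "\<dots> \<le> (\<integral>\<^sup>+v. ennreal ?k * (ennreal (U v) * indicator (ball x (2 * R)) v) \<partial>M)"
    proof (intro nn_integral_mono)
      fix v
      have V2: "0 < V v (2 * s)" using r by (intro V_pos) simp
      have "(\<integral>\<^sup>+z. ?G z v \<partial>M) \<le> (\<integral>\<^sup>+z. ennreal (?k * U v / V v (2 * s)) * indicator (ball x (2 * R)) v * indicator (ball v (2 * s)) z \<partial>M)"
      proof (intro nn_integral_mono)
        fix z
        show "?G z v \<le> ennreal (?k * U v / V v (2 * s)) * indicator (ball x (2 * R)) v * indicator (ball v (2 * s)) z"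
        proof (cases "dist z v < 2 * s \<and> z \<in> ball x R")
          case True
          then have "dist x v < 2 * R" using dist_triangle[of x v z] r that by simp
          then show ?thesis using True by (simp add: dist_commute)
        qed (auto simp: indicator_def)
      qed
      also have "\<dots> = ennreal (?k * U v / V v (2 * s)) * indicator (ball x (2 * R)) v * ennreal (V v (2 * s))"
        by (simp add: nn_integral_cmult emeasure_ball)
      also have "\<dots> = ennreal ?k * (ennreal (U v) * indicator (ball x (2 * R)) v)"
        using V2 k U0[of v] by (simp add: indicator_def ennreal_mult'[symmetric])
      finally show "(\<integral>\<^sup>+z. ?G z v \<partial>M) \<le> ennreal ?k * (ennreal (U v) * indicator (ball x (2 * R)) v)" .
    qed
    also have "\<dots> = ennreal ?k * (\<integral>\<^sup>+v. ennreal (U v) * indicator (ball x (2 * R)) v \<partial>M)"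
      by (intro nn_integral_cmult) measurable
    also have "\<dots> \<le> ennreal ?k * ennreal (m * V x (2 * R))"
      using R by (intro mult_left_mono ball_le) auto
    also have "\<dots> \<le> ennreal ?k * ennreal (m * (D * 2 powr n * V x R))"
      using R m by (intro mult_left_mono ennreal_leI V_compare) auto
    also have "\<dots> = ennreal (?k * (D * 2 powr n) * m) * ennreal (V x R)"
      using k m D1 by (simp add: ennreal_mult'[symmetric] mult_ac)
    finally show ?thesis .
  qed
  define p where "p = q - 1"
  have p: "0 < p" "n * p = b / 2" using q1 n_pos by (auto simp: p_def q_def)
  define c where "c = (m * D) powr p * (2 * r / s) powr (b / 2)"
  have c: "0 \<le> c" by (simp add: c_def)
  have pt: "E g r x z * A z powr q \<le> c * (E (g - b / 2) r x z * A z)" for z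
  proof -
    define R where "R = r + dist x z"
    have R: "0 < R" using r0 by (simp add: R_def add_pos_nonneg)
    have "A z powr p \<le> (m * D * (2 * R / s) powr n) powr p"
      using A1[of z] A0[of z] p by (intro powr_mono2) (auto simp: R_def)
    also have "\<dots> = (m * D) powr p * (2 * R / s) powr (b / 2)"
      by (simp add: powr_mult powr_powr p)
    also have "(2 * R / s) powr (b / 2) = (2 * r / s) powr (b / 2) * (R / r) powr (b / 2)"
      using r0 powr_mult[of "2 * r / s" "R / r" "b / 2"] by simp
    finally have le: "A z powr p \<le> c * (R / r) powr (b / 2)" by (simp add: c_def mult.assoc)
    have Aq: "A z powr q = A z powr p * A z"
      using A0[of z] q1 by (cases "A z = 0") (auto simp: p_def powr_diff)
    have "E g r x z * A z powr q \<le> E g r x z * (c * (R / r) powr (b / 2) * A z)"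
      unfolding Aq using le A0 by (intro mult_left_mono mult_right_mono) auto
    also have "\<dots> = c * (E g r x z * (R / r) powr (b / 2)) * A z" by (simp add: mult_ac)
    \<comment> \<open>The growth \<open>(R / r) powr (b / 2)\<close> of the pointwise bound is
      absorbed by lowering the decay exponent of the envelope by \<open>b / 2\<close>.\<close>
    also have "E g r x z * (R / r) powr (b / 2) = E (g - b / 2) r x z"
    proof -
      have "(r / R) powr g * (R / r) powr (b / 2) = (r / R) powr (g - b / 2)"
      proof -
        have "(R / r) powr (b / 2) = (r / R) powr (- (b / 2))"
          using R r0 by (simp add: powr_minus powr_divide)
        then show ?thesis by (simp add: powr_add[symmetric])
      qed
      then show ?thesis unfolding E_def R_def[symmetric] by (simp add: divide_simps mult_ac)
    qed
    finally show ?thesis by (simp add: mult.assoc)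
  qed
  have "(\<integral>\<^sup>+z. ennreal (E g r x z * A z powr q) \<partial>M) \<le> (\<integral>\<^sup>+z. ennreal c * (ennreal (E (g - b / 2) r x z) * ennreal (A z)) \<partial>M)"
    using pt c A0 by (intro nn_integral_mono) (simp add: ennreal_mult'[symmetric] ennreal_leI)
  also have "\<dots> = ennreal c * (\<integral>\<^sup>+z. ennreal (E (g - b / 2) r x z) * ennreal (A z) \<partial>M)"
    by (intro nn_integral_cmult) measurable
  also have "\<dots> \<le> ennreal c * (ennreal (KI (g - b / 2)) * ennreal (D * 5 powr n * (D * 2 powr n) * m))"
    using b by (intro mult_left_mono E_layer A2 r0) auto
  also have "\<dots> = ennreal (c * (KI (g - b / 2) * (D * 5 powr n * (D * 2 powr n) * m)))"
    using c KI_pos[of "g - b / 2"] b m D1 by (simp add: ennreal_mult')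
  also have "c * (KI (g - b / 2) * (D * 5 powr n * (D * 2 powr n) * m)) = KB * (2 * r / s) powr (b / 2) * m powr q"
  proof -
    have "m powr p * m = m powr q" using m(1) q1 by (cases "m = 0") (auto simp: p_def powr_diff)
    moreover have "(m * D) powr p = m powr p * D powr p" by (rule powr_mult)
    ultimately show ?thesis unfolding c_def KB_def p_def[symmetric] by (simp add: mult_ac)
  qed
  also have "ennreal \<dots> = ennreal (KB * (2 * r / s) powr (b / 2)) * maxf q U x"
    unfolding m(2)[symmetric] using KB_pos by (intro ennreal_mult) auto
  finally show ?thesis unfolding A_def .
qed

end

context doubling_measure
begin

text \<open>From \<open>u powr q \<le> 1 + u\<close>. Local integrability is all that the maximal
  operator asks of \<open>u powr (1 / q)\<close>, which need not be integrable globally.\<close>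

lemma powr_locally_integrable:
  fixes u :: "'a \<Rightarrow> real"
  assumes u: "integrable M u" "\<And>z. 0 \<le> u z" and q: "0 \<le> q" "q \<le> 1"
  shows "integrable M (\<lambda>z. u z powr q * indicator (ball c s) z)"
proof (rule Bochner_Integration.integrable_bound)
  have "integrable M (\<lambda>z. indicator (ball c s) z :: real)"
    by (intro integrable_real_indicator) (auto simp: emeasure_ball)
  then show "integrable M (\<lambda>z. indicator (ball c s) z + u z)" by (intro Bochner_Integration.integrable_add u)
  have [measurable]: "u \<in> borel_measurable M" using u by auto
  show "(\<lambda>z. u z powr q * indicator (ball c s) z) \<in> borel_measurable M" by measurable
  have "u z powr q \<le> 1 + u z" for z
  proof (cases "u z \<le> 1")
    case True
    then have "u z powr q \<le> 1" using u q by (intro powr_le1) auto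
    then show ?thesis using u(2)[of z] by simp
  next
    case False
    then have "u z powr q \<le> u z powr 1" using q by (intro powr_mono) auto
    then show ?thesis using False by simp
  qed
  then show "AE z in M. norm (u z powr q * indicator (ball c s) z) \<le> norm (indicator (ball c s) z + u z)"
    using u by (intro AE_I2) (auto simp: indicator_def)
qed

end

context kernel_admissible
begin

lemma mn_mono: "0 \<le> s \<Longrightarrow> s \<le> s' \<Longrightarrow> mn s \<le> mn s'"
  unfolding mn_def using b by (intro powr_mono2) auto

text \<open>Rounding the radius down to an integral power of \<open>\<delta>\<close>, so that only
  countably many kernels occur; the envelope changes by a factor of at most \<open>\<delta>\<close>
  to the power \<open>- g\<close>.\<close>

lemma cls_smaller_scale:
  assumes \<phi>: "cls x r 1 1 \<phi>" and r: "0 < r'" "r' \<le> r" "\<delta> * r \<le> r'"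
  shows "cls x r' 1 1 (\<lambda>y. \<delta> powr g * \<phi> y)"
proof -
  have d: "0 < \<delta>" by (rule \<delta>)
  have E: "\<delta> powr g * E g r x y \<le> E g r' x y" for y
  proof -
    have "E g r x y \<le> (1 / \<delta>) powr g * E g r' x y"
      using r d g_pos by (intro E_smaller) (auto simp: field_simps)
    then have "\<delta> powr g * E g r x y \<le> \<delta> powr g * ((1 / \<delta>) powr g * E g r' x y)" by (intro mult_left_mono) auto
    also have "\<dots> = E g r' x y" using d by (simp add: powr_divide)
    finally show ?thesis .
  qed
  have r0: "0 < r" using r by simp
  have [measurable]: "\<phi> \<in> borel_measurable M" using \<phi> unfolding cls_def by (rule conjunct1)
  have size: "\<bar>\<phi> y\<bar> \<le> E g r x y" for y using \<phi> by (simp add: cls_def)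
  show ?thesis unfolding cls_def
  proof (intro conjI allI)
    show "(\<lambda>y. \<delta> powr g * \<phi> y) \<in> borel_measurable M" by measurable
    show "\<bar>\<delta> powr g * \<phi> y\<bar> \<le> 1 * E g r' x y" for y
    proof -
      have "\<delta> powr g * \<bar>\<phi> y\<bar> \<le> \<delta> powr g * E g r x y" using size by (intro mult_left_mono) auto
      then show ?thesis using E[of y] by (simp add: abs_mult)
    qed
    fix y z
    have "\<bar>\<phi> y - \<phi> z\<bar> \<le> mn (dist y z / r) * (E g r x y + E g r x z)" using \<phi> by (simp add: cls_def)
    also have "\<dots> \<le> mn (dist y z / r') * (E g r x y + E g r x z)"
      using r r0 by (intro mult_right_mono mn_mono) (auto intro!: divide_left_mono add_nonneg_nonneg)
    finally have "\<delta> powr g * \<bar>\<phi> y - \<phi> z\<bar> \<le> \<delta> powr g * (mn (dist y z / r') * (E g r x y + E g r x z))"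
      by (intro mult_left_mono) auto
    also have "\<dots> = mn (dist y z / r') * (\<delta> powr g * E g r x y + \<delta> powr g * E g r x z)" by (simp add: algebra_simps)
    also have "\<dots> \<le> mn (dist y z / r') * (E g r' x y + E g r' x z)"
      by (intro mult_left_mono add_mono E) auto
    finally show "\<bar>\<delta> powr g * \<phi> y - \<delta> powr g * \<phi> z\<bar> \<le> 1 * mn (dist y z / r') * (E g r' x y + E g r' x z)"
      by (simp add: right_diff_distrib[symmetric] abs_mult)
  qed
qed

definition CF :: real where "CF = Kr powr g * (D * 2 powr n) * (2 * C) * KC1"
text \<open>The 2 sums a geometric series, the bracket collects the contributions from inside and
  outside \<open>ball x (\<rho> x)\<close>, and division by \<open>\<delta> powr g\<close> undoes
  the rounding of the radius.\<close>

definition Kk :: real where "Kk = 2 * (KB * (4 / \<delta>\<^sup>2) powr (b / 2) + CF) / \<delta> powr g"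

lemma CF_pos: "0 < CF" unfolding CF_def using Kr D1 C consts_pos by simp
lemma Kk_pos: "0 < Kk"
proof -
  have "0 < KB * (4 / \<delta>\<^sup>2) powr (b / 2) + CF" using KB_pos CF_pos by (simp add: add_nonneg_pos)
  then show ?thesis unfolding Kk_def using \<delta>(1) by simp
qed

text \<open>Both denominators \<open>r + dist x z\<close> and \<open>\<sigma> x + dist x z\<close>
  lie between \<open>dist x z\<close> and twice that, and \<open>r\<close> is at most
  \<open>Kr * \<sigma> x\<close>.\<close>

lemma E_far:
  assumes "0 < r" "r \<le> \<rho> x" "\<rho> x \<le> dist x z"
  shows "E g r x z \<le> Kr powr g * (D * 2 powr n) * E g (\<sigma> x) x z"
proof (rule E_comp)
  let ?d = "dist x z"
  have p: "0 < \<sigma> x" "\<sigma> x \<le> \<rho> x" "\<rho> x \<le> Kr * \<sigma> x" using \<sigma>_pos \<sigma>_le \<rho>_le by auto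
  have d: "0 \<le> ?d" by simp
  have "r * (\<sigma> x + ?d) \<le> Kr * \<sigma> x * (r + ?d)"
  proof -
    have "r * ?d \<le> Kr * \<sigma> x * ?d" using assms p by (intro mult_right_mono) auto
    moreover have "r * \<sigma> x \<le> Kr * (r * \<sigma> x)" using Kr assms p mult_right_mono[of 1 Kr "r * \<sigma> x"] by simp
    ultimately show ?thesis by (simp add: algebra_simps)
  qed
  then show "r / (r + ?d) \<le> Kr * (\<sigma> x / (\<sigma> x + ?d))"
    using assms p by (simp add: divide_simps add_pos_nonneg mult_ac)
  show "dist x x + (\<sigma> x + ?d) \<le> 2 * (r + ?d)" using assms p by simp
qed (use assms \<sigma>_pos g_pos Kr in auto)

text \<open>The hypothesis concerns only the radii \<open>\<delta> powr m\<close> below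
  \<open>\<sigma> z\<close>, and almost every \<open>z\<close>. For points within
  \<open>\<rho> x\<close> of \<open>x\<close> the radii of the iteration lie below
  \<open>\<sigma>\<close> at the sampling points, so \<open>u\<close> applies there; farther points
  are estimated by kernel sizes alone and go into \<open>H\<close>.\<close>

theorem key_estimate:
  assumes f: "integrable M f" and u: "integrable M u" "\<And>z. 0 \<le> u z"
    and fu: "AE z in M. \<forall>m::int. \<delta> powr m < \<sigma> z \<longrightarrow> \<bar>kop M (P (\<delta> powr m)) f z\<bar> \<le> u z"
    and r: "0 < r" "r < \<rho> x" and \<phi>: "cls x r 1 1 \<phi>"
  shows "ennreal \<bar>\<integral>y. f y * \<phi> y \<partial>M\<bar> \<le> ennreal Kk * (maxf q (\<lambda>z. u z powr (1 / q)) x + H g f x)"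
proof -
  interpret sigma_finite_measure M by (rule sigma_finite_M)
  interpret MM: pair_sigma_finite M M ..
  have [measurable]: "f \<in> borel_measurable M" "u \<in> borel_measurable M" using f u by auto
  define U where "U = (\<lambda>z. u z powr (1 / q))"
  have [measurable]: "U \<in> borel_measurable M" unfolding U_def by measurable
  have U0: "0 \<le> U z" for z by (simp add: U_def)
  have loc: "integrable M (\<lambda>z. U z * indicator (ball c s) z)" for c s
    unfolding U_def using q1 by (intro powr_locally_integrable u) auto
  from AE_E3[OF fu] obtain N where N: "N \<in> null_sets M"
    and fuN: "\<And>z m. z \<notin> N \<Longrightarrow> \<delta> powr real_of_int m < \<sigma> z \<Longrightarrow> \<bar>kop M (P (\<delta> powr m)) f z\<bar> \<le> u z"
    by (metis DiffI UNIV_I space_M)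
  have d: "0 < \<delta>" "\<delta> < 1" "\<delta> \<le> 1/2" using \<delta> by auto
  define m0 where "m0 = \<lceil>log \<delta> r\<rceil>"
  define r' where "r' = \<delta> powr m0"
  have lg: "\<delta> powr (log \<delta> r) = r" using d r by simp
  have r': "0 < r'" "r' \<le> r" "\<delta> * r \<le> r'"
  proof -
    show "0 < r'" using d by (simp add: r'_def)
    have "\<delta> powr m0 \<le> \<delta> powr (log \<delta> r)" using d by (intro powr_mono') (auto simp: m0_def)
    then show "r' \<le> r" by (simp only: lg r'_def)
    have "real_of_int m0 \<le> log \<delta> r + 1" unfolding m0_def by linarith
    then have "\<delta> powr (log \<delta> r + 1) \<le> \<delta> powr m0" using d by (intro powr_mono') auto
    then show "\<delta> * r \<le> r'" using d lg by (simp add: powr_add r'_def mult.commute)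
  qed
  define t where "t k = \<delta> ^ Suc k * r'" for k
  define s where "s k = \<delta> * t k / 2" for k
  have t: "0 < t k" "t k \<le> \<delta> * r" "t k \<le> r'" "t k = \<delta> powr (m0 + int (Suc k))" for k
  proof -
    show "0 < t k" using d r' by (simp add: t_def)
    have "\<delta> ^ Suc k * r' \<le> \<delta> ^ 1 * r" using d r' by (intro mult_mono power_decreasing) auto
    then show "t k \<le> \<delta> * r" by (simp add: t_def)
    have "\<delta> ^ Suc k * r' \<le> 1 * r'" using d r' by (intro mult_right_mono power_le_one) auto
    then show "t k \<le> r'" by (simp add: t_def)
    have "\<delta> powr (real_of_int m0 + real (Suc k)) = \<delta> powr m0 * \<delta> ^ Suc k"
      unfolding powr_add using d by (simp only: powr_realpow)
    then show "t k = \<delta> powr (m0 + int (Suc k))" by (simp add: t_def r'_def)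
  qed
  have s: "0 < s k" "2 * s k \<le> r'" "2 * s k = \<delta> * t k" for k
  proof -
    show "0 < s k" using t[of k] d by (simp add: s_def)
    show *: "2 * s k = \<delta> * t k" by (simp add: s_def)
    have "\<delta> * t k \<le> 1 * t k" using d t[of k] by (intro mult_right_mono) auto
    then show "2 * s k \<le> r'" using t(3)[of k] unfolding * by simp
  qed
  \<comment> \<open>sampling where \<open>U\<close> is at most its mean replaces point values of \<open>U\<close> by averages\<close>
  define zz where "zz k j = (SOME v. v \<in> ball (w j) (s k) \<and> v \<notin> N \<and> U v \<le> avg U (w j) (s k))" for k j
  have zz: "zz k j \<in> ball (w j) (s k) \<and> zz k j \<notin> N \<and> U (zz k j) \<le> avg U (w j) (s k)" for k j
    unfolding zz_def by (rule someI_ex, rule exists_le_avg[OF loc N s(1)])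
  define \<zeta> where "\<zeta> k z = zz k (idx (s k) z)" for k z
  have \<zeta>m: "\<zeta> k \<in> measurable M M" for k
    unfolding \<zeta>_def by (rule measurable_compose[OF idx_measurable]) simp
  have \<zeta>d: "dist z (\<zeta> k z) \<le> \<delta> * t k" for k z
  proof -
    have "dist z (w (idx (s k) z)) < s k" by (rule idx_dist[OF s(1)])
    moreover have "dist (w (idx (s k) z)) (\<zeta> k z) < s k" using zz[of k "idx (s k) z"] by (simp add: \<zeta>_def)
    ultimately show ?thesis using dist_triangle[of z "\<zeta> k z" "w (idx (s k) z)"] s(3)[of k] by linarith
  qed
  define A where "A k z = avg U (w (idx (s k) z)) (s k)" for k z
  have [measurable]: "A k \<in> borel_measurable M" for k
    unfolding A_def by (rule measurable_compose[OF idx_measurable]) simp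
  \<comment> \<open>Contribution of a distant point \<open>z\<close>: only sizes of kernels, with
    the envelope at scale \<open>r'\<close> already replaced by the one at scale
    \<open>\<sigma> x\<close>.\<close>
  define Y where "Y k z = (\<integral>\<^sup>+y. ennreal (Kr powr g * (D * 2 powr n) * (2 * C) * \<bar>f y\<bar>) * ennreal (E g (\<sigma> x) x z * E g (t k) y z) \<partial>M)" for k z
  have [measurable]: "Y k \<in> borel_measurable M" for k
    unfolding Y_def by measurable
  have pt: "ennreal (E g r' x z * \<bar>kop M (P (t k)) f (\<zeta> k z)\<bar>) \<le> ennreal (E g r' x z * A k z powr q) + Y k z" for k z
  proof (cases "dist x z \<le> \<rho> x")
    case True
    have "dist x (\<zeta> k z) \<le> dist x z + \<delta> * t k" using dist_triangle[of x "\<zeta> k z" z] \<zeta>d[of z k] by linarith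
    moreover have "\<delta> * t k \<le> \<rho> x" using s(2,3)[of k] r r' by linarith
    ultimately have "\<rho> x \<le> KA * \<rho> (\<zeta> k z)" using True by (intro \<rho>_near) simp
    also have "\<dots> \<le> KA * (Kr * \<sigma> (\<zeta> k z))" using KA by (intro mult_left_mono \<rho>_le) auto
    finally have 1: "\<rho> x \<le> KA * Kr * \<sigma> (\<zeta> k z)" by simp
    \<comment> \<open>This chain uses the part \<open>\<delta> \<le> 1 / (KA * Kr)\<close> of the
      choice of \<open>\<delta>\<close>, where \<open>KA\<close> passes from \<open>x\<close> to the
      sampling point and \<open>Kr\<close> from \<open>\<rho>\<close> to
      \<open>\<sigma>\<close>.\<close>
    have "t k < \<delta> * \<rho> x" using t(2)[of k] r d by (meson mult_strict_left_mono order.strict_trans1)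
    also have "\<dots> \<le> 1 / (KA * Kr) * (KA * Kr * \<sigma> (\<zeta> k z))"
      using 1 \<delta> d \<rho>_pos[of x] KA Kr by (intro mult_mono) auto
    also have "\<dots> = \<sigma> (\<zeta> k z)" using KA Kr by simp
    finally have ts: "t k < \<sigma> (\<zeta> k z)" .
    have "\<bar>kop M (P (t k)) f (\<zeta> k z)\<bar> \<le> u (\<zeta> k z)"
      using fuN[of "\<zeta> k z" "m0 + int (Suc k)"] zz[of k "idx (s k) z"] ts unfolding t(4) by (simp add: \<zeta>_def)
    also have "\<dots> = U (\<zeta> k z) powr q" using u(2) q1 by (simp add: U_def powr_powr)
    also have "\<dots> \<le> A k z powr q" using zz[of k "idx (s k) z"] q1 U0 by (intro powr_mono2) (auto simp: \<zeta>_def A_def)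
    finally have "E g r' x z * \<bar>kop M (P (t k)) f (\<zeta> k z)\<bar> \<le> E g r' x z * A k z powr q" by (intro mult_left_mono) auto
    then show ?thesis by (intro add_increasing2 ennreal_leI) auto
  next
    case False
    have F: "E g r' x z \<le> Kr powr g * (D * 2 powr n) * E g (\<sigma> x) x z"
      using False r r' by (intro E_far) auto
    have "ennreal \<bar>kop M (P (t k)) f (\<zeta> k z)\<bar> \<le> (\<integral>\<^sup>+y. ennreal (norm (P (t k) (\<zeta> k z) y * f y)) \<partial>M)"
      unfolding kop_def using integral_norm_bound_ennreal[OF kop_integrable[OF t(1) f]] by simp
    also have "\<dots> \<le> (\<integral>\<^sup>+y. ennreal (2 * C * E g (t k) y z * \<bar>f y\<bar>) \<partial>M)"
    proof (intro nn_integral_mono ennreal_leI)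
      fix y
      have "\<bar>P (t k) (\<zeta> k z) y\<bar> \<le> 2 * C * E g (t k) y z"
        using \<zeta>d[of z k] d by (intro P_zeta(2)[OF t(1)]) auto
      from mult_right_mono[OF this, of "\<bar>f y\<bar>"]
      show "norm (P (t k) (\<zeta> k z) y * f y) \<le> 2 * C * E g (t k) y z * \<bar>f y\<bar>" by (simp add: abs_mult)
    qed
    finally have k: "ennreal \<bar>kop M (P (t k)) f (\<zeta> k z)\<bar> \<le> (\<integral>\<^sup>+y. ennreal (2 * C * E g (t k) y z * \<bar>f y\<bar>) \<partial>M)" .
    have "ennreal (E g r' x z * \<bar>kop M (P (t k)) f (\<zeta> k z)\<bar>) = ennreal (E g r' x z) * ennreal \<bar>kop M (P (t k)) f (\<zeta> k z)\<bar>"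
      by (simp add: ennreal_mult')
    also have "\<dots> \<le> ennreal (Kr powr g * (D * 2 powr n) * E g (\<sigma> x) x z) * (\<integral>\<^sup>+y. ennreal (2 * C * E g (t k) y z * \<bar>f y\<bar>) \<partial>M)"
      using k by (intro mult_mono ennreal_leI F) auto
    also have "\<dots> = (\<integral>\<^sup>+y. ennreal (Kr powr g * (D * 2 powr n) * E g (\<sigma> x) x z) * ennreal (2 * C * E g (t k) y z * \<bar>f y\<bar>) \<partial>M)"
      by (intro nn_integral_cmult[symmetric]) measurable
    also have "\<dots> = Y k z" unfolding Y_def
      using D1 C by (intro nn_integral_cong) (simp add: ennreal_mult'[symmetric] mult_ac)
    finally show ?thesis by (simp add: add_increasing)
  qed
  have YI: "(\<integral>\<^sup>+z. Y k z \<partial>M) \<le> ennreal CF * H g f x" for k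
  proof -
    define c where "c = Kr powr g * (D * 2 powr n) * (2 * C)"
    have c: "0 \<le> c" using D1 C by (simp add: c_def)
    have tk: "t k \<le> \<sigma> x"
    proof -
      have "t k \<le> \<delta> * \<rho> x" using t(2)[of k] r d by (meson less_imp_le mult_left_mono order.trans)
      also have "\<dots> \<le> 1 / (KA * Kr) * (Kr * \<sigma> x)" using \<delta> \<rho>_le[of x] \<rho>_pos[of x] KA Kr by (intro mult_mono) auto
      also have "\<dots> = \<sigma> x / KA" using Kr by simp
      also have "\<dots> \<le> \<sigma> x" using KA \<sigma>_pos[of x] by (simp add: divide_le_eq mult_le_cancel_left1)
      finally show ?thesis .
    qed
    have "(\<integral>\<^sup>+z. Y k z \<partial>M) = (\<integral>\<^sup>+y. \<integral>\<^sup>+z. ennreal (c * \<bar>f y\<bar>) * ennreal (E g (\<sigma> x) x z * E g (t k) y z) \<partial>M \<partial>M)"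
      unfolding Y_def c_def by (rule MM.Fubini'[symmetric]) measurable
    also have "\<dots> = (\<integral>\<^sup>+y. ennreal (c * \<bar>f y\<bar>) * (\<integral>\<^sup>+z. ennreal (E g (\<sigma> x) x z * E g (t k) y z) \<partial>M) \<partial>M)"
      by (intro nn_integral_cong nn_integral_cmult) measurable
    also have "\<dots> \<le> (\<integral>\<^sup>+y. ennreal (c * \<bar>f y\<bar>) * ennreal (KC1 * E g (\<sigma> x) x y) \<partial>M)"
      by (intro nn_integral_mono mult_left_mono conv1 t tk) auto
    also have "\<dots> = (\<integral>\<^sup>+y. ennreal CF * ennreal (E g (\<sigma> x) x y * \<bar>f y\<bar>) \<partial>M)"
      using c CF_pos consts_pos by (intro nn_integral_cong) (simp add: ennreal_mult'[symmetric] CF_def c_def mult_ac)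
    also have "\<dots> = ennreal CF * (\<integral>\<^sup>+y. ennreal (E g (\<sigma> x) x y * \<bar>f y\<bar>) \<partial>M)"
      by (intro nn_integral_cmult) measurable
    also have "\<dots> \<le> ennreal CF * H g f x" by (intro mult_left_mono H_ge) auto
    finally show ?thesis .
  qed
  define c1 where "c1 = KB * (4 / \<delta>\<^sup>2) powr (b / 2)"
  have c1: "0 \<le> c1" using KB_pos by (simp add: c1_def)
  define L where "L = 2 * KK * \<delta> powr b"
  define Z where "Z = ennreal c1 * maxf q U x + ennreal CF * H g f x"
  have L0: "0 \<le> L" using consts_pos by (simp add: L_def)
  \<comment> \<open>In each step the residual gains \<open>2 * KK * \<delta> powr b\<close> and the
    local means lose \<open>\<delta> powr (- (b / 2))\<close>; the choice of \<open>\<delta>\<close>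
    leaves a factor \<open>1/2\<close>.\<close>
  have L2: "L * \<delta> powr (- (b / 2)) \<le> 1/2"
  proof -
    have "\<delta> powr b * \<delta> powr (- (b / 2)) = \<delta> powr (b / 2)" by (simp add: powr_add[symmetric])
    then have "L * \<delta> powr (- (b / 2)) = 2 * KK * \<delta> powr (b / 2)" by (simp add: L_def mult.assoc)
    then show ?thesis using \<delta>(4) by simp
  qed
  have L1: "L \<le> 1/2"
  proof -
    have "\<delta> powr b \<le> \<delta> powr (b / 2)" using d b by (intro powr_mono') auto
    then have "L \<le> 2 * KK * \<delta> powr (b / 2)" unfolding L_def using consts_pos by (intro mult_left_mono) auto
    then show ?thesis using \<delta>(4) by simp
  qed
  have term_le: "ennreal (L ^ k) * (\<integral>\<^sup>+z. ennreal (E g r' x z * \<bar>kop M (P (t k)) f (\<zeta> k z)\<bar>) \<partial>M) \<le> ennreal ((1/2) ^ k) * Z" for k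
  proof -
    have "(\<integral>\<^sup>+z. ennreal (E g r' x z * \<bar>kop M (P (t k)) f (\<zeta> k z)\<bar>) \<partial>M) \<le>
        (\<integral>\<^sup>+z. ennreal (E g r' x z * A k z powr q) + Y k z \<partial>M)" by (intro nn_integral_mono pt)
    also have "\<dots> = (\<integral>\<^sup>+z. ennreal (E g r' x z * A k z powr q) \<partial>M) + (\<integral>\<^sup>+z. Y k z \<partial>M)"
      by (intro nn_integral_add) measurable
    also have "\<dots> \<le> ennreal (KB * (2 * r' / s k) powr (b / 2)) * maxf q U x + ennreal CF * H g f x"
      unfolding A_def by (intro add_mono averages_bound YI U0 loc s) measurable
    finally have *: "(\<integral>\<^sup>+z. ennreal (E g r' x z * \<bar>kop M (P (t k)) f (\<zeta> k z)\<bar>) \<partial>M) \<le>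
        ennreal (KB * (2 * r' / s k) powr (b / 2)) * maxf q U x + ennreal CF * H g f x" .
    have sk: "(2 * r' / s k) powr (b / 2) = (4 / \<delta>\<^sup>2) powr (b / 2) * (\<delta> powr (- (b / 2))) ^ k"
    proof -
      have "2 * r' / s k = (4 / \<delta>\<^sup>2) * (1 / \<delta>) ^ k"
        using r' d by (simp add: s_def t_def power2_eq_square power_one_over divide_simps)
      then have "(2 * r' / s k) powr (b / 2) = (4 / \<delta>\<^sup>2) powr (b / 2) * ((1 / \<delta>) ^ k) powr (b / 2)"
        by (simp only: powr_mult)
      also have "((1 / \<delta>) ^ k) powr (b / 2) = ((1 / \<delta>) powr (b / 2)) ^ k"
        using d by (simp add: powr_power powr_realpow[symmetric] powr_powr mult.commute)
      also have "(1 / \<delta>) powr (b / 2) = \<delta> powr (- (b / 2))" using d by (simp add: powr_minus powr_divide inverse_eq_divide)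
      finally show ?thesis .
    qed
    have a1: "ennreal (L ^ k) * (ennreal (KB * (2 * r' / s k) powr (b / 2)) * maxf q U x) \<le> ennreal ((1/2) ^ k) * (ennreal c1 * maxf q U x)"
    proof -
      have "L ^ k * (KB * (2 * r' / s k) powr (b / 2)) = (L * \<delta> powr (- (b / 2))) ^ k * c1"
        unfolding sk c1_def by (simp add: power_mult_distrib)
      also have "\<dots> \<le> (1/2) ^ k * c1" using L0 L2 c1 by (intro mult_right_mono power_mono) auto
      finally have "ennreal (L ^ k * (KB * (2 * r' / s k) powr (b / 2))) \<le> ennreal ((1/2) ^ k * c1)" by (rule ennreal_leI)
      then have "ennreal (L ^ k) * ennreal (KB * (2 * r' / s k) powr (b / 2)) \<le> ennreal ((1/2) ^ k) * ennreal c1"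
        using L0 by (simp add: ennreal_mult')
      from mult_right_mono[OF this, of "maxf q U x"] show ?thesis by (simp only: mult.assoc) simp
    qed
    have a2: "ennreal (L ^ k) * (ennreal CF * H g f x) \<le> ennreal ((1/2) ^ k) * (ennreal CF * H g f x)"
      using L0 L1 by (intro mult_right_mono ennreal_leI power_mono) auto
    have "ennreal (L ^ k) * (\<integral>\<^sup>+z. ennreal (E g r' x z * \<bar>kop M (P (t k)) f (\<zeta> k z)\<bar>) \<partial>M) \<le>
      ennreal (L ^ k) * (ennreal (KB * (2 * r' / s k) powr (b / 2)) * maxf q U x + ennreal CF * H g f x)"
      by (intro mult_left_mono *) auto
    also have "\<dots> \<le> ennreal ((1/2) ^ k) * Z" unfolding Z_def distrib_left by (intro add_mono a1 a2)
    finally show ?thesis .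
  qed
  let ?\<psi> = "\<lambda>y. \<delta> powr g * \<phi> y"
  have "ennreal \<bar>\<integral>y. f y * ?\<psi> y \<partial>M\<bar> \<le> (\<Sum>k. ennreal (L ^ k) * (\<integral>\<^sup>+z. ennreal (E g r' x z * \<bar>kop M (P (t k)) f (\<zeta> k z)\<bar>) \<partial>M))"
    unfolding L_def t_def
  proof (rule iteration_bound[OF d(1,3) r'(1) \<zeta>m _ _ _ f])
    show "dist z (\<zeta> k z) \<le> \<delta> * (\<delta> ^ Suc k * r')" for k z using \<zeta>d[of z k] by (simp only: t_def)
    show "cls x r' 1 1 ?\<psi>" by (rule cls_smaller_scale[OF \<phi> r'])
    show "2 * KK * \<delta> powr b < 1" using L1 by (simp add: L_def)
  qed
  also have "\<dots> \<le> (\<Sum>k. ennreal ((1/2) ^ k) * Z)" by (intro suminf_le term_le) auto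
  also have "\<dots> = (\<Sum>k. ennreal ((1/2) ^ k)) * Z" by simp
  also have "(\<Sum>k. ennreal ((1/2) ^ k)) = ennreal 2"
    by (subst suminf_ennreal2) (auto simp: suminf_geometric intro: summable_geometric)
  finally have main: "ennreal \<bar>\<integral>y. f y * ?\<psi> y \<partial>M\<bar> \<le> ennreal 2 * Z" .
  have Z: "Z \<le> ennreal (c1 + CF) * (maxf q U x + H g f x)"
    unfolding Z_def distrib_left using c1 CF_pos by (intro add_mono mult_right_mono ennreal_leI) auto
  have "\<bar>\<integral>y. f y * \<phi> y \<partial>M\<bar> = 1 / \<delta> powr g * \<bar>\<integral>y. f y * ?\<psi> y \<partial>M\<bar>"
  proof -
    have "(\<integral>y. f y * ?\<psi> y \<partial>M) = (\<integral>y. \<delta> powr g * (f y * \<phi> y) \<partial>M)" by (simp add: mult_ac)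
    then show ?thesis using d by (simp add: abs_mult)
  qed
  then have "ennreal \<bar>\<integral>y. f y * \<phi> y \<partial>M\<bar> = ennreal (1 / \<delta> powr g) * ennreal \<bar>\<integral>y. f y * ?\<psi> y \<partial>M\<bar>"
    by (simp add: ennreal_mult'[symmetric])
  also have "\<dots> \<le> ennreal (1 / \<delta> powr g) * (ennreal 2 * (ennreal (c1 + CF) * (maxf q U x + H g f x)))"
    by (intro mult_left_mono order.trans[OF main] Z) auto
  also have "\<dots> = ennreal Kk * (maxf q U x + H g f x)"
  proof -
    have "ennreal Kk = ennreal (1 / \<delta> powr g) * (ennreal 2 * ennreal (c1 + CF))"
    proof -
      have "0 \<le> c1 + CF" using c1 CF_pos by simp
      then have "ennreal (1 / \<delta> powr g) * (ennreal 2 * ennreal (c1 + CF)) = ennreal (1 / \<delta> powr g * (2 * (c1 + CF)))"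
        using ennreal_mult[of 2 "c1 + CF"] ennreal_mult[of "1 / \<delta> powr g" "2 * (c1 + CF)"] by (simp del: ennreal_plus)
      moreover have "1 / \<delta> powr g * (2 * (c1 + CF)) = Kk" by (simp add: Kk_def c1_def)
      ultimately show ?thesis by (simp only:)
    qed
    then show ?thesis by (simp only: mult.assoc)
  qed
  finally show ?thesis unfolding U_def .
qed

lemma majorant_integral:
  assumes f: "integrable M f" and u: "integrable M u" "\<And>z. 0 \<le> u z"
  shows "(\<integral>\<^sup>+x. ennreal Kk * (maxf q (\<lambda>z. u z powr (1 / q)) x + H g f x) \<partial>M) \<le>
    ennreal (Kk * KM q) * (\<integral>\<^sup>+x. ennreal (u x) \<partial>M) + ennreal (Kk * KHH g) * (\<integral>\<^sup>+x. ennreal \<bar>f x\<bar> \<partial>M)"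
proof -
  have [measurable]: "f \<in> borel_measurable M" "u \<in> borel_measurable M" using f u by auto
  let ?U = "\<lambda>z. u z powr (1 / q)"
  have "(\<integral>\<^sup>+x. maxf q ?U x \<partial>M) \<le> ennreal (KM q) * (\<integral>\<^sup>+x. ennreal (?U x powr q) \<partial>M)"
    using q1 by (intro maxf_bound powr_locally_integrable u) auto
  also have "(\<integral>\<^sup>+x. ennreal (?U x powr q) \<partial>M) = (\<integral>\<^sup>+x. ennreal (u x) \<partial>M)"
    using q1 u by (simp add: powr_powr)
  finally have 1: "(\<integral>\<^sup>+x. maxf q ?U x \<partial>M) \<le> ennreal (KM q) * (\<integral>\<^sup>+x. ennreal (u x) \<partial>M)" .
  have "(\<integral>\<^sup>+x. ennreal Kk * (maxf q ?U x + H g f x) \<partial>M) = ennreal Kk * ((\<integral>\<^sup>+x. maxf q ?U x \<partial>M) + (\<integral>\<^sup>+x. H g f x \<partial>M))"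
    by (subst nn_integral_cmult) (auto simp: nn_integral_add)
  also have "\<dots> \<le> ennreal Kk * (ennreal (KM q) * (\<integral>\<^sup>+x. ennreal (u x) \<partial>M) + ennreal (KHH g) * (\<integral>\<^sup>+x. ennreal \<bar>f x\<bar> \<partial>M))"
    using g_pos by (intro mult_left_mono add_mono 1 H_bound) auto
  also have "\<dots> = ennreal (Kk * KM q) * (\<integral>\<^sup>+x. ennreal (u x) \<partial>M) + ennreal (Kk * KHH g) * (\<integral>\<^sup>+x. ennreal \<bar>f x\<bar> \<partial>M)"
    using Kk_pos KM_pos[OF q1] KHH_nonneg[of g] g_pos
    by (simp add: distrib_left ennreal_mult' mult.assoc[symmetric])
  finally show ?thesis .
qed

end

context doubling_measure
begin

text \<open>Bounded, of bounded support and globally Hoelder. These functions lie in the test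
  function spaces of smoothness at most \<open>\<theta>\<close> and suffice both for recovering
  integral norms by duality and for determining functionals. The centre serves only to locate the
  support.\<close>

definition bump :: "'a \<Rightarrow> real \<Rightarrow> ('a \<Rightarrow> real) \<Rightarrow> bool" where
  "bump x \<theta> \<phi> \<longleftrightarrow> (\<exists>R B. 0 < R \<and> 0 \<le> B \<and> (\<forall>y. \<bar>\<phi> y\<bar> \<le> B) \<and> (\<forall>y. R \<le> dist x y \<longrightarrow> \<phi> y = 0) \<and>
     (\<forall>y z. \<bar>\<phi> y - \<phi> z\<bar> \<le> B * dist y z powr \<theta>))"

lemma holder_continuous:
  fixes \<phi> :: "'a \<Rightarrow> real"
  assumes "\<And>y z. \<bar>\<phi> y - \<phi> z\<bar> \<le> B * dist y z powr \<theta>" "0 < \<theta>"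
  shows "continuous_on UNIV \<phi>"
proof -
  have "(\<phi> \<longlongrightarrow> \<phi> z) (at z)" for z
  proof -
    have "((\<lambda>y. dist y z) \<longlongrightarrow> 0) (at z)" using tendsto_dist[OF tendsto_ident_at tendsto_const[of z], of z UNIV] by simp
    then have "((\<lambda>y. B * dist y z powr \<theta>) \<longlongrightarrow> B * 0 powr \<theta>) (at z)"
      using assms(2) by (intro tendsto_mult tendsto_const tendsto_powr') auto
    then have l: "((\<lambda>y. B * dist y z powr \<theta>) \<longlongrightarrow> 0) (at z)" using assms(2) by simp
    have "((\<lambda>y. \<phi> y - \<phi> z) \<longlongrightarrow> 0) (at z)"
      by (rule Lim_null_comparison[OF _ l]) (use assms(1) in simp)
    then show ?thesis by (simp add: LIM_zero_iff)
  qed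
  then show ?thesis by (simp add: continuous_on_def)
qed

lemma holder_measurable:
  fixes \<phi> :: "'a \<Rightarrow> real"
  assumes "\<And>y z. \<bar>\<phi> y - \<phi> z\<bar> \<le> B * dist y z powr \<theta>" "0 < \<theta>"
  shows "\<phi> \<in> borel_measurable M"
  unfolding measurable_M_eq by (rule borel_measurable_continuous_onI[OF holder_continuous[OF assms]])

lemma bump_measurable:
  assumes "bump x \<theta> \<phi>" "0 < \<theta>" shows "\<phi> \<in> borel_measurable M"
proof -
  from assms(1) obtain B where "\<forall>y z. \<bar>\<phi> y - \<phi> z\<bar> \<le> B * dist y z powr \<theta>"
    unfolding bump_def by (elim exE conjE)
  then show ?thesis using holder_measurable[of \<phi> B \<theta>] assms(2) by simp
qed

lemma bump_diff:
  assumes "bump x \<theta> \<phi>" "bump x \<theta> \<psi>" shows "bump x \<theta> (\<lambda>y. \<phi> y - \<psi> y)"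
proof -
  from assms(1) obtain R B where 1: "0 < R" "0 \<le> B" "\<forall>y. \<bar>\<phi> y\<bar> \<le> B" "\<forall>y. R \<le> dist x y \<longrightarrow> \<phi> y = 0"
     "\<forall>y z. \<bar>\<phi> y - \<phi> z\<bar> \<le> B * dist y z powr \<theta>" unfolding bump_def by (elim exE conjE)
  from assms(2) obtain R' B' where 2: "0 < R'" "0 \<le> B'" "\<forall>y. \<bar>\<psi> y\<bar> \<le> B'" "\<forall>y. R' \<le> dist x y \<longrightarrow> \<psi> y = 0"
     "\<forall>y z. \<bar>\<psi> y - \<psi> z\<bar> \<le> B' * dist y z powr \<theta>" unfolding bump_def by (elim exE conjE)
  show ?thesis unfolding bump_def
  proof (rule exI[of _ "max R R'"], rule exI[of _ "B + B'"], intro conjI allI impI)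
    show "\<bar>\<phi> y - \<psi> y\<bar> \<le> B + B'" for y using 1(3)[rule_format, of y] 2(3)[rule_format, of y] by linarith
    show "\<bar>\<phi> y - \<psi> y - (\<phi> z - \<psi> z)\<bar> \<le> (B + B') * dist y z powr \<theta>" for y z
      using 1(5)[rule_format, of y z] 2(5)[rule_format, of y z] unfolding distrib_right by linarith
  qed (use 1 2 in auto)
qed

end

section \<open>Recovering the norm from averages\<close>

locale regular_doubling = doubling_measure +
  assumes outer: "A \<in> sets M \<Longrightarrow> emeasure M A = (INF U\<in>{U. open U \<and> A \<subseteq> U}. emeasure M U)"
    and infinite: "emeasure M UNIV = \<infinity>"
begin

text \<open>Outer regularity yields an open set of almost the same mass, and truncated multiples of
  the distance to its complement increase to its indicator.\<close>

lemma bump_approx_indicator: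
  assumes A: "A \<in> sets M" "A \<subseteq> ball x R" and R: "0 < R" and e: "0 < e"
  shows "\<exists>\<phi>. bump x 1 \<phi> \<and> (\<forall>y. 0 \<le> \<phi> y \<and> \<phi> y \<le> 1) \<and> (\<integral>y. \<bar>\<phi> y - indicator A y\<bar> \<partial>M) \<le> e"
proof -
  have fin: "emeasure M A < \<infinity>"
    using emeasure_mono[OF A(2), of M] by (simp add: emeasure_ball order.strict_trans1)
  have "emeasure M A < emeasure M A + ennreal (e / 2)" using fin e by (simp add: ennreal_add_left_cancel_less[where c = 0, simplified] less_top)
  then have "(INF U\<in>{U. open U \<and> A \<subseteq> U}. emeasure M U) < emeasure M A + ennreal (e / 2)" using outer[OF A(1)] by simp
  then obtain U0 where U0: "open U0" "A \<subseteq> U0" "emeasure M U0 < emeasure M A + ennreal (e / 2)"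
    unfolding INF_less_iff by auto
  define U where "U = U0 \<inter> ball x R"
  have U: "open U" "A \<subseteq> U" "U \<subseteq> ball x R" using U0 A by (auto simp: U_def)
  have Um[measurable]: "U \<in> sets M" using U by (simp add: sets_M)
  note A(1)[measurable]
  have Ufin: "emeasure M U < \<infinity>"
    using emeasure_mono[OF U(3), of M] by (simp add: emeasure_ball order.strict_trans1)
  have iU: "integrable M (indicator U :: 'a \<Rightarrow> real)" and iA: "integrable M (indicator A :: 'a \<Rightarrow> real)"
    using Ufin fin by (auto intro!: integrable_real_indicator)
  have mU: "measure M U \<le> measure M A + e / 2"
  proof -
    have "emeasure M U \<le> emeasure M A + ennreal (e / 2)"
      using emeasure_mono[of U U0 M] U0 by (auto simp: U_def sets_M)
    then have "ennreal (measure M U) \<le> ennreal (measure M A) + ennreal (e / 2)"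
      using Ufin fin by (simp add: emeasure_eq_ennreal_measure less_top)
    also have "ennreal (measure M A) + ennreal (e / 2) = ennreal (measure M A + e / 2)"
      using e by (intro ennreal_plus[symmetric]) auto
    finally show ?thesis using e by (simp add: ennreal_le_iff del: ennreal_plus)
  qed
  \<comment> \<open>\<open>infdist\<close> to the empty set is 0, so the complement must be
    nonempty; the infinite total mass guarantees this.\<close>
  have ne: "- U \<noteq> {}"
  proof
    assume "- U = {}"
    then have "U = UNIV" by auto
    then show False using Ufin infinite by simp
  qed
  have cl: "closed (- U)" using U by (simp add: closed_Compl)
  define \<psi> where "\<psi> k y = min 1 (real k * infdist y (- U))" for k y
  have \<psi>01: "0 \<le> \<psi> k y" "\<psi> k y \<le> 1" for k y by (auto simp: \<psi>_def infdist_nonneg)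
  have \<psi>0: "\<psi> k y = 0" if "y \<notin> U" for k y using that by (simp add: \<psi>_def)
  have lip: "\<bar>\<psi> k y - \<psi> k z\<bar> \<le> real k * dist y z" for k y z
  proof -
    have "\<bar>infdist y (- U) - infdist z (- U)\<bar> \<le> dist y z" by (rule infdist_triangle_abs)
    then have "real k * \<bar>infdist y (- U) - infdist z (- U)\<bar> \<le> real k * dist y z" by (intro mult_left_mono) auto
    then have "\<bar>real k * infdist y (- U) - real k * infdist z (- U)\<bar> \<le> real k * dist y z"
      by (simp add: right_diff_distrib[symmetric] abs_mult)
    then show ?thesis unfolding \<psi>_def by linarith
  qed
  have b: "bump x 1 (\<psi> k)" for k
    unfolding bump_def
  proof (rule exI[of _ R], rule exI[of _ "1 + real k"], intro conjI allI impI)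
    show "\<bar>\<psi> k y\<bar> \<le> 1 + real k" for y using \<psi>01[of k y] by simp
    show "\<psi> k y = 0" if "R \<le> dist x y" for y using that U(3) by (intro \<psi>0) auto
    show "\<bar>\<psi> k y - \<psi> k z\<bar> \<le> (1 + real k) * dist y z powr 1" for y z
      using order.trans[OF lip[of k y z] mult_right_mono[of "real k" "1 + real k" "dist y z"]] by simp
  qed (use R in auto)
  have [measurable]: "\<psi> k \<in> borel_measurable M" for k by (rule bump_measurable[OF b]) simp
  have lim: "(\<lambda>k. \<bar>\<psi> k y - indicator U y\<bar>) \<longlonglongrightarrow> 0" for y
  proof (cases "y \<in> U")
    case False then show ?thesis by (simp add: \<psi>0)
  next
    case True
    then have "0 < infdist y (- U)" using infdist_pos_not_in_closed[OF cl ne] by simp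
    then obtain K :: nat where K: "1 < real K * infdist y (- U)" using ex_less_of_nat_mult by blast
    have "\<forall>k\<ge>K. \<bar>\<psi> k y - indicator U y\<bar> = 0"
    proof (intro allI impI)
      fix k assume "K \<le> k"
      then have "real K * infdist y (- U) \<le> real k * infdist y (- U)" by (intro mult_right_mono infdist_nonneg) auto
      then show "\<bar>\<psi> k y - indicator U y\<bar> = 0" using K True by (simp add: \<psi>_def)
    qed
    then have "eventually (\<lambda>k. \<bar>\<psi> k y - indicator U y\<bar> = 0) sequentially" unfolding eventually_sequentially by blast
    then show ?thesis by (rule tendsto_eventually)
  qed
  have i1: "integrable M (\<lambda>y. \<bar>\<psi> k y - indicator U y\<bar>)" for k
    by (rule Bochner_Integration.integrable_bound[OF iU])
       (use \<psi>01 \<psi>0 in \<open>auto intro!: AE_I2 simp: indicator_def\<close>)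
  have "(\<lambda>k. \<integral>y. \<bar>\<psi> k y - indicator U y\<bar> \<partial>M) \<longlonglongrightarrow> (\<integral>y. 0 \<partial>M)"
    by (rule integral_dominated_convergence[where w = "indicator U"])
       (use lim \<psi>01 \<psi>0 iU in \<open>auto intro!: AE_I2 simp: indicator_def\<close>)
  then have "eventually (\<lambda>k. (\<integral>y. \<bar>\<psi> k y - indicator U y\<bar> \<partial>M) < e / 2) sequentially"
    using e by (intro order_tendstoD(2)[where y = 0]) auto
  then obtain k where k: "(\<integral>y. \<bar>\<psi> k y - indicator U y\<bar> \<partial>M) < e / 2"
    by (auto simp: eventually_sequentially)
  have i2: "integrable M (\<lambda>y. indicator U y - indicator A y :: real)" using iU iA by simp
  have "(\<integral>y. \<bar>\<psi> k y - indicator A y\<bar> \<partial>M) \<le> (\<integral>y. \<bar>\<psi> k y - indicator U y\<bar> + (indicator U y - indicator A y) \<partial>M)"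
  proof (rule integral_mono)
    show "integrable M (\<lambda>y. \<bar>\<psi> k y - indicator A y\<bar>)"
      by (rule Bochner_Integration.integrable_bound[OF iU])
         (use \<psi>01 \<psi>0 U(2) in \<open>auto intro!: AE_I2 simp: indicator_def\<close>)
    show "integrable M (\<lambda>y. \<bar>\<psi> k y - indicator U y\<bar> + (indicator U y - indicator A y))" using i1 i2 by simp
    show "\<bar>\<psi> k y - indicator A y\<bar> \<le> \<bar>\<psi> k y - indicator U y\<bar> + (indicator U y - indicator A y)" for y
      using U(2) by (auto simp: indicator_def)
  qed
  also have "\<dots> = (\<integral>y. \<bar>\<psi> k y - indicator U y\<bar> \<partial>M) + (measure M U - measure M A)"
    using i1 i2 iU iA by simp
  also have "\<dots> \<le> e" using k mU by simp
  finally show ?thesis using b \<psi>01 by (intro exI[of _ "\<psi> k"]) auto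
qed

text \<open>The sign of \<open>f\<close>, cut off at growing radii, is approximated by differences
  of bumps in the mean, hence almost everywhere along a subsequence. Dominated convergence then
  turns pairings with these bumps into the integral of \<open>\<bar>f y\<bar>\<close>.\<close>

lemma L1_norm_by_bumps:
  assumes f: "integrable M f"
    and W: "\<And>\<phi>. bump x 1 \<phi> \<Longrightarrow> (\<And>y. \<bar>\<phi> y\<bar> \<le> 1) \<Longrightarrow> ennreal (\<integral>y. f y * \<phi> y \<partial>M) \<le> W"
  shows "(\<integral>\<^sup>+y. ennreal \<bar>f y\<bar> \<partial>M) \<le> W"
proof -
  have [measurable]: "f \<in> borel_measurable M" using f by auto
  define A where "A k = {y. 0 < f y} \<inter> ball x (real (Suc k))" for k
  define B where "B k = {y. f y < 0} \<inter> ball x (real (Suc k))" for k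
  have AB[measurable]: "A k \<in> sets M" "B k \<in> sets M" for k
  proof -
    have "{y \<in> space M. 0 < f y} \<in> sets M" "{y \<in> space M. f y < 0} \<in> sets M" by measurable
    then show "A k \<in> sets M" "B k \<in> sets M" unfolding A_def B_def by (auto intro!: sets.Int)
  qed
  define app where "app S k \<phi> \<longleftrightarrow> bump x 1 \<phi> \<and> (\<forall>y. 0 \<le> \<phi> y \<and> \<phi> y \<le> 1) \<and> (\<integral>y. \<bar>\<phi> y - indicator S y\<bar> \<partial>M) \<le> 1 / real (Suc k)" for S k \<phi>
  define \<phi> where "\<phi> k = (SOME \<phi>. app (A k) k \<phi>)" for k
  define \<psi> where "\<psi> k = (SOME \<phi>. app (B k) k \<phi>)" for k
  have \<phi>: "app (A k) k (\<phi> k)" for k unfolding \<phi>_def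
    by (rule someI_ex[of "app (A k) k"], unfold app_def, rule bump_approx_indicator[OF AB(1), where R = "real (Suc k)"]) (auto simp: A_def)
  have \<psi>: "app (B k) k (\<psi> k)" for k unfolding \<psi>_def
    by (rule someI_ex[of "app (B k) k"], unfold app_def, rule bump_approx_indicator[OF AB(2), where R = "real (Suc k)"]) (auto simp: B_def)
  have bp: "bump x 1 (\<phi> k)" "bump x 1 (\<psi> k)" for k using \<phi>[of k] \<psi>[of k] by (auto simp: app_def)
  have r01: "0 \<le> \<phi> k y" "\<phi> k y \<le> 1" "0 \<le> \<psi> k y" "\<psi> k y \<le> 1" for k y using \<phi>[of k] \<psi>[of k] by (auto simp: app_def)
  have [measurable]: "\<phi> k \<in> borel_measurable M" "\<psi> k \<in> borel_measurable M" for k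
    by (auto intro: bump_measurable[OF bp(1)] bump_measurable[OF bp(2)])
  define v where "v k y = \<bar>\<phi> k y - indicator (A k) y\<bar> + \<bar>\<psi> k y - indicator (B k) y\<bar>" for k y
  have ind: "integrable M (indicator (ball x R) :: 'a \<Rightarrow> real)" for R
    by (intro integrable_real_indicator) (auto simp: emeasure_ball)
  have ibump: "integrable M \<theta>" if "bump x 1 \<theta>" for \<theta>
  proof -
    from that obtain R B where 1: "0 < R" "0 \<le> B" "\<forall>y. \<bar>\<theta> y\<bar> \<le> B" "\<forall>y. R \<le> dist x y \<longrightarrow> \<theta> y = 0"
      unfolding bump_def by (elim exE conjE)
    have "\<theta> \<in> borel_measurable M" using that by (rule bump_measurable) simp
    moreover have "norm (\<theta> y) \<le> norm (B * indicator (ball x R) y)" for y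
      using 1 by (auto simp: indicator_def)
    ultimately show ?thesis
      by (intro Bochner_Integration.integrable_bound[OF integrable_mult_right[OF ind]]) auto
  qed
  have iA: "integrable M (indicator (A k) :: 'a \<Rightarrow> real)" "integrable M (indicator (B k) :: 'a \<Rightarrow> real)" for k
    by (auto intro!: Bochner_Integration.integrable_bound[OF ind[of "real (Suc k)"]] AE_I2 simp: A_def B_def indicator_def)
  have iv: "integrable M (v k)" for k
    unfolding v_def using ibump[OF bp(1)[of k]] ibump[OF bp(2)[of k]] iA[of k] by simp
  have "(\<lambda>k. \<integral>y. norm (v k y) \<partial>M) \<longlonglongrightarrow> 0"
  proof (rule tendsto_sandwich[where f = "\<lambda>_. 0" and h = "\<lambda>k. 2 * (1 / real (Suc k))"])
    have "(\<integral>y. norm (v k y) \<partial>M) = (\<integral>y. \<bar>\<phi> k y - indicator (A k) y\<bar> \<partial>M) + (\<integral>y. \<bar>\<psi> k y - indicator (B k) y\<bar> \<partial>M)" for k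
      unfolding v_def using ibump[OF bp(1)[of k]] ibump[OF bp(2)[of k]] iA[of k] by simp
    then show "\<forall>\<^sub>F k in sequentially. (\<integral>y. norm (v k y) \<partial>M) \<le> 2 * (1 / real (Suc k))"
      using \<phi> \<psi> unfolding app_def by (intro always_eventually allI) (smt (verit))
    show "(\<lambda>k. 2 * (1 / real (Suc k))) \<longlonglongrightarrow> 0"
      using tendsto_mult_left[OF LIMSEQ_Suc[OF lim_1_over_n], of "2::real"] by simp
  qed (auto intro!: always_eventually)
  from tendsto_L1_AE_subseq[OF iv this] obtain r where r: "strict_mono r" "AE y in M. (\<lambda>k. v (r k) y) \<longlonglongrightarrow> 0"
    by (elim exE conjE)
  define \<theta> where "\<theta> k y = \<phi> (r k) y - \<psi> (r k) y" for k y
  have [measurable]: "\<theta> k \<in> borel_measurable M" for k unfolding \<theta>_def by measurable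
  have b\<theta>: "bump x 1 (\<theta> k)" for k unfolding \<theta>_def by (intro bump_diff bp)
  have \<theta>1: "\<bar>\<theta> k y\<bar> \<le> 1" for k y using r01[of "r k" y] by (auto simp: \<theta>_def)
  have lim: "AE y in M. (\<lambda>k. f y * \<theta> k y) \<longlonglongrightarrow> \<bar>f y\<bar>"
    using r(2)
  proof eventually_elim
    fix y assume v0: "(\<lambda>k. v (r k) y) \<longlonglongrightarrow> 0"
    define g where "g k = (indicator (A (r k)) y - indicator (B (r k)) y :: real)" for k
    have "(\<lambda>k. \<theta> k y - g k) \<longlonglongrightarrow> 0"
      by (rule Lim_null_comparison[OF _ v0], rule always_eventually) (auto simp: v_def \<theta>_def g_def)
    moreover have "eventually (\<lambda>k. g k = sgn (f y)) sequentially"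
    proof -
      obtain K :: nat where K: "dist x y < real K" using reals_Archimedean2[of "dist x y"] by (elim exE)
      have "g k = sgn (f y)" if "K \<le> k" for k
      proof -
        have "k \<le> r k" using r(1) by (rule seq_suble)
        then have "dist x y < real (Suc (r k))" using K that by simp
        then show ?thesis by (auto simp: g_def A_def B_def indicator_def sgn_if)
      qed
      then show ?thesis unfolding eventually_sequentially by blast
    qed
    then have "g \<longlonglongrightarrow> sgn (f y)" by (rule tendsto_eventually)
    ultimately have "(\<lambda>k. (\<theta> k y - g k) + g k) \<longlonglongrightarrow> 0 + sgn (f y)" by (rule tendsto_add)
    then have "(\<lambda>k. f y * \<theta> k y) \<longlonglongrightarrow> f y * sgn (f y)" by (intro tendsto_mult tendsto_const) simp
    then show "(\<lambda>k. f y * \<theta> k y) \<longlonglongrightarrow> \<bar>f y\<bar>" by (simp add: abs_sgn)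
  qed
  have "(\<lambda>k. \<integral>y. f y * \<theta> k y \<partial>M) \<longlonglongrightarrow> (\<integral>y. \<bar>f y\<bar> \<partial>M)"
  proof (rule integral_dominated_convergence[where w = "\<lambda>y. \<bar>f y\<bar>"])
    have "\<bar>f y\<bar> * \<bar>\<theta> k y\<bar> \<le> \<bar>f y\<bar> * 1" for k y by (intro mult_left_mono \<theta>1) auto
    then show "AE y in M. norm (f y * \<theta> k y) \<le> \<bar>f y\<bar>" for k by (intro AE_I2) (simp add: abs_mult)
  qed (use f lim in auto)
  then have "(\<lambda>k. ennreal (\<integral>y. f y * \<theta> k y \<partial>M)) \<longlonglongrightarrow> ennreal (\<integral>y. \<bar>f y\<bar> \<partial>M)" by (rule tendsto_ennrealI)
  then have "ennreal (\<integral>y. \<bar>f y\<bar> \<partial>M) \<le> W"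
    by (rule LIMSEQ_le_const2) (use W[OF b\<theta> \<theta>1] in blast)
  then show ?thesis using f by (subst nn_integral_eq_integral) auto
qed

end

context kernel
begin

text \<open>On the support the envelope at scale 1 is bounded below by \<open>e0\<close>; for pairs
  at distance above 1 the modulus equals 1 and the sup bound suffices.\<close>

lemma bump_cls:
  assumes "bump x \<theta> \<phi>" "b \<le> \<theta>"
  shows "\<exists>A\<ge>0. cls x 1 A A \<phi>"
proof -
  from assms(1) obtain R B where 1: "0 < R" "0 \<le> B" "\<And>y. \<bar>\<phi> y\<bar> \<le> B" "\<And>y. R \<le> dist x y \<Longrightarrow> \<phi> y = 0"
     "\<And>y z. \<bar>\<phi> y - \<phi> z\<bar> \<le> B * dist y z powr \<theta>" unfolding bump_def by (elim exE conjE) blast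
  have [measurable]: "\<phi> \<in> borel_measurable M" using bump_measurable[OF assms(1)] assms b by simp
  define e0 where "e0 = (1 / (1 + R)) powr g / V x (1 + R)"
  have Vp: "0 < V x (1 + R)" using 1 by (intro V_pos) simp
  have e0: "0 < e0" using Vp 1 by (simp add: e0_def)
  have low: "e0 \<le> E g 1 x y" if "dist x y < R" for y
    unfolding e0_def E_def using that g_pos 1
    by (intro frac_le powr_mono2 V_mono V_pos) (auto simp: add_pos_nonneg intro!: divide_left_mono)
  define A where "A = 2 * B / e0"
  have A: "0 \<le> A" using e0 1 by (simp add: A_def)
  have AB: "2 * B \<le> A * E g 1 x y" if "dist x y < R" for y
  proof -
    have "2 * B = A * e0" using e0 by (simp add: A_def)
    also have "\<dots> \<le> A * E g 1 x y" by (intro mult_left_mono low that A)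
    finally show ?thesis .
  qed
  have hol: "\<bar>\<phi> y - \<phi> z\<bar> \<le> 2 * B * mn (dist y z)" for y z
  proof (cases "dist y z \<le> 1")
    case True
    have "dist y z powr \<theta> \<le> dist y z powr b" using assms True by (intro powr_mono') auto
    then have "B * dist y z powr \<theta> \<le> B * dist y z powr b" using 1 by (intro mult_left_mono) auto
    moreover have "B * dist y z powr b \<le> 2 * (B * dist y z powr b)" using 1(2) by simp
    ultimately show ?thesis using 1(5)[of y z] True by (simp add: mn_def min_def)
  next
    case False
    then show ?thesis using 1(3)[of y] 1(3)[of z] by (simp add: mn_def min_def)
  qed
  have "cls x 1 A A \<phi>" unfolding cls_def
  proof (intro conjI allI)
    show "\<phi> \<in> borel_measurable M" by measurable
    fix y
    show "\<bar>\<phi> y\<bar> \<le> A * E g 1 x y"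
    proof (cases "dist x y < R")
      case True
      then show ?thesis using AB[OF True] 1(2) 1(3)[of y] by linarith
    next
      case False
      then show ?thesis using 1(4)[of y] A by simp
    qed
    fix z
    show "\<bar>\<phi> y - \<phi> z\<bar> \<le> A * mn (dist y z / 1) * (E g 1 x y + E g 1 x z)"
    proof (cases "dist x y < R \<or> dist x z < R")
      case True
      have nn: "0 \<le> A * E g 1 x y" "0 \<le> A * E g 1 x z" using A by auto
      have "2 * B \<le> A * (E g 1 x y + E g 1 x z)"
        using True AB[of y] AB[of z] nn unfolding distrib_left by linarith
      then have "2 * B * mn (dist y z) \<le> A * (E g 1 x y + E g 1 x z) * mn (dist y z)" by (intro mult_right_mono) auto
      then show ?thesis using hol[of y z] by (simp add: mult_ac)
    next
      case False
      then show ?thesis using 1(4)[of y] 1(4)[of z] A by simp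
    qed
  qed
  then show ?thesis using A by blast
qed

text \<open>A single averaging step with \<open>\<zeta>\<close> the identity, \<open>r = 1\<close>
  and \<open>\<eta> = t\<close>.\<close>

lemma approximate_identity:
  assumes \<phi>: "cls x 1 A A \<phi>" and A: "0 \<le> A" and f: "integrable M f" and t: "0 < t" "t \<le> 1/2"
  shows "\<bar>(\<integral>y. f y * \<phi> y \<partial>M) - (\<integral>z. \<phi> z * kop M (P t) f z \<partial>M)\<bar> \<le> 2 * KK * A * ((\<integral>y. \<bar>f y\<bar> \<partial>M) / V x 1) * t powr b"
proof -
  have t1: "t \<le> 1" using t by simp
  have z: "dist z z \<le> t * t" for z :: 'a using t by simp
  have t0: "0 \<le> t" using t by simp
  have id: "(\<lambda>z. z) \<in> measurable M M" by simp
  note st = smear_step[OF t(1) t1 t0 t(2) id z \<phi> A]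
  note sp = smear_pairing[OF t(1) t1 t0 t(2) id z \<phi> f]
  have "(\<integral>y. f y * (\<phi> y - smear t (\<lambda>z. z) \<phi> y) \<partial>M) = (\<integral>y. f y * \<phi> y \<partial>M) - (\<integral>z. \<phi> z * kop M (P t) f z \<partial>M)"
    unfolding right_diff_distrib using cls_pairing(1)[OF \<phi> _ f] sp by simp
  moreover have "\<bar>\<integral>y. f y * (\<phi> y - smear t (\<lambda>z. z) \<phi> y) \<partial>M\<bar> \<le> KK * ((t / 1) powr b * A + t powr b * A) * ((\<integral>y. \<bar>f y\<bar> \<partial>M) / V x 1)"
    by (rule cls_pairing(2)[OF st _ f]) simp
  ultimately show ?thesis by (simp add: algebra_simps)
qed

end

section \<open>Kernels and test functions\<close>

context doubling_measure
begin

text \<open>The envelope in the form used in the definition of test functions; it is comparable with \<open>E\<close>.\<close>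

definition env :: "real \<Rightarrow> real \<Rightarrow> 'a \<Rightarrow> 'a \<Rightarrow> real" where
  "env g r x y = 1 / (Vr M r x + Vxy M x y) * (r / (r + dist x y)) powr g"

lemma Vr_V: "Vr M r x = V x r" and Vxy_V: "Vxy M x y = V x (dist x y)"
  by (simp_all add: Vr_def Vxy_def V_def)

lemma env_nonneg [simp]: "0 \<le> env g r x y"
  by (simp add: env_def Vr_V Vxy_V)

lemma env_pos: "0 < r \<Longrightarrow> 0 < env g r x y"
  using V_pos[of r x] add_pos_nonneg[of r "dist x y"] unfolding env_def Vr_V Vxy_V
  by (intro mult_pos_pos divide_pos_pos add_pos_nonneg) auto

lemma env_mono_exp: "0 < r \<Longrightarrow> g \<le> g' \<Longrightarrow> env g' r x y \<le> env g r x y"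
  unfolding env_def
  by (intro mult_left_mono powr_mono') (auto simp: add_pos_nonneg divide_le_eq_1 Vr_V Vxy_V)

lemma env_le_E:
  assumes r: "0 < r" shows "env g r x y \<le> D * 2 powr n * E g r x y"
proof -
  let ?d = "dist x y"
  have d: "0 \<le> ?d" by simp
  have p: "0 < V x r" by (rule V_pos[OF r])
  have K: "0 \<le> D * 2 powr n" using D1 by simp
  have "V x (r + ?d) \<le> D * 2 powr n * (V x r + V x ?d)"
  proof (cases "?d \<le> r")
    case True
    then have "V x (r + ?d) \<le> D * 2 powr n * V x r" using r by (intro V_compare) auto
    also have "\<dots> \<le> D * 2 powr n * (V x r + V x ?d)" using K by (intro mult_left_mono) auto
    finally show ?thesis .
  next
    case False
    then have "V x (r + ?d) \<le> D * 2 powr n * V x ?d" using r by (intro V_compare) auto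
    also have "\<dots> \<le> D * 2 powr n * (V x r + V x ?d)" using K by (intro mult_left_mono) auto
    finally show ?thesis .
  qed
  moreover have "0 < V x (r + ?d)" using r d by (intro V_pos) linarith
  moreover have "0 < V x r + V x ?d" using p by (simp add: add_pos_nonneg)
  ultimately have "1 / (V x r + V x ?d) \<le> D * 2 powr n / V x (r + ?d)"
    by (simp add: divide_simps mult.commute)
  from mult_right_mono[OF this, of "(r / (r + ?d)) powr g"]
  show ?thesis by (simp add: env_def E_def Vr_V Vxy_V mult_ac)
qed

lemma G_bound_env: "G_bound M x r \<beta> \<gamma> f C \<longleftrightarrow>
   (\<forall>y. \<bar>f y\<bar> \<le> C * env \<gamma> r x y) \<and>
   (\<forall>y y'. dist y y' \<le> (r + dist x y) / 2 \<longrightarrow>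
      \<bar>f y - f y'\<bar> \<le> C * (dist y y' / (r + dist x y)) powr \<beta> * env \<gamma> r x y)"
  unfolding G_bound_def env_def by (simp add: mult.assoc)

lemma G_bound_measurable:
  assumes G: "G_bound M x r \<beta> \<gamma> \<phi> C" and r: "0 < r" and \<beta>: "0 < \<beta>"
  shows "\<phi> \<in> borel_measurable M"
proof -
  have "(\<phi> \<longlongrightarrow> \<phi> y) (at y)" for y
  proof -
    let ?R = "r + dist x y" and ?c = "C * env \<gamma> r x y"
    have R: "0 < ?R" using r by (simp add: add_pos_nonneg)
    have l1: "((\<lambda>y'. dist y y') \<longlongrightarrow> 0) (at y)" using tendsto_dist[OF tendsto_const[of y] tendsto_ident_at, of y UNIV] by simp
    have "((\<lambda>y'. dist y y' / ?R) \<longlongrightarrow> 0 / ?R) (at y)" using R by (intro tendsto_divide l1 tendsto_const) auto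
    then have "((\<lambda>y'. (dist y y' / ?R) powr \<beta> * ?c) \<longlongrightarrow> (0 / ?R) powr \<beta> * ?c) (at y)"
      using \<beta> R by (intro tendsto_mult tendsto_const tendsto_powr') auto
    then have l: "((\<lambda>y'. (dist y y' / ?R) powr \<beta> * ?c) \<longlongrightarrow> 0) (at y)" using \<beta> by simp
    have ev: "\<forall>\<^sub>F y' in at y. dist y y' < ?R / 2" using R by (intro order_tendstoD(2)[OF l1]) simp
    have "((\<lambda>y'. \<phi> y' - \<phi> y) \<longlongrightarrow> 0) (at y)"
    proof (rule Lim_null_comparison[OF _ l])
      show "\<forall>\<^sub>F y' in at y. norm (\<phi> y' - \<phi> y) \<le> (dist y y' / ?R) powr \<beta> * ?c"
        using ev
      proof eventually_elim
        fix y' assume "dist y y' < ?R / 2"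
        then have "\<bar>\<phi> y - \<phi> y'\<bar> \<le> C * (dist y y' / ?R) powr \<beta> * env \<gamma> r x y"
          using G unfolding G_bound_env by simp
        then show "norm (\<phi> y' - \<phi> y) \<le> (dist y y' / ?R) powr \<beta> * ?c" by (simp add: abs_minus_commute mult_ac)
      qed
    qed
    then show ?thesis by (simp add: LIM_zero_iff)
  qed
  then have "continuous_on UNIV \<phi>" by (simp add: continuous_on_def)
  then show ?thesis unfolding measurable_M_eq by (rule borel_measurable_continuous_onI)
qed

end

context kernel
begin

definition KG :: real where "KG = 2 * (D * 2 powr n)"

text \<open>The test function condition controls close pairs only. For the others
  \<open>dist y z\<close> exceeds \<open>r / 2\<close>, so the modulus is at least
  \<open>1 / 2\<close> by \<open>b \<le> 1\<close>, and the two size bounds suffice.\<close>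

lemma G_bound_cls:
  assumes G: "G_bound M x r \<beta> \<gamma> \<phi> A" and r: "0 < r" and A: "0 \<le> A" and ex: "b \<le> \<beta>" "g \<le> \<gamma>" and b1: "b \<le> 1"
  shows "cls x r (KG * A) (KG * A) \<phi>"
  unfolding cls_def
proof (intro conjI allI)
  let ?c = "D * 2 powr n"
  have c: "0 \<le> ?c" using D1 by simp
  have "0 < \<beta>" using ex b by simp
  then show "\<phi> \<in> borel_measurable M" using G_bound_measurable[OF G r] by simp
  have W: "env \<gamma> r x y \<le> ?c * E g r x y" for y
    using env_mono_exp[OF r ex(2)] env_le_E[OF r] by (rule order.trans)
  have sz: "\<bar>\<phi> y\<bar> \<le> A * (?c * E g r x y)" for y
  proof -
    have "\<bar>\<phi> y\<bar> \<le> A * env \<gamma> r x y" using G unfolding G_bound_env by simp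
    also have "\<dots> \<le> A * (?c * E g r x y)" by (intro mult_left_mono W A)
    finally show ?thesis .
  qed
  have nn: "0 \<le> A * (?c * E g r x y)" for y using A c by simp
  show "\<bar>\<phi> y\<bar> \<le> KG * A * E g r x y" for y
    using sz[of y] nn[of y] by (simp add: KG_def mult_ac)
  fix y z
  let ?S = "E g r x y + E g r x z" and ?d = "dist y z"
  show "\<bar>\<phi> y - \<phi> z\<bar> \<le> KG * A * mn (?d / r) * ?S"
  proof (cases "?d \<le> (r + dist x y) / 2")
    case True
    have R: "0 < r + dist x y" using r by (simp add: add_pos_nonneg)
    have "?d / (r + dist x y) \<le> 1 / 2" using True R by (simp add: divide_simps)
    then have "(?d / (r + dist x y)) powr \<beta> \<le> (?d / (r + dist x y)) powr b"
      using ex R by (intro powr_mono') auto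
    also have "\<dots> \<le> mn (?d / r)" unfolding mn_def
    proof (intro powr_mono2)
      have "?d / (r + dist x y) \<le> ?d / r" using r by (intro divide_left_mono) (auto simp: add_pos_nonneg)
      moreover have "?d / (r + dist x y) \<le> 1" using \<open>?d / (r + dist x y) \<le> 1 / 2\<close> by linarith
      ultimately show "?d / (r + dist x y) \<le> min 1 (?d / r)" by (intro min.boundedI)
    qed (use b R in auto)
    finally have m: "(?d / (r + dist x y)) powr \<beta> \<le> mn (?d / r)" .
    have "\<bar>\<phi> y - \<phi> z\<bar> \<le> A * (?d / (r + dist x y)) powr \<beta> * env \<gamma> r x y" using G True unfolding G_bound_env by simp
    also have "\<dots> \<le> A * mn (?d / r) * (?c * E g r x y)" using A by (intro mult_mono m W mult_left_mono) auto
    also have "\<dots> \<le> A * mn (?d / r) * (2 * ?c * ?S)"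
    proof (rule mult_left_mono)
      have "?c * E g r x y \<le> ?c * (2 * ?S)" using c by (intro mult_left_mono) auto
      moreover have "?c * (2 * ?S) = 2 * ?c * ?S" by (simp only: mult_ac)
      ultimately show "?c * E g r x y \<le> 2 * ?c * ?S" by (simp only:)
    qed (use A in simp)
    finally show ?thesis by (simp add: KG_def mult_ac)
  next
    case False
    have "r \<le> 2 * ?d" using False zero_le_dist[of x y] by argo
    then have "1 / 2 \<le> ?d / r" using r by (simp add: divide_simps)
    then have "1 / 2 \<le> min 1 (?d / r)" by simp
    have "(1/2::real) powr 1 \<le> (1 / 2) powr b" using b1 by (intro powr_mono') auto
    also have "\<dots> \<le> mn (?d / r)" unfolding mn_def using b \<open>1 / 2 \<le> min 1 (?d / r)\<close> by (intro powr_mono2) auto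
    finally have m: "1 \<le> 2 * mn (?d / r)" by simp
    have "\<bar>\<phi> y - \<phi> z\<bar> \<le> A * (?c * ?S) * 1" using sz[of y] sz[of z] by (simp add: distrib_left)
    also have "\<dots> \<le> A * (?c * ?S) * (2 * mn (?d / r))" using A c by (intro mult_left_mono m) auto
    finally show ?thesis by (simp add: KG_def mult_ac)
  qed
qed

lemma cls_scale:
  assumes "cls x r A A \<phi>" "0 < A" shows "cls x r 1 1 (\<lambda>y. \<phi> y / A)"
  using assms unfolding cls_def
  by (auto simp: abs_div diff_divide_distrib[symmetric] divide_le_eq mult_ac)

end

context doubling_measure
begin

text \<open>\<open>E_sym\<close> moves the envelope to the second variable, where
  \<open>kernel\<close> wants it, and \<open>pw\<close> lowers the exponent \<open>e1\<close> to
  \<open>2 * b\<close>. The rows of \<open>S\<close> are returned as test functions as well, which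
  later lets a grand majorant bound \<open>kop M (S t) f\<close>.\<close>

lemma kernel_of_AOTI:
  assumes S: "cont_AOTI M e1 e2 e3 S" and b: "0 < b" "2 * b \<le> g" "2 * b \<le> e1" "g \<le> e2"
  shows "\<exists>C>0. kernel M D n S g b C \<and> (\<forall>t>0. \<forall>x. G_bound M x t e1 e2 (S t x) C)"
proof -
  from S obtain C6 where C6: "0 < C6" and
    all: "\<forall>t>0. \<forall>x x' y y'.
      \<bar>S t x y\<bar> \<le> C6 * (1 / (Vr M t x + Vxy M x y)) * (t / (t + dist x y)) powr e2 \<and>
      (dist x x' \<le> (t + dist x y) / 2 \<longrightarrow>
         \<bar>S t x y - S t x' y\<bar> \<le> C6 * (dist x x' / (t + dist x y)) powr e1
             * (1 / (Vr M t x + Vxy M x y)) * (t / (t + dist x y)) powr e2) \<and>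
      (dist y y' \<le> (t + dist x y) / 2 \<longrightarrow>
         \<bar>S t x y - S t x y'\<bar> \<le> C6 * (dist y y' / (t + dist x y)) powr e1
             * (1 / (Vr M t x + Vxy M x y)) * (t / (t + dist x y)) powr e2) \<and>
      (dist x x' \<le> (t + dist x y) / 3 \<longrightarrow> dist y y' \<le> (t + dist x y) / 3 \<longrightarrow>
         \<bar>(S t x y - S t x y') - (S t x' y - S t x' y')\<bar> \<le>
             C6 * (dist x x' / (t + dist x y)) powr e1 * (dist y y' / (t + dist x y)) powr e1
             * (1 / (Vr M t x + Vxy M x y)) * (t / (t + dist x y)) powr e3) \<and>
      (\<integral>z. S t x z \<partial>M) = 1 \<and> (\<integral>z. S t z y \<partial>M) = 1"
    unfolding cont_AOTI_def by (elim conjE exE)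
  have 1: "\<bar>S t x y\<bar> \<le> C6 * env e2 t x y"
    and 2: "dist x x' \<le> (t + dist x y) / 2 \<Longrightarrow> \<bar>S t x y - S t x' y\<bar> \<le> C6 * (dist x x' / (t + dist x y)) powr e1 * env e2 t x y"
    and 3: "dist y y' \<le> (t + dist x y) / 2 \<Longrightarrow> \<bar>S t x y - S t x y'\<bar> \<le> C6 * (dist y y' / (t + dist x y)) powr e1 * env e2 t x y"
    and 5: "(\<integral>z. S t z y \<partial>M) = 1"
    if "0 < t" for t x x' y y'
    using all[rule_format, OF that, of x y x' y'] by (simp_all add: env_def mult.assoc)
  define K where "K = (D * 2 powr n) * (D * 2 powr n)"
  have K: "0 < K" using D1 by (simp add: K_def)
  have K1: "1 \<le> K"
  proof -
    have "1 \<le> D * 2 powr n" by (rule D_powr_ge1) simp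
    then show ?thesis unfolding K_def using mult_mono[of 1 "D * 2 powr n" 1 "D * 2 powr n"] by simp
  qed
  have W: "env e2 t x y \<le> K * E g t y x" if t: "0 < t" for t x y
  proof -
    have "env e2 t x y \<le> D * 2 powr n * E g t x y"
      using env_mono_exp[OF t b(4)] env_le_E[OF t] by (rule order.trans)
    also have "\<dots> \<le> D * 2 powr n * (D * 2 powr n * E g t y x)"
      using D1 t b by (intro mult_left_mono E_sym) auto
    finally show ?thesis by (simp add: K_def mult.assoc)
  qed
  have pw: "(d / (t + dist x y)) powr e1 \<le> (d / t) powr (2 * b)" if "0 < t" "0 \<le> d" "d \<le> t / 2" for d t and x y :: 'a
  proof -
    have R: "0 < t + dist x y" using that by (simp add: add_pos_nonneg)
    have "d \<le> t + dist x y" using that zero_le_dist[of x y] by linarith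
    then have "d / (t + dist x y) \<le> 1" using R by simp
    then have "(d / (t + dist x y)) powr e1 \<le> (d / (t + dist x y)) powr (2 * b)"
      using b that R by (intro powr_mono') auto
    also have "\<dots> \<le> (d / t) powr (2 * b)"
      using b that R by (intro powr_mono2 divide_left_mono) (auto simp: add_pos_nonneg)
    finally show ?thesis .
  qed
  have "kernel M D n S g b (C6 * K)"
  proof (unfold_locales)
    show "0 < b" "2 * b \<le> g" "0 < C6 * K" using b C6 K by auto
    fix t :: real assume t: "0 < t"
    show "(\<lambda>(x, y). S t x y) \<in> borel_measurable (M \<Otimes>\<^sub>M M)"
      using S t unfolding cont_AOTI_def L2_kernel_op_def by blast
    show "\<bar>S t z y\<bar> \<le> C6 * K * E g t y z" for z y
    proof -
      have "C6 * env e2 t z y \<le> C6 * (K * E g t y z)" using C6 by (intro mult_left_mono W t) auto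
      then show ?thesis using 1[OF t, of z y] by (simp add: mult.assoc)
    qed
    show "\<bar>S t z y - S t z' y\<bar> \<le> C6 * K * (dist z z' / t) powr (2 * b) * E g t y z" if d: "dist z z' \<le> t / 2" for z z' y
    proof -
      have "dist z z' \<le> (t + dist z y) / 2" using d zero_le_dist[of z y] by argo
      from 2[OF t this] have "\<bar>S t z y - S t z' y\<bar> \<le> C6 * (dist z z' / (t + dist z y)) powr e1 * env e2 t z y" .
      also have "\<dots> \<le> C6 * (dist z z' / t) powr (2 * b) * (K * E g t y z)"
        using C6 t d by (intro mult_mono pw W) auto
      finally show ?thesis by (simp add: mult_ac)
    qed
    show "\<bar>S t z y - S t z y'\<bar> \<le> C6 * K * (dist y y' / t) powr (2 * b) * E g t y z" if d: "dist y y' \<le> t / 2" for z y y'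
    proof -
      have "dist y y' \<le> (t + dist z y) / 2" using d zero_le_dist[of z y] by argo
      from 3[OF t this] have "\<bar>S t z y - S t z y'\<bar> \<le> C6 * (dist y y' / (t + dist z y)) powr e1 * env e2 t z y" .
      also have "\<dots> \<le> C6 * (dist y y' / t) powr (2 * b) * (K * E g t y z)"
        using C6 t d by (intro mult_mono pw W) auto
      finally show ?thesis by (simp add: mult_ac)
    qed
    show "(\<integral>z. S t z y \<partial>M) = 1" for y by (rule 5[OF t])
  qed
  moreover have "G_bound M x t e1 e2 (S t x) (C6 * K)" if t: "0 < t" for t x
    unfolding G_bound_env
  proof (intro conjI allI impI)
    have CK: "C6 \<le> C6 * K" using C6 K1 by simp
    show "\<bar>S t x y\<bar> \<le> C6 * K * env e2 t x y" for y
      using 1[OF t, of x y] mult_right_mono[OF CK env_nonneg[of e2 t x y]] by linarith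
    show "\<bar>S t x y - S t x y'\<bar> \<le> C6 * K * (dist y y' / (t + dist x y)) powr e1 * env e2 t x y" if "dist y y' \<le> (t + dist x y) / 2" for y y'
    proof -
      have "C6 * ((dist y y' / (t + dist x y)) powr e1 * env e2 t x y) \<le> C6 * K * ((dist y y' / (t + dist x y)) powr e1 * env e2 t x y)"
        by (intro mult_right_mono CK) auto
      then show ?thesis using 3[OF t that] by (simp add: mult.assoc)
    qed
  qed
  moreover have "0 < C6 * K" using C6 K by simp
  ultimately show ?thesis by blast
qed

section \<open>A kernel with bounded support\<close>

definition tent :: "real \<Rightarrow> 'a \<Rightarrow> 'a \<Rightarrow> real" where "tent t z y = max 0 (1 - dist z y / t)"
definition tmass :: "real \<Rightarrow> 'a \<Rightarrow> real" where "tmass t y = (\<integral>z. tent t z y \<partial>M)"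
text \<open>Normalised in the first variable, so that the mass condition of \<open>kernel\<close>
  holds exactly. The price is that differences in \<open>y\<close> also involve the normalising
  factor \<open>tmass\<close>.\<close>

definition Q :: "real \<Rightarrow> 'a \<Rightarrow> 'a \<Rightarrow> real" where "Q t z y = tent t z y / tmass t y"

lemma tent_bounds: "0 \<le> tent t z y" "0 < t \<Longrightarrow> tent t z y \<le> 1" "0 < t \<Longrightarrow> t \<le> dist z y \<Longrightarrow> tent t z y = 0"
  by (auto simp: tent_def divide_simps)

lemma tent_lip1: "0 < t \<Longrightarrow> \<bar>tent t z y - tent t z' y\<bar> \<le> dist z z' / t"
proof -
  assume t: "0 < t"
  have "\<bar>dist z y - dist z' y\<bar> \<le> dist z z'"
    using dist_triangle[of z y z'] dist_triangle[of z' y z] by (simp add: dist_commute)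
  then have "\<bar>dist z y / t - dist z' y / t\<bar> \<le> dist z z' / t"
    using t by (simp add: diff_divide_distrib[symmetric] divide_right_mono)
  then show ?thesis unfolding tent_def by linarith
qed

lemma tent_sym: "tent t z y = tent t y z" by (simp add: tent_def dist_commute)

lemma tent_lip2: "0 < t \<Longrightarrow> \<bar>tent t z y - tent t z y'\<bar> \<le> dist y y' / t"
  using tent_lip1[of t y z y'] by (simp add: tent_sym[of t z])

lemma tent_measurable [measurable (raw)]:
  assumes [measurable]: "u \<in> measurable N M" "v \<in> measurable N M"
  shows "(\<lambda>p. tent t (u p) (v p)) \<in> borel_measurable N"
  unfolding tent_def by measurable

lemma indicator_ball_integrable: "integrable M (indicator (ball c s) :: 'a \<Rightarrow> real)"
  by (intro integrable_real_indicator) (auto simp: emeasure_ball)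

lemma tent_integrable: "0 < t \<Longrightarrow> integrable M (\<lambda>z. tent t z y)"
  by (rule Bochner_Integration.integrable_bound[OF indicator_ball_integrable[of y t]])
     (use tent_bounds[of t _ y] in \<open>auto intro!: AE_I2 simp: indicator_def dist_commute not_less\<close>)

definition "Kq0 = 2 * (D * 2 powr n)"
definition "Kq = Kq0 + Kq0 * Kq0 * ((D * 2 powr n) * (D * 2 powr n))"

lemma Kq: "0 < Kq0" "Kq0 \<le> Kq" "0 < Kq" using D1 by (auto simp: Kq0_def Kq_def add_pos_nonneg)

lemma tmass_lower: assumes t: "0 < t" shows "V y t \<le> Kq0 * tmass t y"
proof -
  have "V y (t / 2) / 2 = (\<integral>z. 1 / 2 * indicator (ball y (t / 2)) z \<partial>M)" by (simp add: V_def)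
  also have "\<dots> \<le> tmass t y" unfolding tmass_def
  proof (rule integral_mono)
    show "1 / 2 * indicator (ball y (t / 2)) z \<le> tent t z y" for z
      using t by (auto simp: indicator_def tent_def dist_commute divide_simps)
  qed (use tent_integrable[OF t] indicator_ball_integrable in auto)
  finally have 1: "V y (t / 2) \<le> 2 * tmass t y" by simp
  have "V y t \<le> D * 2 powr n * V y (t / 2)" using t by (intro V_compare) auto
  also have "\<dots> \<le> D * 2 powr n * (2 * tmass t y)" using 1 D1 by (intro mult_left_mono) auto
  finally show ?thesis by (simp add: Kq0_def mult_ac)
qed

lemma tmass_pos: "0 < t \<Longrightarrow> 0 < tmass t y"
  using tmass_lower[of t y] V_pos[of t y] Kq(1) by (metis less_le_trans zero_less_mult_pos)

lemma tmass_inverse: "0 < t \<Longrightarrow> 1 / tmass t y \<le> Kq0 / V y t"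
  using tmass_lower[of t y] tmass_pos[of t y] V_pos[of t y] by (simp add: divide_simps mult.commute)

lemma tmass_lip:
  assumes t: "0 < t" and d: "dist y y' \<le> t / 2"
  shows "\<bar>tmass t y - tmass t y'\<bar> \<le> dist y y' / t * (D * 2 powr n * V y t)"
proof -
  have "tmass t y - tmass t y' = (\<integral>z. tent t z y - tent t z y' \<partial>M)"
    unfolding tmass_def using tent_integrable[OF t] by simp
  also have "\<bar>\<dots>\<bar> \<le> (\<integral>z. dist y y' / t * indicator (ball y (2 * t)) z \<partial>M)"
  proof (rule order.trans[OF integral_abs_bound integral_mono])
    show "integrable M (\<lambda>z. dist y y' / t * indicator (ball y (2 * t)) z)" using indicator_ball_integrable by simp
    show "integrable M (\<lambda>z. \<bar>tent t z y - tent t z y'\<bar>)" using tent_integrable[OF t] by simp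
    show "\<bar>tent t z y - tent t z y'\<bar> \<le> dist y y' / t * indicator (ball y (2 * t)) z" for z
    proof (cases "dist y z < 2 * t")
      case True then show ?thesis using tent_lip2[OF t, of z y y'] by simp
    next
      case False
      then have "t \<le> dist z y" "t \<le> dist z y'"
        using d t dist_triangle[of y z y'] by (auto simp: dist_commute)
      then show ?thesis using tent_bounds(3)[OF t] False by simp
    qed
  qed
  also have "\<dots> = dist y y' / t * V y (2 * t)" by (simp add: V_def)
  also have "\<dots> \<le> dist y y' / t * (D * 2 powr n * V y t)"
    using t by (intro mult_left_mono V_compare) auto
  finally show ?thesis .
qed

lemma Q_size: "0 < t \<Longrightarrow> \<bar>Q t z y\<bar> \<le> Kq / V y t"
proof -
  assume t: "0 < t"
  have "\<bar>Q t z y\<bar> = tent t z y * (1 / tmass t y)" using tent_bounds(1)[of t z y] tmass_pos[OF t, of y] by (simp add: Q_def)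
  also have "\<dots> \<le> 1 * (Kq0 / V y t)" using tent_bounds[of t z y] t tmass_pos[OF t, of y] Kq by (intro mult_mono tmass_inverse) auto
  also have "\<dots> \<le> Kq / V y t" using Kq by (simp add: divide_right_mono)
  finally show ?thesis .
qed

lemma Q_zero: "0 < t \<Longrightarrow> t \<le> dist z y \<Longrightarrow> Q t z y = 0"
  by (simp add: Q_def tent_bounds)

lemma Q_lip1: "0 < t \<Longrightarrow> \<bar>Q t z y - Q t z' y\<bar> \<le> Kq * (dist z z' / t) / V y t"
proof -
  assume t: "0 < t"
  have "\<bar>Q t z y - Q t z' y\<bar> = \<bar>tent t z y - tent t z' y\<bar> * (1 / tmass t y)"
    using tmass_pos[OF t, of y] by (simp add: Q_def diff_divide_distrib[symmetric] abs_div)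
  also have "\<dots> \<le> dist z z' / t * (Kq0 / V y t)"
    using t tmass_pos[OF t, of y] by (intro mult_mono tent_lip1 tmass_inverse) auto
  also have "\<dots> = Kq0 * (dist z z' / t) / V y t" by simp
  also have "\<dots> \<le> Kq * (dist z z' / t) / V y t" using Kq t by (intro divide_right_mono mult_right_mono) auto
  finally show ?thesis .
qed

text \<open>Quotient rule. \<open>tmass\<close> is Lipschitz with constant of order
  \<open>V y t / t\<close>, since moving \<open>y\<close> by at most \<open>t / 2\<close> changes
  \<open>tent\<close> only within distance \<open>2 * t\<close> of \<open>y\<close>.\<close>

lemma Q_lip2:
  assumes t: "0 < t" and d: "dist y y' \<le> t / 2"
  shows "\<bar>Q t z y - Q t z y'\<bar> \<le> Kq * (dist y y' / t) / V y t"
proof -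
  let ?N = "tmass t y" and ?N' = "tmass t y'" and ?h = "tent t z y" and ?h' = "tent t z y'" and ?d = "dist y y' / t"
  define k where "k = D * 2 powr n"
  have k: "0 < k" using D1 by (simp add: k_def)
  have N: "0 < ?N" "0 < ?N'" using tmass_pos[OF t] by auto
  have Vp: "0 < V y t" "0 < V y' t" using t V_pos by auto
  have d0: "0 \<le> ?d" using t by simp
  have V': "V y t \<le> k * V y' t" unfolding k_def using t d by (intro V_compare) auto
  have i': "1 / ?N' \<le> Kq0 * k / V y t"
  proof -
    have "1 / ?N' \<le> Kq0 / V y' t" by (rule tmass_inverse[OF t])
    also have "\<dots> \<le> Kq0 * k / V y t" using V' Vp Kq(1) by (simp add: divide_simps mult_ac)
    finally show ?thesis .
  qed
  have "Q t z y - Q t z y' = (?h - ?h') / ?N + ?h' * (?N' - ?N) / (?N * ?N')"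
    using N by (simp add: Q_def field_simps)
  then have "\<bar>Q t z y - Q t z y'\<bar> \<le> \<bar>(?h - ?h') / ?N\<bar> + \<bar>?h' * (?N' - ?N) / (?N * ?N')\<bar>" by (simp only: abs_triangle_ineq)
  also have "\<bar>(?h - ?h') / ?N\<bar> = \<bar>?h - ?h'\<bar> * (1 / ?N)" using N by (simp add: abs_div)
  also have "\<bar>?h' * (?N' - ?N) / (?N * ?N')\<bar> = ?h' * \<bar>?N - ?N'\<bar> * (1 / ?N) * (1 / ?N')"
    using N tent_bounds(1)[of t z y'] by (simp add: abs_mult abs_div abs_minus_commute)
  also have "\<bar>?h - ?h'\<bar> * (1 / ?N) + ?h' * \<bar>?N - ?N'\<bar> * (1 / ?N) * (1 / ?N') \<le>
      ?d * (Kq0 / V y t) + 1 * (?d * (k * V y t)) * (Kq0 / V y t) * (Kq0 * k / V y t)"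
    unfolding k_def using D1 t N Kq(1) k Vp tent_bounds(1)[of t z y'] tmass_lip[OF t d] i'
    by (intro add_mono mult_mono tent_lip2 tmass_inverse tent_bounds) (auto simp: k_def)
  also have "\<dots> = Kq * ?d / V y t"
    using Vp t by (simp add: Kq_def k_def[symmetric] field_simps)
  finally show ?thesis .
qed

lemma tmass_measurable [measurable]: "tmass t \<in> borel_measurable M"
proof -
  interpret sigma_finite_measure M by (rule sigma_finite_M)
  show ?thesis unfolding tmass_def
    by (rule borel_measurable_lebesgue_integral) (simp add: case_prod_beta', measurable)
qed

lemma kernel_Q:
  assumes b: "0 < b" "2 * b \<le> g" "2 * b \<le> 1"
  shows "kernel M D n Q g b (Kq * (3 powr g * (D * 3 powr n)))"
proof unfold_locales
  define k where "k = 3 powr g * (D * 3 powr n)"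
  have k: "0 < k" using D1 by (simp add: k_def)
  have low: "1 / V y t \<le> k * E g t y z" if t: "0 < t" and d: "dist y z \<le> 2 * t" for t y z
  proof -
    have R: "0 < t + dist y z" "t + dist y z \<le> 3 * t" using t d by (auto simp: add_pos_nonneg)
    have "V y (t + dist y z) \<le> D * 3 powr n * V y t" using t R by (intro V_compare) auto
    then have 1: "1 / V y t \<le> D * 3 powr n / V y (t + dist y z)"
      using V_pos[OF t, of y] V_pos[OF R(1), of y] by (simp add: divide_simps mult.commute)
    have "(1 / 3) powr g \<le> (t / (t + dist y z)) powr g"
      using R t b by (intro powr_mono2) (auto simp: divide_simps)
    then have "3 powr g * (1 / 3) powr g \<le> 3 powr g * (t / (t + dist y z)) powr g" by (intro mult_left_mono) auto
    moreover have "3 powr g * (1 / 3) powr g = (1 :: real)" using powr_mult[of 3 "1/3" g] by simp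
    ultimately have 2: "1 \<le> 3 powr g * (t / (t + dist y z)) powr g" by argo
    have "1 * (1 / V y t) \<le> (3 powr g * (t / (t + dist y z)) powr g) * (D * 3 powr n / V y (t + dist y z))"
      by (intro mult_mono 1 2) auto
    then show ?thesis by (simp add: E_def k_def mult_ac)
  qed
  show "0 < b" "2 * b \<le> g" using b by auto
  show "0 < Kq * (3 powr g * (D * 3 powr n))" using Kq(3) k by (simp add: k_def)
  fix t :: real assume t: "0 < t"
  have pw: "d / t \<le> (d / t) powr (2 * b)" if "0 \<le> d" "d \<le> t / 2" for d
    using powr_mono'[of "2 * b" 1 "d / t"] that t b by (simp add: divide_simps)
  show "(\<lambda>(x, y). Q t x y) \<in> borel_measurable (M \<Otimes>\<^sub>M M)" unfolding Q_def case_prod_beta' by measurable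
  \<comment> \<open>All the differences vanish when \<open>dist y z\<close> exceeds
    \<open>2 * t\<close>, and up to that distance \<open>1 / V y t\<close> is comparable with the
    envelope.\<close>
  have bd: "\<bar>X\<bar> \<le> Kq * (3 powr g * (D * 3 powr n)) * c * E g t y z"
    if "\<bar>X\<bar> \<le> Kq * c / V y t" "0 \<le> c" "2 * t < dist y z \<Longrightarrow> X = 0" for X c y z
  proof (cases "2 * t < dist y z")
    case True then show ?thesis using that Kq(3) k by (simp add: k_def[symmetric])
  next
    case False
    then have "1 / V y t \<le> k * E g t y z" using t by (intro low) auto
    then have "Kq * c * (1 / V y t) \<le> Kq * c * (k * E g t y z)" using that Kq(3) by (intro mult_left_mono) auto
    then show ?thesis using that(1) by (simp add: k_def mult_ac)
  qed
  show "\<bar>Q t z y\<bar> \<le> Kq * (3 powr g * (D * 3 powr n)) * E g t y z" for z y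
    using bd[of "Q t z y" 1 y z] Q_size[OF t, of z y] Q_zero[OF t, of z y] t by (simp add: dist_commute)
  show "\<bar>Q t z y - Q t z' y\<bar> \<le> Kq * (3 powr g * (D * 3 powr n)) * (dist z z' / t) powr (2 * b) * E g t y z"
    if d: "dist z z' \<le> t / 2" for z z' y
  proof (rule bd)
    have "Kq * (dist z z' / t) / V y t \<le> Kq * (dist z z' / t) powr (2 * b) / V y t"
      using Kq(3) d by (intro divide_right_mono mult_left_mono pw) auto
    then show "\<bar>Q t z y - Q t z' y\<bar> \<le> Kq * (dist z z' / t) powr (2 * b) / V y t" using Q_lip1[OF t, of z y z'] by linarith
    assume "2 * t < dist y z"
    then have "t \<le> dist z y" "t \<le> dist z' y" using d t dist_triangle[of y z z'] by (auto simp: dist_commute)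
    then show "Q t z y - Q t z' y = 0" using Q_zero[OF t] by simp
  qed simp
  show "\<bar>Q t z y - Q t z y'\<bar> \<le> Kq * (3 powr g * (D * 3 powr n)) * (dist y y' / t) powr (2 * b) * E g t y z"
    if d: "dist y y' \<le> t / 2" for z y y'
  proof (rule bd)
    have "Kq * (dist y y' / t) / V y t \<le> Kq * (dist y y' / t) powr (2 * b) / V y t"
      using Kq(3) d by (intro divide_right_mono mult_left_mono pw) auto
    then show "\<bar>Q t z y - Q t z y'\<bar> \<le> Kq * (dist y y' / t) powr (2 * b) / V y t" using Q_lip2[OF t d, of z] by linarith
    assume "2 * t < dist y z"
    then have "t \<le> dist z y" "t \<le> dist z y'" using d t dist_triangle[of y z y'] by (auto simp: dist_commute)
    then show "Q t z y - Q t z y' = 0" using Q_zero[OF t] by simp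
  qed simp
  show "(\<integral>z. Q t z y \<partial>M) = 1" for y
    using tmass_pos[OF t, of y] by (simp add: Q_def tmass_def)
qed

definition CQ :: "real \<Rightarrow> real" where
  "CQ \<gamma> = 2 * (D * 6 powr n) * 4 powr \<gamma> * (8 * Kq * (1 + D * 3 powr n))"

lemma CQ_pos: "0 < CQ \<gamma>" unfolding CQ_def using D1 Kq(3) by (simp add: add_pos_nonneg)

lemma Q_G_bound:
  assumes t: "0 < t" and \<beta>: "0 < \<beta>" "\<beta> \<le> 1" and \<gamma>: "0 < \<gamma>"
  shows "G_bound M z t \<beta> \<gamma> (Q t z) (CQ \<gamma>)"
proof -
  define k where "k = 2 * (D * 6 powr n) * 4 powr \<gamma>"
  define m where "m = D * 3 powr n"
  have k: "0 < k" and m: "0 < m" using D1 by (auto simp: k_def m_def)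
  have CQ: "CQ \<gamma> = k * (8 * Kq * (1 + m))" by (simp add: CQ_def k_def m_def)
  have low: "1 / V y t \<le> k * env \<gamma> t z y" if d: "dist z y \<le> 3 * t" for y
  proof -
    let ?d = "dist z y"
    have R: "0 < t + ?d" "t + ?d \<le> 4 * t" using t d by (auto simp: add_pos_nonneg)
    have "V z t + V z ?d \<le> V z (3 * t) + V z (3 * t)" using d t by (intro add_mono V_mono) auto
    also have "\<dots> \<le> 2 * (D * 6 powr n * V y t)" using V_compare[OF t, of 6 z y "3 * t"] d by simp
    finally have a: "V z t + V z ?d \<le> 2 * (D * 6 powr n) * V y t" by simp
    have "0 < V z t + V z ?d" using V_pos[OF t, of z] by (simp add: add_pos_nonneg)
    then have 1: "1 / V y t \<le> 2 * (D * 6 powr n) / (V z t + V z ?d)"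
      using a V_pos[OF t, of y] by (simp add: divide_simps mult.commute)
    have "(1 / 4) powr \<gamma> \<le> (t / (t + ?d)) powr \<gamma>"
      using R t \<gamma> by (intro powr_mono2) (auto simp: divide_simps)
    then have "4 powr \<gamma> * (1 / 4) powr \<gamma> \<le> 4 powr \<gamma> * (t / (t + ?d)) powr \<gamma>" by (intro mult_left_mono) auto
    moreover have "4 powr \<gamma> * (1 / 4) powr \<gamma> = (1 :: real)" using powr_mult[of 4 "1/4" \<gamma>] by simp
    ultimately have 2: "1 \<le> 4 powr \<gamma> * (t / (t + ?d)) powr \<gamma>" by argo
    have "1 / V y t * 1 \<le> (2 * (D * 6 powr n) / (V z t + V z ?d)) * (4 powr \<gamma> * (t / (t + ?d)) powr \<gamma>)"
      using D1 by (intro mult_mono 1 2) auto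
    then show ?thesis by (simp add: env_def k_def Vr_V Vxy_V mult_ac)
  qed
  have K0: "0 \<le> CQ \<gamma>" using CQ_pos[of \<gamma>] by simp
  have bd: "\<bar>X\<bar> \<le> CQ \<gamma> * c * env \<gamma> t z y" if X: "\<bar>X\<bar> \<le> 8 * Kq * (1 + m) * c / V y t" and c: "0 \<le> c" and far: "3 * t < dist z y \<Longrightarrow> X = 0" for X c y
  proof (cases "3 * t < dist z y")
    case True then show ?thesis using far c K0 by simp
  next
    case False
    have "0 \<le> 8 * Kq * (1 + m) * c" using c Kq(3) m by simp
    then have "8 * Kq * (1 + m) * c * (1 / V y t) \<le> 8 * Kq * (1 + m) * c * (k * env \<gamma> t z y)"
      using False by (intro mult_left_mono low) auto
    then show ?thesis using X unfolding CQ by (simp add: mult_ac)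
  qed
  have big: "Kq \<le> 8 * Kq * (1 + m)"
  proof -
    have "Kq * 1 \<le> Kq * (8 * (1 + m))" using Kq(3) m by (intro mult_left_mono) auto
    moreover have "Kq * (8 * (1 + m)) = 8 * Kq * (1 + m)" by (simp only: mult_ac)
    ultimately show ?thesis by (simp only: mult_1_right)
  qed
  show ?thesis unfolding G_bound_env
  proof (intro conjI allI impI)
    fix y
    have "Kq / V y t \<le> 8 * Kq * (1 + m) * 1 / V y t" using big by (intro divide_right_mono) auto
    then show "\<bar>Q t z y\<bar> \<le> CQ \<gamma> * env \<gamma> t z y"
      using bd[of "Q t z y" 1 y] Q_size[OF t, of z y] Q_zero[OF t, of z y] t by simp
    fix y' assume d: "dist y y' \<le> (t + dist z y) / 2"
    let ?x = "dist y y' / (t + dist z y)"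
    have R: "0 < t + dist z y" using t by (simp add: add_pos_nonneg)
    have x: "0 \<le> ?x" "?x \<le> 1" using d R by (auto simp: divide_simps)
    have xb: "?x \<le> ?x powr \<beta>" using powr_mono'[of \<beta> 1 ?x] x \<beta> by (simp add: abs_of_pos[OF R])
    show "\<bar>Q t z y - Q t z y'\<bar> \<le> CQ \<gamma> * ?x powr \<beta> * env \<gamma> t z y"
    proof (rule bd)
      assume "3 * t < dist z y"
      then have "t \<le> dist z y" "t \<le> dist z y'" using d t dist_triangle[of z y y'] by (auto simp: dist_commute)
      then show "Q t z y - Q t z y' = 0" using Q_zero[OF t] by simp
    next
      show "\<bar>Q t z y - Q t z y'\<bar> \<le> 8 * Kq * (1 + m) * ?x powr \<beta> / V y t"
      proof (cases "3 * t < dist z y")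
        case True
        then have "t \<le> dist z y" "t \<le> dist z y'" using d t dist_triangle[of z y y'] by (auto simp: dist_commute)
        then show ?thesis using Q_zero[OF t] Kq(3) m by simp
      next
        case near: False
        show ?thesis
        proof (cases "dist y y' \<le> t / 2")
          case True
          have "dist y y' * (t + dist z y) \<le> dist y y' * (4 * t)" using near by (intro mult_left_mono) auto
          then have "dist y y' / t \<le> 4 * ?x" using t R by (simp add: divide_simps mult_ac)
          then have "Kq * (dist y y' / t) \<le> Kq * (4 * ?x powr \<beta>)" using xb Kq(3) by (intro mult_left_mono) auto
          also have "\<dots> \<le> Kq * ((8 * (1 + m)) * ?x powr \<beta>)" using Kq(3) m by (intro mult_left_mono mult_right_mono) auto
          finally have "Kq * (dist y y' / t) / V y t \<le> Kq * ((8 * (1 + m)) * ?x powr \<beta>) / V y t" by (intro divide_right_mono) auto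
          moreover have "Kq * ((8 * (1 + m)) * ?x powr \<beta>) = 8 * Kq * (1 + m) * ?x powr \<beta>" by (simp only: mult_ac)
          ultimately show ?thesis using Q_lip2[OF t True, of z] by argo
        next
          case False
          have "1 / 8 \<le> ?x" using False near R by (simp add: divide_simps)
          then have x8: "1 \<le> 8 * ?x powr \<beta>" using xb by argo
          have "V y t \<le> m * V y' t" unfolding m_def using d near t by (intro V_compare) auto
          then have "1 / V y' t \<le> m / V y t" using V_pos[OF t, of y] V_pos[OF t, of y'] by (simp add: divide_simps mult.commute)
          then have "Kq * (1 / V y' t) \<le> Kq * (m / V y t)" using Kq(3) by (intro mult_left_mono) auto
          then have "\<bar>Q t z y - Q t z y'\<bar> \<le> Kq * (1 + m) / V y t * 1"
            using Q_size[OF t, of z y] Q_size[OF t, of z y'] by (simp add: distrib_left add_divide_distrib)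
          also have "\<dots> \<le> Kq * (1 + m) / V y t * (8 * ?x powr \<beta>)"
            using Kq(3) m by (intro mult_left_mono x8) auto
          also have "\<dots> = 8 * Kq * (1 + m) * ?x powr \<beta> / V y t" by (simp only: mult_ac times_divide_eq_left times_divide_eq_right)
          finally show ?thesis .
        qed
      qed
    qed simp
  qed
qed

text \<open>Let each \<open>w j\<close> contribute the value \<open>\<rho> (w j)\<close> on its own
  ball of radius \<open>\<rho> (w j)\<close>, and 0 elsewhere. The supremum is a countable one of
  measurable functions. Admissibility makes \<open>\<rho>\<close> comparable with
  \<open>\<rho> (w j)\<close> on that ball, and every \<open>x\<close> lies in the ball of some
  nearby \<open>w j\<close>; dividing by \<open>KA\<close> puts the result below
  \<open>\<rho>\<close>.\<close>

lemma admissible_minorant: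
  assumes "admissible \<rho>"
  shows "\<exists>\<sigma> a Ca Kr. admissible_pair M D n \<rho> \<sigma> a Ca Kr"
proof -
  from assms obtain C3 k0 where pos: "\<forall>x. 0 < \<rho> x" and k0: "0 < C3" "0 < k0"
    and adm0: "\<forall>x y. \<rho> y \<le> C3 * (\<rho> x) powr (1 / (1 + k0)) * (\<rho> x + dist x y) powr (k0 / (1 + k0))"
    unfolding admissible_def by (elim conjE exE)
  define a where "a = 1 / (1 + k0)"
  have a: "0 < a" "a < 1" "1 - a = k0 / (1 + k0)" using k0 by (auto simp: a_def field_simps)
  define Ca where "Ca = max 1 C3"
  have Ca: "1 \<le> Ca" by (simp add: Ca_def)
  have p: "0 < \<rho> x" for x using pos by simp
  have adm: "\<rho> y \<le> Ca * \<rho> x powr a * (\<rho> x + dist x y) powr (1 - a)" for x y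
  proof -
    have "\<rho> y \<le> C3 * (\<rho> x powr a * (\<rho> x + dist x y) powr (1 - a))"
      using adm0[rule_format, of y x] unfolding a(3) a_def[symmetric] by (simp add: mult.assoc)
    also have "\<dots> \<le> Ca * (\<rho> x powr a * (\<rho> x + dist x y) powr (1 - a))"
      by (intro mult_right_mono) (auto simp: Ca_def)
    finally show ?thesis by (simp add: mult.assoc)
  qed
  define KA where "KA = (2 * Ca) powr (1 / a)"
  have KA: "1 \<le> KA" unfolding KA_def using a Ca by (intro ge_one_powr_ge_zero) auto
  have near: "\<rho> x \<le> KA * \<rho> y" if d: "dist x y \<le> \<rho> x" for x y
  proof (cases "\<rho> x \<le> \<rho> y")
    case True
    then show ?thesis using p[of y] mult_right_mono[OF KA, of "\<rho> y"] by linarith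
  next
    case False
    have "\<rho> x \<le> Ca * \<rho> y powr a * (\<rho> y + dist x y) powr (1 - a)" using adm[of x y] by (simp add: dist_commute)
    also have "\<dots> \<le> Ca * \<rho> y powr a * (2 * \<rho> x) powr (1 - a)"
      using False d Ca a p[of x] p[of y] by (intro mult_left_mono powr_mono2) auto
    also have "\<dots> \<le> Ca * \<rho> y powr a * (2 * \<rho> x powr (1 - a))"
    proof (intro mult_left_mono)
      have "(2::real) powr (1 - a) \<le> 2 powr 1" using a by (intro powr_mono) auto
      then show "(2 * \<rho> x) powr (1 - a) \<le> 2 * \<rho> x powr (1 - a)" by (simp add: powr_mult mult_right_mono)
    qed (use Ca in auto)
    finally have "\<rho> x * \<rho> x powr (a - 1) \<le> (Ca * \<rho> y powr a * (2 * \<rho> x powr (1 - a))) * \<rho> x powr (a - 1)"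
      by (intro mult_right_mono) auto
    moreover have "\<rho> x * \<rho> x powr (a - 1) = \<rho> x powr a" using p[of x] by (simp add: powr_diff)
    moreover have "\<rho> x powr (1 - a) * \<rho> x powr (a - 1) = 1" using p[of x] by (simp add: powr_add[symmetric])
    ultimately have "\<rho> x powr a \<le> 2 * Ca * \<rho> y powr a" by (simp add: mult.assoc mult.left_commute)
    then have "(\<rho> x powr a) powr (1 / a) \<le> (2 * Ca * \<rho> y powr a) powr (1 / a)"
      using a by (rule_tac powr_mono2) auto
    then show ?thesis using a p[of x] p[of y] by (simp add: KA_def powr_mult powr_powr)
  qed
  have far: "\<rho> y \<le> 2 * Ca * \<rho> x" if d: "dist x y \<le> \<rho> x" for x y
  proof -
    have "\<rho> y \<le> Ca * (\<rho> x powr a * (\<rho> x + dist x y) powr (1 - a))" using adm[of y x] by (simp add: mult.assoc)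
    also have "\<dots> \<le> Ca * ((2 * \<rho> x) powr a * (2 * \<rho> x) powr (1 - a))"
      using d Ca a p[of x] by (intro mult_left_mono mult_mono powr_mono2) auto
    also have "(2 * \<rho> x) powr a * (2 * \<rho> x) powr (1 - a) = 2 * \<rho> x" using p[of x] by (simp add: powr_add[symmetric])
    finally show ?thesis by (simp add: mult_ac)
  qed
  define F where "F j x = (if dist x (w j) < \<rho> (w j) then \<rho> (w j) else 0)" for j x
  define s where "s x = (SUP j. F j x)" for x
  have Fle: "F j x \<le> KA * \<rho> x" for j x
  proof (cases "dist x (w j) < \<rho> (w j)")
    case True then show ?thesis using near[of "w j" x] by (simp add: F_def dist_commute)
  next
    case False then show ?thesis using KA p[of x] by (simp add: F_def)
  qed
  have bdd: "bdd_above (range (\<lambda>j. F j x))" for x by (rule bdd_aboveI[of _ "KA * \<rho> x"]) (use Fle in auto)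
  have s_le: "s x \<le> KA * \<rho> x" for x unfolding s_def by (intro cSUP_least Fle) simp
  have s_ge: "\<rho> x \<le> KA * s x" for x
  proof -
    have "0 < \<rho> x / KA" using p[of x] KA by simp
    \<comment> \<open>At distance below \<open>\<rho> x / KA\<close> the comparison
      \<open>near\<close> gives \<open>\<rho> x / KA \<le> \<rho> (w j)\<close>, so that
      \<open>x\<close> falls into the ball of \<open>w j\<close>.\<close>
    from w_dense[OF this, of x] obtain j where j: "dist x (w j) < \<rho> x / KA" by (elim exE)
    have "\<rho> x / KA \<le> \<rho> x" using p[of x] KA by (simp add: divide_le_eq mult_le_cancel_left1)
    then have 1: "\<rho> x \<le> KA * \<rho> (w j)" using j by (intro near) simp
    then have "\<rho> x / KA \<le> \<rho> (w j)" using KA by (simp add: divide_le_eq mult.commute)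
    then have "F j x = \<rho> (w j)" using j by (simp add: F_def)
    moreover have "F j x \<le> s x" unfolding s_def by (intro cSUP_upper bdd) simp
    ultimately have "KA * \<rho> (w j) \<le> KA * s x" using KA by (intro mult_left_mono) auto
    then show ?thesis using 1 by simp
  qed
  have [measurable]: "s \<in> borel_measurable M"
    unfolding s_def
  proof (intro borel_measurable_cSUP)
    fix j
    have "{x \<in> space M. dist x (w j) < \<rho> (w j)} \<in> sets M" by measurable
    then show "F j \<in> borel_measurable M" unfolding F_def by measurable
  qed (use bdd in auto)
  define \<sigma> where "\<sigma> x = s x / KA" for x
  have "admissible_pair M D n \<rho> \<sigma> a Ca (KA * KA)"
  proof unfold_locales
    show "0 < a" "a < 1" "1 \<le> Ca" using a Ca by auto
    show "1 \<le> KA * KA" using KA mult_mono[of 1 KA 1 KA] by simp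
    show "\<sigma> \<in> borel_measurable M" unfolding \<sigma>_def by measurable
    fix x y
    have "0 < KA * s x" using p[of x] s_ge[of x] by linarith
    then show "0 < \<sigma> x" using KA by (simp add: \<sigma>_def zero_less_mult_iff)
    show "\<sigma> x \<le> \<rho> x" using s_le[of x] KA by (simp add: \<sigma>_def divide_le_eq mult.commute)
    show "\<rho> x \<le> KA * KA * \<sigma> x" using s_ge[of x] KA by (simp add: \<sigma>_def)
    show "\<rho> y \<le> Ca * \<rho> x powr a * (\<rho> x + dist x y) powr (1 - a)" by (rule adm)
  qed
  then show ?thesis by blast
qed

end

context admissible_pair
begin

text \<open>Where \<open>\<sigma> y < 1\<close>, admissibility read from \<open>y\<close> gives
  \<open>\<sigma> x \<le> Ca * Kr * (1 + R) * \<sigma> y powr a\<close>, so \<open>\<sigma>\<close>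
  cannot degenerate on bounded sets. Hence one small radius lies below \<open>\<sigma>\<close> on a
  whole ball.\<close>

lemma \<sigma>_lower:
  assumes R: "0 \<le> R" shows "\<exists>c>0. \<forall>y. dist x y \<le> R \<longrightarrow> c \<le> \<sigma> y"
proof -
  define m where "m = min 1 ((\<sigma> x / (Ca * Kr * (1 + R))) powr (1 / a))"
  have den: "0 < Ca * Kr * (1 + R)" using Ca Kr R by simp
  have q: "0 < \<sigma> x / (Ca * Kr * (1 + R))" using den \<sigma>_pos[of x] by simp
  have m: "0 < m" "m \<le> 1" using q by (auto simp: m_def)
  have "m \<le> \<sigma> y" if d: "dist x y \<le> R" for y
  proof (rule ccontr)
    assume "\<not> m \<le> \<sigma> y"
    then have lt: "\<sigma> y < m" by simp
    have "\<sigma> x \<le> Ca * Kr * (\<sigma> y powr a * (\<sigma> y + dist x y) powr (1 - a))"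
      using \<sigma>_adm[of 1 x y] by (simp add: dist_commute mult.assoc)
    also have "\<dots> \<le> Ca * Kr * (\<sigma> y powr a * (1 + R) powr 1)"
    proof (intro mult_left_mono)
      have "(\<sigma> y + dist x y) powr (1 - a) \<le> (1 + R) powr (1 - a)"
        using a lt m d \<sigma>_pos[of y] by (intro powr_mono2) (auto intro: add_nonneg_nonneg)
      also have "\<dots> \<le> (1 + R) powr 1" using a R by (intro powr_mono) auto
      finally show "(\<sigma> y + dist x y) powr (1 - a) \<le> (1 + R) powr 1" .
    qed (use Ca Kr in auto)
    finally have "\<sigma> x \<le> Ca * Kr * (1 + R) * \<sigma> y powr a" using R by (simp add: mult_ac)
    then have "\<sigma> x / (Ca * Kr * (1 + R)) \<le> \<sigma> y powr a" using den by (simp add: divide_le_eq mult.commute)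
    then have "(\<sigma> x / (Ca * Kr * (1 + R))) powr (1 / a) \<le> (\<sigma> y powr a) powr (1 / a)"
      using q a by (rule_tac powr_mono2) auto
    then have "m \<le> \<sigma> y" using a \<sigma>_pos[of y] by (simp add: powr_powr m_def)
    then show False using lt by simp
  qed
  then show ?thesis using m by blast
qed

end

locale kernel_regular = kernel_admissible M D n P g b C \<rho> \<sigma> a Ca Kr + regular_doubling M D n
  for M :: "'a::metric_space measure" and D n P g b C \<rho> \<sigma> a Ca Kr +
  assumes b1: "b \<le> 1"
begin

text \<open>Duality: the pairing of \<open>f\<close> with a bump is the limit of the pairings of the
  bump with \<open>kop M (P t) f\<close>, and these see only a ball and arbitrarily small
  \<open>t\<close>.\<close>

lemma L1_le:
  assumes f: "integrable M f"
    and lim: "\<And>R t0 e. 0 < R \<Longrightarrow> 0 < t0 \<Longrightarrow> 0 < e \<Longrightarrow>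
      \<exists>t. 0 < t \<and> t < t0 \<and> (\<integral>\<^sup>+z. ennreal \<bar>kop M (P t) f z\<bar> * indicator (ball x R) z \<partial>M) \<le> W + ennreal e"
  shows "(\<integral>\<^sup>+y. ennreal \<bar>f y\<bar> \<partial>M) \<le> W"
proof (rule L1_norm_by_bumps[OF f])
  fix \<phi> assume bp: "bump x 1 \<phi>" and le1: "\<And>y. \<bar>\<phi> y\<bar> \<le> 1"
  have [measurable]: "f \<in> borel_measurable M" using f by auto
  from bp obtain R where R: "0 < R" "\<forall>y. R \<le> dist x y \<longrightarrow> \<phi> y = 0" unfolding bump_def by (elim exE conjE)
  from bump_cls[OF bp b1] obtain A where A: "0 \<le> A" and \<phi>: "cls x 1 A A \<phi>" by (elim exE conjE)
  have [measurable]: "\<phi> \<in> borel_measurable M" using \<phi> unfolding cls_def by (rule conjunct1)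
  define c where "c = 2 * KK * A * ((\<integral>y. \<bar>f y\<bar> \<partial>M) / V x 1)"
  have c: "0 \<le> c" unfolding c_def using consts_pos(5) A by (intro mult_nonneg_nonneg divide_nonneg_nonneg) auto
  show "ennreal (\<integral>y. f y * \<phi> y \<partial>M) \<le> W"
  proof (rule ennreal_le_epsilon)
    fix e :: real assume e: "0 < e"
    \<comment> \<open>Chosen so that \<open>t powr b \<le> v\<close> makes the error of the
      approximate identity at most \<open>e / 2\<close>; the summand 1 covers the case
      \<open>c = 0\<close>.\<close>
    define v where "v = e / 2 / (1 + c)"
    have "1 + c \<noteq> 0" using c by simp
    from nonzero_eq_divide_eq[THEN iffD1, OF this v_def] have v: "(1 + c) * v = e / 2" "0 < v"
      using e c by (auto simp: v_def mult.commute)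
    define t0 where "t0 = min (1/2) (v powr (1 / b))"
    have t0: "0 < t0" using v by (simp add: t0_def)
    have e2: "0 < e / 2" using e by simp
    from lim[OF R(1) t0 e2] obtain t where t: "0 < t" "t < t0"
      and T: "(\<integral>\<^sup>+z. ennreal \<bar>kop M (P t) f z\<bar> * indicator (ball x R) z \<partial>M) \<le> W + ennreal (e / 2)" by (elim exE conjE)
    have t2: "t \<le> 1/2" using t by (simp add: t0_def)
    have "t powr b \<le> (v powr (1 / b)) powr b" using t b by (intro powr_mono2) (auto simp: t0_def)
    also have "\<dots> = v" using v b by (simp add: powr_powr)
    finally have tb: "t powr b \<le> v" .
    have "c * t powr b \<le> (1 + c) * v" using tb c v by (intro mult_mono) auto
    then have ct: "c * t powr b \<le> e / 2" unfolding v(1) .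
    have [measurable]: "kop M (P t) f \<in> borel_measurable M" using t by (intro kop_measurable) auto
    have int: "integrable M (\<lambda>z. \<phi> z * kop M (P t) f z)"
    proof -
      have t1: "t \<le> 1" and t00: "0 \<le> t" using t2 t by auto
      have z: "dist z z \<le> t * t" for z :: 'a using t by simp
      have id: "(\<lambda>z. z) \<in> measurable M M" by simp
      show ?thesis using smear_pairing(2)[OF t(1) t1 t00 t2 id z \<phi> f] .
    qed
    have "(\<integral>y. f y * \<phi> y \<partial>M) \<le> \<bar>\<integral>z. \<phi> z * kop M (P t) f z \<partial>M\<bar> + e / 2"
      using approximate_identity[OF \<phi> A f t(1) t2] ct unfolding c_def[symmetric] by linarith
    then have "ennreal (\<integral>y. f y * \<phi> y \<partial>M) \<le> ennreal (\<bar>\<integral>z. \<phi> z * kop M (P t) f z \<partial>M\<bar> + e / 2)" by (rule ennreal_leI)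
    also have "\<dots> = ennreal \<bar>\<integral>z. \<phi> z * kop M (P t) f z \<partial>M\<bar> + ennreal (e / 2)" using e by (intro ennreal_plus) auto
    also have "ennreal \<bar>\<integral>z. \<phi> z * kop M (P t) f z \<partial>M\<bar> \<le> (\<integral>\<^sup>+z. ennreal (norm (\<phi> z * kop M (P t) f z)) \<partial>M)"
      using integral_norm_bound_ennreal[OF int] by simp
    also have "\<dots> \<le> (\<integral>\<^sup>+z. ennreal \<bar>kop M (P t) f z\<bar> * indicator (ball x R) z \<partial>M)"
    proof (intro nn_integral_mono)
      fix z
      show "ennreal (norm (\<phi> z * kop M (P t) f z)) \<le> ennreal \<bar>kop M (P t) f z\<bar> * indicator (ball x R) z"
      proof (cases "dist x z < R")
        case True
        have "\<bar>\<phi> z\<bar> * \<bar>kop M (P t) f z\<bar> \<le> 1 * \<bar>kop M (P t) f z\<bar>" by (intro mult_right_mono le1) auto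
        then show ?thesis using True by (simp add: abs_mult ennreal_leI)
      next
        case False then show ?thesis using R(2) by simp
      qed
    qed
    also note T
    finally have "ennreal (\<integral>y. f y * \<phi> y \<partial>M) \<le> W + ennreal (e / 2) + ennreal (e / 2)" by (simp add: add_right_mono)
    also have "\<dots> = W + ennreal e" using e by (simp add: add.assoc ennreal_plus[symmetric] del: ennreal_plus)
    finally show "ennreal (\<integral>y. f y * \<phi> y \<partial>M) \<le> W + ennreal e" .
  qed
qed

text \<open>The maximal operator of a family of kernels along the countable set of radii \<open>\<delta> powr m\<close>;
  unlike the supremum over all radii it is measurable.\<close>
definition dmax :: "(real \<Rightarrow> 'a \<Rightarrow> 'a \<Rightarrow> real) \<Rightarrow> ('a \<Rightarrow> real) \<Rightarrow> 'a \<Rightarrow> ennreal" where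
  "dmax T f z = (SUP m::int. ennreal (if \<delta> powr m < \<sigma> z then \<bar>kop M (T (\<delta> powr m)) f z\<bar> else 0))"

lemma dmax_upper: "\<delta> powr real_of_int m < \<sigma> z \<Longrightarrow> ennreal \<bar>kop M (T (\<delta> powr m)) f z\<bar> \<le> dmax T f z"
  unfolding dmax_def by (intro SUP_upper2[where i = m]) auto

lemma dmax_measurable [measurable]:
  assumes "\<And>t. 0 < t \<Longrightarrow> kop M (T t) f \<in> borel_measurable M"
  shows "dmax T f \<in> borel_measurable M"
proof -
  have [measurable]: "kop M (T (\<delta> powr real_of_int m)) f \<in> borel_measurable M" for m
    using \<delta>(1) by (intro assms) simp
  show ?thesis unfolding dmax_def by measurable
qed

lemma dyadic_small: assumes "0 < c" obtains m :: int where "\<delta> powr m < c" "0 < \<delta> powr m"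
proof -
  have d: "0 < \<delta>" "\<delta> < 1" using \<delta> by auto
  from real_arch_pow_inv[OF assms d(2)] obtain k where "\<delta> ^ k < c" by (elim exE)
  then have "\<delta> powr real_of_int (int k) < c" using d by (simp add: powr_realpow)
  then show ?thesis using d by (intro that[of "int k"]) auto
qed

text \<open>On a fixed ball \<open>\<sigma>\<close> is bounded below, so \<open>dmax\<close> admits
  all small grid radii there, and along these \<open>kop M (P t) f\<close> recovers
  \<open>f\<close>. Bounds in terms of the norm of \<open>f\<close>, such as \<open>H_bound\<close>,
  thereby become bounds by \<open>dmax\<close>.\<close>

lemma L1_le_dmax:
  assumes f: "integrable M f" shows "(\<integral>\<^sup>+y. ennreal \<bar>f y\<bar> \<partial>M) \<le> (\<integral>\<^sup>+z. dmax P f z \<partial>M)"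
proof (rule L1_le[OF f, of undefined])
  fix R t0 e :: real assume R: "0 < R" and t0: "0 < t0" and e: "0 < e"
  from \<sigma>_lower[of R undefined] R obtain c where c: "0 < c" "\<forall>y. dist undefined y \<le> R \<longrightarrow> c \<le> \<sigma> y" by (meson less_imp_le)
  from dyadic_small[of "min c t0"] c t0 obtain m :: int where m: "\<delta> powr m < min c t0" "0 < \<delta> powr m" by (metis min_less_iff_conj)
  have "(\<integral>\<^sup>+z. ennreal \<bar>kop M (P (\<delta> powr m)) f z\<bar> * indicator (ball undefined R) z \<partial>M) \<le> (\<integral>\<^sup>+z. dmax P f z \<partial>M)"
  proof (intro nn_integral_mono)
    fix z
    show "ennreal \<bar>kop M (P (\<delta> powr m)) f z\<bar> * indicator (ball undefined R) z \<le> dmax P f z"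
    proof (cases "dist undefined z < R")
      case True
      then have "\<delta> powr m < \<sigma> z" using c m by (meson less_imp_le less_le_trans min_less_iff_conj)
      then show ?thesis using dmax_upper True by simp
    qed simp
  qed
  then show "\<exists>t. 0 < t \<and> t < t0 \<and> (\<integral>\<^sup>+z. ennreal \<bar>kop M (P t) f z\<bar> * indicator (ball undefined R) z \<partial>M) \<le> (\<integral>\<^sup>+z. dmax P f z \<partial>M) + ennreal e"
    using m by (intro exI[of _ "\<delta> powr m"]) (auto intro: add_increasing2)
qed

definition KF :: real where "KF = Kk * KM q + Kk * KHH g"

lemma KF_pos: "0 < KF" unfolding KF_def
  using Kk_pos KM_pos[OF q1] KHH_nonneg[of g] g_pos by (intro add_pos_nonneg) auto

text \<open>A measurable stand-in for the grand maximal function: \<open>G\<close> is chosen before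
  \<open>\<phi>\<close> and \<open>r\<close>. The norm of \<open>f\<close> that enters through
  \<open>H\<close> is replaced with the integral of \<open>dmax\<close> by means of
  \<open>L1_le_dmax\<close>.\<close>

theorem grand_majorant:
  assumes f: "integrable M f"
  shows "\<exists>G\<in>borel_measurable M. (\<forall>x r \<phi>. 0 < r \<longrightarrow> r < \<rho> x \<longrightarrow> cls x r 1 1 \<phi> \<longrightarrow> ennreal \<bar>\<integral>y. f y * \<phi> y \<partial>M\<bar> \<le> G x) \<and>
     (\<integral>\<^sup>+x. G x \<partial>M) \<le> ennreal KF * (\<integral>\<^sup>+z. dmax P f z \<partial>M)"
proof (cases "(\<integral>\<^sup>+z. dmax P f z \<partial>M) = \<infinity>")
  case True
  then have "ennreal KF * (\<integral>\<^sup>+z. dmax P f z \<partial>M) = \<infinity>" using KF_pos by (simp add: ennreal_mult_top)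
  then show ?thesis by (intro bexI[of _ "\<lambda>_. \<infinity>"]) auto
next
  case False
  have [measurable]: "f \<in> borel_measurable M" using f by auto
  have [measurable]: "dmax P f \<in> borel_measurable M" by (intro dmax_measurable kop_measurable) auto
  define u where "u z = enn2real (dmax P f z)" for z
  have [measurable]: "u \<in> borel_measurable M" unfolding u_def by measurable
  have ae: "AE z in M. dmax P f z \<noteq> \<infinity>" by (rule nn_integral_noteq_infinite) (use False in auto)
  have ae2: "AE z in M. ennreal (u z) = dmax P f z"
    using ae by eventually_elim (simp add: u_def less_top)
  have nu: "(\<integral>\<^sup>+z. ennreal (u z) \<partial>M) = (\<integral>\<^sup>+z. dmax P f z \<partial>M)" by (rule nn_integral_cong_AE[OF ae2])
  have u: "integrable M u" "0 \<le> u z" for z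
    using False nu by (auto intro!: integrableI_nonneg AE_I2 simp: u_def less_top)
  have fu: "AE z in M. \<forall>m::int. \<delta> powr m < \<sigma> z \<longrightarrow> \<bar>kop M (P (\<delta> powr m)) f z\<bar> \<le> u z"
    using ae2
  proof eventually_elim
    fix z assume z: "ennreal (u z) = dmax P f z"
    show "\<forall>m::int. \<delta> powr m < \<sigma> z \<longrightarrow> \<bar>kop M (P (\<delta> powr m)) f z\<bar> \<le> u z"
    proof (intro allI impI)
      fix m :: int assume "\<delta> powr m < \<sigma> z"
      from dmax_upper[OF this, of P f] have "ennreal \<bar>kop M (P (\<delta> powr m)) f z\<bar> \<le> ennreal (u z)" unfolding z .
      then show "\<bar>kop M (P (\<delta> powr m)) f z\<bar> \<le> u z" using u(2)[of z] by (simp add: ennreal_le_iff)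
    qed
  qed
  define G where "G x = ennreal Kk * (maxf q (\<lambda>z. u z powr (1 / q)) x + H g f x)" for x
  have "(\<integral>\<^sup>+x. G x \<partial>M) \<le> ennreal (Kk * KM q) * (\<integral>\<^sup>+x. ennreal (u x) \<partial>M) + ennreal (Kk * KHH g) * (\<integral>\<^sup>+x. ennreal \<bar>f x\<bar> \<partial>M)"
    unfolding G_def by (rule majorant_integral[OF f u])
  also have "\<dots> \<le> ennreal (Kk * KM q) * (\<integral>\<^sup>+z. dmax P f z \<partial>M) + ennreal (Kk * KHH g) * (\<integral>\<^sup>+z. dmax P f z \<partial>M)"
    unfolding nu by (intro add_left_mono mult_left_mono L1_le_dmax f) auto
  also have "\<dots> = ennreal KF * (\<integral>\<^sup>+z. dmax P f z \<partial>M)"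
    unfolding KF_def using Kk_pos KM_pos[OF q1] KHH_nonneg[of g] g_pos
    by (subst ennreal_plus) (auto simp: distrib_right)
  finally have "(\<integral>\<^sup>+x. G x \<partial>M) \<le> ennreal KF * (\<integral>\<^sup>+z. dmax P f z \<partial>M)" .
  moreover have "G \<in> borel_measurable M" unfolding G_def by measurable
  moreover have "ennreal \<bar>\<integral>y. f y * \<phi> y \<partial>M\<bar> \<le> G x" if "0 < r" "r < \<rho> x" "cls x r 1 1 \<phi>" for x r \<phi>
    unfolding G_def by (rule key_estimate[OF f u fu that])
  ultimately show ?thesis by blast
qed

end

section \<open>Perturbed kernels\<close>

locale perturbed_kernel = kernel_regular M D n P g b C \<rho> \<sigma> a Ca Kr
  for M :: "'a::metric_space measure" and D n P g b C \<rho> \<sigma> a Ca Kr +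
  fixes T :: "real \<Rightarrow> 'a \<Rightarrow> 'a \<Rightarrow> real" and d1 d2 d3 CT :: real
  assumes CT: "0 < CT" and d123: "g \<le> d1" "g \<le> d2" "g \<le> d3"
    and T_meas: "0 < t \<Longrightarrow> (\<lambda>(x, y). T t x y) \<in> borel_measurable (M \<Otimes>\<^sub>M M)"
    and T_size: "0 < t \<Longrightarrow> \<bar>T t x y\<bar> \<le> CT * env d2 t x y * (\<rho> x / (t + \<rho> x)) powr d3"
    and T_diff: "0 < t \<Longrightarrow> \<bar>T t x y - P t x y\<bar> \<le> CT * (t / (t + \<rho> x)) powr d1 * env d2 t x y"
begin

definition c2 :: real where "c2 = CT * (D * 2 powr n)"
lemma c2: "0 < c2" using CT D1 by (simp add: c2_def)

lemma env_d2: "0 < t \<Longrightarrow> CT * env d2 t x y \<le> c2 * E g t x y"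
  using order.trans[OF env_mono_exp[OF _ d123(2), of t x y] env_le_E[of t g x y]] CT
  by (simp add: c2_def mult.assoc)

lemma T_E: assumes t: "0 < t" shows "\<bar>T t x y\<bar> \<le> c2 * (\<rho> x / (t + \<rho> x)) powr g * E g t x y"
proof -
  have "(\<rho> x / (t + \<rho> x)) powr d3 \<le> (\<rho> x / (t + \<rho> x)) powr g"
    using t \<rho>_pos[of x] d123 by (intro powr_mono') auto
  then have "CT * env d2 t x y * (\<rho> x / (t + \<rho> x)) powr d3 \<le> (c2 * E g t x y) * (\<rho> x / (t + \<rho> x)) powr g"
    using c2 by (intro mult_mono[OF env_d2[OF t]]) auto
  then show ?thesis using T_size[OF t, of x y] by (simp add: mult_ac)
qed

lemma T_P_E: assumes t: "0 < t" shows "\<bar>T t x y - P t x y\<bar> \<le> c2 * (t / (t + \<rho> x)) powr g * E g t x y"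
proof -
  have "(t / (t + \<rho> x)) powr d1 \<le> (t / (t + \<rho> x)) powr g"
    using t \<rho>_pos[of x] d123 by (intro powr_mono') auto
  then have "(CT * env d2 t x y) * (t / (t + \<rho> x)) powr d1 \<le> (c2 * E g t x y) * (t / (t + \<rho> x)) powr g"
    using c2 by (intro mult_mono[OF env_d2[OF t]]) auto
  then show ?thesis using T_diff[OF t, of x y] by (simp add: mult_ac)
qed

lemma T_measurable:
  assumes "0 < t" "u \<in> measurable N M" "v \<in> measurable N M"
  shows "(\<lambda>p. T t (u p) (v p)) \<in> borel_measurable N"
  using measurable_compose[OF measurable_Pair[OF assms(2,3)] T_meas[OF assms(1)]] by simp

lemma kopT_measurable:
  assumes t: "0 < t" and [measurable]: "f \<in> borel_measurable M"
  shows "kop M (T t) f \<in> borel_measurable M"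
proof -
  interpret sigma_finite_measure M by (rule sigma_finite_M)
  have [measurable]: "(\<lambda>p. T t (fst p) (snd p)) \<in> borel_measurable (M \<Otimes>\<^sub>M M)"
    by (rule T_measurable[OF t]) measurable
  show ?thesis unfolding kop_def
    by (rule borel_measurable_lebesgue_integral) (simp add: case_prod_beta')
qed

lemma kopT_integrable:
  assumes t: "0 < t" and f: "integrable M f"
  shows "integrable M (\<lambda>y. T t z y * f y)"
proof (rule Bochner_Integration.integrable_bound)
  show "integrable M (\<lambda>y. c2 / V z t * f y)" using f by simp
  have [measurable]: "f \<in> borel_measurable M" "(\<lambda>y. T t z y) \<in> borel_measurable M"
    using f t by (auto intro!: T_measurable)
  show "(\<lambda>y. T t z y * f y) \<in> borel_measurable M" by measurable
  have "\<bar>T t z y\<bar> \<le> c2 / V z t" for y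
  proof -
    have "c2 * (\<rho> z / (t + \<rho> z)) powr g * E g t z y \<le> c2 * 1 * (1 / V z t)"
      using c2 t g_pos \<rho>_pos[of z] by (intro mult_mono E_le powr_le1) auto
    then show ?thesis using T_E[OF t, of z y] by simp
  qed
  from mult_right_mono[OF this, of "\<bar>f _\<bar>"]
  show "AE y in M. norm (T t z y * f y) \<le> norm (c2 / V z t * f y)"
    using c2 by (intro AE_I2) (simp add: abs_mult)
qed

lemma kop_le:
  assumes K: "integrable M (\<lambda>y. K x y * f y)" and le: "\<And>y. \<bar>K x y\<bar> \<le> k * L y" and k: "0 \<le> k"
    and [measurable]: "f \<in> borel_measurable M" "L \<in> borel_measurable M"
  shows "ennreal \<bar>kop M K f x\<bar> \<le> ennreal k * (\<integral>\<^sup>+y. ennreal (L y * \<bar>f y\<bar>) \<partial>M)"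
proof -
  have "ennreal \<bar>kop M K f x\<bar> \<le> (\<integral>\<^sup>+y. ennreal (norm (K x y * f y)) \<partial>M)"
    unfolding kop_def using integral_norm_bound_ennreal[OF K] by simp
  also have "\<dots> \<le> (\<integral>\<^sup>+y. ennreal k * ennreal (L y * \<bar>f y\<bar>) \<partial>M)"
  proof (intro nn_integral_mono)
    fix y
    show "ennreal (norm (K x y * f y)) \<le> ennreal k * ennreal (L y * \<bar>f y\<bar>)"
      using mult_right_mono[OF le[of y], of "\<bar>f y\<bar>"] k
      by (simp add: ennreal_mult'[symmetric] ennreal_leI abs_mult mult.assoc)
  qed
  also have "\<dots> = ennreal k * (\<integral>\<^sup>+y. ennreal (L y * \<bar>f y\<bar>) \<partial>M)" by (intro nn_integral_cmult) measurable
  finally show ?thesis .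
qed

definition K2 :: real where "K2 = c2 * (Kr powr g + D * 2 powr n)"
lemma K2: "0 < K2" unfolding K2_def using c2 D1 by (intro mult_pos_pos add_nonneg_pos) auto

text \<open>With \<open>d = dist x y\<close>, the product of
  \<open>\<rho> x / (t + \<rho> x)\<close> and \<open>t / (t + d)\<close> is at most
  \<open>\<rho> x / (\<rho> x + d)\<close>. The extra decay of \<open>T\<close> in \<open>t\<close>
  thus brings every large scale back to \<open>\<rho> x\<close>, and no cancellation is called
  for.\<close>

lemma T_large:
  assumes f: "integrable M f" and t: "\<rho> x \<le> t"
  shows "ennreal \<bar>kop M (T t) f x\<bar> \<le> ennreal K2 * H g f x"
proof -
  have [measurable]: "f \<in> borel_measurable M" using f by auto
  have r: "0 < \<rho> x" by (rule \<rho>_pos)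
  have t0: "0 < t" using r t by simp
  have le: "\<bar>T t x y\<bar> \<le> c2 * Kr powr g * E g (\<sigma> x) x y" for y
  proof -
    let ?d = "dist x y"
    have d: "0 \<le> ?d" by simp
    have "\<rho> x / (t + \<rho> x) * (t / (t + ?d)) \<le> \<rho> x / (\<rho> x + ?d)"
    proof -
      have "0 \<le> \<rho> x * (t * t) + \<rho> x * (?d * \<rho> x)" using r t0 by (intro add_nonneg_nonneg mult_nonneg_nonneg) auto
      then have "\<rho> x * t * (\<rho> x + ?d) \<le> \<rho> x * ((t + \<rho> x) * (t + ?d))" by (simp add: algebra_simps)
      then show ?thesis using r t0 d by (simp add: divide_simps add_pos_nonneg mult_ac)
    qed
    then have "(\<rho> x / (t + \<rho> x) * (t / (t + ?d))) powr g \<le> (\<rho> x / (\<rho> x + ?d)) powr g"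
      using r t0 d g_pos by (intro powr_mono2) auto
    then have "(\<rho> x / (t + \<rho> x)) powr g * (t / (t + ?d)) powr g \<le> (\<rho> x / (\<rho> x + ?d)) powr g" by (simp only: powr_mult)
    then have "(\<rho> x / (t + \<rho> x)) powr g * E g t x y \<le> E g (\<rho> x) x y"
      unfolding E_def times_divide_eq_right using r t d by (intro frac_le V_pos V_mono) (auto simp: add_pos_nonneg)
    also have "\<dots> \<le> Kr powr g * E g (\<sigma> x) x y" using \<sigma>_pos \<sigma>_le \<rho>_le g_pos by (intro E_smaller) auto
    finally have "c2 * ((\<rho> x / (t + \<rho> x)) powr g * E g t x y) \<le> c2 * (Kr powr g * E g (\<sigma> x) x y)"
      using c2 by (intro mult_left_mono) auto
    then show ?thesis using T_E[OF t0, of x y] by (simp add: mult.assoc)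
  qed
  have "ennreal \<bar>kop M (T t) f x\<bar> \<le> ennreal (c2 * Kr powr g) * (\<integral>\<^sup>+y. ennreal (E g (\<sigma> x) x y * \<bar>f y\<bar>) \<partial>M)"
    using c2 by (intro kop_le kopT_integrable t0 f le) auto
  also have "\<dots> \<le> ennreal K2 * H g f x"
  proof (intro mult_mono H_ge ennreal_leI)
    have "c2 * Kr powr g \<le> c2 * (Kr powr g + D * 2 powr n)" using c2 D1 by (intro mult_left_mono) auto
    then show "c2 * Kr powr g \<le> K2" by (simp add: K2_def)
  qed auto
  finally show ?thesis .
qed

lemma kop_diff:
  assumes f: "integrable M f" and t: "0 < t"
  shows "kop M (T t) f x - kop M (P t) f x = kop M (\<lambda>x y. T t x y - P t x y) f x"
    and "integrable M (\<lambda>y. (T t x y - P t x y) * f y)"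
  unfolding kop_def left_diff_distrib
  using kopT_integrable[OF t f, of x] kop_integrable[OF t f, of x] by auto

text \<open>The kernel difference carries the weight \<open>(t / \<rho> x) powr g\<close>, which is
  precisely the weight that \<open>H\<close> was built to handle for all scales up to
  \<open>\<rho> x\<close>.\<close>

lemma T_P_small:
  assumes f: "integrable M f" and t: "0 < t" "t \<le> \<rho> x"
  shows "ennreal \<bar>kop M (T t) f x - kop M (P t) f x\<bar> \<le> ennreal K2 * H g f x"
proof -
  have [measurable]: "f \<in> borel_measurable M" using f by auto
  have le: "\<bar>T t x y - P t x y\<bar> \<le> c2 * (t / \<rho> x) powr g * E g t x y" for y
  proof -
    have "(t / (t + \<rho> x)) powr g \<le> (t / \<rho> x) powr g"
      using t \<rho>_pos[of x] g_pos by (intro powr_mono2 divide_left_mono) auto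
    then have "c2 * (t / (t + \<rho> x)) powr g * E g t x y \<le> c2 * (t / \<rho> x) powr g * E g t x y"
      using c2 by (intro mult_right_mono mult_left_mono) auto
    then show ?thesis using T_P_E[OF t(1), of x y] by simp
  qed
  have "ennreal \<bar>kop M (T t) f x - kop M (P t) f x\<bar> \<le> ennreal (c2 * (t / \<rho> x) powr g) * (\<integral>\<^sup>+y. ennreal (E g t x y * \<bar>f y\<bar>) \<partial>M)"
    unfolding kop_diff(1)[OF f t(1)] using c2 by (intro kop_le kop_diff f t le) auto
  also have "\<dots> = ennreal c2 * (ennreal ((t / \<rho> x) powr g) * (\<integral>\<^sup>+y. ennreal (E g t x y * \<bar>f y\<bar>) \<partial>M))"
    using c2 by (simp add: ennreal_mult' mult.assoc)
  also have "\<dots> \<le> ennreal c2 * (ennreal (Kr powr g + D * 2 powr n) * H g f x)"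
    using t g_pos by (intro mult_left_mono small_scale_H) auto
  also have "\<dots> = ennreal K2 * H g f x"
    using c2 D1 by (simp add: K2_def ennreal_mult' mult.assoc)
  finally show ?thesis .
qed

lemma T_le_P:
  assumes f: "integrable M f" and t: "0 < t"
  shows "ennreal \<bar>kop M (T t) f x\<bar> \<le> (if t < \<rho> x then ennreal \<bar>kop M (P t) f x\<bar> else 0) + ennreal K2 * H g f x"
proof (cases "t < \<rho> x")
  case True
  have "ennreal \<bar>kop M (T t) f x\<bar> \<le> ennreal (\<bar>kop M (P t) f x\<bar> + \<bar>kop M (T t) f x - kop M (P t) f x\<bar>)"
    by (intro ennreal_leI) linarith
  also have "\<dots> = ennreal \<bar>kop M (P t) f x\<bar> + ennreal \<bar>kop M (T t) f x - kop M (P t) f x\<bar>"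
    by (intro ennreal_plus) auto
  also have "\<dots> \<le> ennreal \<bar>kop M (P t) f x\<bar> + ennreal K2 * H g f x"
    using True by (intro add_left_mono T_P_small f t) simp
  finally show ?thesis using True by simp
next
  case False then show ?thesis using T_large[OF f, of x t] by simp
qed

lemma dmax_P_le:
  assumes f: "integrable M f" shows "dmax P f z \<le> dmax T f z + ennreal K2 * H g f z"
  unfolding dmax_def[of P]
proof (rule SUP_least)
  fix m :: int
  let ?t = "\<delta> powr m"
  have t: "0 < ?t" using \<delta>(1) by simp
  show "ennreal (if ?t < \<sigma> z then \<bar>kop M (P ?t) f z\<bar> else 0) \<le> dmax T f z + ennreal K2 * H g f z"
  proof (cases "?t < \<sigma> z")
    case True
    have "ennreal \<bar>kop M (P ?t) f z\<bar> \<le> ennreal (\<bar>kop M (T ?t) f z\<bar> + \<bar>kop M (T ?t) f z - kop M (P ?t) f z\<bar>)"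
      by (intro ennreal_leI) linarith
    also have "\<dots> = ennreal \<bar>kop M (T ?t) f z\<bar> + ennreal \<bar>kop M (T ?t) f z - kop M (P ?t) f z\<bar>"
      by (intro ennreal_plus) auto
    also have "\<dots> \<le> dmax T f z + ennreal K2 * H g f z"
      using True \<sigma>_le[of z] by (intro add_mono dmax_upper T_P_small f t) auto
    finally show ?thesis using True by simp
  qed simp
qed

text \<open>Where \<open>\<sigma>\<close> is at least \<open>c\<close> the difference carries the
  factor \<open>(t / c) powr g\<close>, which vanishes with \<open>t\<close>. The estimate is
  confined to a ball because \<open>\<sigma>_lower\<close> provides such a \<open>c\<close> on
  balls.\<close>

lemma T_P_L1:
  assumes f: "integrable M f" and t: "0 < t" and c: "0 < c" "\<And>z. dist x z \<le> R \<Longrightarrow> c \<le> \<sigma> z"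
  shows "(\<integral>\<^sup>+z. ennreal \<bar>kop M (T t) f z - kop M (P t) f z\<bar> * indicator (ball x R) z \<partial>M)
    \<le> ennreal (c2 * (D * 2 powr n) * KI g * (t / c) powr g) * (\<integral>\<^sup>+y. ennreal \<bar>f y\<bar> \<partial>M)"
proof -
  interpret sigma_finite_measure M by (rule sigma_finite_M)
  interpret MM: pair_sigma_finite M M ..
  have [measurable]: "f \<in> borel_measurable M" using f by auto
  define k where "k = c2 * (t / c) powr g * (D * 2 powr n)"
  have k: "0 \<le> k" using c2 D1 by (simp add: k_def)
  have pt: "ennreal \<bar>kop M (T t) f z - kop M (P t) f z\<bar> * indicator (ball x R) z \<le> (\<integral>\<^sup>+y. ennreal (k * \<bar>f y\<bar>) * ennreal (E g t y z) \<partial>M)" for z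
  proof (cases "dist x z < R")
    case True
    then have cz: "c \<le> \<rho> z" using c(2)[of z] \<sigma>_le[of z] by simp
    have le: "\<bar>T t z y - P t z y\<bar> \<le> k * E g t y z" for y
    proof -
      have "t / (t + \<rho> z) \<le> t / c" using t c cz by (intro divide_left_mono) (auto intro!: mult_pos_pos add_pos_pos \<rho>_pos)
      then have "(t / (t + \<rho> z)) powr g \<le> (t / c) powr g" using t \<rho>_pos[of z] g_pos by (intro powr_mono2) auto
      then have "c2 * (t / (t + \<rho> z)) powr g * E g t z y \<le> c2 * (t / c) powr g * (D * 2 powr n * E g t y z)"
        using c2 t g_pos by (intro mult_mono E_sym mult_left_mono) auto
      then show ?thesis using T_P_E[OF t, of z y] by (simp add: k_def mult_ac)
    qed
    have "ennreal \<bar>kop M (T t) f z - kop M (P t) f z\<bar> \<le> ennreal k * (\<integral>\<^sup>+y. ennreal (E g t y z * \<bar>f y\<bar>) \<partial>M)"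
      unfolding kop_diff(1)[OF f t] using k by (intro kop_le kop_diff f t le) auto
    also have "\<dots> = (\<integral>\<^sup>+y. ennreal k * ennreal (E g t y z * \<bar>f y\<bar>) \<partial>M)" by (intro nn_integral_cmult[symmetric]) measurable
    also have "\<dots> = (\<integral>\<^sup>+y. ennreal (k * \<bar>f y\<bar>) * ennreal (E g t y z) \<partial>M)"
      using k by (intro nn_integral_cong) (simp add: ennreal_mult'[symmetric] mult_ac)
    finally show ?thesis using True by simp
  qed simp
  have "(\<integral>\<^sup>+z. ennreal \<bar>kop M (T t) f z - kop M (P t) f z\<bar> * indicator (ball x R) z \<partial>M) \<le>
    (\<integral>\<^sup>+z. \<integral>\<^sup>+y. ennreal (k * \<bar>f y\<bar>) * ennreal (E g t y z) \<partial>M \<partial>M)" by (intro nn_integral_mono pt)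
  also have "\<dots> = (\<integral>\<^sup>+y. \<integral>\<^sup>+z. ennreal (k * \<bar>f y\<bar>) * ennreal (E g t y z) \<partial>M \<partial>M)"
    by (rule MM.Fubini'[symmetric]) measurable
  also have "\<dots> = (\<integral>\<^sup>+y. ennreal (k * \<bar>f y\<bar>) * (\<integral>\<^sup>+z. ennreal (E g t y z) \<partial>M) \<partial>M)"
    by (intro nn_integral_cong nn_integral_cmult) measurable
  also have "\<dots> \<le> (\<integral>\<^sup>+y. ennreal (k * \<bar>f y\<bar>) * ennreal (KI g) \<partial>M)"
    using t g_pos by (intro nn_integral_mono mult_left_mono E_integral) auto
  also have "\<dots> = (\<integral>\<^sup>+y. ennreal (k * KI g) * ennreal \<bar>f y\<bar> \<partial>M)"
    using k KI_pos[OF g_pos(1)] by (intro nn_integral_cong) (simp add: ennreal_mult'[symmetric] mult_ac)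
  also have "\<dots> = ennreal (k * KI g) * (\<integral>\<^sup>+y. ennreal \<bar>f y\<bar> \<partial>M)" by (intro nn_integral_cmult) measurable
  also have "k * KI g = c2 * (D * 2 powr n) * KI g * (t / c) powr g" by (simp add: k_def mult_ac)
  finally show ?thesis .
qed

text \<open>A detour through \<open>dmax_P_le\<close> would be circular, as \<open>H\<close> is
  itself controlled by the norm of \<open>f\<close>. Instead \<open>kop M (P t) f\<close> in
  \<open>L1_le\<close> is replaced on a ball by \<open>kop M (T t) f\<close>, with an error that
  vanishes with \<open>t\<close>.\<close>

lemma L1_le_dmax_T:
  assumes f: "integrable M f" shows "(\<integral>\<^sup>+y. ennreal \<bar>f y\<bar> \<partial>M) \<le> (\<integral>\<^sup>+z. dmax T f z \<partial>M)"
proof (rule L1_le[OF f, of undefined])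
  fix R t0 e :: real assume R: "0 < R" and t0: "0 < t0" and e: "0 < e"
  have [measurable]: "f \<in> borel_measurable M" using f by auto
  from \<sigma>_lower[of R undefined] R obtain c where c: "0 < c" "\<forall>y. dist undefined y \<le> R \<longrightarrow> c \<le> \<sigma> y" by (meson less_imp_le)
  define F where "F = (\<integral>y. \<bar>f y\<bar> \<partial>M)"
  define k where "k = c2 * (D * 2 powr n) * KI g * F"
  have k: "0 \<le> k" using c2 D1 KI_pos[OF g_pos(1)] by (simp add: k_def F_def)
  define v where "v = e / (1 + k)"
  have "1 + k \<noteq> 0" using k by simp
  from nonzero_eq_divide_eq[THEN iffD1, OF this v_def] have v: "(1 + k) * v = e" "0 < v"
    using e k by (auto simp: v_def mult.commute)
  define t1 where "t1 = c * v powr (1 / g)"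
  have t1: "0 < t1" using c v by (simp add: t1_def)
  from dyadic_small[of "min (min c t1) t0"] c t0 t1 obtain m :: int where m: "\<delta> powr m < min (min c t1) t0" "0 < \<delta> powr m" by (metis min_less_iff_conj)
  define t where "t = \<delta> powr m"
  have t: "0 < t" "t < c" "t < t1" "t < t0" using m by (auto simp: t_def)
  have tg: "k * (t / c) powr g \<le> e"
  proof -
    have "t / c \<le> v powr (1 / g)" using t c by (simp add: t1_def divide_le_eq mult.commute)
    then have "(t / c) powr g \<le> (v powr (1 / g)) powr g" using t c g_pos by (rule_tac powr_mono2) auto
    also have "\<dots> = v" using v g_pos by (simp add: powr_powr)
    finally have "k * (t / c) powr g \<le> (1 + k) * v" using k v by (intro mult_mono) auto
    then show ?thesis unfolding v(1) .
  qed
  have [measurable]: "kop M (T t) f \<in> borel_measurable M" "kop M (P t) f \<in> borel_measurable M"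
    using t by (auto intro!: kopT_measurable kop_measurable)
  have "(\<integral>\<^sup>+z. ennreal \<bar>kop M (P t) f z\<bar> * indicator (ball undefined R) z \<partial>M) \<le>
     (\<integral>\<^sup>+z. ennreal \<bar>kop M (T t) f z\<bar> * indicator (ball undefined R) z + ennreal \<bar>kop M (T t) f z - kop M (P t) f z\<bar> * indicator (ball undefined R) z \<partial>M)"
  proof (intro nn_integral_mono)
    fix z
    have "ennreal \<bar>kop M (P t) f z\<bar> \<le> ennreal (\<bar>kop M (T t) f z\<bar> + \<bar>kop M (T t) f z - kop M (P t) f z\<bar>)"
      by (intro ennreal_leI) linarith
    also have "\<dots> = ennreal \<bar>kop M (T t) f z\<bar> + ennreal \<bar>kop M (T t) f z - kop M (P t) f z\<bar>"
      by (intro ennreal_plus) auto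
    finally show "ennreal \<bar>kop M (P t) f z\<bar> * indicator (ball undefined R) z \<le>
      ennreal \<bar>kop M (T t) f z\<bar> * indicator (ball undefined R) z + ennreal \<bar>kop M (T t) f z - kop M (P t) f z\<bar> * indicator (ball undefined R) z"
      by (auto simp: indicator_def)
  qed
  also have "\<dots> = (\<integral>\<^sup>+z. ennreal \<bar>kop M (T t) f z\<bar> * indicator (ball undefined R) z \<partial>M) + (\<integral>\<^sup>+z. ennreal \<bar>kop M (T t) f z - kop M (P t) f z\<bar> * indicator (ball undefined R) z \<partial>M)"
    by (intro nn_integral_add) measurable
  also have "\<dots> \<le> (\<integral>\<^sup>+z. dmax T f z \<partial>M) + ennreal (c2 * (D * 2 powr n) * KI g * (t / c) powr g) * (\<integral>\<^sup>+y. ennreal \<bar>f y\<bar> \<partial>M)"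
  proof (intro add_mono T_P_L1 f t c nn_integral_mono)
    fix z
    show "ennreal \<bar>kop M (T t) f z\<bar> * indicator (ball undefined R) z \<le> dmax T f z"
    proof (cases "dist undefined z < R")
      case True
      then have "c \<le> \<sigma> z" using c by simp
      then have "\<delta> powr m < \<sigma> z" using t(2) unfolding t_def by (rule less_le_trans[rotated])
      then show ?thesis using dmax_upper True by (simp add: t_def)
    qed simp
    show "dist undefined z \<le> R \<Longrightarrow> c \<le> \<sigma> z" using c by simp
  qed
  also have "ennreal (c2 * (D * 2 powr n) * KI g * (t / c) powr g) * (\<integral>\<^sup>+y. ennreal \<bar>f y\<bar> \<partial>M) = ennreal (k * (t / c) powr g)"
  proof -
    have "(\<integral>\<^sup>+y. ennreal \<bar>f y\<bar> \<partial>M) = ennreal F" unfolding F_def using f by (intro nn_integral_eq_integral) auto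
    moreover have "0 \<le> F" by (simp add: F_def)
    ultimately show ?thesis using c2 D1 KI_pos[OF g_pos(1)] by (simp add: ennreal_mult''[symmetric] k_def mult_ac)
  qed
  also have "\<dots> \<le> ennreal e" by (intro ennreal_leI tg)
  finally have "(\<integral>\<^sup>+z. ennreal \<bar>kop M (P t) f z\<bar> * indicator (ball undefined R) z \<partial>M) \<le> (\<integral>\<^sup>+z. dmax T f z \<partial>M) + ennreal e"
    by (simp add: add_left_mono)
  then show "\<exists>t. 0 < t \<and> t < t0 \<and> (\<integral>\<^sup>+z. ennreal \<bar>kop M (P t) f z\<bar> * indicator (ball undefined R) z \<partial>M) \<le> (\<integral>\<^sup>+z. dmax T f z \<partial>M) + ennreal e"
    using t by (intro exI[of _ t]) auto
qed

text \<open>Passing from \<open>P\<close> to \<open>T\<close> costs \<open>H\<close>, hence the norm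
  of \<open>f\<close>, which \<open>L1_le_dmax_T\<close> turns into the maximal function of
  \<open>T\<close> again.\<close>

lemma dmax_P_integral:
  assumes f: "integrable M f"
  shows "(\<integral>\<^sup>+z. dmax P f z \<partial>M) \<le> ennreal (1 + K2 * KHH g) * (\<integral>\<^sup>+z. dmax T f z \<partial>M)"
proof -
  have [measurable]: "f \<in> borel_measurable M" using f by auto
  have [measurable]: "dmax T f \<in> borel_measurable M" by (intro dmax_measurable kopT_measurable) auto
  have "(\<integral>\<^sup>+z. dmax P f z \<partial>M) \<le> (\<integral>\<^sup>+z. dmax T f z + ennreal K2 * H g f z \<partial>M)" by (intro nn_integral_mono dmax_P_le f)
  also have "\<dots> = (\<integral>\<^sup>+z. dmax T f z \<partial>M) + ennreal K2 * (\<integral>\<^sup>+z. H g f z \<partial>M)"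
    by (subst nn_integral_add) (auto simp: nn_integral_cmult)
  also have "\<dots> \<le> (\<integral>\<^sup>+z. dmax T f z \<partial>M) + ennreal K2 * (ennreal (KHH g) * (\<integral>\<^sup>+z. dmax T f z \<partial>M))"
    using g_pos by (intro add_left_mono mult_left_mono order.trans[OF H_bound] L1_le_dmax_T f) auto
  also have "\<dots> = ennreal (1 + K2 * KHH g) * (\<integral>\<^sup>+z. dmax T f z \<partial>M)"
    using K2 KHH_nonneg[OF g_pos(1)] by (simp add: distrib_right ennreal_mult' mult.assoc)
  finally show ?thesis .
qed

lemma dmax_T_le: "dmax T f z \<le> Tplus_rho M \<rho> T f z"
  unfolding dmax_def Tplus_rho_def
proof (rule SUP_least)
  fix m :: int
  show "ennreal (if \<delta> powr m < \<sigma> z then \<bar>kop M (T (\<delta> powr m)) f z\<bar> else 0) \<le> (SUP t\<in>{0<..<\<rho> z}. ennreal \<bar>kop M (T t) f z\<bar>)"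
  proof (cases "\<delta> powr m < \<sigma> z")
    case True
    then have "\<delta> powr m \<in> {0<..<\<rho> z}" using \<sigma>_le[of z] \<delta>(1) by auto
    then show ?thesis using True by (intro SUP_upper2[where i = "\<delta> powr m"]) auto
  qed simp
qed

end

section \<open>The spaces of test functions and their norms\<close>

lemma interpolate:
  fixes X P Q s :: real
  assumes "0 \<le> X" "X \<le> P" "X \<le> Q" "0 \<le> s" "s \<le> 1"
  shows "X \<le> P powr (1 - s) * Q powr s"
proof (cases "X = 0")
  case False
  have "X = X powr (1 - s) * X powr s" using assms(1) False by (simp add: powr_add[symmetric])
  also have "\<dots> \<le> P powr (1 - s) * Q powr s" using assms by (intro mult_mono powr_mono2) auto
  finally show ?thesis .
qed simp

context doubling_measure
begin

lemma G_bound_nonneg: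
  assumes "G_bound M x r \<beta> \<gamma> f C" "0 < r" shows "0 \<le> C"
proof -
  have "0 \<le> C * env \<gamma> r x x" using assms(1) abs_ge_zero[of "f x"] unfolding G_bound_env by (meson order.trans)
  then show ?thesis using env_pos[OF assms(2), of \<gamma> x x] by (simp add: zero_le_mult_iff)
qed

lemma G_bound_mono:
  assumes "G_bound M x r \<beta> \<gamma> f C" "C \<le> C'" shows "G_bound M x r \<beta> \<gamma> f C'"
  unfolding G_bound_env
proof (intro conjI allI impI)
  show "\<bar>f y\<bar> \<le> C' * env \<gamma> r x y" for y
  proof -
    have "\<bar>f y\<bar> \<le> C * env \<gamma> r x y" using assms(1) unfolding G_bound_env by blast
    also have "\<dots> \<le> C' * env \<gamma> r x y" by (intro mult_right_mono assms(2)) simp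
    finally show ?thesis .
  qed
  fix y y' assume d: "dist y y' \<le> (r + dist x y) / 2"
  have "\<bar>f y - f y'\<bar> \<le> C * (dist y y' / (r + dist x y)) powr \<beta> * env \<gamma> r x y"
    using assms(1) d unfolding G_bound_env by blast
  also have "\<dots> \<le> C' * (dist y y' / (r + dist x y)) powr \<beta> * env \<gamma> r x y"
    by (intro mult_right_mono assms(2)) auto
  finally show "\<bar>f y - f y'\<bar> \<le> C' * (dist y y' / (r + dist x y)) powr \<beta> * env \<gamma> r x y" .
qed

lemma G_bound_mono_exp:
  assumes G: "G_bound M x r \<beta> \<gamma> f C" and r: "0 < r" and e: "\<beta>' \<le> \<beta>" "\<gamma>' \<le> \<gamma>"
  shows "G_bound M x r \<beta>' \<gamma>' f C"
  unfolding G_bound_env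
proof (intro conjI allI impI)
  have C: "0 \<le> C" by (rule G_bound_nonneg[OF G r])
  have W: "env \<gamma> r x y \<le> env \<gamma>' r x y" for y by (rule env_mono_exp[OF r e(2)])
  show "\<bar>f y\<bar> \<le> C * env \<gamma>' r x y" for y
  proof -
    have "\<bar>f y\<bar> \<le> C * env \<gamma> r x y" using G unfolding G_bound_env by blast
    also have "\<dots> \<le> C * env \<gamma>' r x y" by (intro mult_left_mono W C)
    finally show ?thesis .
  qed
  fix y y' assume d: "dist y y' \<le> (r + dist x y) / 2"
  let ?q = "dist y y' / (r + dist x y)"
  have R: "0 < r + dist x y" using r by (simp add: add_pos_nonneg)
  have q: "0 \<le> ?q" "?q \<le> 1" using d R by (auto simp: divide_simps)
  have "\<bar>f y - f y'\<bar> \<le> C * ?q powr \<beta> * env \<gamma> r x y" using G d unfolding G_bound_env by blast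
  also have "\<dots> \<le> C * ?q powr \<beta>' * env \<gamma>' r x y"
    using C q e by (intro mult_mono W powr_mono' mult_left_mono) auto
  finally show "\<bar>f y - f y'\<bar> \<le> C * ?q powr \<beta>' * env \<gamma>' r x y" .
qed

lemma G_bound_lin:
  assumes "G_bound M x r \<beta> \<gamma> f A" "G_bound M x r \<beta> \<gamma> h B"
  shows "G_bound M x r \<beta> \<gamma> (\<lambda>y. a * f y + c * h y) (\<bar>a\<bar> * A + \<bar>c\<bar> * B)"
  unfolding G_bound_env
proof (intro conjI allI impI)
  have f: "\<bar>f y\<bar> \<le> A * env \<gamma> r x y" and h: "\<bar>h y\<bar> \<le> B * env \<gamma> r x y" for y
    using assms unfolding G_bound_env by blast+
  show "\<bar>a * f y + c * h y\<bar> \<le> (\<bar>a\<bar> * A + \<bar>c\<bar> * B) * env \<gamma> r x y" for y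
  proof -
    have "\<bar>a * f y + c * h y\<bar> \<le> \<bar>a\<bar> * \<bar>f y\<bar> + \<bar>c\<bar> * \<bar>h y\<bar>"
      using abs_triangle_ineq[of "a * f y" "c * h y"] by (simp add: abs_mult)
    also have "\<dots> \<le> \<bar>a\<bar> * (A * env \<gamma> r x y) + \<bar>c\<bar> * (B * env \<gamma> r x y)"
      by (intro add_mono mult_left_mono f h) auto
    finally show ?thesis by (simp add: algebra_simps)
  qed
  fix y y' assume d: "dist y y' \<le> (r + dist x y) / 2"
  let ?q = "(dist y y' / (r + dist x y)) powr \<beta>"
  have f: "\<bar>f y - f y'\<bar> \<le> A * ?q * env \<gamma> r x y" and h: "\<bar>h y - h y'\<bar> \<le> B * ?q * env \<gamma> r x y"
    using assms d unfolding G_bound_env by blast+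
  have "a * f y + c * h y - (a * f y' + c * h y') = a * (f y - f y') + c * (h y - h y')" by (simp add: algebra_simps)
  then have "\<bar>a * f y + c * h y - (a * f y' + c * h y')\<bar> \<le> \<bar>a\<bar> * \<bar>f y - f y'\<bar> + \<bar>c\<bar> * \<bar>h y - h y'\<bar>"
    using abs_triangle_ineq[of "a * (f y - f y')" "c * (h y - h y')"] by (simp add: abs_mult)
  also have "\<dots> \<le> \<bar>a\<bar> * (A * ?q * env \<gamma> r x y) + \<bar>c\<bar> * (B * ?q * env \<gamma> r x y)"
    by (intro add_mono mult_left_mono f h) auto
  finally show "\<bar>a * f y + c * h y - (a * f y' + c * h y')\<bar> \<le> (\<bar>a\<bar> * A + \<bar>c\<bar> * B) * ?q * env \<gamma> r x y"
    by (simp add: algebra_simps)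
qed

lemma Gnorm_le:
  assumes "G_bound M x r \<beta> \<gamma> f C" "0 < r" shows "Gnorm M x r \<beta> \<gamma> f \<le> C"
  unfolding Gnorm_def using assms
  by (intro cInf_lower) (auto intro!: bdd_belowI[of _ 0] dest: G_bound_nonneg)

text \<open>The infimum is attained, since every defining inequality is closed in the
  constant.\<close>

lemma Gnorm_bound:
  assumes f: "f \<in> Gsp M x r \<beta> \<gamma>" and r: "0 < r"
  shows "G_bound M x r \<beta> \<gamma> f (Gnorm M x r \<beta> \<gamma> f)"
proof -
  let ?S = "{C. G_bound M x r \<beta> \<gamma> f C}"
  have ne: "?S \<noteq> {}" using f by (auto simp: Gsp_def)
  have lim: "X \<le> Inf ?S * Y" if "0 \<le> Y" "\<And>C. C \<in> ?S \<Longrightarrow> X \<le> C * Y" for X Y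
  proof (cases "Y = 0")
    case True then show ?thesis using that ne by auto
  next
    case False
    then have Y: "0 < Y" using that by simp
    have "X / Y \<le> Inf ?S" using ne
    proof (rule cInf_greatest)
      fix C assume "C \<in> ?S"
      from that(2)[OF this] show "X / Y \<le> C" using Y by (simp add: divide_le_eq)
    qed
    then show ?thesis using Y by (simp add: divide_le_eq)
  qed
  define I where "I = Inf ?S"
  show ?thesis unfolding Gnorm_def I_def[symmetric] unfolding G_bound_env mult.assoc
  proof (intro conjI allI impI)
    show "\<bar>f y\<bar> \<le> I * env \<gamma> r x y" for y
      unfolding I_def by (rule lim) (auto simp: G_bound_env)
    show "\<bar>f y - f y'\<bar> \<le> I * ((dist y y' / (r + dist x y)) powr \<beta> * env \<gamma> r x y)"
      if "dist y y' \<le> (r + dist x y) / 2" for y y'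
      unfolding I_def by (rule lim) (use that in \<open>auto simp: G_bound_env mult.assoc\<close>)
  qed
qed

lemma Gnorm_nonneg: "f \<in> Gsp M x r \<beta> \<gamma> \<Longrightarrow> 0 < r \<Longrightarrow> 0 \<le> Gnorm M x r \<beta> \<gamma> f"
  using G_bound_nonneg[OF Gnorm_bound] by blast

lemma GspI: "G_bound M x r \<beta> \<gamma> f C \<Longrightarrow> f \<in> Gsp M x r \<beta> \<gamma>"
  by (auto simp: Gsp_def)

lemma Gsp_mono: "f \<in> Gsp M x r \<beta> \<gamma> \<Longrightarrow> 0 < r \<Longrightarrow> \<beta>' \<le> \<beta> \<Longrightarrow> \<gamma>' \<le> \<gamma> \<Longrightarrow> f \<in> Gsp M x r \<beta>' \<gamma>'"
  using G_bound_mono_exp[OF Gnorm_bound] by (blast intro: GspI)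

lemma G0_I:
  assumes f: "f \<in> Gsp M x r \<epsilon> \<epsilon>" and r: "0 < r" and e: "\<beta> \<le> \<epsilon>" "\<gamma> \<le> \<epsilon>"
  shows "f \<in> G0 M \<epsilon> x r \<beta> \<gamma>"
proof -
  have "G_bound M x r \<beta> \<gamma> (\<lambda>y. f y - f y) 0" by (simp add: G_bound_env)
  from Gnorm_le[OF this r] have "Gnorm M x r \<beta> \<gamma> (\<lambda>y. f y - f y) \<le> 0" .
  then have "\<forall>e>0. \<exists>g\<in>Gsp M x r \<epsilon> \<epsilon>. Gnorm M x r \<beta> \<gamma> (\<lambda>y. f y - g y) < e"
    using f by (intro allI impI bexI[of _ f]) auto
  then show ?thesis unfolding G0_def using Gsp_mono[OF f r e] by simp
qed

lemma G0_Gsp: "f \<in> G0 M \<epsilon> x r \<beta> \<gamma> \<Longrightarrow> f \<in> Gsp M x r \<beta> \<gamma>" by (simp add: G0_def)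

lemma G0_lin:
  assumes f: "f \<in> G0 M \<epsilon> x r \<beta> \<gamma>" and h: "h \<in> G0 M \<epsilon> x r \<beta> \<gamma>" and r: "0 < r" and e: "\<beta> \<le> \<epsilon>" "\<gamma> \<le> \<epsilon>"
  shows "(\<lambda>y. a * f y + c * h y) \<in> G0 M \<epsilon> x r \<beta> \<gamma>"
  unfolding G0_def
proof (intro CollectI conjI allI impI)
  show "(\<lambda>y. a * f y + c * h y) \<in> Gsp M x r \<beta> \<gamma>"
    using G_bound_lin[OF Gnorm_bound[OF G0_Gsp[OF f] r] Gnorm_bound[OF G0_Gsp[OF h] r]] by (rule GspI)
  fix \<eta> :: real assume \<eta>: "0 < \<eta>"
  define k where "k = \<bar>a\<bar> + \<bar>c\<bar> + 1"
  have k: "0 < k" by (simp add: k_def)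
  have "0 < \<eta> / k" using \<eta> k by simp
  then obtain f' h' where fh: "f' \<in> Gsp M x r \<epsilon> \<epsilon>" "Gnorm M x r \<beta> \<gamma> (\<lambda>y. f y - f' y) < \<eta> / k"
     "h' \<in> Gsp M x r \<epsilon> \<epsilon>" "Gnorm M x r \<beta> \<gamma> (\<lambda>y. h y - h' y) < \<eta> / k"
    using f h unfolding G0_def by blast
  have d: "(\<lambda>y. u y - v y) \<in> Gsp M x r \<beta> \<gamma>" if "u \<in> Gsp M x r \<beta> \<gamma>" "v \<in> Gsp M x r \<epsilon> \<epsilon>" for u v
    using GspI[OF G_bound_lin[OF Gnorm_bound[OF that(1) r] Gnorm_bound[OF Gsp_mono[OF that(2) r e] r], of 1 "-1"]] by simp
  have 1: "G_bound M x r \<beta> \<gamma> (\<lambda>y. f y - f' y) (\<eta> / k)"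
    by (rule G_bound_mono[OF Gnorm_bound[OF d[OF G0_Gsp[OF f] fh(1)] r]]) (use fh in simp)
  have 2: "G_bound M x r \<beta> \<gamma> (\<lambda>y. h y - h' y) (\<eta> / k)"
    by (rule G_bound_mono[OF Gnorm_bound[OF d[OF G0_Gsp[OF h] fh(3)] r]]) (use fh in simp)
  have "(\<lambda>y. a * f' y + c * h' y) \<in> Gsp M x r \<epsilon> \<epsilon>"
    using G_bound_lin[OF Gnorm_bound[OF fh(1) r] Gnorm_bound[OF fh(3) r]] by (rule GspI)
  moreover have "Gnorm M x r \<beta> \<gamma> (\<lambda>y. (a * f y + c * h y) - (a * f' y + c * h' y)) < \<eta>"
  proof -
    have eq: "(\<lambda>y. (a * f y + c * h y) - (a * f' y + c * h' y)) = (\<lambda>y. a * (f y - f' y) + c * (h y - h' y))"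
      by (simp add: algebra_simps)
    have "Gnorm M x r \<beta> \<gamma> (\<lambda>y. a * (f y - f' y) + c * (h y - h' y)) \<le> \<bar>a\<bar> * (\<eta> / k) + \<bar>c\<bar> * (\<eta> / k)"
      by (rule Gnorm_le[OF G_bound_lin[OF 1 2] r])
    also have "\<dots> = (\<bar>a\<bar> + \<bar>c\<bar>) * (\<eta> / k)" by (simp only: distrib_right)
    also have "\<dots> < k * (\<eta> / k)" using \<eta> k by (intro mult_strict_right_mono) (auto simp: k_def)
    also have "\<dots> = \<eta>" using k by simp
    finally show ?thesis unfolding eq .
  qed
  ultimately show "\<exists>g\<in>Gsp M x r \<epsilon> \<epsilon>. Gnorm M x r \<beta> \<gamma> (\<lambda>y. a * f y + c * h y - g y) < \<eta>"
    by (intro bexI[where x = "\<lambda>y. a * f' y + c * h' y"])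
qed

definition KR :: "'a \<Rightarrow> real \<Rightarrow> real \<Rightarrow> real \<Rightarrow> real" where
  "KR x \<beta> \<gamma> R = 2 * (2 * R + 2) powr \<beta> * (2 * V x (2 * R + 1) * (2 * R + 2) powr \<gamma>)"

text \<open>Interpolating the size \<open>a\<close> with the \<open>\<theta>\<close>-Hoelder
  constant \<open>B\<close> bounds the \<open>\<beta>\<close>-Hoelder constant by a multiple of
  \<open>a powr (1 - \<beta> / \<theta>) * B powr (\<beta> / \<theta>)\<close>. If
  \<open>\<beta> < \<theta>\<close> and \<open>B\<close> stays bounded, this tends to 0 with
  \<open>a\<close>: uniform smallness becomes smallness in the test function norm.\<close>

lemma supported_G_bound:
  assumes R: "0 < R" and \<beta>: "0 < \<beta>" "\<beta> \<le> \<theta>" and \<gamma>: "0 \<le> \<gamma>" and aB: "0 \<le> a" "0 \<le> B"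
    and sz: "\<And>y. \<bar>\<psi> y\<bar> \<le> a" and supp: "\<And>y. R \<le> dist x y \<Longrightarrow> \<psi> y = 0"
    and hol: "\<And>y z. \<bar>\<psi> y - \<psi> z\<bar> \<le> B * dist y z powr \<theta>"
  shows "G_bound M x 1 \<beta> \<gamma> \<psi> (KR x \<beta> \<gamma> R * (a + a powr (1 - \<beta> / \<theta>) * B powr (\<beta> / \<theta>)))"
proof -
  define s where "s = \<beta> / \<theta>"
  have s: "0 < s" "s \<le> 1" "\<theta> * s = \<beta>" using \<beta> by (auto simp: s_def)
  define W where "W = 2 * V x (2 * R + 1) * (2 * R + 2) powr \<gamma>"
  have VR: "0 < V x (2 * R + 1)" using R by (intro V_pos) simp
  have W: "0 < W" using VR R by (simp add: W_def)
  have low: "1 \<le> W * env \<gamma> 1 x y" if d: "dist x y \<le> 2 * R + 1" for y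
  proof -
    let ?d = "dist x y"
    have "V x 1 + V x ?d \<le> V x (2 * R + 1) + V x (2 * R + 1)" using d R by (intro add_mono V_mono) auto
    moreover have p: "0 < V x 1 + V x ?d" using V_pos[of 1 x] by (simp add: add_pos_nonneg)
    ultimately have 1: "1 \<le> 2 * V x (2 * R + 1) * (1 / (V x 1 + V x ?d))" by (simp add: divide_simps)
    have "(1 / (2 * R + 2)) powr \<gamma> \<le> (1 / (1 + ?d)) powr \<gamma>"
      using d R \<gamma> by (intro powr_mono2 divide_left_mono) (auto simp: add_pos_nonneg intro!: mult_pos_pos)
    then have "(2 * R + 2) powr \<gamma> * (1 / (2 * R + 2)) powr \<gamma> \<le> (2 * R + 2) powr \<gamma> * (1 / (1 + ?d)) powr \<gamma>" by (intro mult_left_mono) auto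
    moreover have "(2 * R + 2) powr \<gamma> * (1 / (2 * R + 2)) powr \<gamma> = 1" using R by (simp add: powr_mult[symmetric])
    ultimately have 2: "1 \<le> (2 * R + 2) powr \<gamma> * (1 / (1 + ?d)) powr \<gamma>" by argo
    have "1 * 1 \<le> (2 * V x (2 * R + 1) * (1 / (V x 1 + V x ?d))) * ((2 * R + 2) powr \<gamma> * (1 / (1 + ?d)) powr \<gamma>)"
      using VR by (intro mult_mono 1 2) auto
    then show ?thesis by (simp add: W_def env_def Vr_V Vxy_V mult_ac)
  qed
  define k where "k = 2 * (2 * R + 2) powr \<beta>"
  have k: "2 \<le> k" using R \<beta> by (simp add: k_def ge_one_powr_ge_zero)
  define A where "A = a + a powr (1 - s) * B powr s"
  have A: "0 \<le> A" "a \<le> A" "a powr (1 - s) * B powr s \<le> A" using aB by (auto simp: A_def)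
  have KR: "KR x \<beta> \<gamma> R = k * W" by (simp add: KR_def k_def W_def)
  show ?thesis unfolding s_def[symmetric] A_def[symmetric] KR G_bound_env
  proof (intro conjI allI impI)
    fix y
    show "\<bar>\<psi> y\<bar> \<le> k * W * A * env \<gamma> 1 x y"
    proof (cases "R \<le> dist x y")
      case True then show ?thesis using supp[OF True] k W A by simp
    next
      case False
      have "\<bar>\<psi> y\<bar> \<le> A * 1" using sz[of y] A by simp
      also have "\<dots> \<le> A * (W * env \<gamma> 1 x y)" using False R by (intro mult_left_mono low A) auto
      also have "\<dots> \<le> k * (A * (W * env \<gamma> 1 x y))" using k A W mult_right_mono[of 1 k "A * (W * env \<gamma> 1 x y)"] by simp
      finally show ?thesis by (simp add: mult_ac)
    qed
    fix y' assume d: "dist y y' \<le> (1 + dist x y) / 2"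
    let ?d = "dist y y'" and ?q = "dist y y' / (1 + dist x y)"
    have pos: "0 < 1 + dist x y" by (simp add: add_pos_nonneg)
    show "\<bar>\<psi> y - \<psi> y'\<bar> \<le> k * W * A * ?q powr \<beta> * env \<gamma> 1 x y"
    proof (cases "R \<le> dist x y \<and> R \<le> dist x y'")
      case True then show ?thesis using supp[of y] supp[of y'] k W A by simp
    next
      case False
      have "dist x y \<le> dist x y' + ?d" using dist_triangle[of x y y'] by (simp add: dist_commute)
      then have near: "dist x y \<le> 2 * R + 1" using False d R by argo
      have "\<bar>\<psi> y - \<psi> y'\<bar> \<le> 2 * a" using sz[of y] sz[of y'] by linarith
      from interpolate[OF _ this hol[of y y'], of s] s
      have "\<bar>\<psi> y - \<psi> y'\<bar> \<le> (2 * a) powr (1 - s) * (B * ?d powr \<theta>) powr s" by simp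
      also have "\<dots> = 2 powr (1 - s) * (a powr (1 - s) * B powr s) * ?d powr \<beta>"
        using s by (simp add: powr_mult powr_powr mult_ac)
      also have "\<dots> \<le> 2 * A * ?d powr \<beta>"
      proof (intro mult_right_mono mult_mono A)
        show "2 powr (1 - s) \<le> (2::real)" using powr_mono[of "1 - s" 1 "2::real"] s by simp
      qed auto
      also have "?d powr \<beta> = ?q powr \<beta> * (1 + dist x y) powr \<beta>" using pos by (simp add: powr_mult[symmetric])
      also have "2 * A * (?q powr \<beta> * (1 + dist x y) powr \<beta>) \<le> 2 * A * (?q powr \<beta> * (2 * R + 2) powr \<beta>)"
        using near A \<beta> pos by (intro mult_left_mono powr_mono2) auto
      also have "\<dots> = k * A * ?q powr \<beta> * 1" by (simp add: k_def mult_ac)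
      also have "\<dots> \<le> k * A * ?q powr \<beta> * (W * env \<gamma> 1 x y)" using k A by (intro mult_left_mono low near) auto
      finally show ?thesis by (simp add: mult_ac)
    qed
  qed
qed

lemma bump_Gsp:
  assumes "bump x \<theta> \<psi>" "0 < \<beta>" "\<beta> \<le> \<theta>" "0 \<le> \<gamma>" shows "\<psi> \<in> Gsp M x 1 \<beta> \<gamma>"
proof -
  from assms(1) obtain R B where "0 < R" "0 \<le> B" "\<And>y. \<bar>\<psi> y\<bar> \<le> B" "\<And>y. R \<le> dist x y \<Longrightarrow> \<psi> y = 0"
     "\<And>y z. \<bar>\<psi> y - \<psi> z\<bar> \<le> B * dist y z powr \<theta>" unfolding bump_def by (elim exE conjE) blast
  from GspI[OF supported_G_bound[OF this(1) assms(2-4) this(2,2,3,4,5)]] show ?thesis .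
qed

lemma inverse_V_le:
  assumes t: "0 < t" and k: "D * 3 powr n / V z t \<le> k" and d: "dist z y \<le> 2 * t"
  shows "1 / V y t \<le> k"
proof -
  have "V z t \<le> D * 3 powr n * V y t" using t d by (intro V_compare) auto
  then have "1 / V y t \<le> D * 3 powr n / V z t"
    using V_pos[OF t, of z] V_pos[OF t, of y] by (simp add: divide_simps mult.commute)
  then show ?thesis using k by simp
qed

lemma Q_bound_k:
  assumes t: "0 < t" and kV: "D * 3 powr n / V z t \<le> k"
  shows "\<bar>Q t z y\<bar> \<le> Kq * k" and "\<bar>Q t z y - Q t z y'\<bar> \<le> 4 * Kq * k / t * dist y y'"
proof -
  have "0 \<le> D * 3 powr n / V z t" using D1 by simp
  then have k: "0 \<le> k" using kV by simp
  note inv = inverse_V_le[OF t kV]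
  have sz: "\<bar>Q t z y\<bar> \<le> Kq * k" for y
  proof (cases "t \<le> dist z y")
    case True then show ?thesis using Q_zero[OF t True] Kq(3) k by simp
  next
    case False
    then have "Kq * (1 / V y t) \<le> Kq * k" using Kq(3) t by (intro mult_left_mono inv) auto
    then show ?thesis using Q_size[OF t, of z y] by simp
  qed
  have lip: "\<bar>Q t z y - Q t z y'\<bar> \<le> 4 * Kq * k / t * dist y y'" for y y'
  proof (cases "dist y y' \<le> t / 2")
    case True
    show ?thesis
    proof (cases "2 * t < dist z y")
      case far: True
      then have "t \<le> dist z y" "t \<le> dist z y'" using True t dist_triangle[of z y y'] by (auto simp: dist_commute)
      then show ?thesis using Q_zero[OF t] Kq(3) k t by simp
    next
      case False
      have "Kq * (dist y y' / t) * (1 / V y t) \<le> Kq * (dist y y' / t) * k"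
        using Kq(3) t False by (intro mult_left_mono inv) auto
      also have "\<dots> \<le> 4 * (Kq * (dist y y' / t) * k)"
      proof -
        have "0 \<le> Kq * (dist y y' / t) * k" using Kq(3) t k by simp
        then show ?thesis by linarith
      qed
      also have "\<dots> = 4 * Kq * k / t * dist y y'" by simp
      finally show ?thesis using Q_lip2[OF t True, of z] by simp
    qed
  next
    case False
    have "\<bar>Q t z y - Q t z y'\<bar> \<le> 2 * Kq * k * 1" using sz[of y] sz[of y'] by linarith
    also have "\<dots> \<le> 2 * Kq * k * (2 * dist y y' / t)"
      using False t Kq(3) k by (intro mult_left_mono) (auto simp: divide_simps)
    finally show ?thesis by (simp add: mult_ac)
  qed
  show "\<bar>Q t z y\<bar> \<le> Kq * k" "\<bar>Q t z y - Q t z y'\<bar> \<le> 4 * Kq * k / t * dist y y'" by (rule sz, rule lip)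
qed

lemma Q_bound_z:
  assumes t: "0 < t" shows "\<exists>B\<ge>0. (\<forall>y. \<bar>Q t z y\<bar> \<le> B) \<and> (\<forall>y y'. \<bar>Q t z y - Q t z y'\<bar> \<le> B * dist y y')"
proof -
  define k where "k = D * 3 powr n / V z t"
  have k: "0 \<le> k" using D1 by (simp add: k_def)
  note bd = Q_bound_k[OF t, of z k]
  define B where "B = max (Kq * k) (4 * Kq * k / t)"
  have "0 \<le> B" using Kq(3) k by (simp add: B_def le_max_iff_disj)
  moreover have "\<bar>Q t z y\<bar> \<le> B" for y using bd(1)[of y] by (simp add: B_def k_def le_max_iff_disj)
  moreover have "\<bar>Q t z y - Q t z y'\<bar> \<le> B * dist y y'" for y y'
    using order.trans[OF bd(2)[of y y'] mult_right_mono[of _ B "dist y y'"]] by (simp add: B_def k_def)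
  ultimately show ?thesis by blast
qed

lemma Q_bump:
  assumes t: "0 < t" shows "bump x 1 (Q t z)"
proof -
  from Q_bound_z[OF t, of z] obtain B where B: "0 \<le> B" "\<forall>y. \<bar>Q t z y\<bar> \<le> B" "\<forall>y y'. \<bar>Q t z y - Q t z y'\<bar> \<le> B * dist y y'"
    by (elim exE conjE)
  show ?thesis unfolding bump_def
  proof (rule exI[of _ "dist x z + t"], rule exI[of _ B], intro conjI allI impI)
    show "Q t z y = 0" if "dist x z + t \<le> dist x y" for y
      using that dist_triangle[of x y z] by (intro Q_zero t) simp
  qed (use B t in \<open>auto simp: add_nonneg_pos\<close>)
qed

lemma Q_G0:
  assumes t: "0 < t" and e: "0 < \<epsilon>" "\<epsilon> \<le> 1" "\<beta> \<le> \<epsilon>" "\<gamma> \<le> \<epsilon>"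
  shows "Q t z \<in> G0 M \<epsilon> x 1 \<beta> \<gamma>"
  using e by (intro G0_I bump_Gsp[OF Q_bump[OF t]]) auto

text \<open>The hypothesis on \<open>L\<close> is a single instance of linearity, available for
  functionals in the dual as well as for pairings. The summand with coefficient 0 fits it to the
  two-term form of linearity in \<open>Gdual\<close>.\<close>

lemma Gmax_ge_Q:
  assumes t: "0 < t" "t < \<rho> z" and e: "0 < \<epsilon>" "\<epsilon> \<le> 1" "\<beta> \<le> \<epsilon>" "\<gamma> \<le> \<epsilon>" and bg: "0 < \<beta>" "0 < \<gamma>"
    and L: "L (\<lambda>y. (1 / CQ \<gamma>) * Q t z y + 0 * Q t z y) = (1 / CQ \<gamma>) * L (Q t z) + 0 * L (Q t z)"
  shows "ennreal (1 / CQ \<gamma>) * ennreal \<bar>L (Q t z)\<bar> \<le> Gmax M \<rho> \<epsilon> x \<beta> \<gamma> L z"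
proof -
  define \<phi> where "\<phi> = (\<lambda>y. (1 / CQ \<gamma>) * Q t z y + 0 * Q t z y)"
  have C: "0 < CQ \<gamma>" by (rule CQ_pos)
  have QG: "Q t z \<in> G0 M \<epsilon> x 1 \<beta> \<gamma>" by (rule Q_G0[OF t(1) e])
  have "\<phi> \<in> G0 M \<epsilon> x 1 \<beta> \<gamma>" unfolding \<phi>_def by (rule G0_lin[OF QG QG _ e(3,4)]) simp
  moreover have G: "G_bound M z t \<beta> \<gamma> \<phi> 1"
  proof -
    have "G_bound M z t \<beta> \<gamma> (Q t z) (CQ \<gamma>)" using e bg by (intro Q_G_bound t) auto
    from G_bound_lin[OF this this, of "1 / CQ \<gamma>" 0] show ?thesis using C by (simp add: \<phi>_def)
  qed
  moreover have "Gnorm M z t \<beta> \<gamma> \<phi> \<le> 1" by (rule Gnorm_le[OF G t(1)])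
  ultimately have "\<phi> \<in> {\<phi> \<in> G0 M \<epsilon> x 1 \<beta> \<gamma>. \<exists>r. 0 < r \<and> r < \<rho> z \<and> \<phi> \<in> Gsp M z r \<beta> \<gamma> \<and> Gnorm M z r \<beta> \<gamma> \<phi> \<le> 1}"
    using t GspI[OF G] by blast
  then have "ennreal \<bar>L \<phi>\<bar> \<le> Gmax M \<rho> \<epsilon> x \<beta> \<gamma> L z" unfolding Gmax_def by (rule SUP_upper)
  moreover have "ennreal \<bar>L \<phi>\<bar> = ennreal (1 / CQ \<gamma>) * ennreal \<bar>L (Q t z)\<bar>"
    unfolding \<phi>_def L using C by (simp add: ennreal_mult'[symmetric] abs_mult)
  ultimately show ?thesis by simp
qed

end

section \<open>The Hardy norm bounded by the maximal function along a countable set of radii\<close>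

context kernel_regular
begin

lemma cls_pairing_le:
  assumes G: "\<forall>x r \<phi>. 0 < r \<longrightarrow> r < \<rho> x \<longrightarrow> cls x r 1 1 \<phi> \<longrightarrow> ennreal \<bar>\<integral>y. f y * \<phi> y \<partial>M\<bar> \<le> G x"
    and r: "0 < r" "r < \<rho> x" and \<phi>: "G_bound M x r \<beta> \<gamma> \<phi> A" and A: "0 < A" and ex: "b \<le> \<beta>" "g \<le> \<gamma>"
  shows "ennreal \<bar>\<integral>y. f y * \<phi> y \<partial>M\<bar> \<le> ennreal (KG * A) * G x"
proof -
  have K: "0 < KG * A" using A D1 by (simp add: KG_def)
  have "cls x r (KG * A) (KG * A) \<phi>" using A by (intro G_bound_cls[OF \<phi> r(1) _ ex b1]) simp
  from cls_scale[OF this K] have "cls x r 1 1 (\<lambda>y. \<phi> y / (KG * A))" .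
  with G r have le: "ennreal \<bar>\<integral>y. f y * (\<phi> y / (KG * A)) \<partial>M\<bar> \<le> G x" by blast
  have eq: "(\<integral>y. f y * (\<phi> y / (KG * A)) \<partial>M) = (\<integral>y. f y * \<phi> y \<partial>M) / (KG * A)" by simp
  have sc: "\<bar>X\<bar> = k * \<bar>X / k\<bar>" if "0 < k" for X k :: real using that by simp
  have "\<bar>\<integral>y. f y * \<phi> y \<partial>M\<bar> = KG * A * \<bar>\<integral>y. f y * (\<phi> y / (KG * A)) \<partial>M\<bar>"
    unfolding eq by (rule sc[OF K])
  then have "ennreal \<bar>\<integral>y. f y * \<phi> y \<partial>M\<bar> = ennreal (KG * A) * ennreal \<bar>\<integral>y. f y * (\<phi> y / (KG * A)) \<partial>M\<bar>"
    using K by (simp only:) (rule ennreal_mult, auto)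
  also have "\<dots> \<le> ennreal (KG * A) * G x" by (intro mult_left_mono le) simp
  finally show ?thesis .
qed

lemma KG_pos: "0 < KG" using D1 by (simp add: KG_def)

theorem H1norm_le_dmax:
  assumes f: "integrable M f" and ex: "b \<le> \<beta>" "g \<le> \<gamma>"
  shows "H1norm M \<rho> \<epsilon> x1 \<beta> \<gamma> (pairing M f) \<le> ennreal (KG * KF) * (\<integral>\<^sup>+z. dmax P f z \<partial>M)"
proof -
  from grand_majorant[OF f] obtain G where Gm[measurable]: "G \<in> borel_measurable M"
    and G: "\<forall>x r \<phi>. 0 < r \<longrightarrow> r < \<rho> x \<longrightarrow> cls x r 1 1 \<phi> \<longrightarrow> ennreal \<bar>\<integral>y. f y * \<phi> y \<partial>M\<bar> \<le> G x"
    and GI: "(\<integral>\<^sup>+x. G x \<partial>M) \<le> ennreal KF * (\<integral>\<^sup>+z. dmax P f z \<partial>M)" by (elim bexE conjE)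
  have "Gmax M \<rho> \<epsilon> x1 \<beta> \<gamma> (pairing M f) x \<le> ennreal KG * G x" for x
    unfolding Gmax_def
  proof (rule SUP_least)
    fix \<phi> assume "\<phi> \<in> {\<phi> \<in> G0 M \<epsilon> x1 1 \<beta> \<gamma>. \<exists>r. 0 < r \<and> r < \<rho> x \<and> \<phi> \<in> Gsp M x r \<beta> \<gamma> \<and> Gnorm M x r \<beta> \<gamma> \<phi> \<le> 1}"
    then obtain r where r: "0 < r" "r < \<rho> x" "\<phi> \<in> Gsp M x r \<beta> \<gamma>" "Gnorm M x r \<beta> \<gamma> \<phi> \<le> 1" by blast
    have B: "G_bound M x r \<beta> \<gamma> \<phi> 1" by (rule G_bound_mono[OF Gnorm_bound[OF r(3,1)] r(4)])
    show "ennreal \<bar>pairing M f \<phi>\<bar> \<le> ennreal KG * G x"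
      using cls_pairing_le[OF G r(1,2) B _ ex] by (simp add: pairing_def)
  qed
  then have "H1norm M \<rho> \<epsilon> x1 \<beta> \<gamma> (pairing M f) \<le> (\<integral>\<^sup>+x. ennreal KG * G x \<partial>M)"
    unfolding H1norm_def by (intro nn_integral_mono)
  also have "\<dots> = ennreal KG * (\<integral>\<^sup>+x. G x \<partial>M)" by (intro nn_integral_cmult) measurable
  also have "\<dots> \<le> ennreal KG * (ennreal KF * (\<integral>\<^sup>+z. dmax P f z \<partial>M))" by (intro mult_left_mono GI) simp
  also have "\<dots> = ennreal (KG * KF) * (\<integral>\<^sup>+z. dmax P f z \<partial>M)" using KG_pos KF_pos by (simp add: ennreal_mult' mult.assoc)
  finally show ?thesis .
qed

end

text \<open>Riesz by minimisation in the pre-Hilbert space \<open>H\<close> with weight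
  \<open>v\<close>. The functional \<open>ip \<phi> \<phi> - 2 * L \<phi>\<close> is bounded below,
  by domination and completing the square. A minimising sequence is Cauchy in the weighted square
  norm by the parallelogram law, and since \<open>v\<close> has finite mass its products with
  \<open>v\<close> converge in the integral norm; the limit is \<open>f\<close>, so \<open>H\<close>
  need not be completed.\<close>

lemma riesz_dominated:
  fixes L :: "('b \<Rightarrow> real) \<Rightarrow> real" and v :: "'b \<Rightarrow> real"
  assumes v: "integrable N v" "\<And>x. 0 \<le> v x"
    and H: "\<And>\<phi>. \<phi> \<in> H \<Longrightarrow> \<phi> \<in> borel_measurable N" "\<And>\<phi>. \<phi> \<in> H \<Longrightarrow> \<exists>B. \<forall>x. \<bar>\<phi> x\<bar> \<le> B" "H \<noteq> {}"
    and Hlin: "\<And>\<phi> \<psi> a c. \<phi> \<in> H \<Longrightarrow> \<psi> \<in> H \<Longrightarrow> (\<lambda>x. a * \<phi> x + c * \<psi> x) \<in> H"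
    and Llin: "\<And>\<phi> \<psi> a c. \<phi> \<in> H \<Longrightarrow> \<psi> \<in> H \<Longrightarrow> L (\<lambda>x. a * \<phi> x + c * \<psi> x) = a * L \<phi> + c * L \<psi>"
    and dom: "\<And>\<phi>. \<phi> \<in> H \<Longrightarrow> \<bar>L \<phi>\<bar> \<le> (\<integral>x. \<bar>\<phi> x\<bar> * v x \<partial>N)"
  shows "\<exists>f. integrable N f \<and> (\<forall>\<phi>\<in>H. L \<phi> = (\<integral>x. f x * \<phi> x \<partial>N))"
proof -
  have [measurable]: "v \<in> borel_measurable N" using v by auto
  have ib: "integrable N (\<lambda>x. h x * v x)" if [measurable]: "h \<in> borel_measurable N" and "\<And>x. \<bar>h x\<bar> \<le> B" for h B
  proof (rule Bochner_Integration.integrable_bound)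
    show "integrable N (\<lambda>x. B * v x)" using v by simp
    have "\<bar>h x\<bar> * v x \<le> \<bar>B\<bar> * v x" for x using that(2)[of x] v(2)[of x] by (intro mult_right_mono) auto
    then show "AE x in N. norm (h x * v x) \<le> norm (B * v x)" using v(2) by (intro AE_I2) (simp add: abs_mult)
  qed measurable
  have i1: "integrable N (\<lambda>x. \<phi> x * v x)" "integrable N (\<lambda>x. \<bar>\<phi> x\<bar> * v x)" if "\<phi> \<in> H" for \<phi>
  proof -
    from H(2)[OF that] obtain B where B: "\<forall>x. \<bar>\<phi> x\<bar> \<le> B" by (elim exE)
    note H(1)[OF that, measurable]
    show "integrable N (\<lambda>x. \<phi> x * v x)" by (rule ib[of \<phi> B]) (use B in auto)
    show "integrable N (\<lambda>x. \<bar>\<phi> x\<bar> * v x)" by (rule ib[of "\<lambda>x. \<bar>\<phi> x\<bar>" B]) (use B in auto)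
  qed
  have i2: "integrable N (\<lambda>x. \<phi> x * \<psi> x * v x)" if "\<phi> \<in> H" "\<psi> \<in> H" for \<phi> \<psi>
  proof -
    from H(2)[OF that(1)] obtain B where B: "\<forall>x. \<bar>\<phi> x\<bar> \<le> B" by (elim exE)
    from H(2)[OF that(2)] obtain B' where B': "\<forall>x. \<bar>\<psi> x\<bar> \<le> B'" by (elim exE)
    note H(1)[OF that(1), measurable] H(1)[OF that(2), measurable]
    have "\<bar>\<phi> x * \<psi> x\<bar> \<le> B * B'" for x unfolding abs_mult using B B' by (intro mult_mono) (auto intro: order.trans[OF abs_ge_zero])
    then show ?thesis by (intro ib[of "\<lambda>x. \<phi> x * \<psi> x" "B * B'"]) auto
  qed
  define ip where "ip \<phi> \<psi> = (\<integral>x. \<phi> x * \<psi> x * v x \<partial>N)" for \<phi> \<psi>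
  define Q where "Q \<phi> = ip \<phi> \<phi> - 2 * L \<phi>" for \<phi>
  define W where "W = (\<integral>x. v x \<partial>N)"
  have ip_add: "ip (\<lambda>x. a * \<phi> x + c * \<psi> x) (\<lambda>x. a * \<phi> x + c * \<psi> x) = a\<^sup>2 * ip \<phi> \<phi> + 2 * a * c * ip \<phi> \<psi> + c\<^sup>2 * ip \<psi> \<psi>"
    if "\<phi> \<in> H" "\<psi> \<in> H" for \<phi> \<psi> a c
  proof -
    have "ip (\<lambda>x. a * \<phi> x + c * \<psi> x) (\<lambda>x. a * \<phi> x + c * \<psi> x) =
       (\<integral>x. a\<^sup>2 * (\<phi> x * \<phi> x * v x) + 2 * a * c * (\<phi> x * \<psi> x * v x) + c\<^sup>2 * (\<psi> x * \<psi> x * v x) \<partial>N)"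
      unfolding ip_def by (intro Bochner_Integration.integral_cong) (auto simp: algebra_simps power2_eq_square)
    then show ?thesis using i2[OF that] i2[OF that(1,1)] i2[OF that(2,2)] by (simp add: ip_def)
  qed
  have Q_low: "- W \<le> Q \<phi>" if "\<phi> \<in> H" for \<phi>
  proof -
    have "(\<integral>x. - v x \<partial>N) \<le> (\<integral>x. \<phi> x * \<phi> x * v x - 2 * (\<bar>\<phi> x\<bar> * v x) \<partial>N)"
    proof (rule integral_mono)
      fix x
      have "0 \<le> (\<bar>\<phi> x\<bar> - 1)\<^sup>2 * v x" using v(2) by simp
      also have "(\<bar>\<phi> x\<bar> - 1)\<^sup>2 = \<phi> x * \<phi> x - 2 * \<bar>\<phi> x\<bar> + 1" by (simp add: power2_eq_square algebra_simps abs_mult_self_eq)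
      finally show "- v x \<le> \<phi> x * \<phi> x * v x - 2 * (\<bar>\<phi> x\<bar> * v x)" by (simp add: algebra_simps)
    qed (use v i2[OF that that] i1[OF that] in auto)
    also have "\<dots> = ip \<phi> \<phi> - 2 * (\<integral>x. \<bar>\<phi> x\<bar> * v x \<partial>N)" using i2[OF that that] i1[OF that] by (simp add: ip_def)
    also have "\<dots> \<le> Q \<phi>" using dom[OF that] by (simp add: Q_def)
    finally show ?thesis by (simp add: W_def)
  qed
  define I where "I = Inf (Q ` H)"
  have bdd: "bdd_below (Q ` H)" by (rule bdd_belowI[of _ "- W"]) (use Q_low in auto)
  have I_le: "I \<le> Q \<phi>" if "\<phi> \<in> H" for \<phi> unfolding I_def using that by (intro cInf_lower bdd) auto
  \<comment> \<open>The rate is \<open>s^3\<close> for \<open>s = (1/2)^n\<close>: perturbing the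
    minimiser by a multiple \<open>s\<close> of a test element and dividing by \<open>s\<close>
    still leaves an error of order \<open>s\<close>.\<close>
  have "\<exists>\<phi>. \<phi> \<in> H \<and> Q \<phi> < I + (1/8) ^ n" for n
  proof -
    have "Inf (Q ` H) < I + (1/8) ^ n" by (simp add: I_def)
    then show ?thesis using H(3) bdd by (subst (asm) cInf_less_iff) auto
  qed
  then obtain \<phi> where \<phi>: "\<And>n. \<phi> n \<in> H" "\<And>n::nat. Q (\<phi> n) < I + (1/8) ^ n" by metis
  have Q_add: "Q (\<lambda>x. a * \<alpha> x + c * \<psi> x) = a\<^sup>2 * ip \<alpha> \<alpha> + 2 * a * c * ip \<alpha> \<psi> + c\<^sup>2 * ip \<psi> \<psi> - 2 * (a * L \<alpha> + c * L \<psi>)"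
    if "\<alpha> \<in> H" "\<psi> \<in> H" for \<alpha> \<psi> a c
    unfolding Q_def using ip_add[OF that] Llin[OF that] by simp
  have EL: "\<bar>ip (\<phi> n) \<psi> - L \<psi>\<bar> \<le> (1/2) ^ n * (1 + ip \<psi> \<psi>)" if \<psi>: "\<psi> \<in> H" for n \<psi>
  proof -
    define s where "s = (1/2::real) ^ n"
    have s: "0 < s" "s \<le> 1" by (auto simp: s_def power_le_one)
    have s3: "(1/8::real) ^ n = s * s\<^sup>2" by (simp add: s_def power_mult_distrib[symmetric] power2_eq_square)
    have Y: "0 \<le> ip \<psi> \<psi>" unfolding ip_def using v(2) by (intro Bochner_Integration.integral_nonneg) auto
    have *: "- (s * s\<^sup>2) \<le> 2 * c * (ip (\<phi> n) \<psi> - L \<psi>) + c\<^sup>2 * ip \<psi> \<psi>" for c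
    proof -
      have "(\<lambda>x. 1 * \<phi> n x + c * \<psi> x) \<in> H" by (rule Hlin[OF \<phi>(1) \<psi>])
      from I_le[OF this] have "I \<le> Q (\<phi> n) + (2 * c * (ip (\<phi> n) \<psi> - L \<psi>) + c\<^sup>2 * ip \<psi> \<psi>)"
        unfolding Q_add[OF \<phi>(1) \<psi>] by (simp add: Q_def algebra_simps)
      then show ?thesis using \<phi>(2)[of n] unfolding s3 by linarith
    qed
    have "2 * s * \<bar>ip (\<phi> n) \<psi> - L \<psi>\<bar> \<le> s * s\<^sup>2 + s\<^sup>2 * ip \<psi> \<psi>"
    proof -
      have "\<bar>2 * s * (ip (\<phi> n) \<psi> - L \<psi>)\<bar> \<le> s * s\<^sup>2 + s\<^sup>2 * ip \<psi> \<psi>"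
        using *[of s] *[of "- s"] by (intro abs_leI) auto
      then show ?thesis using s by (simp add: abs_mult)
    qed
    then have "s * (2 * \<bar>ip (\<phi> n) \<psi> - L \<psi>\<bar>) \<le> s * (s\<^sup>2 + s * ip \<psi> \<psi>)" by (simp add: algebra_simps power2_eq_square)
    then have "2 * \<bar>ip (\<phi> n) \<psi> - L \<psi>\<bar> \<le> s\<^sup>2 + s * ip \<psi> \<psi>" using s by simp
    also have "s\<^sup>2 \<le> s" using s by (simp add: power2_eq_square mult_left_le)
    finally have "2 * \<bar>ip (\<phi> n) \<psi> - L \<psi>\<bar> \<le> s * (1 + ip \<psi> \<psi>)" by (simp add: algebra_simps)
    then show ?thesis unfolding s_def by (rule order.trans[rotated]) simp
  qed
  define \<Delta> where "\<Delta> n x = \<phi> (Suc n) x - \<phi> n x" for n x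
  have \<Delta>H: "\<Delta> n \<in> H" for n
    using Hlin[OF \<phi>(1) \<phi>(1), of 1 "Suc n" "-1" n] by (simp add: \<Delta>_def[abs_def])
  have sq: "ip (\<Delta> n) (\<Delta> n) \<le> 4 * (1/8) ^ n" for n
  proof -
    have mid: "(\<lambda>x. 1/2 * \<phi> (Suc n) x + 1/2 * \<phi> n x) \<in> H" by (rule Hlin[OF \<phi>(1) \<phi>(1)])
    have eq: "\<Delta> n = (\<lambda>x. 1 * \<phi> (Suc n) x + (-1) * \<phi> n x)" by (simp add: \<Delta>_def[abs_def])
    \<comment> \<open>Parallelogram law; the midpoint belongs to \<open>H\<close>, so its value is
      at least the infimum.\<close>
    have "ip (\<Delta> n) (\<Delta> n) = 2 * Q (\<phi> (Suc n)) + 2 * Q (\<phi> n) - 4 * Q (\<lambda>x. 1/2 * \<phi> (Suc n) x + 1/2 * \<phi> n x)"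
      unfolding Q_add[OF \<phi>(1) \<phi>(1)] unfolding eq ip_add[OF \<phi>(1) \<phi>(1)] Q_def by (simp add: power2_eq_square algebra_simps)
    moreover have "(1/8::real) ^ Suc n \<le> (1/8) ^ n" by simp
    ultimately show ?thesis using \<phi>(2)[of "Suc n"] \<phi>(2)[of n] I_le[OF mid] by linarith
  qed
  define h where "h n x = \<Delta> n x * v x" for n x
  have [measurable]: "\<phi> n \<in> borel_measurable N" "\<Delta> n \<in> borel_measurable N" for n using H(1) \<phi>(1) \<Delta>H by auto
  have hi: "integrable N (h n)" for n unfolding h_def using i1(1)[OF \<Delta>H[of n]] by simp
  have hL1: "(\<integral>x. \<bar>h n x\<bar> \<partial>N) \<le> (2 + W) * (1/2) ^ n" for n
  proof -
    define s where "s = (1/2::real) ^ n"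
    have s: "0 < s" "s \<le> 1" by (auto simp: s_def power_le_one)
    have s3: "(1/8::real) ^ n = s * s * s" by (simp add: s_def power_mult_distrib[symmetric])
    \<comment> \<open>Arithmetic-geometric mean inequality with weight \<open>s\<close>, balancing
      the square norm of order \<open>s^3\<close> against the mass of \<open>v\<close>; both
      resulting terms are of order at most \<open>s\<close>.\<close>
    have "(\<integral>x. \<bar>h n x\<bar> \<partial>N) \<le> (\<integral>x. 1 / (2 * s) * (\<Delta> n x * \<Delta> n x * v x) + s / 2 * v x \<partial>N)"
    proof (rule integral_mono)
      fix x
      have "0 \<le> (\<bar>\<Delta> n x\<bar> - s)\<^sup>2" by simp
      then have "2 * s * \<bar>\<Delta> n x\<bar> \<le> \<Delta> n x * \<Delta> n x + s * s" by (simp add: power2_eq_square algebra_simps)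
      then have "\<bar>\<Delta> n x\<bar> \<le> 1 / (2 * s) * (\<Delta> n x * \<Delta> n x) + s / 2" using s by (simp add: field_simps)
      from mult_right_mono[OF this v(2)[of x]]
      show "\<bar>h n x\<bar> \<le> 1 / (2 * s) * (\<Delta> n x * \<Delta> n x * v x) + s / 2 * v x"
        using v(2)[of x] by (simp add: h_def abs_mult distrib_right)
    qed (use hi i2[OF \<Delta>H \<Delta>H, of n n] v in auto)
    also have "\<dots> = 1 / (2 * s) * ip (\<Delta> n) (\<Delta> n) + s / 2 * W"
      using i2[OF \<Delta>H \<Delta>H, of n n] v by (simp add: ip_def W_def)
    also have "\<dots> \<le> 1 / (2 * s) * (4 * (s * s * s)) + s / 2 * W"
      using sq[of n] s unfolding s3 by (intro add_right_mono mult_left_mono) auto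
    also have "\<dots> = 2 * (s * s) + s / 2 * W" using s by simp
    also have "\<dots> \<le> 2 * (s * 1) + s * W"
    proof -
      have "0 \<le> W" unfolding W_def using v by (intro Bochner_Integration.integral_nonneg) auto
      then have "s / 2 * W \<le> s * W" using s by (intro mult_right_mono) auto
      moreover have "s * s \<le> s * 1" using s by (intro mult_left_mono) auto
      ultimately show ?thesis by linarith
    qed
    finally show ?thesis by (simp add: s_def algebra_simps)
  qed
  have sumL1: "summable (\<lambda>n. \<integral>x. norm (h n x) \<partial>N)"
    by (rule summable_comparison_test'[where g = "\<lambda>n. (2 + W) * (1/2) ^ n" and N = 0])
       (use hL1 in \<open>auto intro!: summable_mult summable_geometric\<close>)
  have ae: "AE x in N. summable (\<lambda>n. norm (h n x))"
  proof -
    have [measurable]: "h n \<in> borel_measurable N" for n using hi by auto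
    have "(\<integral>\<^sup>+x. (\<Sum>n. ennreal (norm (h n x))) \<partial>N) = (\<Sum>n. \<integral>\<^sup>+x. ennreal (norm (h n x)) \<partial>N)"
      by (intro nn_integral_suminf) measurable
    also have "\<dots> = (\<Sum>n. ennreal (\<integral>x. norm (h n x) \<partial>N))"
      using hi by (intro arg_cong[where f = suminf] ext nn_integral_eq_integral) auto
    also have "\<dots> = ennreal (\<Sum>n. \<integral>x. norm (h n x) \<partial>N)"
      using sumL1 by (intro suminf_ennreal2) auto
    finally have "(\<integral>\<^sup>+x. (\<Sum>n. ennreal (norm (h n x))) \<partial>N) \<noteq> \<infinity>" by simp
    then have "AE x in N. (\<Sum>n. ennreal (norm (h n x))) \<noteq> \<infinity>" by (intro nn_integral_noteq_infinite) auto
    then show ?thesis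
    proof eventually_elim
      fix x assume "(\<Sum>n. ennreal (norm (h n x))) \<noteq> \<infinity>"
      then show "summable (\<lambda>n. norm (h n x))" by (intro summable_suminf_not_top) auto
    qed
  qed
  define f where "f x = \<phi> 0 x * v x + (\<Sum>n. h n x)" for x
  have f: "integrable N f"
    unfolding f_def using i1(1)[OF \<phi>(1)] integrable_suminf[OF hi ae sumL1] by simp
  have "L \<psi> = (\<integral>x. f x * \<psi> x \<partial>N)" if \<psi>: "\<psi> \<in> H" for \<psi>
  proof -
    from H(2)[OF \<psi>] obtain B where B: "\<forall>x. \<bar>\<psi> x\<bar> \<le> B" by (elim exE)
    note H(1)[OF \<psi>, measurable]
    have B0: "0 \<le> B" using B abs_ge_zero[of "\<psi> undefined"] by (meson order.trans)
    have [measurable]: "h n \<in> borel_measurable N" for n using hi by auto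
    have le: "\<bar>h n x * \<psi> x\<bar> \<le> B * \<bar>h n x\<bar>" for n x
      using mult_right_mono[of "\<bar>\<psi> x\<bar>" B "\<bar>h n x\<bar>"] B by (simp add: abs_mult mult.commute)
    have hi': "integrable N (\<lambda>x. h n x * \<psi> x)" for n
      by (rule Bochner_Integration.integrable_bound[of N "\<lambda>x. B * \<bar>h n x\<bar>"]) (use hi le B0 in \<open>auto intro!: AE_I2\<close>)
    have ae': "AE x in N. summable (\<lambda>n. norm (h n x * \<psi> x))"
      using ae
    proof eventually_elim
      fix x assume "summable (\<lambda>n. norm (h n x))"
      then show "summable (\<lambda>n. norm (h n x * \<psi> x))" unfolding norm_mult by (rule summable_mult2)
    qed
    have sum': "summable (\<lambda>n. \<integral>x. norm (h n x * \<psi> x) \<partial>N)"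
    proof (rule summable_comparison_test'[where N = 0])
      show "summable (\<lambda>n. B * (\<integral>x. norm (h n x) \<partial>N))" by (intro summable_mult sumL1)
      fix n
      have "(\<integral>x. norm (h n x * \<psi> x) \<partial>N) \<le> (\<integral>x. B * norm (h n x) \<partial>N)"
        using hi hi' le by (intro integral_mono) auto
      then show "norm (\<integral>x. norm (h n x * \<psi> x) \<partial>N) \<le> B * (\<integral>x. norm (h n x) \<partial>N)" by simp
    qed
    have s1: "(\<lambda>n. \<integral>x. h n x * \<psi> x \<partial>N) sums (\<integral>x. (\<Sum>n. h n x * \<psi> x) \<partial>N)"
      by (rule sums_integral[OF hi' ae' sum'])
    have part: "(\<Sum>i<n. \<integral>x. h i x * \<psi> x \<partial>N) = ip (\<phi> n) \<psi> - ip (\<phi> 0) \<psi>" for n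
    proof (induction n)
      case (Suc n)
      have "(\<integral>x. h n x * \<psi> x \<partial>N) = (\<integral>x. \<phi> (Suc n) x * \<psi> x * v x - \<phi> n x * \<psi> x * v x \<partial>N)"
        by (intro Bochner_Integration.integral_cong) (auto simp: h_def \<Delta>_def algebra_simps)
      also have "\<dots> = ip (\<phi> (Suc n)) \<psi> - ip (\<phi> n) \<psi>"
        unfolding ip_def using i2[OF \<phi>(1) \<psi>] by simp
      finally show ?case using Suc by simp
    qed simp
    have "(\<lambda>n. ip (\<phi> n) \<psi> - L \<psi>) \<longlonglongrightarrow> 0"
    proof (rule Lim_null_comparison)
      show "\<forall>\<^sub>F n in sequentially. norm (ip (\<phi> n) \<psi> - L \<psi>) \<le> (1/2) ^ n * (1 + ip \<psi> \<psi>)"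
        using EL[OF \<psi>] by (intro always_eventually allI) simp
      show "(\<lambda>n. (1/2) ^ n * (1 + ip \<psi> \<psi>)) \<longlonglongrightarrow> 0"
        by (intro tendsto_mult_left_zero LIMSEQ_power_zero) simp
    qed
    then have "(\<lambda>n. (ip (\<phi> n) \<psi> - L \<psi>) + (L \<psi> - ip (\<phi> 0) \<psi>)) \<longlonglongrightarrow> 0 + (L \<psi> - ip (\<phi> 0) \<psi>)"
      by (intro tendsto_add tendsto_const)
    then have "(\<lambda>n. \<integral>x. h n x * \<psi> x \<partial>N) sums (L \<psi> - ip (\<phi> 0) \<psi>)"
      unfolding sums_def part by (simp add: algebra_simps)
    then have 1: "L \<psi> = ip (\<phi> 0) \<psi> + (\<integral>x. (\<Sum>n. h n x * \<psi> x) \<partial>N)" using sums_unique2[OF s1] by simp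
    have "(\<integral>x. f x * \<psi> x \<partial>N) = (\<integral>x. \<phi> 0 x * \<psi> x * v x + (\<Sum>n. h n x * \<psi> x) \<partial>N)"
    proof (rule integral_cong_AE)
      show "AE x in N. f x * \<psi> x = \<phi> 0 x * \<psi> x * v x + (\<Sum>n. h n x * \<psi> x)"
        using ae
      proof eventually_elim
        fix x assume "summable (\<lambda>n. norm (h n x))"
        then have sm: "summable (\<lambda>n. h n x)" by (rule summable_norm_cancel)
        show "f x * \<psi> x = \<phi> 0 x * \<psi> x * v x + (\<Sum>n. h n x * \<psi> x)"
          unfolding f_def distrib_right suminf_mult2[OF sm] by simp
      qed
      show "(\<lambda>x. f x * \<psi> x) \<in> borel_measurable N" using f by measurable
      show "(\<lambda>x. \<phi> 0 x * \<psi> x * v x + (\<Sum>n. h n x * \<psi> x)) \<in> borel_measurable N" by measurable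
    qed
    also have "\<dots> = ip (\<phi> 0) \<psi> + (\<integral>x. (\<Sum>n. h n x * \<psi> x) \<partial>N)"
      unfolding ip_def using i2[OF \<phi>(1) \<psi>] integrable_suminf[OF hi' ae' sum'] by simp
    finally show ?thesis using 1 by simp
  qed
  then show ?thesis using f by blast
qed

section \<open>Smoothing with \<open>Q\<close> and density of bumps\<close>

context doubling_measure
begin

lemma Q_lip_z:
  assumes t: "0 < t" and k: "D * 3 powr n / V z t \<le> k" "D * 3 powr n / V z' t \<le> k"
  shows "\<bar>Q t z y - Q t z' y\<bar> \<le> Kq * k / t * dist z z'"
proof -
  have "0 \<le> D * 3 powr n / V z t" using D1 by simp
  then have k0: "0 \<le> k" using k by simp
  show ?thesis
  proof (cases "dist z y \<le> 2 * t")
    case True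
    have "Kq * (dist z z' / t) * (1 / V y t) \<le> Kq * (dist z z' / t) * k"
      using Kq(3) t True by (intro mult_left_mono inverse_V_le[OF t k(1)]) auto
    then show ?thesis using Q_lip1[OF t, of z y z'] by (simp add: mult_ac)
  next
    case False
    then have 0: "Q t z y = 0" using t by (intro Q_zero) auto
    show ?thesis
    proof (cases "t \<le> dist z' y")
      case True then show ?thesis using 0 Q_zero[OF t True] Kq(3) k0 t by simp
    next
      case near: False
      have "t \<le> dist z z'" using False near dist_triangle[of z y z'] by simp
      then have "Kq * k * 1 \<le> Kq * k * (dist z z' / t)" using Kq(3) k0 t by (intro mult_left_mono) auto
      then show ?thesis using Q_bound_k(1)[OF t k(2), of y] 0 by (simp add: mult_ac)
    qed
  qed
qed

lemma V_inverse_uniform: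
  assumes t: "0 < t" and R: "0 \<le> R"
  shows "\<exists>k\<ge>0. \<forall>z. dist x z \<le> R \<longrightarrow> D * 3 powr n / V z t \<le> k"
proof -
  define l where "l = (R + t) / t"
  define k where "k = D * 3 powr n * (D * l powr n / V x t)"
  have "D * 3 powr n / V z t \<le> k" if "dist x z \<le> R" for z
  proof -
    have "V x t \<le> D * l powr n * V z t" using t R that by (intro V_compare) (auto simp: l_def divide_simps)
    then have "1 / V z t \<le> D * l powr n / V x t"
      using V_pos[OF t, of x] V_pos[OF t, of z] by (simp add: divide_simps mult.commute)
    then have "D * 3 powr n * (1 / V z t) \<le> k" unfolding k_def using D1 by (intro mult_left_mono) auto
    then show ?thesis by simp
  qed
  moreover have "0 \<le> k" using D1 by (simp add: k_def)
  ultimately show ?thesis by blast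
qed

lemma Q_measurable [measurable (raw)]:
  assumes [measurable]: "u \<in> measurable N M" "v \<in> measurable N M"
  shows "(\<lambda>p. Q t (u p) (v p)) \<in> borel_measurable N"
  unfolding Q_def by measurable

lemma Q_mass: "0 < t \<Longrightarrow> (\<integral>z. Q t z y \<partial>M) = 1"
  using tmass_pos[of t y] by (simp add: Q_def tmass_def)

lemma Q_integrable: "0 < t \<Longrightarrow> integrable M (\<lambda>z. Q t z y)"
  unfolding Q_def using tent_integrable[of t y] by simp

lemma Q_nonneg: "0 < t \<Longrightarrow> 0 \<le> Q t z y"
  unfolding Q_def using tent_bounds(1)[of t z y] tmass_pos[of t y] by simp

lemma bounded_mult_integrable:
  fixes \<phi> h :: "'a \<Rightarrow> real"
  assumes "integrable M h" "\<phi> \<in> borel_measurable M" "\<And>z. \<bar>\<phi> z\<bar> \<le> B"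
  shows "integrable M (\<lambda>z. \<phi> z * h z)"
proof (rule Bochner_Integration.integrable_bound)
  show "integrable M (\<lambda>z. B * h z)" using assms by simp
  have [measurable]: "h \<in> borel_measurable M" "\<phi> \<in> borel_measurable M" using assms by auto
  show "(\<lambda>z. \<phi> z * h z) \<in> borel_measurable M" by measurable
  have "\<bar>\<phi> z\<bar> * \<bar>h z\<bar> \<le> \<bar>B\<bar> * \<bar>h z\<bar>" for z using assms(3)[of z] by (intro mult_right_mono) auto
  then show "AE z in M. norm (\<phi> z * h z) \<le> norm (B * h z)" by (intro AE_I2) (simp add: abs_mult)
qed

text \<open>The point is that the Hoelder constant of the error does not depend on \<open>t\<close>
  while its size vanishes with \<open>t\<close>. Close pairs exploit that \<open>Q\<close> has unit
  mass for both arguments, which allows \<open>\<phi> y\<close> to be subtracted under the integral;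
  distant pairs use the size.\<close>

lemma Q_smooth:
  assumes t: "0 < t" and \<epsilon>: "0 < \<epsilon>" "\<epsilon> \<le> 1" and B: "0 \<le> B" "\<And>y. \<bar>\<phi> y\<bar> \<le> B"
    and supp: "\<And>y. R \<le> dist x y \<Longrightarrow> \<phi> y = 0"
    and hol: "\<And>y z. \<bar>\<phi> y - \<phi> z\<bar> \<le> B * dist y z powr \<epsilon>"
  defines "\<Phi> \<equiv> \<lambda>y. \<integral>z. \<phi> z * Q t z y \<partial>M"
  shows "\<bar>\<phi> y - \<Phi> y\<bar> \<le> B * t powr \<epsilon>"
    and "R + t \<le> dist x y \<Longrightarrow> \<Phi> y = 0"
    and "\<bar>(\<phi> y - \<Phi> y) - (\<phi> y' - \<Phi> y')\<bar> \<le> (5 + 2 * Kq * (D * 2 powr n)) * B * dist y y' powr \<epsilon>"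
proof -
  have pm[measurable]: "\<phi> \<in> borel_measurable M" by (rule holder_measurable[OF hol \<epsilon>(1)])
  have iQ: "integrable M (\<lambda>z. \<phi> z * Q t z y)" for y by (rule bounded_mult_integrable[OF Q_integrable[OF t] pm B(2)])
  have size: "\<bar>\<phi> y - \<Phi> y\<bar> \<le> B * t powr \<epsilon>" for y
  proof -
    have "\<phi> y - \<Phi> y = (\<integral>z. \<phi> y * Q t z y - \<phi> z * Q t z y \<partial>M)"
      unfolding \<Phi>_def using iQ Q_integrable[OF t] Q_mass[OF t] by simp
    also have "\<bar>\<dots>\<bar> \<le> (\<integral>z. B * t powr \<epsilon> * Q t z y \<partial>M)"
    proof (rule order.trans[OF integral_abs_bound integral_mono])
      show "integrable M (\<lambda>z. \<bar>\<phi> y * Q t z y - \<phi> z * Q t z y\<bar>)" using iQ Q_integrable[OF t] by simp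
      show "integrable M (\<lambda>z. B * t powr \<epsilon> * Q t z y)" using Q_integrable[OF t] by simp
      fix z
      show "\<bar>\<phi> y * Q t z y - \<phi> z * Q t z y\<bar> \<le> B * t powr \<epsilon> * Q t z y"
      proof (cases "dist z y < t")
        case True
        have "\<bar>\<phi> y - \<phi> z\<bar> \<le> B * dist y z powr \<epsilon>" by (rule hol)
        also have "\<dots> \<le> B * t powr \<epsilon>" using True B \<epsilon> by (intro mult_left_mono powr_mono2) (auto simp: dist_commute)
        finally have "\<bar>\<phi> y - \<phi> z\<bar> * Q t z y \<le> B * t powr \<epsilon> * Q t z y" using Q_nonneg[OF t] by (intro mult_right_mono) auto
        then show ?thesis using Q_nonneg[OF t, of z y] by (simp add: left_diff_distrib[symmetric] abs_mult)
      next
        case False then show ?thesis using Q_zero[OF t, of z y] by simp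
      qed
    qed
    also have "\<dots> = B * t powr \<epsilon>" using Q_mass[OF t] by simp
    finally show ?thesis .
  qed
  then show "\<bar>\<phi> y - \<Phi> y\<bar> \<le> B * t powr \<epsilon>" .
  show "\<Phi> y = 0" if far: "R + t \<le> dist x y"
  proof -
    have "\<phi> z * Q t z y = 0" for z
    proof (cases "R \<le> dist x z")
      case True then show ?thesis using supp by simp
    next
      case False
      then have "t \<le> dist z y" using far dist_triangle[of x y z] by simp
      then show ?thesis using Q_zero[OF t] by simp
    qed
    then have "(\<lambda>z. \<phi> z * Q t z y) = (\<lambda>_. 0)" by (rule ext)
    then show ?thesis by (simp add: \<Phi>_def)
  qed
  define k where "k = D * 2 powr n"
  have k: "0 < k" using D1 by (simp add: k_def)
  let ?d = "dist y y'"
  show "\<bar>(\<phi> y - \<Phi> y) - (\<phi> y' - \<Phi> y')\<bar> \<le> (5 + 2 * Kq * (D * 2 powr n)) * B * ?d powr \<epsilon>"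
    unfolding k_def[symmetric]
  proof (cases "?d \<le> t / 2")
    case False
    have "t powr \<epsilon> \<le> (2 * ?d) powr \<epsilon>" using False t \<epsilon> by (intro powr_mono2) auto
    also have "\<dots> \<le> 2 * ?d powr \<epsilon>"
      using powr_mono[of \<epsilon> 1 "2::real"] \<epsilon> by (simp add: powr_mult mult_right_mono)
    finally have "B * t powr \<epsilon> \<le> B * (2 * ?d powr \<epsilon>)" using B by (intro mult_left_mono) auto
    then have 1: "\<bar>(\<phi> y - \<Phi> y) - (\<phi> y' - \<Phi> y')\<bar> \<le> 4 * (B * ?d powr \<epsilon>)" using size[of y] size[of y'] by linarith
    have "4 * (B * ?d powr \<epsilon>) \<le> (5 + 2 * Kq * k) * (B * ?d powr \<epsilon>)"
      using Kq(3) k B(1) by (intro mult_right_mono) (auto simp: add_increasing2)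
    then show "\<bar>(\<phi> y - \<Phi> y) - (\<phi> y' - \<Phi> y')\<bar> \<le> (5 + 2 * Kq * k) * B * ?d powr \<epsilon>" using 1 by (simp add: mult.assoc)
  next
    case True
    have d0: "0 \<le> ?d" by simp
    define c where "c = B * (2 * t) powr \<epsilon> * (Kq * (?d / t) / V y t)"
    have "\<Phi> y - \<Phi> y' = (\<integral>z. \<phi> z * Q t z y - \<phi> z * Q t z y' - (\<phi> y * Q t z y - \<phi> y * Q t z y') \<partial>M)"
      unfolding \<Phi>_def using iQ Q_integrable[OF t] Q_mass[OF t] by simp
    also have "\<bar>\<dots>\<bar> \<le> (\<integral>z. c * indicator (ball y (2 * t)) z \<partial>M)"
    proof (rule order.trans[OF integral_abs_bound integral_mono])
      show "integrable M (\<lambda>z. \<bar>\<phi> z * Q t z y - \<phi> z * Q t z y' - (\<phi> y * Q t z y - \<phi> y * Q t z y')\<bar>)"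
        using iQ Q_integrable[OF t] by simp
      show "integrable M (\<lambda>z. c * indicator (ball y (2 * t)) z)" using indicator_ball_integrable by simp
      fix z
      have eq: "\<phi> z * Q t z y - \<phi> z * Q t z y' - (\<phi> y * Q t z y - \<phi> y * Q t z y') = (\<phi> z - \<phi> y) * (Q t z y - Q t z y')"
        by (simp add: algebra_simps)
      show "\<bar>\<phi> z * Q t z y - \<phi> z * Q t z y' - (\<phi> y * Q t z y - \<phi> y * Q t z y')\<bar> \<le> c * indicator (ball y (2 * t)) z"
      proof (cases "dist y z < 2 * t")
        case near: True
        have "\<bar>\<phi> z - \<phi> y\<bar> \<le> B * dist z y powr \<epsilon>" by (rule hol)
        also have "\<dots> \<le> B * (2 * t) powr \<epsilon>" using near B \<epsilon> by (intro mult_left_mono powr_mono2) (auto simp: dist_commute)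
        finally have "\<bar>\<phi> z - \<phi> y\<bar> * \<bar>Q t z y - Q t z y'\<bar> \<le> c"
          unfolding c_def using B by (intro mult_mono Q_lip2[OF t True]) auto
        then show ?thesis unfolding eq abs_mult using near by simp
      next
        case False
        then have "t \<le> dist z y" "t \<le> dist z y'" using True t dist_triangle[of y z y'] by (auto simp: dist_commute)
        then show ?thesis unfolding eq using Q_zero[OF t] False by simp
      qed
    qed
    also have "\<dots> = c * V y (2 * t)" by (simp add: V_def)
    also have "\<dots> \<le> c * (k * V y t)"
    proof -
      have "V y (2 * t) \<le> k * V y t" unfolding k_def using t by (intro V_compare) auto
      then show ?thesis unfolding c_def using B Kq(3) t by (intro mult_left_mono) auto
    qed
    also have "\<dots> = B * Kq * k * ((2 * t) powr \<epsilon> * (?d / t))" using V_pos[OF t, of y] by (simp add: c_def)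
    also have "\<dots> \<le> B * Kq * k * (2 * ?d powr \<epsilon>)"
    proof (intro mult_left_mono)
      have "?d / t \<le> (?d / t) powr \<epsilon>" using powr_mono'[of \<epsilon> 1 "?d / t"] \<epsilon> t True by (simp add: divide_simps)
      then have "(2 * t) powr \<epsilon> * (?d / t) \<le> (2 * t) powr \<epsilon> * (?d / t) powr \<epsilon>" by (intro mult_left_mono) auto
      also have "\<dots> = 2 powr \<epsilon> * ?d powr \<epsilon>" using t by (simp add: powr_mult[symmetric])
      also have "\<dots> \<le> 2 * ?d powr \<epsilon>" using powr_mono[of \<epsilon> 1 "2::real"] \<epsilon> by (intro mult_right_mono) auto
      finally show "(2 * t) powr \<epsilon> * (?d / t) \<le> 2 * ?d powr \<epsilon>" .
    qed (use B Kq(3) k in auto)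
    finally have 1: "\<bar>\<Phi> y - \<Phi> y'\<bar> \<le> 2 * Kq * k * (B * ?d powr \<epsilon>)" by (simp add: mult_ac)
    have "\<bar>(\<phi> y - \<Phi> y) - (\<phi> y' - \<Phi> y')\<bar> \<le> 1 * (B * ?d powr \<epsilon>) + 2 * Kq * k * (B * ?d powr \<epsilon>)"
      using 1 hol[of y y'] by linarith
    also have "\<dots> \<le> 5 * (B * ?d powr \<epsilon>) + 2 * Kq * k * (B * ?d powr \<epsilon>)"
      using B(1) by (intro add_right_mono mult_right_mono) auto
    also have "\<dots> = (5 + 2 * Kq * k) * B * ?d powr \<epsilon>" by (simp add: algebra_simps)
    finally show "\<bar>(\<phi> y - \<Phi> y) - (\<phi> y' - \<Phi> y')\<bar> \<le> (5 + 2 * Kq * k) * B * ?d powr \<epsilon>" .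
  qed
qed

lemma bump_weaken:
  assumes "bump x \<theta> \<phi>" "\<theta>' \<le> \<theta>" "0 < \<theta>'" shows "bump x \<theta>' \<phi>"
proof -
  from assms(1) obtain R B where 1: "0 < R" "0 \<le> B" "\<forall>y. \<bar>\<phi> y\<bar> \<le> B" "\<forall>y. R \<le> dist x y \<longrightarrow> \<phi> y = 0"
     "\<forall>y z. \<bar>\<phi> y - \<phi> z\<bar> \<le> B * dist y z powr \<theta>" unfolding bump_def by (elim exE conjE)
  show ?thesis unfolding bump_def
  proof (rule exI[of _ R], rule exI[of _ "2 * B"], intro conjI allI impI)
    show "\<bar>\<phi> y\<bar> \<le> 2 * B" for y using 1(2) 1(3)[rule_format, of y] by linarith
    show "\<bar>\<phi> y - \<phi> z\<bar> \<le> 2 * B * dist y z powr \<theta>'" for y z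
    proof (cases "dist y z \<le> 1")
      case True
      have "B * dist y z powr \<theta> \<le> B * dist y z powr \<theta>'" using 1 assms True by (intro mult_left_mono powr_mono') auto
      moreover have "0 \<le> B * dist y z powr \<theta>'" using 1 by simp
      ultimately show ?thesis using 1(5)[rule_format, of y z] by linarith
    next
      case False
      then have "1 \<le> dist y z powr \<theta>'" using assms by (intro ge_one_powr_ge_zero) auto
      then have "2 * B * 1 \<le> 2 * B * dist y z powr \<theta>'" using 1 by (intro mult_left_mono) auto
      then show ?thesis using 1(3)[rule_format, of y] 1(3)[rule_format, of z] by linarith
    qed
  qed (use 1 in auto)
qed

lemma bump_lin:
  assumes "bump x \<theta> \<phi>" "bump x \<theta> \<psi>" shows "bump x \<theta> (\<lambda>y. a * \<phi> y + c * \<psi> y)"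
proof -
  have sc: "bump x \<theta> (\<lambda>y. a * \<phi> y)" if "bump x \<theta> \<phi>" for a \<phi>
  proof -
    from that obtain R B where 1: "0 < R" "0 \<le> B" "\<forall>y. \<bar>\<phi> y\<bar> \<le> B" "\<forall>y. R \<le> dist x y \<longrightarrow> \<phi> y = 0"
       "\<forall>y z. \<bar>\<phi> y - \<phi> z\<bar> \<le> B * dist y z powr \<theta>" unfolding bump_def by (elim exE conjE)
    show ?thesis unfolding bump_def
    proof (rule exI[of _ R], rule exI[of _ "\<bar>a\<bar> * B"], intro conjI allI impI)
      show "\<bar>a * \<phi> y\<bar> \<le> \<bar>a\<bar> * B" for y using 1 by (simp add: abs_mult mult_left_mono)
      show "\<bar>a * \<phi> y - a * \<phi> z\<bar> \<le> \<bar>a\<bar> * B * dist y z powr \<theta>" for y z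
        using mult_left_mono[OF 1(5)[rule_format, of y z], of "\<bar>a\<bar>"] by (simp add: right_diff_distrib[symmetric] abs_mult mult.assoc)
    qed (use 1 in auto)
  qed
  from bump_diff[OF sc[OF assms(1), of a] sc[OF assms(2), of "- c"]] show ?thesis by simp
qed

text \<open>Cut-off at radius \<open>R\<close>. Wherever the error is tested,
  \<open>1 + dist x y\<close> is at least \<open>R / 4\<close>, so weakening the decay exponent from
  \<open>\<epsilon>\<close> to \<open>\<gamma>\<close> gains
  \<open>(4 / R) powr (\<epsilon> - \<gamma>)\<close>.\<close>

lemma bump_dense:
  assumes g: "G_bound M x 1 \<epsilon> \<epsilon> \<phi> C" and e: "0 < \<beta>" "\<beta> < \<epsilon>" "0 < \<gamma>" "\<gamma> < \<epsilon>" "\<epsilon> \<le> 1" and \<eta>: "0 < \<eta>"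
  shows "\<exists>\<psi>. bump x \<epsilon> \<psi> \<and> G_bound M x 1 \<beta> \<gamma> (\<lambda>y. \<phi> y - \<psi> y) \<eta>"
proof -
  have C: "0 \<le> C" by (rule G_bound_nonneg[OF g]) simp
  have sz: "\<bar>\<phi> y\<bar> \<le> C * env \<epsilon> 1 x y" for y using g unfolding G_bound_env by blast
  have hl: "\<bar>\<phi> y - \<phi> y'\<bar> \<le> C * (dist y y' / (1 + dist x y)) powr \<epsilon> * env \<epsilon> 1 x y" if "dist y y' \<le> (1 + dist x y) / 2" for y y'
    using g that unfolding G_bound_env by blast
  define \<kappa> where "\<kappa> = \<epsilon> - \<gamma>"
  have \<kappa>: "0 < \<kappa>" using e by (simp add: \<kappa>_def)
  \<comment> \<open>The 9 is 1 for the variation of \<open>\<phi>\<close> plus 8 for that of the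
    cut-off, see \<open>ch\<close>.\<close>
  obtain R where R: "1 \<le> R" "9 * C * (4 / R) powr \<kappa> \<le> \<eta>"
  proof -
    define v where "v = (\<eta> / (9 * C + 1)) powr (1 / \<kappa>)"
    have c9: "0 < 9 * C + 1" using C by simp
    have v: "0 < v" "v powr \<kappa> = \<eta> / (9 * C + 1)" using \<eta> c9 \<kappa> by (auto simp: v_def powr_powr)
    have a: "4 / max 1 (4 / v) \<le> v" using v by (simp add: max_def divide_simps)
    have "(4 / max 1 (4 / v)) powr \<kappa> \<le> v powr \<kappa>" using v \<kappa> by (intro powr_mono2 a) auto
    then have "9 * C * (4 / max 1 (4 / v)) powr \<kappa> \<le> 9 * C * (\<eta> / (9 * C + 1))" unfolding v(2) using C by (intro mult_left_mono) auto
    also have "\<dots> \<le> (9 * C + 1) * (\<eta> / (9 * C + 1))" using C \<eta> by (intro mult_right_mono) auto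
    also have "\<dots> = \<eta>" using c9 by simp
    finally show ?thesis using that[of "max 1 (4 / v)"] by simp
  qed
  define cut where "cut y = max 0 (min 1 (2 - dist x y / R))" for y
  have cut: "0 \<le> cut y" "cut y \<le> 1" "dist x y \<le> R \<Longrightarrow> cut y = 1" "2 * R \<le> dist x y \<Longrightarrow> cut y = 0" for y
    using R by (auto simp: cut_def divide_simps)
  have cut_lip: "\<bar>cut y - cut y'\<bar> \<le> dist y y' / R" for y y'
  proof -
    have "\<bar>dist x y - dist x y'\<bar> \<le> dist y y'"
      using dist_triangle[of x y y'] dist_triangle[of x y' y] by (simp add: dist_commute)
    then have "\<bar>dist x y / R - dist x y' / R\<bar> \<le> dist y y' / R"
      using R by (simp add: diff_divide_distrib[symmetric] divide_right_mono)
    then show ?thesis unfolding cut_def by linarith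
  qed
  define \<psi> where "\<psi> y = \<phi> y * cut y" for y
  have sup: "\<bar>\<phi> y\<bar> \<le> C / V x 1" for y
  proof -
    have "env \<epsilon> 1 x y \<le> 1 / V x 1 * 1"
      unfolding env_def Vr_V Vxy_V using V_pos[of 1 x] e
      by (intro mult_mono divide_left_mono powr_le1) (auto simp: divide_simps add_pos_nonneg intro!: mult_pos_pos)
    then have "C * env \<epsilon> 1 x y \<le> C * (1 / V x 1)" using C by (intro mult_left_mono) auto
    then show ?thesis using sz[of y] by simp
  qed
  have env1: "env \<epsilon> 1 x y \<le> 1 / V x 1" for y
  proof -
    have "env \<epsilon> 1 x y \<le> 1 / V x 1 * 1"
      unfolding env_def Vr_V Vxy_V using V_pos[of 1 x] e
      by (intro mult_mono divide_left_mono powr_le1) (auto simp: divide_simps add_pos_nonneg intro!: mult_pos_pos)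
    then show ?thesis by simp
  qed
  define K where "K = C / V x 1"
  have K: "0 \<le> K" using C by (simp add: K_def)
  have "bump x \<epsilon> \<psi>" unfolding bump_def
  proof (rule exI[of _ "2 * R"], rule exI[of _ "4 * K"], intro conjI allI impI)
    show "0 < 2 * R" "0 \<le> 4 * K" using R K by auto
    show "\<psi> y = 0" if "2 * R \<le> dist x y" for y using cut(4)[OF that] by (simp add: \<psi>_def)
    have \<psi>K: "\<bar>\<psi> y\<bar> \<le> K" for y
      using mult_mono[OF sup[of y] cut(2)[of y]] cut(1)[of y] K by (simp add: \<psi>_def abs_mult K_def)
    show "\<bar>\<psi> y\<bar> \<le> 4 * K" for y using \<psi>K[of y] K by linarith
    fix y y' :: 'a
    let ?d = "dist y y'"
    show "\<bar>\<psi> y - \<psi> y'\<bar> \<le> 4 * K * ?d powr \<epsilon>"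
    proof (cases "?d \<le> 1 / 2")
      case True
      have T: "?d \<le> (1 + dist x y) / 2" using True zero_le_dist[of x y] by argo
      have "\<bar>\<phi> y - \<phi> y'\<bar> \<le> C * (?d / (1 + dist x y)) powr \<epsilon> * env \<epsilon> 1 x y" by (rule hl[OF T])
      also have "\<dots> \<le> C * ?d powr \<epsilon> * (1 / V x 1)"
      proof -
        have p: "0 < 1 + dist x y" by (simp add: add_pos_nonneg)
        have "?d * 1 \<le> ?d * (1 + dist x y)" by (intro mult_left_mono) auto
        then have "?d / (1 + dist x y) \<le> ?d" using p by (simp add: divide_le_eq)
        moreover have "0 \<le> ?d / (1 + dist x y)" using p by simp
        ultimately show ?thesis using C e by (intro mult_mono env1 mult_left_mono powr_mono2) auto
      qed
      finally have 1: "\<bar>\<phi> y - \<phi> y'\<bar> \<le> K * ?d powr \<epsilon>" by (simp add: K_def)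
      have 2: "\<bar>cut y - cut y'\<bar> \<le> ?d powr \<epsilon>"
      proof -
        have "\<bar>cut y - cut y'\<bar> \<le> ?d / R" by (rule cut_lip)
        also have "\<dots> \<le> ?d / 1" using R by (intro divide_left_mono) auto
        also have "\<dots> \<le> ?d powr \<epsilon>" using powr_mono'[of \<epsilon> 1 ?d] e True by simp
        finally show ?thesis .
      qed
      have "\<psi> y - \<psi> y' = (\<phi> y - \<phi> y') * cut y + \<phi> y' * (cut y - cut y')" by (simp add: \<psi>_def algebra_simps)
      then have "\<bar>\<psi> y - \<psi> y'\<bar> \<le> \<bar>\<phi> y - \<phi> y'\<bar> * cut y + \<bar>\<phi> y'\<bar> * \<bar>cut y - cut y'\<bar>"
        using abs_triangle_ineq[of "(\<phi> y - \<phi> y') * cut y" "\<phi> y' * (cut y - cut y')"] cut(1)[of y] by (simp add: abs_mult)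
      also have "\<dots> \<le> (K * ?d powr \<epsilon>) * 1 + K * ?d powr \<epsilon>"
        using 1 2 cut K sup[of y'] by (intro add_mono mult_mono) (auto simp: K_def)
      also have "\<dots> \<le> 4 * K * ?d powr \<epsilon>" using K by simp
      finally show ?thesis .
    next
      case False
      have "(1/2) powr 1 \<le> (1/2::real) powr \<epsilon>" using e by (intro powr_mono') auto
      also have "\<dots> \<le> ?d powr \<epsilon>" using False e by (intro powr_mono2) auto
      finally have "4 * K * (1/2) \<le> 4 * K * ?d powr \<epsilon>" using K by (intro mult_left_mono) auto
      then show ?thesis using \<psi>K[of y] \<psi>K[of y'] by linarith
    qed
  qed
  moreover have "G_bound M x 1 \<beta> \<gamma> (\<lambda>y. \<phi> y - \<psi> y) \<eta>"
    unfolding G_bound_env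
  proof (intro conjI allI impI)
    have env_gain: "env \<epsilon> 1 x y \<le> (4 / R) powr \<kappa> * env \<gamma> 1 x y" if "R \<le> 4 * (1 + dist x y)" for y
    proof -
      have p: "0 < 1 + dist x y" by (simp add: add_pos_nonneg)
      have "1 / (1 + dist x y) \<le> 4 / R" using that R p by (simp add: divide_simps)
      then have "(1 / (1 + dist x y)) powr \<kappa> \<le> (4 / R) powr \<kappa>" using \<kappa> p by (intro powr_mono2) auto
      then have "(1 / (1 + dist x y)) powr \<kappa> * env \<gamma> 1 x y \<le> (4 / R) powr \<kappa> * env \<gamma> 1 x y" by (intro mult_right_mono) auto
      moreover have "(1 / (1 + dist x y)) powr \<kappa> * env \<gamma> 1 x y = env \<epsilon> 1 x y"
        by (simp add: env_def powr_add[symmetric] \<kappa>_def)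
      ultimately show ?thesis by simp
    qed
    have diff: "\<phi> y - \<psi> y = \<phi> y * (1 - cut y)" for y by (simp add: \<psi>_def algebra_simps)
    have C9: "C * (4 / R) powr \<kappa> * 9 \<le> \<eta>" using R(2) by (simp add: mult_ac)
    fix y
    have p: "0 < 1 + dist x y" by (simp add: add_pos_nonneg)
    show "\<bar>\<phi> y - \<psi> y\<bar> \<le> \<eta> * env \<gamma> 1 x y"
    proof (cases "dist x y \<le> R")
      case True then show ?thesis unfolding diff using cut(3)[OF True] \<eta> by simp
    next
      case False
      have big: "R \<le> 4 * (1 + dist x y)" using False zero_le_dist[of x y] by argo
      have "\<bar>\<phi> y\<bar> * \<bar>1 - cut y\<bar> \<le> \<bar>\<phi> y\<bar> * 1" using cut(1,2)[of y] by (intro mult_left_mono) auto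
      also have "\<dots> \<le> C * env \<epsilon> 1 x y" using sz[of y] by simp
      also have "\<dots> \<le> C * ((4 / R) powr \<kappa> * env \<gamma> 1 x y)" using C big by (intro mult_left_mono env_gain) auto
      also have "\<dots> \<le> C * (4 / R) powr \<kappa> * 9 * env \<gamma> 1 x y"
      proof -
        have "0 \<le> C * ((4 / R) powr \<kappa> * env \<gamma> 1 x y)" using C by simp
        then show ?thesis by (simp add: mult_ac)
      qed
      also have "\<dots> \<le> \<eta> * env \<gamma> 1 x y" by (intro mult_right_mono C9) simp
      finally show ?thesis unfolding diff abs_mult .
    qed
    fix y' assume d: "dist y y' \<le> (1 + dist x y) / 2"
    let ?q = "dist y y' / (1 + dist x y)"
    have q: "0 \<le> ?q" "?q \<le> 1" using d p by (auto simp: divide_simps)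
    have qb: "?q powr \<epsilon> \<le> ?q powr \<beta>" "?q \<le> ?q powr \<beta>"
      using powr_mono'[of \<beta> \<epsilon> ?q] powr_mono'[of \<beta> 1 ?q] q e p by (auto simp: abs_of_pos)
    show "\<bar>\<phi> y - \<psi> y - (\<phi> y' - \<psi> y')\<bar> \<le> \<eta> * ?q powr \<beta> * env \<gamma> 1 x y"
    proof (cases "dist x y \<le> R \<and> dist x y' \<le> R")
      case True then show ?thesis unfolding diff using cut(3)[of y] cut(3)[of y'] \<eta> by simp
    next
      case False
      have tri: "dist x y' \<le> dist x y + dist y y'" "dist x y \<le> dist x y' + dist y y'"
        using dist_triangle[of x y' y] dist_triangle[of x y y'] by (auto simp: dist_commute)
      have big: "R \<le> 4 * (1 + dist x y)" using False tri d R zero_le_dist[of x y] by argo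
      have ch: "\<bar>cut y - cut y'\<bar> \<le> 8 * ?q powr \<beta>"
      proof (cases "1 + dist x y \<le> 8 * R")
        case True
        have "\<bar>cut y - cut y'\<bar> \<le> dist y y' / R" by (rule cut_lip)
        also have "\<dots> \<le> 8 * ?q"
        proof -
          have "dist y y' * (1 + dist x y) \<le> dist y y' * (8 * R)" using True by (intro mult_left_mono) auto
          then show ?thesis using R p by (simp add: divide_simps mult_ac)
        qed
        also have "\<dots> \<le> 8 * ?q powr \<beta>" using qb by simp
        finally show ?thesis .
      next
        case far: False
        have "2 * R \<le> dist x y" "2 * R \<le> dist x y'" using far tri d R by argo+
        then show ?thesis using cut(4)[of y] cut(4)[of y'] by simp
      qed
      have eq: "\<phi> y - \<psi> y - (\<phi> y' - \<psi> y') = (\<phi> y - \<phi> y') * (1 - cut y') - \<phi> y * (cut y - cut y')"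
        by (simp add: \<psi>_def algebra_simps)
      have "\<bar>\<phi> y - \<psi> y - (\<phi> y' - \<psi> y')\<bar> \<le> \<bar>\<phi> y - \<phi> y'\<bar> * \<bar>1 - cut y'\<bar> + \<bar>\<phi> y\<bar> * \<bar>cut y - cut y'\<bar>"
        unfolding eq abs_mult[symmetric] by (rule abs_triangle_ineq4)
      also have "\<dots> \<le> (C * ?q powr \<beta> * env \<epsilon> 1 x y) * 1 + (C * env \<epsilon> 1 x y) * (8 * ?q powr \<beta>)"
      proof (intro add_mono mult_mono ch sz)
        have "C * ?q powr \<epsilon> * env \<epsilon> 1 x y \<le> C * ?q powr \<beta> * env \<epsilon> 1 x y"
          using C by (intro mult_right_mono mult_left_mono qb) auto
        then show "\<bar>\<phi> y - \<phi> y'\<bar> \<le> C * ?q powr \<beta> * env \<epsilon> 1 x y" using hl[OF d] by linarith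
        show "\<bar>1 - cut y'\<bar> \<le> 1" using cut(1,2)[of y'] by auto
      qed (use C in auto)
      also have "\<dots> = C * 9 * ?q powr \<beta> * env \<epsilon> 1 x y" by (simp add: algebra_simps)
      also have "\<dots> \<le> C * 9 * ?q powr \<beta> * ((4 / R) powr \<kappa> * env \<gamma> 1 x y)"
        using C by (intro mult_left_mono env_gain big) auto
      also have "\<dots> = (C * (4 / R) powr \<kappa> * 9) * (?q powr \<beta> * env \<gamma> 1 x y)" by (simp add: mult_ac)
      also have "\<dots> \<le> \<eta> * (?q powr \<beta> * env \<gamma> 1 x y)" by (intro mult_right_mono C9) simp
      finally show ?thesis by (simp add: mult.assoc)
    qed
  qed
  ultimately show ?thesis by blast
qed

end

section \<open>Representation of functionals\<close>

locale hardy_functional = admissible_pair M D n \<rho> \<sigma> a Ca Kr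
  for M :: "'a::metric_space measure" and D n \<rho> \<sigma> a Ca Kr +
  fixes x1 :: 'a and L :: "('a \<Rightarrow> real) \<Rightarrow> real" and \<epsilon> \<beta> \<gamma> BL :: real
  assumes \<epsilon>: "0 < \<epsilon>" "\<epsilon> < 1" and \<beta>: "0 < \<beta>" "\<beta> < \<epsilon>" and \<gamma>: "0 < \<gamma>" "\<gamma> < \<epsilon>"
    and L_lin: "\<phi> \<in> G0 M \<epsilon> x1 1 \<beta> \<gamma> \<Longrightarrow> \<psi> \<in> G0 M \<epsilon> x1 1 \<beta> \<gamma> \<Longrightarrow>
        L (\<lambda>y. s * \<phi> y + t * \<psi> y) = s * L \<phi> + t * L \<psi>"
    and L_bound: "\<phi> \<in> G0 M \<epsilon> x1 1 \<beta> \<gamma> \<Longrightarrow> \<bar>L \<phi>\<bar> \<le> BL * Gnorm M x1 1 \<beta> \<gamma> \<phi>"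
    and BL: "0 \<le> BL"
    and H1: "H1norm M \<rho> \<epsilon> x1 \<beta> \<gamma> L < \<infinity>"
begin

abbreviation "G \<equiv> G0 M \<epsilon> x1 1 \<beta> \<gamma>"

lemma bump_G: assumes "bump x1 \<theta> \<psi>" "\<epsilon> \<le> \<theta>" shows "\<psi> \<in> G"
  using assms \<epsilon> \<beta> \<gamma> by (intro G0_I bump_Gsp[OF assms(1)]) auto

lemma Q_G: "0 < t \<Longrightarrow> Q t z \<in> G"
  using \<epsilon> by (intro bump_G[OF Q_bump]) auto

lemma G_lin: "\<phi> \<in> G \<Longrightarrow> \<psi> \<in> G \<Longrightarrow> (\<lambda>y. s * \<phi> y + t * \<psi> y) \<in> G"
  using \<beta> \<gamma> by (intro G0_lin) auto

lemma G_diff: "\<phi> \<in> G \<Longrightarrow> \<psi> \<in> G \<Longrightarrow> (\<lambda>y. \<phi> y - \<psi> y) \<in> G"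
  using G_lin[of \<phi> \<psi> 1 "- 1"] by simp

lemma L_diff: "\<phi> \<in> G \<Longrightarrow> \<psi> \<in> G \<Longrightarrow> L (\<lambda>y. \<phi> y - \<psi> y) = L \<phi> - L \<psi>"
  using L_lin[of \<phi> \<psi> 1 "- 1"] by simp

text \<open>Quantitative continuity: on functions with a common bounded support and a bounded
  Hoelder constant, uniform convergence to 0 implies that \<open>L\<close> tends to 0.\<close>

lemma L_small:
  assumes R: "0 < R" and \<theta>: "\<epsilon> \<le> \<theta>" and aB: "0 \<le> s" "0 \<le> B"
    and sz: "\<And>y. \<bar>\<psi> y\<bar> \<le> s" and supp: "\<And>y. R \<le> dist x1 y \<Longrightarrow> \<psi> y = 0"
    and hol: "\<And>y z. \<bar>\<psi> y - \<psi> z\<bar> \<le> B * dist y z powr \<theta>"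
  shows "\<psi> \<in> G" "\<bar>L \<psi>\<bar> \<le> BL * (KR x1 \<beta> \<gamma> R * (s + s powr (1 - \<beta> / \<theta>) * B powr (\<beta> / \<theta>)))"
proof -
  have "bump x1 \<theta> \<psi>" unfolding bump_def
  proof (rule exI[of _ R], rule exI[of _ "s + B"], intro conjI allI impI)
    show "\<bar>\<psi> y\<bar> \<le> s + B" for y using sz[of y] aB by linarith
    show "\<bar>\<psi> y - \<psi> z\<bar> \<le> (s + B) * dist y z powr \<theta>" for y z
    proof -
      have "B * dist y z powr \<theta> \<le> (s + B) * dist y z powr \<theta>" using aB by (intro mult_right_mono) auto
      then show ?thesis using hol[of y z] by linarith
    qed
  qed (use R aB supp in auto)
  then show G: "\<psi> \<in> G" by (rule bump_G[OF _ \<theta>])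
  have "\<beta> \<le> \<theta>" "0 \<le> \<gamma>" using \<theta> \<beta> \<gamma> by auto
  from supported_G_bound[OF R \<beta>(1) this aB sz supp hol]
  have "Gnorm M x1 1 \<beta> \<gamma> \<psi> \<le> KR x1 \<beta> \<gamma> R * (s + s powr (1 - \<beta> / \<theta>) * B powr (\<beta> / \<theta>))" by (intro Gnorm_le) auto
  from mult_left_mono[OF this BL] L_bound[OF G]
  show "\<bar>L \<psi>\<bar> \<le> BL * (KR x1 \<beta> \<gamma> R * (s + s powr (1 - \<beta> / \<theta>) * B powr (\<beta> / \<theta>)))" by linarith
qed

text \<open>Continuity in \<open>z\<close>: the difference of two rows tends to 0 uniformly while
  its Lipschitz constant stays bounded, so \<open>L_small\<close> applies with
  \<open>\<theta> = 1\<close>.\<close>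

lemma LQ_measurable [measurable]:
  assumes t: "0 < t" shows "(\<lambda>z. L (Q t z)) \<in> borel_measurable M"
proof -
  have "((\<lambda>z'. L (Q t z')) \<longlongrightarrow> L (Q t z)) (at z)" for z
  proof -
    define R where "R = dist x1 z + 1"
    have R: "0 \<le> R" "0 < R + t" using t by (auto simp: R_def add_nonneg_pos)
    from V_inverse_uniform[OF t R(1), of x1] obtain k where k: "0 \<le> k" "\<forall>z. dist x1 z \<le> R \<longrightarrow> D * 3 powr n / V z t \<le> k"
      by (elim exE conjE)
    define s where "s z' = Kq * k / t * dist z' z" for z'
    define B where "B = 2 * (4 * Kq * k / t)"
    have B: "0 \<le> B" using Kq(3) k t by (simp add: B_def)
    define F where "F u = BL * (KR x1 \<beta> \<gamma> (R + t) * (u + u powr (1 - \<beta> / 1) * B powr (\<beta> / 1)))" for u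
    have le: "\<bar>L (Q t z') - L (Q t z)\<bar> \<le> F (s z')" if "dist z' z < 1" for z'
    proof -
      have z': "dist x1 z' \<le> R" "dist x1 z \<le> R" using that dist_triangle[of x1 z' z] by (auto simp: R_def dist_commute)
      have kz: "D * 3 powr n / V z t \<le> k" "D * 3 powr n / V z' t \<le> k" using k z' by auto
      have "\<bar>L (\<lambda>y. Q t z' y - Q t z y)\<bar> \<le> F (s z')" unfolding F_def
      proof (rule L_small(2)[OF R(2)])
        show "\<bar>Q t z' y - Q t z y\<bar> \<le> s z'" for y unfolding s_def by (rule Q_lip_z[OF t kz(2,1)])
        show "Q t z' y - Q t z y = 0" if "R + t \<le> dist x1 y" for y
        proof -
          have "t \<le> dist z' y" "t \<le> dist z y"
            using that z' dist_triangle[of x1 y z'] dist_triangle[of x1 y z] by argo+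
          then show ?thesis using Q_zero[OF t] by simp
        qed
        show "\<bar>(Q t z' y - Q t z y) - (Q t z' v - Q t z v)\<bar> \<le> B * dist y v powr 1" for y v
          using Q_bound_k(2)[OF t kz(1), of y v] Q_bound_k(2)[OF t kz(2), of y v] by (simp add: B_def)
      qed (use \<epsilon> B Kq(3) k t in \<open>auto simp: s_def\<close>)
      then show ?thesis by (simp only: L_diff[OF Q_G[OF t] Q_G[OF t]])
    qed
    have d0: "((\<lambda>z'. dist z' z) \<longlongrightarrow> 0) (at z)" using tendsto_dist[OF tendsto_ident_at tendsto_const[of z], of z UNIV] by simp
    have ev: "\<forall>\<^sub>F z' in at z. dist z' z < 1" by (rule order_tendstoD(2)[OF d0]) simp
    have s0: "(s \<longlongrightarrow> Kq * k / t * 0) (at z)" unfolding s_def by (intro tendsto_mult tendsto_const d0)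
    then have s0: "(s \<longlongrightarrow> 0) (at z)" by simp
    have snn: "0 \<le> s z'" for z' using Kq(3) k t by (simp add: s_def)
    have "((\<lambda>z'. F (s z')) \<longlongrightarrow> BL * (KR x1 \<beta> \<gamma> (R + t) * (0 + 0 powr (1 - \<beta> / 1) * B powr (\<beta> / 1)))) (at z)"
      unfolding F_def using \<beta> \<epsilon>
      by (intro tendsto_mult tendsto_add tendsto_const tendsto_powr' s0) (auto simp: snn)
    then have "((\<lambda>z'. F (s z')) \<longlongrightarrow> 0) (at z)" using \<beta> \<epsilon> by simp
    then have "((\<lambda>z'. L (Q t z') - L (Q t z)) \<longlongrightarrow> 0) (at z)"
      by (rule Lim_null_comparison[rotated]) (use ev le in \<open>auto elim: eventually_mono\<close>)
    then show ?thesis by (simp add: LIM_zero_iff)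
  qed
  then have "continuous_on UNIV (\<lambda>z. L (Q t z))" by (simp add: continuous_on_def)
  then show ?thesis unfolding measurable_M_eq by (rule borel_measurable_continuous_onI)
qed

text \<open>The radii are restricted to a countable set to obtain a measurable function dominated
  by the grand maximal function.\<close>

definition wmax :: "'a \<Rightarrow> ennreal" where
  "wmax z = (SUP m::nat. ennreal (if (1/2) ^ m < \<sigma> z then \<bar>L (Q ((1/2) ^ m) z)\<bar> else 0))"

lemma wmax_measurable [measurable]: "wmax \<in> borel_measurable M"
proof -
  have [measurable]: "(\<lambda>z. L (Q ((1/2) ^ m) z)) \<in> borel_measurable M" for m by (rule LQ_measurable) simp
  show ?thesis unfolding wmax_def by measurable
qed

text \<open>Divided by \<open>CQ \<gamma>\<close>, the rows of \<open>Q\<close> at radii below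
  \<open>\<rho> z\<close> compete in \<open>Gmax\<close>. Monotonicity of the lower integral is
  enough to compare with the Hardy norm.\<close>

lemma wmax_finite: "(\<integral>\<^sup>+z. wmax z \<partial>M) < \<infinity>"
proof -
  have C: "0 < CQ \<gamma>" by (rule CQ_pos)
  have le: "ennreal (1 / CQ \<gamma>) * wmax z \<le> Gmax M \<rho> \<epsilon> x1 \<beta> \<gamma> L z" for z
    unfolding wmax_def SUP_mult_left_ennreal
  proof (rule SUP_least)
    fix m :: nat
    show "ennreal (1 / CQ \<gamma>) * ennreal (if (1/2) ^ m < \<sigma> z then \<bar>L (Q ((1/2) ^ m) z)\<bar> else 0) \<le> Gmax M \<rho> \<epsilon> x1 \<beta> \<gamma> L z"
    proof (cases "(1/2) ^ m < \<sigma> z")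
      case True
      define t where "t = (1/2::real) ^ m"
      have t: "0 < t" "t < \<rho> z" using True \<sigma>_le[of z] by (auto simp: t_def)
      have "ennreal (1 / CQ \<gamma>) * ennreal \<bar>L (Q t z)\<bar> \<le> Gmax M \<rho> \<epsilon> x1 \<beta> \<gamma> L z"
        using \<epsilon> \<beta> \<gamma> by (intro Gmax_ge_Q t L_lin Q_G) auto
      then show ?thesis using True by (simp add: t_def)
    qed simp
  qed
  have "ennreal (1 / CQ \<gamma>) * (\<integral>\<^sup>+z. wmax z \<partial>M) = (\<integral>\<^sup>+z. ennreal (1 / CQ \<gamma>) * wmax z \<partial>M)"
    by (intro nn_integral_cmult[symmetric]) measurable
  also have "\<dots> \<le> H1norm M \<rho> \<epsilon> x1 \<beta> \<gamma> L" unfolding H1norm_def by (intro nn_integral_mono le)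
  also have "\<dots> < \<infinity>" by (rule H1)
  finally show ?thesis using C by (auto simp: ennreal_mult_less_top less_top)
qed

definition v :: "'a \<Rightarrow> real" where "v z = enn2real (wmax z)"

lemma v_integrable: "integrable M v" "0 \<le> v z"
proof -
  have [measurable]: "v \<in> borel_measurable M" unfolding v_def by measurable
  have "(\<integral>\<^sup>+z. ennreal (norm (v z)) \<partial>M) \<le> (\<integral>\<^sup>+z. wmax z \<partial>M)"
    by (intro nn_integral_mono) (simp add: v_def ennreal_enn2real_if)
  then show "integrable M v" using wmax_finite by (intro integrableI_bounded) auto
  show "0 \<le> v z" by (simp add: v_def)
qed

lemma v_null: "\<exists>N\<in>null_sets M. \<forall>z m. z \<notin> N \<longrightarrow> (1/2) ^ m < \<sigma> z \<longrightarrow> \<bar>L (Q ((1/2) ^ m) z)\<bar> \<le> v z"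
proof -
  have "AE z in M. wmax z \<noteq> \<infinity>" by (rule nn_integral_noteq_infinite) (use wmax_finite in auto)
  from AE_E3[OF this] obtain N where N: "N \<in> null_sets M" "\<And>z. z \<in> space M - N \<Longrightarrow> wmax z \<noteq> \<infinity>" by blast
  have "\<bar>L (Q ((1/2) ^ m) z)\<bar> \<le> v z" if "z \<notin> N" "(1/2) ^ m < \<sigma> z" for z and m :: nat
  proof -
    have "ennreal \<bar>L (Q ((1/2) ^ m) z)\<bar> \<le> wmax z" unfolding wmax_def
      using that(2) by (intro SUP_upper2[where i = m]) auto
    also have "wmax z = ennreal (v z)" using N(2)[of z] that(1) by (simp add: v_def less_top)
    finally show ?thesis using v_integrable(2)[of z] by (simp add: ennreal_le_iff)
  qed
  then show ?thesis using N(1) by blast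
qed

lemma L_sum_Q:
  assumes "finite J" "0 < t"
  shows "(\<lambda>y. \<Sum>j\<in>J. c j * Q t (p j) y) \<in> G \<and> L (\<lambda>y. \<Sum>j\<in>J. c j * Q t (p j) y) = (\<Sum>j\<in>J. c j * L (Q t (p j)))"
  using assms(1)
proof induction
  case empty
  show ?case using G_lin[OF Q_G Q_G, of t t 0 _ 0] L_lin[OF Q_G Q_G, of t t 0 _ 0] assms(2) by simp
next
  case (insert j J)
  let ?S = "\<lambda>y. \<Sum>j\<in>J. c j * Q t (p j) y"
  have S: "?S \<in> G" "L ?S = (\<Sum>j\<in>J. c j * L (Q t (p j)))" using insert.IH by auto
  have eq: "(\<lambda>y. \<Sum>j\<in>insert j J. c j * Q t (p j) y) = (\<lambda>y. c j * Q t (p j) y + 1 * ?S y)"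
    using insert.hyps by simp
  have "(\<lambda>y. c j * Q t (p j) y + 1 * ?S y) \<in> G" by (rule G_lin[OF Q_G[OF assms(2)] S(1)])
  moreover have "L (\<lambda>y. c j * Q t (p j) y + 1 * ?S y) = c j * L (Q t (p j)) + 1 * L ?S" by (rule L_lin[OF Q_G[OF assms(2)] S(1)])
  ultimately show ?case unfolding eq using S(2) insert.hyps by simp
qed

context
  fixes \<phi> :: "'a \<Rightarrow> real" and R B :: real
  assumes R: "0 < R" and B: "0 \<le> B" "\<And>y. \<bar>\<phi> y\<bar> \<le> B"
    and supp: "\<And>y. R \<le> dist x1 y \<Longrightarrow> \<phi> y = 0"
    and hol: "\<And>y z. \<bar>\<phi> y - \<phi> z\<bar> \<le> B * dist y z powr \<epsilon>"
begin

private lemma pm [measurable]: "\<phi> \<in> borel_measurable M" by (rule holder_measurable[OF hol \<epsilon>(1)])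

private lemma phi_int: "integrable M \<phi>"
proof (rule Bochner_Integration.integrable_bound)
  show "integrable M (\<lambda>z. B * indicator (ball x1 R) z)" using indicator_ball_integrable by simp
  show "AE y in M. norm (\<phi> y) \<le> norm (B * indicator (ball x1 R) y)"
    using B supp by (intro AE_I2) (auto simp: indicator_def)
qed measurable

private lemma phi_int_bound:
  assumes [measurable]: "h \<in> borel_measurable M" and h: "\<And>z. dist x1 z < R \<Longrightarrow> \<bar>h z\<bar> \<le> c" and c: "0 \<le> c"
  shows "integrable M (\<lambda>z. \<phi> z * h z)" "\<bar>\<integral>z. \<phi> z * h z \<partial>M\<bar> \<le> B * c * V x1 R"
proof -
  have le: "\<bar>\<phi> z * h z\<bar> \<le> B * c * indicator (ball x1 R) z" for z
  proof (cases "dist x1 z < R")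
    case True then show ?thesis using B h[OF True] by (auto simp: abs_mult intro!: mult_mono)
  next
    case False then show ?thesis using supp[of z] by simp
  qed
  have i: "integrable M (\<lambda>z. B * c * indicator (ball x1 R) z)" using indicator_ball_integrable by simp
  show *: "integrable M (\<lambda>z. \<phi> z * h z)"
    by (rule Bochner_Integration.integrable_bound[OF i]) (use le B c in \<open>auto intro!: AE_I2\<close>)
  have "\<bar>\<integral>z. \<phi> z * h z \<partial>M\<bar> \<le> (\<integral>z. B * c * indicator (ball x1 R) z \<partial>M)"
    by (rule order.trans[OF integral_abs_bound integral_mono]) (use * i le in auto)
  also have "\<dots> = B * c * V x1 R" by (simp add: V_def)
  finally show "\<bar>\<integral>z. \<phi> z * h z \<partial>M\<bar> \<le> B * c * V x1 R" .
qed

private definition "\<Phi> t y = (\<integral>z. \<phi> z * Q t z y \<partial>M)"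

text \<open>By \<open>Q_smooth\<close> the error has size of order \<open>t powr \<epsilon>\<close>
  and a bounded \<open>\<epsilon>\<close>-Hoelder constant, so \<open>L_small\<close> with
  \<open>\<beta> < \<epsilon>\<close> makes it negligible. The radius is a power of
  \<open>1/2\<close>, as in \<open>wmax\<close>.\<close>

private lemma first_error:
  fixes e c0 :: real assumes e: "0 < e" and c0: "0 < c0"
  shows "\<exists>m::nat. (1/2) ^ m < c0 \<and> (\<lambda>y. \<phi> y - \<Phi> ((1/2) ^ m) y) \<in> G \<and> \<bar>L (\<lambda>y. \<phi> y - \<Phi> ((1/2) ^ m) y)\<bar> < e"
proof -
  define B1 where "B1 = (5 + 2 * Kq * (D * 2 powr n)) * B"
  define F where "F s = BL * (KR x1 \<beta> \<gamma> (R + 1) * (s + s powr (1 - \<beta> / \<epsilon>) * B1 powr (\<beta> / \<epsilon>)))" for s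
  have B1: "0 \<le> B1" using Kq(3) D1 B by (auto simp: B1_def intro!: mult_nonneg_nonneg add_nonneg_nonneg)
  have t0: "(\<lambda>m. (1/2::real) ^ m) \<longlonglongrightarrow> 0" by (rule LIMSEQ_power_zero) simp
  have "(\<lambda>m. B * ((1/2::real) ^ m) powr \<epsilon>) \<longlonglongrightarrow> B * 0 powr \<epsilon>"
    using \<epsilon> t0 by (intro tendsto_mult tendsto_const tendsto_powr') auto
  then have s0: "(\<lambda>m. B * ((1/2::real) ^ m) powr \<epsilon>) \<longlonglongrightarrow> 0" using \<epsilon> by simp
  have "(\<lambda>m. F (B * ((1/2::real) ^ m) powr \<epsilon>)) \<longlonglongrightarrow> BL * (KR x1 \<beta> \<gamma> (R + 1) * (0 + 0 powr (1 - \<beta> / \<epsilon>) * B1 powr (\<beta> / \<epsilon>)))"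
    unfolding F_def using s0 B \<beta> \<epsilon> by (intro tendsto_mult tendsto_add tendsto_const tendsto_powr') (auto simp: divide_simps)
  then have F0: "(\<lambda>m. F (B * ((1/2::real) ^ m) powr \<epsilon>)) \<longlonglongrightarrow> 0" using \<beta> \<epsilon> by simp
  have "\<forall>\<^sub>F m in sequentially. (1/2::real) ^ m < c0 \<and> F (B * ((1/2::real) ^ m) powr \<epsilon>) < e"
    using order_tendstoD(2)[OF t0 c0] order_tendstoD(2)[OF F0 e] by (rule eventually_conj)
  then obtain m where m: "(1/2::real) ^ m < c0" "F (B * ((1/2::real) ^ m) powr \<epsilon>) < e"
    by (auto simp: eventually_sequentially)
  define t where "t = (1/2::real) ^ m"
  have t: "0 < t" "t \<le> 1" by (auto simp: t_def power_le_one)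
  note sm0 = Q_smooth[OF t(1) \<epsilon>(1) less_imp_le[OF \<epsilon>(2)] B _ hol, where R = R and x = x1, folded \<Phi>_def]
  have sm: "\<bar>\<phi> y - \<Phi> t y\<bar> \<le> B * t powr \<epsilon>"
    "\<bar>(\<phi> y - \<Phi> t y) - (\<phi> y' - \<Phi> t y')\<bar> \<le> (5 + 2 * Kq * (D * 2 powr n)) * B * dist y y' powr \<epsilon>" for y y'
    by (rule sm0(1), rule supp, assumption) (rule sm0(3), rule supp, assumption)
  have sm2: "\<Phi> t y = 0" if "R + t \<le> dist x1 y" for y by (rule sm0(2)[OF _ that], rule supp)
  have supp': "\<phi> y - \<Phi> t y = 0" if "R + 1 \<le> dist x1 y" for y
  proof -
    have "R + t \<le> dist x1 y" "R \<le> dist x1 y" using that t by auto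
    from sm2[OF this(1)] supp[OF this(2)] show ?thesis by simp
  qed
  have R1: "0 < R + 1" using R by simp
  have s: "0 \<le> B * t powr \<epsilon>" using B by simp
  have hol': "\<bar>\<phi> y - \<Phi> t y - (\<phi> z - \<Phi> t z)\<bar> \<le> B1 * dist y z powr \<epsilon>" for y z unfolding B1_def by (rule sm(2))
  note * = L_small[OF R1 order.refl s B1 sm(1) supp' hol']
  show ?thesis using *(1) *(2) m unfolding F_def t_def by (intro exI[of _ m]) auto
qed

text \<open>\<open>L\<close> is only finitely additive, so it is not moved through the integral that
  defines \<open>\<Phi> t\<close>. That integral is replaced with a finite sum over the cells of
  \<open>idx s\<close>, on which linearity acts, and each value of \<open>L\<close> on a row is
  bounded by the mean of \<open>v\<close> over its cell.\<close>

lemma L_dominated: "\<bar>L \<phi>\<bar> \<le> (\<integral>z. \<bar>\<phi> z\<bar> * v z \<partial>M)"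
proof -
  define W where "W = (\<integral>z. v z \<partial>M)"
  have W: "0 \<le> W" unfolding W_def using v_integrable by (intro Bochner_Integration.integral_nonneg) auto
  have [measurable]: "v \<in> borel_measurable M" using v_integrable by auto
  have iv: "integrable M (\<lambda>z. \<bar>\<phi> z\<bar> * v z)" by (rule bounded_mult_integrable[OF v_integrable(1), where B = B]) (use B in auto)
  from \<sigma>_lower[of "R + 1" x1] R obtain c0 where c0: "0 < c0" "\<forall>y. dist x1 y \<le> R + 1 \<longrightarrow> c0 \<le> \<sigma> y" by (auto simp: less_imp_le)
  from v_null obtain N where N: "N \<in> null_sets M" "\<forall>z m. z \<notin> N \<longrightarrow> (1/2) ^ m < \<sigma> z \<longrightarrow> \<bar>L (Q ((1/2) ^ m) z)\<bar> \<le> v z"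
    by (elim bexE)
  show ?thesis
  proof (rule field_le_epsilon)
    fix e :: real assume e: "0 < e"
    \<comment> \<open>One third each for the smoothing, the discretisation and the oscillation of
      \<open>\<phi>\<close> on the cells.\<close>
    define e3 where "e3 = e / 3"
    have e3: "0 < e3" using e by (simp add: e3_def)
    have c01: "0 < c0" using c0 by simp
    from first_error[OF e3 c01] obtain m :: nat where m: "(1/2) ^ m < c0" "(\<lambda>y. \<phi> y - \<Phi> ((1/2) ^ m) y) \<in> G"
      "\<bar>L (\<lambda>y. \<phi> y - \<Phi> ((1/2) ^ m) y)\<bar> < e3" by (elim exE conjE)
    define t where "t = (1/2::real) ^ m"
    have t: "0 < t" "t \<le> 1" "t < c0" using m by (auto simp: t_def power_le_one)
    have R1: "0 \<le> R + 1" "0 < R + 2" using R by auto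
    from V_inverse_uniform[OF t(1) R1(1), of x1] obtain k where k: "0 \<le> k" "\<forall>z. dist x1 z \<le> R + 1 \<longrightarrow> D * 3 powr n / V z t \<le> k"
      by (elim exE conjE)
    define B2 where "B2 = B * (2 * (4 * Kq * k / t)) * V x1 R"
    have B2: "0 \<le> B2" using B Kq(3) k t by (simp add: B2_def)
    define F where "F u = BL * (KR x1 \<beta> \<gamma> (R + 2) * (u + u powr (1 - \<beta> / 1) * B2 powr (\<beta> / 1)))" for u
    define su where "su s = B * (Kq * k / t * (2 * s)) * V x1 R" for s :: real
    have s0: "(\<lambda>i. (1/2::real) ^ Suc i) \<longlonglongrightarrow> 0" by (intro LIMSEQ_Suc LIMSEQ_power_zero) simp
    \<comment> \<open>The size of the cells is fixed after \<open>t\<close>, because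
      \<open>k\<close> and \<open>B2\<close> depend on \<open>t\<close>.\<close>
    obtain s where s: "0 < s" "2 * s \<le> 1" "F (su s) < e3" "2 * B * (2 * s) powr \<epsilon> * W < e3"
    proof -
      have "(\<lambda>i. su ((1/2::real) ^ Suc i)) \<longlonglongrightarrow> B * (Kq * k / t * (2 * 0)) * V x1 R"
        unfolding su_def by (intro tendsto_mult tendsto_const s0)
      then have su0: "(\<lambda>i. su ((1/2::real) ^ Suc i)) \<longlonglongrightarrow> 0" by simp
      have sup: "0 \<le> su ((1/2::real) ^ Suc i)" for i using B Kq(3) k t by (simp add: su_def)
      have "(\<lambda>i. F (su ((1/2::real) ^ Suc i))) \<longlonglongrightarrow> BL * (KR x1 \<beta> \<gamma> (R + 2) * (0 + 0 powr (1 - \<beta> / 1) * B2 powr (\<beta> / 1)))"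
        unfolding F_def using su0 sup \<beta> \<epsilon>
        by (intro tendsto_mult tendsto_add tendsto_const tendsto_powr') (auto simp del: power_Suc)
      then have F0: "(\<lambda>i. F (su ((1/2::real) ^ Suc i))) \<longlonglongrightarrow> 0" using \<beta> \<epsilon> by simp
      have "(\<lambda>i. 2 * B * (2 * (1/2::real) ^ Suc i) powr \<epsilon> * W) \<longlonglongrightarrow> 2 * B * (2 * 0) powr \<epsilon> * W"
        using \<epsilon> by (intro tendsto_mult tendsto_const tendsto_powr' s0) auto
      then have G0: "(\<lambda>i. 2 * B * (2 * (1/2::real) ^ Suc i) powr \<epsilon> * W) \<longlonglongrightarrow> 0" using \<epsilon> by simp
      have "\<forall>\<^sub>F i in sequentially. F (su ((1/2::real) ^ Suc i)) < e3 \<and> 2 * B * (2 * (1/2::real) ^ Suc i) powr \<epsilon> * W < e3"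
        using order_tendstoD(2)[OF F0 e3] order_tendstoD(2)[OF G0 e3] by (rule eventually_conj)
      then obtain i where i: "F (su ((1/2::real) ^ Suc i)) < e3" "2 * B * (2 * (1/2::real) ^ Suc i) powr \<epsilon> * W < e3"
        unfolding eventually_sequentially by blast
      have "2 * (1/2::real) ^ Suc i \<le> 1" by (simp add: power_le_one)
      then show ?thesis using i by (intro that[of "(1/2) ^ Suc i"]) auto
    qed
    define A where "A j = {z. idx s z = j}" for j
    have Am[measurable]: "A j \<in> sets M" for j
    proof -
      have "idx s -` {j} \<inter> space M \<in> sets M" by (rule measurable_sets[OF idx_measurable]) simp
      moreover have "idx s -` {j} \<inter> space M = A j" by (auto simp: A_def)
      ultimately show ?thesis by simp
    qed
    have Aball: "A j \<subseteq> ball (w j) s" for j using idx_dist[OF s(1)] by (auto simp: A_def dist_commute)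
    have Afin: "emeasure M (A j) < \<infinity>" for j
      using emeasure_mono[OF Aball[of j], of M] by (simp add: emeasure_ball order.strict_trans1)
    have Aem: "emeasure M (A j) = ennreal (measure M (A j))" for j
      using emeasure_eq_ennreal_measure[of M "A j"] Afin[of j] by (simp add: less_top)
    \<comment> \<open>Cells of measure 0 carry no weight in the sum, so membership is enough there.
      On the others the sample avoids \<open>N\<close> and has a value of \<open>v\<close> at most
      its mean over the cell.\<close>
    define good where "good j p \<longleftrightarrow> p \<in> A j \<and> (0 < measure M (A j) \<longrightarrow> p \<notin> N \<and> v p * measure M (A j) \<le> (\<integral>z. v z * indicator (A j) z \<partial>M))" for j p
    define p where "p j = (SOME q. good j q)" for j
    have vA: "integrable M (\<lambda>z. v z * indicator (A j) z)" for j
      using integrable_real_mult_indicator[OF Am v_integrable(1)] by simp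
    have p: "good j (p j)" if "z \<in> A j" for j z
    proof -
      have "\<exists>q. good j q"
      proof (cases "0 < measure M (A j)")
        case True
        then have "0 < emeasure M (A j)" by (simp add: Aem)
        from exists_le_mean[OF vA Am this Afin N(1)] show ?thesis unfolding good_def by blast
      next
        case False then show ?thesis using that by (auto simp: good_def)
      qed
      then show ?thesis unfolding p_def by (rule someI_ex)
    qed
    define \<zeta> where "\<zeta> z = p (idx s z)" for z
    have \<zeta>A: "\<zeta> z \<in> A (idx s z)" for z using p[of z "idx s z"] by (auto simp: \<zeta>_def good_def A_def)
    have dA: "dist z z' \<le> 2 * s" if "z \<in> A j" "z' \<in> A j" for z z' j
    proof -
      have "dist (w j) z < s" "dist (w j) z' < s" using that Aball[of j] by auto
      then show ?thesis using dist_triangle2[of z z' "w j"] by (simp add: dist_commute)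
    qed
    have \<zeta>d: "dist z (\<zeta> z) \<le> 2 * s" for z using dA[OF _ \<zeta>A, of z z] by (simp add: A_def)
    have [measurable]: "\<zeta> \<in> measurable M M"
      unfolding \<zeta>_def by (rule measurable_compose[OF idx_measurable]) simp
    have \<zeta>R: "dist x1 (\<zeta> z) \<le> R + 1" if "dist x1 z < R" for z
      using that \<zeta>d[of z] s(2) dist_triangle[of x1 "\<zeta> z" z] by linarith
    \<comment> \<open>As \<open>\<zeta>\<close> is constant on each cell, this integral is a finite
      combination of rows of \<open>Q\<close>, see \<open>\<Psi>eq\<close>.\<close>
    define \<Psi> where "\<Psi> y = (\<integral>z. \<phi> z * Q t (\<zeta> z) y \<partial>M)" for y
    have kz: "D * 3 powr n / V z t \<le> k" "D * 3 powr n / V (\<zeta> z) t \<le> k" if "dist x1 z < R" for z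
      using k that \<zeta>R[OF that] by auto
    have iQ: "integrable M (\<lambda>z. \<phi> z * Q t z y)" "integrable M (\<lambda>z. \<phi> z * Q t (\<zeta> z) y)" for y
      by (rule phi_int_bound(1)[where c = "Kq * k"], measurable, rule Q_bound_k(1)[OF t(1)], rule kz, assumption, use Kq(3) k in simp)+
    have d1: "\<bar>\<Phi> t y - \<Psi> y\<bar> \<le> su s" for y
    proof -
      have "\<Phi> t y - \<Psi> y = (\<integral>z. \<phi> z * (Q t z y - Q t (\<zeta> z) y) \<partial>M)"
        unfolding \<Phi>_def \<Psi>_def right_diff_distrib using iQ by simp
      also have "\<bar>\<dots>\<bar> \<le> B * (Kq * k / t * (2 * s)) * V x1 R"
      proof (rule phi_int_bound(2))
        show "\<bar>Q t z y - Q t (\<zeta> z) y\<bar> \<le> Kq * k / t * (2 * s)" if "dist x1 z < R" for z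
        proof -
          have "Kq * k / t * dist z (\<zeta> z) \<le> Kq * k / t * (2 * s)" using Kq(3) k t by (intro mult_left_mono \<zeta>d) auto
          then show ?thesis using Q_lip_z[OF t(1) kz[OF that], of y] by linarith
        qed
      qed (use Kq(3) k t s in auto)
      finally show ?thesis by (simp add: su_def)
    qed
    have d2: "\<bar>(\<Phi> t y - \<Psi> y) - (\<Phi> t y' - \<Psi> y')\<bar> \<le> B2 * dist y y' powr 1" for y y'
    proof -
      have "(\<Phi> t y - \<Psi> y) - (\<Phi> t y' - \<Psi> y') = (\<integral>z. \<phi> z * ((Q t z y - Q t z y') - (Q t (\<zeta> z) y - Q t (\<zeta> z) y')) \<partial>M)"
        unfolding \<Phi>_def \<Psi>_def right_diff_distrib using iQ by simp
      also have "\<bar>\<dots>\<bar> \<le> B * (2 * (4 * Kq * k / t) * dist y y') * V x1 R"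
      proof (rule phi_int_bound(2))
        show "\<bar>(Q t z y - Q t z y') - (Q t (\<zeta> z) y - Q t (\<zeta> z) y')\<bar> \<le> 2 * (4 * Kq * k / t) * dist y y'" if "dist x1 z < R" for z
          using Q_bound_k(2)[OF t(1) kz(1)[OF that], of y y'] Q_bound_k(2)[OF t(1) kz(2)[OF that], of y y'] by linarith
      qed (use Kq(3) k t in auto)
      finally show ?thesis by (simp add: B2_def mult_ac)
    qed
    have d3: "\<Phi> t y - \<Psi> y = 0" if far: "R + 2 \<le> dist x1 y" for y
    proof -
      have "\<phi> z * Q t z y = 0 \<and> \<phi> z * Q t (\<zeta> z) y = 0" for z
      proof (cases "dist x1 z < R")
        case True
        have "t \<le> dist z y" "t \<le> dist (\<zeta> z) y"
          using far True \<zeta>R[OF True] t dist_triangle[of x1 y z] dist_triangle[of x1 y "\<zeta> z"] by argo+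
        then show ?thesis using Q_zero[OF t(1)] by simp
      next
        case False then show ?thesis using supp[of z] by simp
      qed
      then have "(\<lambda>z. \<phi> z * Q t z y) = (\<lambda>_. 0)" "(\<lambda>z. \<phi> z * Q t (\<zeta> z) y) = (\<lambda>_. 0)" by auto
      then show ?thesis by (simp add: \<Phi>_def \<Psi>_def)
    qed
    have su: "0 \<le> su s" using B Kq(3) k t s by (simp add: su_def)
    have e1: "\<epsilon> \<le> 1" using \<epsilon> by simp
    note S2 = L_small[OF R1(2) e1 su B2 d1 d3 d2]
    have L2: "\<bar>L (\<lambda>y. \<Phi> t y - \<Psi> y)\<bar> < e3" using S2(2) s(3) by (simp add: F_def)
    define J where "J = idx s ` ball x1 R"
    have J: "finite J" unfolding J_def by (rule idx_finite[OF s(1)])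
    define c where "c j = (\<integral>z. \<phi> z * indicator (A j) z \<partial>M)" for j
    have ic: "integrable M (\<lambda>z. \<phi> z * indicator (A j) z)" for j using integrable_real_mult_indicator[OF Am phi_int] by simp
    have \<Psi>eq: "\<Psi> = (\<lambda>y. \<Sum>j\<in>J. c j * Q t (p j) y)"
    proof
      fix y
      have "\<phi> z * Q t (\<zeta> z) y = (\<Sum>j\<in>J. \<phi> z * indicator (A j) z * Q t (p j) y)" for z
      proof (cases "dist x1 z < R")
        case True
        then have "idx s z \<in> J" by (auto simp: J_def)
        then show ?thesis using J by (subst sum.remove[of J "idx s z"]) (auto simp: A_def \<zeta>_def indicator_def)
      next
        case False then show ?thesis using supp[of z] by simp
      qed
      then show "\<Psi> y = (\<Sum>j\<in>J. c j * Q t (p j) y)" unfolding \<Psi>_def c_def using ic by simp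
    qed
    have \<Psi>G: "\<Psi> \<in> G" and L\<Psi>: "L \<Psi> = (\<Sum>j\<in>J. c j * L (Q t (p j)))"
      unfolding \<Psi>eq using L_sum_Q[OF J t(1)] by auto
    define \<eta> where "\<eta> = B * (2 * s) powr \<epsilon>"
    have \<eta>: "0 \<le> \<eta>" using B by (simp add: \<eta>_def)
    have ivA: "integrable M (\<lambda>z. (\<bar>\<phi> z\<bar> + 2 * \<eta>) * v z * indicator (A j) z)" for j
      by (rule integrable_real_mult_indicator[OF Am]) (use iv v_integrable in \<open>simp add: distrib_right\<close>)
    \<comment> \<open>The oscillation \<open>\<eta>\<close> enters twice: when \<open>c j\<close> is
      bounded through \<open>\<phi> (p j)\<close>, and when \<open>\<phi> (p j)\<close> is replaced
      with \<open>\<phi> z\<close> under the integral.\<close>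
    have each: "\<bar>c j * L (Q t (p j))\<bar> \<le> (\<integral>z. (\<bar>\<phi> z\<bar> + 2 * \<eta>) * v z * indicator (A j) z \<partial>M)" if j: "j \<in> J" for j
    proof -
      from j obtain z0 where z0: "z0 \<in> A j" "dist x1 z0 < R" by (auto simp: J_def A_def)
      have gd: "good j (p j)" by (rule p[OF z0(1)])
      have pA: "p j \<in> A j" using gd by (simp add: good_def)
      define mj where "mj = measure M (A j)"
      have mj: "0 \<le> mj" by (simp add: mj_def)
      have osc: "\<bar>\<phi> z - \<phi> (p j)\<bar> \<le> \<eta>" if "z \<in> A j" for z
      proof -
        have "B * dist z (p j) powr \<epsilon> \<le> \<eta>" unfolding \<eta>_def using B \<epsilon> dA[OF that pA] by (intro mult_left_mono powr_mono2) auto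
        then show ?thesis using hol[of z "p j"] by linarith
      qed
      have iA: "integrable M (indicator (A j) :: 'a \<Rightarrow> real)" using Afin by (intro integrable_real_indicator) auto
      have cj: "\<bar>c j\<bar> \<le> (\<bar>\<phi> (p j)\<bar> + \<eta>) * mj"
      proof -
        have "\<bar>c j\<bar> \<le> (\<integral>z. (\<bar>\<phi> (p j)\<bar> + \<eta>) * indicator (A j) z \<partial>M)" unfolding c_def
        proof (rule order.trans[OF integral_abs_bound integral_mono])
          show "\<bar>\<phi> z * indicator (A j) z\<bar> \<le> (\<bar>\<phi> (p j)\<bar> + \<eta>) * indicator (A j) z" for z
            using osc[of z] by (auto simp: indicator_def)
        qed (use ic iA in auto)
        then show ?thesis by (simp add: mj_def)
      qed
      have nn: "0 \<le> (\<integral>z. (\<bar>\<phi> z\<bar> + 2 * \<eta>) * v z * indicator (A j) z \<partial>M)"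
        using v_integrable(2) \<eta> by (intro Bochner_Integration.integral_nonneg) auto
      show ?thesis
      proof (cases "mj = 0")
        case True then show ?thesis using cj nn by simp
      next
        case False
        then have "0 < mj" using mj by argo
        then have pos: "0 < measure M (A j)" by (simp only: mj_def)
        have pv: "p j \<notin> N" "v (p j) * mj \<le> (\<integral>z. v z * indicator (A j) z \<partial>M)" using gd pos by (auto simp: good_def mj_def)
        have "dist x1 (p j) \<le> R + 1" using z0 dA[OF z0(1) pA] s(2) dist_triangle[of x1 "p j" z0] by linarith
        then have "t < \<sigma> (p j)" using c0 t by force
        then have Lv: "\<bar>L (Q t (p j))\<bar> \<le> v (p j)" using N(2) pv(1) unfolding t_def by blast
        have "\<bar>c j * L (Q t (p j))\<bar> \<le> ((\<bar>\<phi> (p j)\<bar> + \<eta>) * mj) * v (p j)"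
          unfolding abs_mult using cj Lv \<eta> mj by (intro mult_mono) auto
        also have "\<dots> = (\<bar>\<phi> (p j)\<bar> + \<eta>) * (v (p j) * mj)" by simp
        also have "\<dots> \<le> (\<bar>\<phi> (p j)\<bar> + \<eta>) * (\<integral>z. v z * indicator (A j) z \<partial>M)"
          using \<eta> by (intro mult_left_mono pv) auto
        also have "\<dots> = (\<integral>z. (\<bar>\<phi> (p j)\<bar> + \<eta>) * (v z * indicator (A j) z) \<partial>M)" by simp
        also have "\<dots> \<le> (\<integral>z. (\<bar>\<phi> z\<bar> + 2 * \<eta>) * v z * indicator (A j) z \<partial>M)"
        proof (rule integral_mono)
          show "integrable M (\<lambda>z. (\<bar>\<phi> (p j)\<bar> + \<eta>) * (v z * indicator (A j) z))"
            using integrable_real_mult_indicator[OF Am v_integrable(1), of j] by simp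
          show "(\<bar>\<phi> (p j)\<bar> + \<eta>) * (v z * indicator (A j) z) \<le> (\<bar>\<phi> z\<bar> + 2 * \<eta>) * v z * indicator (A j) z" for z
          proof (cases "z \<in> A j")
            case True
            have "\<bar>\<phi> (p j)\<bar> + \<eta> \<le> \<bar>\<phi> z\<bar> + 2 * \<eta>" using osc[OF True] by linarith
            from mult_right_mono[OF this v_integrable(2)[of z]] show ?thesis using True by simp
          qed simp
        qed (rule ivA)
        finally show ?thesis .
      qed
    qed
    have "\<bar>L \<Psi>\<bar> \<le> (\<Sum>j\<in>J. \<bar>c j * L (Q t (p j))\<bar>)" unfolding L\<Psi> by (rule sum_abs)
    also have "\<dots> \<le> (\<Sum>j\<in>J. \<integral>z. (\<bar>\<phi> z\<bar> + 2 * \<eta>) * v z * indicator (A j) z \<partial>M)" by (intro sum_mono each)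
    also have "\<dots> = (\<integral>z. (\<Sum>j\<in>J. (\<bar>\<phi> z\<bar> + 2 * \<eta>) * v z * indicator (A j) z) \<partial>M)"
      using ivA by (intro Bochner_Integration.integral_sum[symmetric]) auto
    also have "\<dots> \<le> (\<integral>z. (\<bar>\<phi> z\<bar> + 2 * \<eta>) * v z \<partial>M)"
    proof (rule integral_mono)
      show "integrable M (\<lambda>z. \<Sum>j\<in>J. (\<bar>\<phi> z\<bar> + 2 * \<eta>) * v z * indicator (A j) z)" by (intro Bochner_Integration.integrable_sum ivA)
      show "integrable M (\<lambda>z. (\<bar>\<phi> z\<bar> + 2 * \<eta>) * v z)" using iv v_integrable by (simp add: distrib_right)
      fix z
      have "(\<Sum>j\<in>J. indicator (A j) z :: real) \<le> 1"
      proof (cases "idx s z \<in> J")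
        case True
        then show ?thesis using J by (subst sum.remove[of J "idx s z"]) (auto simp: A_def indicator_def)
      next
        case False
        then have "(\<Sum>j\<in>J. indicator (A j) z :: real) = 0" by (intro sum.neutral) (auto simp: A_def indicator_def)
        then show ?thesis by simp
      qed
      then have "(\<bar>\<phi> z\<bar> + 2 * \<eta>) * v z * (\<Sum>j\<in>J. indicator (A j) z) \<le> (\<bar>\<phi> z\<bar> + 2 * \<eta>) * v z * 1"
        using v_integrable(2) \<eta> by (intro mult_left_mono) auto
      then show "(\<Sum>j\<in>J. (\<bar>\<phi> z\<bar> + 2 * \<eta>) * v z * indicator (A j) z) \<le> (\<bar>\<phi> z\<bar> + 2 * \<eta>) * v z"
        by (simp add: sum_distrib_left)
    qed
    also have "\<dots> = (\<integral>z. \<bar>\<phi> z\<bar> * v z \<partial>M) + 2 * \<eta> * W"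
      using iv v_integrable by (simp add: distrib_right W_def)
    also have "2 * \<eta> * W < e3" using s(4) by (simp add: \<eta>_def mult.assoc)
    finally have L3: "\<bar>L \<Psi>\<bar> < (\<integral>z. \<bar>\<phi> z\<bar> * v z \<partial>M) + e3" by simp
    have bp: "bump x1 \<epsilon> \<phi>" unfolding bump_def using R B supp hol by blast
    have \<phi>G: "\<phi> \<in> G" by (rule bump_G[OF bp order.refl])
    have \<Phi>G: "\<Phi> t \<in> G" using G_diff[OF S2(1) G_lin[OF \<Psi>G \<Psi>G, of "-1" 0]] by simp
    have "L (\<lambda>y. \<phi> y - \<Phi> t y) = L \<phi> - L (\<Phi> t)" by (rule L_diff[OF \<phi>G \<Phi>G])
    moreover have "L (\<lambda>y. \<Phi> t y - \<Psi> y) = L (\<Phi> t) - L \<Psi>" by (rule L_diff[OF \<Phi>G \<Psi>G])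
    ultimately have "\<bar>L \<phi>\<bar> \<le> e3 + e3 + ((\<integral>z. \<bar>\<phi> z\<bar> * v z \<partial>M) + e3)" using m(3) L2 L3 unfolding t_def[symmetric] by linarith
    then show "\<bar>L \<phi>\<bar> \<le> (\<integral>z. \<bar>\<phi> z\<bar> * v z \<partial>M) + e" by (simp add: e3_def)
  qed
qed

end

text \<open>On bumps the domination by \<open>v\<close> feeds the Riesz argument. Both sides are
  continuous in the norm with exponents \<open>\<beta>\<close> and \<open>\<gamma>\<close>, and
  bumps are dense: elements of \<open>G\<close> are limits of test functions with exponents
  \<open>\<epsilon>\<close> by definition, and those are limits of bumps by
  \<open>bump_dense\<close>.\<close>

theorem representation: "\<exists>f. integrable M f \<and> (\<forall>\<phi>\<in>G. L \<phi> = pairing M f \<phi>)"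
proof -
  have "\<exists>f. integrable M f \<and> (\<forall>\<phi>\<in>{\<phi>. bump x1 \<epsilon> \<phi>}. L \<phi> = (\<integral>x. f x * \<phi> x \<partial>M))"
  proof (rule riesz_dominated[OF v_integrable])
    show "\<phi> \<in> borel_measurable M" if "\<phi> \<in> {\<phi>. bump x1 \<epsilon> \<phi>}" for \<phi> using that \<epsilon> by (auto intro: bump_measurable)
    show "\<exists>B. \<forall>x. \<bar>\<phi> x\<bar> \<le> B" if "\<phi> \<in> {\<phi>. bump x1 \<epsilon> \<phi>}" for \<phi> using that by (auto simp: bump_def)
    have "bump x1 \<epsilon> (Q 1 x1)" using \<epsilon> by (intro bump_weaken[OF Q_bump]) auto
    then show "{\<phi>. bump x1 \<epsilon> \<phi>} \<noteq> {}" by blast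
    show "(\<lambda>x. a * \<phi> x + c * \<psi> x) \<in> {\<phi>. bump x1 \<epsilon> \<phi>}" if "\<phi> \<in> {\<phi>. bump x1 \<epsilon> \<phi>}" "\<psi> \<in> {\<phi>. bump x1 \<epsilon> \<phi>}" for \<phi> \<psi> a c
      using that bump_lin by simp
    show "L (\<lambda>x. a * \<phi> x + c * \<psi> x) = a * L \<phi> + c * L \<psi>" if "\<phi> \<in> {\<phi>. bump x1 \<epsilon> \<phi>}" "\<psi> \<in> {\<phi>. bump x1 \<epsilon> \<phi>}" for \<phi> \<psi> a c
      using that by (intro L_lin bump_G[of \<epsilon>]) auto
    show "\<bar>L \<phi>\<bar> \<le> (\<integral>x. \<bar>\<phi> x\<bar> * v x \<partial>M)" if "\<phi> \<in> {\<phi>. bump x1 \<epsilon> \<phi>}" for \<phi>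
    proof -
      from that obtain R B where "0 < R" "0 \<le> B" "\<forall>y. \<bar>\<phi> y\<bar> \<le> B" "\<forall>y. R \<le> dist x1 y \<longrightarrow> \<phi> y = 0"
        "\<forall>y z. \<bar>\<phi> y - \<phi> z\<bar> \<le> B * dist y z powr \<epsilon>" unfolding bump_def mem_Collect_eq by (elim exE conjE)
      then show ?thesis by (intro L_dominated[of R B]) auto
    qed
  qed
  then obtain f where f: "integrable M f" and fL: "\<And>\<phi>. bump x1 \<epsilon> \<phi> \<Longrightarrow> L \<phi> = (\<integral>x. f x * \<phi> x \<partial>M)" by blast
  define c where "c = BL + (\<integral>x. \<bar>f x\<bar> \<partial>M) / V x1 1"
  have c: "0 \<le> c" unfolding c_def using BL by (intro add_nonneg_nonneg divide_nonneg_nonneg) auto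
  have pair: "integrable M (\<lambda>y. f y * \<phi> y)" "\<bar>\<integral>y. f y * \<phi> y \<partial>M\<bar> \<le> A * ((\<integral>y. \<bar>f y\<bar> \<partial>M) / V x1 1)"
    if G: "G_bound M x1 1 \<beta> \<gamma> \<phi> A" for \<phi> A
  proof -
    have [measurable]: "\<phi> \<in> borel_measurable M" "f \<in> borel_measurable M"
      using G_bound_measurable[OF G _ \<beta>(1)] f by auto
    have A: "0 \<le> A" by (rule G_bound_nonneg[OF G]) simp
    have le: "\<bar>\<phi> y\<bar> \<le> A / V x1 1" for y
    proof -
      have "env \<gamma> 1 x1 y \<le> 1 / V x1 1 * 1"
        unfolding env_def Vr_V Vxy_V using V_pos[of 1 x1] \<gamma>
        by (intro mult_mono divide_left_mono powr_le1) (auto simp: divide_simps add_pos_nonneg intro!: mult_pos_pos)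
      then have "A * env \<gamma> 1 x1 y \<le> A * (1 / V x1 1)" using A by (intro mult_left_mono) auto
      moreover have "\<bar>\<phi> y\<bar> \<le> A * env \<gamma> 1 x1 y" using G unfolding G_bound_env by blast
      ultimately show ?thesis by simp
    qed
    have le2: "\<bar>f y * \<phi> y\<bar> \<le> A / V x1 1 * \<bar>f y\<bar>" for y
      using mult_right_mono[OF le[of y], of "\<bar>f y\<bar>"] by (simp add: abs_mult mult_ac)
    show i: "integrable M (\<lambda>y. f y * \<phi> y)"
      by (rule Bochner_Integration.integrable_bound[of M "\<lambda>y. A / V x1 1 * \<bar>f y\<bar>"])
         (use f le2 A in \<open>auto intro!: AE_I2 simp: abs_mult\<close>)
    have "\<bar>\<integral>y. f y * \<phi> y \<partial>M\<bar> \<le> (\<integral>y. \<bar>f y * \<phi> y\<bar> \<partial>M)" by (rule integral_abs_bound)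
    also have "\<dots> \<le> (\<integral>y. A / V x1 1 * \<bar>f y\<bar> \<partial>M)" using i f le2 by (intro integral_mono) auto
    also have "\<dots> = A * ((\<integral>y. \<bar>f y\<bar> \<partial>M) / V x1 1)" by simp
    finally show "\<bar>\<integral>y. f y * \<phi> y \<partial>M\<bar> \<le> A * ((\<integral>y. \<bar>f y\<bar> \<partial>M) / V x1 1)" .
  qed
  have "L \<phi> = pairing M f \<phi>" if \<phi>: "\<phi> \<in> G" for \<phi>
  proof -
    have "\<bar>L \<phi> - pairing M f \<phi>\<bar> \<le> 0"
    proof (rule field_le_epsilon)
      fix e :: real assume e: "0 < e"
      define \<eta> where "\<eta> = e / (2 * (c + 1))"
      have \<eta>: "0 < \<eta>" "2 * \<eta> * (c + 1) = e"
      proof -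
        have "0 < 2 * (c + 1)" by (intro mult_pos_pos add_nonneg_pos c) auto
        then have "2 * (c + 1) \<noteq> 0" by simp
        then have "\<eta> * (2 * (c + 1)) = e" using \<eta>_def nonzero_eq_divide_eq[of "2 * (c + 1)" \<eta> e] by blast
        then show "2 * \<eta> * (c + 1) = e" by argo
      qed (use e c in \<open>simp add: \<eta>_def\<close>)
      from \<phi> \<eta>(1) obtain g where g: "g \<in> Gsp M x1 1 \<epsilon> \<epsilon>" "Gnorm M x1 1 \<beta> \<gamma> (\<lambda>y. \<phi> y - g y) < \<eta>"
        unfolding G0_def by blast
      have gG: "g \<in> G" using \<epsilon> \<beta> \<gamma> by (intro G0_I g) auto
      have b1: "G_bound M x1 1 \<beta> \<gamma> (\<lambda>y. \<phi> y - g y) \<eta>"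
        by (rule G_bound_mono[OF Gnorm_bound[OF G0_Gsp[OF G_diff[OF \<phi> gG]]]]) (use g in auto)
      have gb: "G_bound M x1 1 \<epsilon> \<epsilon> g (Gnorm M x1 1 \<epsilon> \<epsilon> g)" by (rule Gnorm_bound[OF g(1)]) simp
      from bump_dense[OF gb \<beta> \<gamma> less_imp_le[OF \<epsilon>(2)] \<eta>(1)] obtain \<psi> where \<psi>: "bump x1 \<epsilon> \<psi>" "G_bound M x1 1 \<beta> \<gamma> (\<lambda>y. g y - \<psi> y) \<eta>"
        by (elim exE conjE)
      have b2: "G_bound M x1 1 \<beta> \<gamma> (\<lambda>y. \<phi> y - \<psi> y) (2 * \<eta>)"
        using G_bound_lin[OF b1 \<psi>(2), of 1 1] by simp
      have \<psi>G: "\<psi> \<in> G" by (rule bump_G[OF \<psi>(1) order.refl])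
      have dG: "(\<lambda>y. \<phi> y - \<psi> y) \<in> G" by (rule G_diff[OF \<phi> \<psi>G])
      have "Gnorm M x1 1 \<beta> \<gamma> (\<lambda>y. \<phi> y - \<psi> y) \<le> 2 * \<eta>" by (rule Gnorm_le[OF b2]) simp
      from mult_left_mono[OF this BL] L_bound[OF dG] have 1: "\<bar>L \<phi> - L \<psi>\<bar> \<le> BL * (2 * \<eta>)"
        unfolding L_diff[OF \<phi> \<psi>G] by linarith
      have \<phi>b: "G_bound M x1 1 \<beta> \<gamma> \<phi> (Gnorm M x1 1 \<beta> \<gamma> \<phi>)" "G_bound M x1 1 \<beta> \<gamma> \<psi> (Gnorm M x1 1 \<beta> \<gamma> \<psi>)"
        by (rule Gnorm_bound[OF G0_Gsp[OF \<phi>]], simp, rule Gnorm_bound[OF G0_Gsp[OF \<psi>G]], simp)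
      have "pairing M f \<phi> - L \<psi> = (\<integral>y. f y * (\<phi> y - \<psi> y) \<partial>M)"
        unfolding pairing_def fL[OF \<psi>(1)] right_diff_distrib using pair(1)[OF \<phi>b(1)] pair(1)[OF \<phi>b(2)] by simp
      with pair(2)[OF b2] have 2: "\<bar>pairing M f \<phi> - L \<psi>\<bar> \<le> 2 * \<eta> * ((\<integral>y. \<bar>f y\<bar> \<partial>M) / V x1 1)" by simp
      have "\<bar>L \<phi> - pairing M f \<phi>\<bar> \<le> BL * (2 * \<eta>) + 2 * \<eta> * ((\<integral>y. \<bar>f y\<bar> \<partial>M) / V x1 1)" using 1 2 by linarith
      also have "\<dots> = 2 * \<eta> * c" by (simp add: c_def algebra_simps)
      also have "\<dots> \<le> 2 * \<eta> * (c + 1)" using \<eta> by (intro mult_left_mono) auto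
      finally show "\<bar>L \<phi> - pairing M f \<phi>\<bar> \<le> 0 + e" unfolding \<eta>(2) by simp
    qed
    then show ?thesis by simp
  qed
  then show ?thesis using f by blast
qed

end

section \<open>Equivalence of the norms\<close>

context kernel_regular
begin

text \<open>The comparison of rows of \<open>Q\<close> with \<open>Gmax\<close>, now for a pairing
  and along the powers of \<open>\<delta>\<close>. Measurability of the left-hand integrand is what
  lets the constant be taken out of the integral.\<close>

lemma dmax_Q_le_H1norm:
  assumes f: "integrable M f" and e: "0 < \<epsilon>" "\<epsilon> \<le> 1" "0 < \<beta>" "\<beta> \<le> \<epsilon>" "0 < \<gamma>" "\<gamma> \<le> \<epsilon>"
    and m: "dmax Q f \<in> borel_measurable M"
  shows "(\<integral>\<^sup>+z. dmax Q f z \<partial>M) \<le> ennreal (CQ \<gamma>) * H1norm M \<rho> \<epsilon> x1 \<beta> \<gamma> (pairing M f)"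
proof -
  have C: "0 < CQ \<gamma>" by (rule CQ_pos)
  have pw: "ennreal (1 / CQ \<gamma>) * dmax Q f z \<le> Gmax M \<rho> \<epsilon> x1 \<beta> \<gamma> (pairing M f) z" for z
    unfolding dmax_def SUP_mult_left_ennreal
  proof (rule SUP_least)
    fix m :: int
    define t where "t = \<delta> powr m"
    have t0: "0 < t" using \<delta>(1) by (simp add: t_def)
    show "ennreal (1 / CQ \<gamma>) * ennreal (if \<delta> powr m < \<sigma> z then \<bar>kop M (Q (\<delta> powr m)) f z\<bar> else 0) \<le> Gmax M \<rho> \<epsilon> x1 \<beta> \<gamma> (pairing M f) z"
      unfolding t_def[symmetric]
    proof (cases "t < \<sigma> z")
      case True
      then have t: "t < \<rho> z" using \<sigma>_le[of z] by simp
      have "kop M (Q t) f z = pairing M f (Q t z)" by (simp add: kop_def pairing_def mult.commute)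
      moreover have "pairing M f (\<lambda>y. (1 / CQ \<gamma>) * Q t z y + 0 * Q t z y) = (1 / CQ \<gamma>) * pairing M f (Q t z) + 0 * pairing M f (Q t z)"
        by (simp add: pairing_def)
      from Gmax_ge_Q[where L = "pairing M f" and \<rho> = \<rho>, OF t0 t e(1,2,4,6,3,5) this, of x1]
      have "ennreal (1 / CQ \<gamma>) * ennreal \<bar>pairing M f (Q t z)\<bar> \<le> Gmax M \<rho> \<epsilon> x1 \<beta> \<gamma> (pairing M f) z" .
      ultimately show "ennreal (1 / CQ \<gamma>) * ennreal (if t < \<sigma> z then \<bar>kop M (Q t) f z\<bar> else 0) \<le> Gmax M \<rho> \<epsilon> x1 \<beta> \<gamma> (pairing M f) z"
        using True by simp
    qed simp
  qed
  have "(\<integral>\<^sup>+z. dmax Q f z \<partial>M) = ennreal (CQ \<gamma>) * (ennreal (1 / CQ \<gamma>) * (\<integral>\<^sup>+z. dmax Q f z \<partial>M))"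
    using C by (simp add: mult.assoc[symmetric] ennreal_mult[symmetric])
  also have "ennreal (1 / CQ \<gamma>) * (\<integral>\<^sup>+z. dmax Q f z \<partial>M) = (\<integral>\<^sup>+z. ennreal (1 / CQ \<gamma>) * dmax Q f z \<partial>M)"
    by (rule nn_integral_cmult[OF m, symmetric])
  also have "ennreal (CQ \<gamma>) * \<dots> \<le> ennreal (CQ \<gamma>) * H1norm M \<rho> \<epsilon> x1 \<beta> \<gamma> (pairing M f)"
    unfolding H1norm_def by (intro mult_left_mono nn_integral_mono pw) simp
  finally show ?thesis .
qed

text \<open>The kernel \<open>P\<close> of the locale and the kernel \<open>S\<close> that
  approximates \<open>T\<close> differ here: rows of \<open>S\<close> serve as test functions for
  the majorant built from \<open>P\<close>. It is applied with \<open>Q\<close> as the kernel of the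
  locale, so that the right-hand side is controlled by the Hardy norm.\<close>

lemma Tplus_le_dmax:
  assumes f: "integrable M f"
    and S: "\<And>t x. 0 < t \<Longrightarrow> G_bound M x t e1 e2 (S t x) A" and A: "0 < A" and ex: "b \<le> e1" "g \<le> e2"
    and K: "0 \<le> K" and TS: "\<And>t x. 0 < t \<Longrightarrow>
      ennreal \<bar>kop M (T t) f x\<bar> \<le> (if t < \<rho> x then ennreal \<bar>kop M (S t) f x\<bar> else 0) + ennreal K * H g f x"
  shows "(\<integral>\<^sup>+x. Tplus M T f x \<partial>M) \<le> ennreal (KG * A * KF + K * KHH g) * (\<integral>\<^sup>+z. dmax P f z \<partial>M)"
proof -
  let ?I = "\<integral>\<^sup>+z. dmax P f z \<partial>M"
  have [measurable]: "f \<in> borel_measurable M" using f by auto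
  from grand_majorant[OF f] obtain G where Gm[measurable]: "G \<in> borel_measurable M"
    and G: "\<forall>x r \<phi>. 0 < r \<longrightarrow> r < \<rho> x \<longrightarrow> cls x r 1 1 \<phi> \<longrightarrow> ennreal \<bar>\<integral>y. f y * \<phi> y \<partial>M\<bar> \<le> G x"
    and GI: "(\<integral>\<^sup>+x. G x \<partial>M) \<le> ennreal KF * ?I" by (elim bexE conjE)
  have "Tplus M T f x \<le> ennreal (KG * A) * G x + ennreal K * H g f x" for x
    unfolding Tplus_def
  proof (rule SUP_least)
    fix t :: real assume "t \<in> {0<..}"
    then have t: "0 < t" by simp
    have "(if t < \<rho> x then ennreal \<bar>kop M (S t) f x\<bar> else 0) \<le> ennreal (KG * A) * G x"
      using cls_pairing_le[OF G t _ S[OF t] A ex, of x] by (simp add: kop_def mult.commute)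
    then show "ennreal \<bar>kop M (T t) f x\<bar> \<le> ennreal (KG * A) * G x + ennreal K * H g f x"
      by (rule order.trans[OF TS[OF t] add_right_mono])
  qed
  then have "(\<integral>\<^sup>+x. Tplus M T f x \<partial>M) \<le> (\<integral>\<^sup>+x. ennreal (KG * A) * G x + ennreal K * H g f x \<partial>M)"
    by (intro nn_integral_mono)
  also have "\<dots> = ennreal (KG * A) * (\<integral>\<^sup>+x. G x \<partial>M) + ennreal K * (\<integral>\<^sup>+x. H g f x \<partial>M)"
    by (subst nn_integral_add) (auto simp: nn_integral_cmult)
  also have "\<dots> \<le> ennreal (KG * A) * (ennreal KF * ?I) + ennreal K * (ennreal (KHH g) * ?I)"
  proof (intro add_mono mult_left_mono GI)
    have "ennreal (KHH g) * (\<integral>\<^sup>+y. ennreal \<bar>f y\<bar> \<partial>M) \<le> ennreal (KHH g) * ?I" by (intro mult_left_mono L1_le_dmax f) simp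
    then show "(\<integral>\<^sup>+x. H g f x \<partial>M) \<le> ennreal (KHH g) * ?I" by (intro order.trans[OF H_bound[OF g_pos(1)]]) auto
  qed auto
  also have "\<dots> = ennreal (KG * A * KF + K * KHH g) * ?I"
    using KG_pos A KF_pos K KHH_nonneg[OF g_pos(1)]
    by (simp add: ennreal_plus ennreal_mult distrib_right mult.assoc)
  finally show ?thesis .
qed

end

context perturbed_kernel
begin

lemma H1norm_le_Tplus_rho:
  assumes f: "integrable M f" and ex: "b \<le> \<beta>" "g \<le> \<gamma>"
  shows "H1norm M \<rho> \<epsilon> x1 \<beta> \<gamma> (pairing M f) \<le> ennreal (KG * KF * (1 + K2 * KHH g)) * (\<integral>\<^sup>+x. Tplus_rho M \<rho> T f x \<partial>M)"
proof -
  have K: "0 \<le> KG * KF" "0 \<le> 1 + K2 * KHH g" using KG_pos KF_pos K2 KHH_nonneg[OF g_pos(1)] by auto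
  have "H1norm M \<rho> \<epsilon> x1 \<beta> \<gamma> (pairing M f) \<le> ennreal (KG * KF) * (\<integral>\<^sup>+z. dmax P f z \<partial>M)" by (rule H1norm_le_dmax[OF f ex])
  also have "\<dots> \<le> ennreal (KG * KF) * (ennreal (1 + K2 * KHH g) * (\<integral>\<^sup>+x. Tplus_rho M \<rho> T f x \<partial>M))"
    by (intro mult_left_mono order.trans[OF dmax_P_integral[OF f]] nn_integral_mono dmax_T_le) auto
  finally show ?thesis unfolding ennreal_mult[OF K] by (simp only: mult.assoc)
qed

end

text \<open>Balls have finite mass and the space has infinite mass, so distances are unbounded and
  the restriction of the radii by the diameter is always met.\<close>

lemma RD_space_doubling:
  fixes M :: "'a::metric_space measure"
  assumes "RD_space M"
  shows "\<exists>D n. regular_doubling M D n"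
proof -
  note A = assms[unfolded RD_space_def]
  note M = A[THEN conjunct1] A[THEN conjunct2, THEN conjunct1]
  note A = A[THEN conjunct2, THEN conjunct2]
  note ball = A[THEN conjunct1]
  note A = A[THEN conjunct2, THEN conjunct2]
  note ex = A[THEN conjunct1] and inf = A[THEN conjunct2]
  from ex obtain \<kappa> n C2 where n: "0 < \<kappa>" "\<kappa> \<le> n" "1 \<le> C2" and
    sc: "\<forall>x r l. 0 < r \<longrightarrow> 1 \<le> l \<longrightarrow> (\<exists>y z::'a. 2 * l * r < dist y z) \<longrightarrow>
           (l powr \<kappa>) * Vr M r x / C2 \<le> Vr M (l * r) x \<and> Vr M (l * r) x \<le> C2 * (l powr n) * Vr M r x"
    by (elim exE conjE)
  have unb: "\<exists>y z::'a. R < dist y z" if R: "0 < R" for R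
  proof (rule ccontr)
    assume "\<nexists>y z::'a. R < dist y z"
    then have "dist undefined z < R + 1" for z :: 'a by (meson not_le le_less_trans less_add_one)
    then have "ball (undefined :: 'a) (R + 1) = UNIV" by auto
    moreover have "emeasure M (ball (undefined :: 'a) (R + 1)) < \<infinity>" using ball R by (simp add: add_pos_nonneg)
    ultimately show False using inf by simp
  qed
  have "regular_doubling M C2 n"
  proof unfold_locales
    fix x :: 'a and r l :: real assume rl: "0 < r" "1 \<le> l"
    then have "\<exists>y z::'a. 2 * l * r < dist y z" by (intro unb) auto
    then show "measure M (ball x (l * r)) \<le> C2 * l powr n * measure M (ball x r)"
      using sc rl unfolding Vr_def by blast
  qed (use M ball inf n in auto)
  then show ?thesis by blast
qed

text \<open>Two instances of the same theory: with \<open>S\<close>, which approximates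
  \<open>T\<close>, it bounds the Hardy norm by the maximal function; with \<open>Q\<close>, whose
  rows compete in \<open>Gmax\<close>, it bounds the maximal function by the Hardy norm.\<close>

theorem H1norm_equiv:
  fixes M :: "'a::metric_space measure" and T S :: "real \<Rightarrow> 'a \<Rightarrow> 'a \<Rightarrow> real"
  assumes RD: "RD_space M" and adm: "admissible \<rho>"
    and e1: "0 < e1" and e2: "0 < e2" and AOTI: "cont_AOTI M e1 e2 e3 S"
    and Top: "\<And>t. 0 < t \<Longrightarrow> L2_kernel_op M (T t)"
    and C: "0 < C" and \<delta>: "0 < \<delta>1" "0 < \<delta>2" "0 < \<delta>3"
    and size: "\<And>t x y. 0 < t \<Longrightarrow> \<bar>T t x y\<bar> \<le> C * (1 / (Vr M t x + Vxy M x y))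
                 * (t / (t + dist x y)) powr \<delta>2 * (\<rho> x / (t + \<rho> x)) powr \<delta>3"
    and diff: "\<And>t x y. 0 < t \<Longrightarrow> \<bar>T t x y - S t x y\<bar> \<le> C * (t / (t + \<rho> x)) powr \<delta>1
                 * (1 / (Vr M t x + Vxy M x y)) * (t / (t + dist x y)) powr \<delta>2"
    and \<epsilon>: "0 < \<epsilon>" "\<epsilon> \<le> 1" and \<beta>: "0 < \<beta>" "\<beta> \<le> \<epsilon>" and \<gamma>: "0 < \<gamma>" "\<gamma> \<le> \<epsilon>"
  shows "\<exists>K>0. \<forall>f. integrable M f \<longrightarrow>
      H1norm M \<rho> \<epsilon> x1 \<beta> \<gamma> (pairing M f) \<le> ennreal K * (\<integral>\<^sup>+ x. Tplus_rho M \<rho> T f x \<partial>M) \<and>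
      (\<integral>\<^sup>+ x. Tplus M T f x \<partial>M) \<le> ennreal K * H1norm M \<rho> \<epsilon> x1 \<beta> \<gamma> (pairing M f)"
proof -
  from RD_space_doubling[OF RD] obtain D n where "regular_doubling M D n" by (elim exE)
  then interpret regular_doubling M D n .
  from admissible_minorant[OF adm] obtain \<sigma> a Ca Kr where ap: "admissible_pair M D n \<rho> \<sigma> a Ca Kr" by (elim exE)
  then interpret admissible_pair M D n \<rho> \<sigma> a Ca Kr .
  \<comment> \<open>\<open>g\<close> lies below all decay exponents involved, and \<open>b\<close>
    is half of what smoothness and decay allow, as \<open>kernel\<close> demands Hoelder exponent
    \<open>2 * b\<close>. The bound \<open>2 * b \<le> 1\<close> needed for the Lipschitz kernel
    \<open>Q\<close> follows from \<open>\<beta> \<le> \<epsilon>\<close> and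
    \<open>\<epsilon> \<le> 1\<close>.\<close>
  define g where "g = min (min \<gamma> e2) (min \<delta>1 (min \<delta>2 \<delta>3))"
  define b where "b = min (min e1 \<beta>) g / 2"
  have g: "0 < g" "g \<le> \<gamma>" "g \<le> e2" "g \<le> \<delta>1" "g \<le> \<delta>2" "g \<le> \<delta>3" using \<gamma> e2 \<delta> by (auto simp: g_def)
  have b: "0 < b" "2 * b \<le> g" "2 * b \<le> e1" "b \<le> \<beta>" "2 * b \<le> 1" "b \<le> 1" "b \<le> e1"
    using e1 \<beta> g(1) \<epsilon> by (auto simp: b_def)
  from kernel_of_AOTI[OF AOTI b(1-3) g(3)] obtain CS where CS: "0 < CS" and kS: "kernel M D n S g b CS"
    and SG: "\<And>t x. 0 < t \<Longrightarrow> G_bound M x t e1 e2 (S t x) CS" by (elim exE conjE) blast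
  interpret S: kernel M D n S g b CS by (rule kS)
  interpret S: perturbed_kernel M D n S g b CS \<rho> \<sigma> a Ca Kr T \<delta>1 \<delta>2 \<delta>3 C
  proof unfold_locales
    show "(\<lambda>(x, y). T t x y) \<in> borel_measurable (M \<Otimes>\<^sub>M M)" if "0 < t" for t
      using Top[OF that] by (simp add: L2_kernel_op_def)
    show "\<bar>T t x y\<bar> \<le> C * env \<delta>2 t x y * (\<rho> x / (t + \<rho> x)) powr \<delta>3" if "0 < t" for t x y
      using size[OF that, of x y] by (simp add: env_def mult.assoc)
    show "\<bar>T t x y - S t x y\<bar> \<le> C * (t / (t + \<rho> x)) powr \<delta>1 * env \<delta>2 t x y" if "0 < t" for t x y
      using diff[OF that, of x y] by (simp add: env_def mult.assoc)
  qed (use b g C in auto)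
  interpret Q: kernel M D n Q g b "Kq * (3 powr g * (D * 3 powr n))" by (rule kernel_Q[OF b(1,2,5)])
  interpret Q: kernel_regular M D n Q g b "Kq * (3 powr g * (D * 3 powr n))" \<rho> \<sigma> a Ca Kr
    by unfold_locales (rule b)
  define K1 where "K1 = S.KG * S.KF * (1 + S.K2 * KHH g)"
  define K2 where "K2 = (Q.KG * CS * Q.KF + S.K2 * KHH g) * CQ \<gamma>"
  have KH: "0 \<le> KHH g" by (rule KHH_nonneg[OF g(1)])
  have K1: "0 < K1" unfolding K1_def using S.KG_pos S.KF_pos S.K2 KH by (intro mult_pos_pos add_pos_nonneg) auto
  have K20: "0 \<le> Q.KG * CS * Q.KF + S.K2 * KHH g" using Q.KG_pos Q.KF_pos CS S.K2 KH by auto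
  have K2: "0 \<le> K2" unfolding K2_def using K20 CQ_pos[of \<gamma>] by auto
  show ?thesis
  proof (rule exI[of _ "K1 + K2"], intro conjI allI impI)
    show "0 < K1 + K2" using K1 K2 by simp
    fix f :: "'a \<Rightarrow> real" assume f: "integrable M f"
    have "H1norm M \<rho> \<epsilon> x1 \<beta> \<gamma> (pairing M f) \<le> ennreal K1 * (\<integral>\<^sup>+ x. Tplus_rho M \<rho> T f x \<partial>M)"
      unfolding K1_def by (rule S.H1norm_le_Tplus_rho[OF f b(4) g(2)])
    also have "\<dots> \<le> ennreal (K1 + K2) * (\<integral>\<^sup>+ x. Tplus_rho M \<rho> T f x \<partial>M)"
      using K2 by (intro mult_right_mono ennreal_leI) auto
    finally show "H1norm M \<rho> \<epsilon> x1 \<beta> \<gamma> (pairing M f) \<le> ennreal (K1 + K2) * (\<integral>\<^sup>+ x. Tplus_rho M \<rho> T f x \<partial>M)" .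
    have m: "Q.dmax Q f \<in> borel_measurable M" by (intro Q.dmax_measurable Q.kop_measurable borel_measurable_integrable f)
    have "(\<integral>\<^sup>+ x. Tplus M T f x \<partial>M) \<le> ennreal (Q.KG * CS * Q.KF + S.K2 * KHH g) * (\<integral>\<^sup>+z. Q.dmax Q f z \<partial>M)"
      by (rule Q.Tplus_le_dmax[OF f SG CS b(7) g(3) less_imp_le[OF S.K2] S.T_le_P[OF f]])
    also have "\<dots> \<le> ennreal (Q.KG * CS * Q.KF + S.K2 * KHH g) * (ennreal (CQ \<gamma>) * H1norm M \<rho> \<epsilon> x1 \<beta> \<gamma> (pairing M f))"
      by (intro mult_left_mono Q.dmax_Q_le_H1norm f \<epsilon> \<beta> \<gamma> m) simp
    also have "\<dots> = ennreal K2 * H1norm M \<rho> \<epsilon> x1 \<beta> \<gamma> (pairing M f)"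
      unfolding K2_def using K20 CQ_pos[of \<gamma>] by (simp add: ennreal_mult mult.assoc)
    also have "\<dots> \<le> ennreal (K1 + K2) * H1norm M \<rho> \<epsilon> x1 \<beta> \<gamma> (pairing M f)"
      using K1 by (intro mult_right_mono ennreal_leI) auto
    finally show "(\<integral>\<^sup>+ x. Tplus M T f x \<partial>M) \<le> ennreal (K1 + K2) * H1norm M \<rho> \<epsilon> x1 \<beta> \<gamma> (pairing M f)" .
  qed
qed

lemma Gdual_representation:
  assumes RD: "RD_space M" and adm: "admissible \<rho>"
    and \<epsilon>: "0 < \<epsilon>" "\<epsilon> < 1" and \<beta>: "0 < \<beta>" "\<beta> < \<epsilon>" and \<gamma>: "0 < \<gamma>" "\<gamma> < \<epsilon>"
    and L: "L \<in> Gdual M \<epsilon> x1 \<beta> \<gamma>" and H1: "H1norm M \<rho> \<epsilon> x1 \<beta> \<gamma> L < \<infinity>"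
  shows "\<exists>f. integrable M f \<and> (\<forall>\<phi>\<in>G0 M \<epsilon> x1 1 \<beta> \<gamma>. L \<phi> = pairing M f \<phi>)"
proof -
  from RD_space_doubling[OF RD] obtain D n where "regular_doubling M D n" by (elim exE)
  then interpret regular_doubling M D n .
  from admissible_minorant[OF adm] obtain \<sigma> a Ca Kr where ap: "admissible_pair M D n \<rho> \<sigma> a Ca Kr" by (elim exE)
  then interpret admissible_pair M D n \<rho> \<sigma> a Ca Kr .
  from L have lin: "\<forall>\<phi>\<in>G0 M \<epsilon> x1 1 \<beta> \<gamma>. \<forall>\<psi>\<in>G0 M \<epsilon> x1 1 \<beta> \<gamma>. \<forall>a b::real.
        L (\<lambda>y. a * \<phi> y + b * \<psi> y) = a * L \<phi> + b * L \<psi>"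
    and "\<exists>B. \<forall>\<phi>\<in>G0 M \<epsilon> x1 1 \<beta> \<gamma>. \<bar>L \<phi>\<bar> \<le> B * Gnorm M x1 1 \<beta> \<gamma> \<phi>" by (auto simp: Gdual_def)
  then obtain B where B: "\<forall>\<phi>\<in>G0 M \<epsilon> x1 1 \<beta> \<gamma>. \<bar>L \<phi>\<bar> \<le> B * Gnorm M x1 1 \<beta> \<gamma> \<phi>" by (elim exE)
  \<comment> \<open>\<open>Gdual\<close> does not ask for a nonnegative bound, hence
    \<open>max B 0\<close>.\<close>
  interpret hardy_functional M D n \<rho> \<sigma> a Ca Kr x1 L \<epsilon> \<beta> \<gamma> "max B 0"
  proof unfold_locales
    show "\<bar>L \<phi>\<bar> \<le> max B 0 * Gnorm M x1 1 \<beta> \<gamma> \<phi>" if \<phi>: "\<phi> \<in> G0 M \<epsilon> x1 1 \<beta> \<gamma>" for \<phi>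
    proof -
      have "0 \<le> Gnorm M x1 1 \<beta> \<gamma> \<phi>" by (rule Gnorm_nonneg[OF G0_Gsp[OF \<phi>]]) simp
      then have "B * Gnorm M x1 1 \<beta> \<gamma> \<phi> \<le> max B 0 * Gnorm M x1 1 \<beta> \<gamma> \<phi>" by (intro mult_right_mono) auto
      with B \<phi> show ?thesis by force
    qed
  qed (use \<epsilon> \<beta> \<gamma> lin H1 in auto)
  show ?thesis by (rule representation)
qed

lemma H1norm_cong:
  assumes "\<And>\<phi>. \<phi> \<in> G0 M \<epsilon> x1 1 \<beta> \<gamma> \<Longrightarrow> L \<phi> = L' \<phi>"
  shows "H1norm M \<rho> \<epsilon> x1 \<beta> \<gamma> L = H1norm M \<rho> \<epsilon> x1 \<beta> \<gamma> L'"
  unfolding H1norm_def Gmax_def using assms by (intro nn_integral_cong SUP_cong) auto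

text \<open>Membership in the Hardy space is a property of functionals, whereas \<open>T\<close>
  acts on functions. Conditions (b) and (c) therefore ask for an integrable function that represents
  the functional on \<open>G0\<close>, whose existence is part of the claim. One constant serves all
  four inequalities.\<close>

theorem theorem4p2:
  fixes M :: "'a::metric_space measure"
    and \<rho> :: "'a \<Rightarrow> real"
    and S T :: "real \<Rightarrow> 'a \<Rightarrow> 'a \<Rightarrow> real"
    and e1 e2 e3 C \<delta>1 \<delta>2 \<delta>3 \<epsilon> \<beta> \<gamma> :: real
    and x1 :: 'a
  assumes RD: "RD_space M"
    and adm: "admissible \<rho>"
    and e1: "0 < e1" "e1 \<le> 1" and e2: "0 < e2" and e3: "0 < e3"
    and AOTI: "cont_AOTI M e1 e2 e3 S"
    and Top: "\<And>t. 0 < t \<Longrightarrow> L2_kernel_op M (T t)"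
    and C: "0 < C"
    and \<delta>: "0 < \<delta>1" "0 < \<delta>2" "\<delta>2 \<le> e2" "0 < \<delta>3"
    and size: "\<And>t x y. 0 < t \<Longrightarrow> \<bar>T t x y\<bar> \<le> C * (1 / (Vr M t x + Vxy M x y))
                 * (t / (t + dist x y)) powr \<delta>2 * (\<rho> x / (t + \<rho> x)) powr \<delta>3"
    and diff: "\<And>t x y. 0 < t \<Longrightarrow> \<bar>T t x y - S t x y\<bar> \<le> C * (t / (t + \<rho> x)) powr \<delta>1
                 * (1 / (Vr M t x + Vxy M x y)) * (t / (t + dist x y)) powr \<delta>2"
    and \<epsilon>: "0 < \<epsilon>" "\<epsilon> < 1"
    and \<beta>: "0 < \<beta>" "\<beta> < \<epsilon>" and \<gamma>: "0 < \<gamma>" "\<gamma> < \<epsilon>"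
  shows
    "(\<forall>L\<in>Gdual M \<epsilon> x1 \<beta> \<gamma>.
        (H1norm M \<rho> \<epsilon> x1 \<beta> \<gamma> L < \<infinity> \<longleftrightarrow>
           (\<exists>f. integrable M f \<and> (\<forall>\<phi>\<in>G0 M \<epsilon> x1 1 \<beta> \<gamma>. L \<phi> = pairing M f \<phi>) \<and>
                (\<integral>\<^sup>+ x. Tplus M T f x \<partial>M) < \<infinity>)) \<and>
        (H1norm M \<rho> \<epsilon> x1 \<beta> \<gamma> L < \<infinity> \<longleftrightarrow>
           (\<exists>f. integrable M f \<and> (\<forall>\<phi>\<in>G0 M \<epsilon> x1 1 \<beta> \<gamma>. L \<phi> = pairing M f \<phi>) \<and>
                (\<integral>\<^sup>+ x. Tplus_rho M \<rho> T f x \<partial>M) < \<infinity>)))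
     \<and> (\<exists>K>0. \<forall>f. integrable M f \<longrightarrow>
          H1norm M \<rho> \<epsilon> x1 \<beta> \<gamma> (pairing M f) \<le> ennreal K * (\<integral>\<^sup>+ x. Tplus M T f x \<partial>M) \<and>
          (\<integral>\<^sup>+ x. Tplus M T f x \<partial>M) \<le> ennreal K * H1norm M \<rho> \<epsilon> x1 \<beta> \<gamma> (pairing M f) \<and>
          H1norm M \<rho> \<epsilon> x1 \<beta> \<gamma> (pairing M f) \<le> ennreal K * (\<integral>\<^sup>+ x. Tplus_rho M \<rho> T f x \<partial>M) \<and>
          (\<integral>\<^sup>+ x. Tplus_rho M \<rho> T f x \<partial>M) \<le> ennreal K * H1norm M \<rho> \<epsilon> x1 \<beta> \<gamma> (pairing M f))"
proof -
  let ?N = "H1norm M \<rho> \<epsilon> x1 \<beta> \<gamma>"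
  from H1norm_equiv[OF RD adm e1(1) e2 AOTI Top C \<delta>(1,2,4) size diff \<epsilon>(1) less_imp_le[OF \<epsilon>(2)] \<beta>(1) less_imp_le[OF \<beta>(2)]
      \<gamma>(1) less_imp_le[OF \<gamma>(2)], of x1]
  obtain K where K: "0 < K" and lower: "\<And>f. integrable M f \<Longrightarrow> ?N (pairing M f) \<le> ennreal K * (\<integral>\<^sup>+ x. Tplus_rho M \<rho> T f x \<partial>M)"
    and upper: "\<And>f. integrable M f \<Longrightarrow> (\<integral>\<^sup>+ x. Tplus M T f x \<partial>M) \<le> ennreal K * ?N (pairing M f)" by blast
  have le: "(\<integral>\<^sup>+ x. Tplus_rho M \<rho> T f x \<partial>M) \<le> (\<integral>\<^sup>+ x. Tplus M T f x \<partial>M)" for f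
    unfolding Tplus_rho_def Tplus_def by (intro nn_integral_mono SUP_subset_mono) auto
  have lower': "?N (pairing M f) \<le> ennreal K * (\<integral>\<^sup>+ x. Tplus M T f x \<partial>M)" if "integrable M f" for f
    by (rule order.trans[OF lower[OF that] mult_left_mono[OF le]]) simp
  have upper': "(\<integral>\<^sup>+ x. Tplus_rho M \<rho> T f x \<partial>M) \<le> ennreal K * ?N (pairing M f)" if "integrable M f" for f
    by (rule order.trans[OF le upper[OF that]])
  have fin: "A < \<infinity>" if "A \<le> ennreal K * B" "B < \<infinity>" for A B
  proof -
    have "ennreal K * B < \<infinity>" using that(2) by (simp add: ennreal_mult_less_top)
    with that(1) show ?thesis by (rule le_less_trans)
  qed
  \<comment> \<open>Formulated for any quantity \<open>I\<close> comparable with the Hardy norm, so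
    that it covers both maximal functions.\<close>
  have iff: "?N L < \<infinity> \<longleftrightarrow>
      (\<exists>f. integrable M f \<and> (\<forall>\<phi>\<in>G0 M \<epsilon> x1 1 \<beta> \<gamma>. L \<phi> = pairing M f \<phi>) \<and> I f < \<infinity>)"
    if L: "L \<in> Gdual M \<epsilon> x1 \<beta> \<gamma>"
      and I: "\<And>f. integrable M f \<Longrightarrow> ?N (pairing M f) \<le> ennreal K * I f"
        "\<And>f. integrable M f \<Longrightarrow> I f \<le> ennreal K * ?N (pairing M f)" for L I
  proof (intro iffI)
    assume N: "?N L < \<infinity>"
    from Gdual_representation[OF RD adm \<epsilon> \<beta> \<gamma> L N] obtain f where f: "integrable M f"
      and rep: "\<forall>\<phi>\<in>G0 M \<epsilon> x1 1 \<beta> \<gamma>. L \<phi> = pairing M f \<phi>" by (elim exE conjE)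
    have "?N (pairing M f) = ?N L" using rep by (intro H1norm_cong) auto
    then have "I f < \<infinity>" using fin[OF I(2)[OF f]] N by simp
    then show "\<exists>f. integrable M f \<and> (\<forall>\<phi>\<in>G0 M \<epsilon> x1 1 \<beta> \<gamma>. L \<phi> = pairing M f \<phi>) \<and> I f < \<infinity>"
      using f rep by blast
  next
    assume "\<exists>f. integrable M f \<and> (\<forall>\<phi>\<in>G0 M \<epsilon> x1 1 \<beta> \<gamma>. L \<phi> = pairing M f \<phi>) \<and> I f < \<infinity>"
    then obtain f where f: "integrable M f" "I f < \<infinity>"
      and rep: "\<forall>\<phi>\<in>G0 M \<epsilon> x1 1 \<beta> \<gamma>. L \<phi> = pairing M f \<phi>" by (elim exE conjE)
    have "?N L = ?N (pairing M f)" using rep by (intro H1norm_cong) auto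
    then show "?N L < \<infinity>" using fin[OF I(1)[OF f(1)] f(2)] by simp
  qed
  show ?thesis
  proof (intro conjI ballI)
    fix L assume L: "L \<in> Gdual M \<epsilon> x1 \<beta> \<gamma>"
    show "?N L < \<infinity> \<longleftrightarrow> (\<exists>f. integrable M f \<and> (\<forall>\<phi>\<in>G0 M \<epsilon> x1 1 \<beta> \<gamma>. L \<phi> = pairing M f \<phi>) \<and>
                (\<integral>\<^sup>+ x. Tplus M T f x \<partial>M) < \<infinity>)" by (rule iff[OF L lower' upper])
    show "?N L < \<infinity> \<longleftrightarrow> (\<exists>f. integrable M f \<and> (\<forall>\<phi>\<in>G0 M \<epsilon> x1 1 \<beta> \<gamma>. L \<phi> = pairing M f \<phi>) \<and>
                (\<integral>\<^sup>+ x. Tplus_rho M \<rho> T f x \<partial>M) < \<infinity>)" by (rule iff[OF L lower upper'])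
  next
    show "\<exists>K>0. \<forall>f. integrable M f \<longrightarrow>
          ?N (pairing M f) \<le> ennreal K * (\<integral>\<^sup>+ x. Tplus M T f x \<partial>M) \<and>
          (\<integral>\<^sup>+ x. Tplus M T f x \<partial>M) \<le> ennreal K * ?N (pairing M f) \<and>
          ?N (pairing M f) \<le> ennreal K * (\<integral>\<^sup>+ x. Tplus_rho M \<rho> T f x \<partial>M) \<and>
          (\<integral>\<^sup>+ x. Tplus_rho M \<rho> T f x \<partial>M) \<le> ennreal K * ?N (pairing M f)"
      using K lower lower' upper upper' by blast
  qed
qed

end
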